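(* Suppose that the system $\dot x=y+X(x,y,\delta),\ \dot y=Y(x,y,\delta)$ satisfies, for all $\delta\in D$ and a fixed integer $n\ge 2$, $g(x,\delta)=x^{2n-1}(a_{2n-1}(\delta)+O(x))$ with $a_{2n-1}(\delta)>0$, and $f(x,\delta)=\sum_{j\ge n-1}b_j(\delta)x^j$ with $b_{n-1}^2(\delta)-4n a_{2n-1}(\delta)<0$. Let $p_n=[1+(-1)^n]/2$, let $v_j(\delta)$ be the coefficients of the expansion $\bar P(x_0,\delta)-x_0=\sum_{j\ge1}v_j(\delta)x_0^j$, and let $k\ge1$ be an integer. (1) If $$\sum_{j=1}^{k+1}|v_{2j-1+p_n}(\delta)|>0\quad\text{for all }\delta\in D,$$ then there exists a neighborhood $U$ of the origin such that the system has at most $k$ limit cycles in $U$ for all $\delta\in D$. (2) If there is $\delta_0\in D$ such that $v_{2k+1+p_n}(\delta_0)\ne0$, $v_{2j-1+p_n}(\delta_0)=0$ for $j=1,\dots,k$, and $$\operatorname{rank}\frac{\partial(v_{1+p_n},v_{3+p_n},\dots,v_{2k-1+p_n})}{\partial(\delta_1,\delta_2,\dots,\delta_m)}(\delta_0)=k,$$ then for an arbitrary sufficiently small neighborhood of the origin there are some $\delta\in D$ near $\delta_0$ such that the system has exactly $k$ limit cycles in the neighborhood.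
   Context: The planar system is $\dot x=y+X(x,y,\delta),\ \dot y=Y(x,y,\delta)$, where $\delta=(\delta_1,\dots,\delta_m)\in D\subset\mathbb{R}^m$, $D$ is compact, $X,Y$ are real analytic, and $X,Y=O(|x,y|^2)$ for $(x,y)$ near the origin and $\delta\in D$. Let $y=F(x,\delta)$ be the solution of $y+X(x,y,\delta)=0$ with $F(0,\delta)=0$, and define $$g(x,\delta)=-Y(x,F(x,\delta),\delta),\qquad f(x,\delta)=-\left[\frac{\partial X}{\partial x}(x,F(x,\delta),\delta)+\frac{\partial Y}{\partial y}(x,F(x,\delta),\delta)\right].$$ Under the assumptions in the claim the origin is a center or a focus for all $\delta\in D$. Poincaré return map: for $\delta\in D$ and $x_0\ne0$ with $|x_0|$ small, let $(x(t,x_0,\delta),y(t,x_0,\delta))$ be the solution of the system with initial condition $(x_0,F(x_0,\delta))$, and let $\tau>0$ be the least positive number with $y(\tau,x_0,\delta)=F(x(\tau,x_0,\delta),\delta)$ and $x_0\,x(\tau,x_0,\delta)>0$. Put $P(x_0,\delta)=x(\tau,x_0,\delta)$ and $P(0,\delta)=0$. The function $\bar P(x_0,\delta)$ is the unique function analytic in $x_0$ at $x_0=0$ that coincides with $P(x_0,\delta)$ for small $x_0>0$. A limit cycle is an isolated periodic orbit.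
   Formalization: In (2), δ₀ is taken in the interior of D rather than anywhere in D: at a boundary point the partial derivatives of the v_j are not defined, and with one-sided derivatives the claim can fail (x'=y, y'=-x³+(δx²+x⁴)y, D=[0,1], δ₀=0, k=1). *)

theory Defs
  imports "HOL-Analysis.Analysis" "HOL-Library.Landau_Symbols"
begin

text \<open>
  Real analyticity in several variables: near the point, the function is the sum of an
  (unconditionally convergent) power series. A multi-index is a function from the standard
  basis to the natural numbers.
\<close>
definition real_analytic_at :: "('a::euclidean_space \<Rightarrow> real) \<Rightarrow> 'a \<Rightarrow> bool" where
  "real_analytic_at h p \<longleftrightarrow>
     (\<exists>r>0. \<exists>c :: ('a \<Rightarrow> nat) \<Rightarrow> real. \<forall>z\<in>ball p r.
        ((\<lambda>\<alpha>. c \<alpha> * (\<Prod>e\<in>Basis. ((z - p) \<bullet> e) ^ \<alpha> e)) has_sum h z) (Basis \<rightarrow>\<^sub>E UNIV))"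

text \<open>
  A perturbation term is a total function of \<open>x\<close>, \<open>y\<close> and \<open>\<delta>\<close>, but only its
  behaviour near the points \<open>(0, 0, \<delta>)\<close> with \<open>\<delta> \<in> D\<close> is constrained: joint analyticity there,
  and a quadratic bound that is uniform over \<open>\<delta> \<in> D\<close>.
\<close>
definition admissible_perturbation ::
    "(real \<Rightarrow> real \<Rightarrow> real^'m \<Rightarrow> real) \<Rightarrow> (real^'m) set \<Rightarrow> bool" where
  "admissible_perturbation X D \<longleftrightarrow>
     (\<forall>\<delta>\<in>D. real_analytic_at (\<lambda>(x, y, d). X x y d) (0, 0, \<delta>)) \<and>
     (\<exists>C. \<exists>r>0. \<forall>\<delta>\<in>D. \<forall>x y. norm (x, y) < r \<longrightarrow> \<bar>X x y \<delta>\<bar> \<le> C * (norm (x, y))\<^sup>2)"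

text \<open>
  The implicit function \<open>y = F(x, \<delta>)\<close> is only determined locally; continuity at \<open>0\<close> singles out
  the branch through the origin and hence the germ of \<open>F(\<cdot>, \<delta>)\<close> at \<open>0\<close>.
\<close>
definition is_implicit_solution ::
    "(real \<Rightarrow> real \<Rightarrow> real^'m \<Rightarrow> real) \<Rightarrow> (real^'m) set \<Rightarrow> (real \<Rightarrow> real^'m \<Rightarrow> real) \<Rightarrow> bool" where
  "is_implicit_solution X D F \<longleftrightarrow>
     (\<forall>\<delta>\<in>D. F 0 \<delta> = 0 \<and> isCont (\<lambda>x. F x \<delta>) 0 \<and>
        (\<forall>\<^sub>F x in nhds 0. F x \<delta> + X x (F x \<delta>) \<delta> = 0))"

definition g_fun ::
    "(real \<Rightarrow> real \<Rightarrow> real^'m \<Rightarrow> real) \<Rightarrow> (real \<Rightarrow> real^'m \<Rightarrow> real) \<Rightarrow> real \<Rightarrow> real^'m \<Rightarrow> real" where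
  "g_fun Y F x \<delta> = - Y x (F x \<delta>) \<delta>"

definition f_fun ::
    "(real \<Rightarrow> real \<Rightarrow> real^'m \<Rightarrow> real) \<Rightarrow> (real \<Rightarrow> real \<Rightarrow> real^'m \<Rightarrow> real) \<Rightarrow>
     (real \<Rightarrow> real^'m \<Rightarrow> real) \<Rightarrow> real \<Rightarrow> real^'m \<Rightarrow> real" where
  "f_fun X Y F x \<delta> =
     - (deriv (\<lambda>u. X u (F x \<delta>) \<delta>) x + deriv (\<lambda>w. Y x w \<delta>) (F x \<delta>))"

definition solution_on ::
    "(real \<Rightarrow> real \<Rightarrow> real^'m \<Rightarrow> real) \<Rightarrow> (real \<Rightarrow> real \<Rightarrow> real^'m \<Rightarrow> real) \<Rightarrow> real^'m \<Rightarrow>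
     real set \<Rightarrow> (real \<Rightarrow> real) \<Rightarrow> (real \<Rightarrow> real) \<Rightarrow> bool" where
  "solution_on X Y \<delta> I x y \<longleftrightarrow>
     (\<forall>t\<in>I. (x has_real_derivative y t + X (x t) (y t) \<delta>) (at t within I) \<and>
            (y has_real_derivative Y (x t) (y t) \<delta>) (at t within I))"

definition first_return ::
    "(real \<Rightarrow> real \<Rightarrow> real^'m \<Rightarrow> real) \<Rightarrow> (real \<Rightarrow> real \<Rightarrow> real^'m \<Rightarrow> real) \<Rightarrow>
     (real \<Rightarrow> real^'m \<Rightarrow> real) \<Rightarrow> real^'m \<Rightarrow> real \<Rightarrow> real \<Rightarrow> bool" where
  "first_return X Y F \<delta> x0 x1 \<longleftrightarrow>
     (\<exists>x y \<tau>. \<tau> > 0 \<and> solution_on X Y \<delta> {0..\<tau>} x y \<and> x 0 = x0 \<and> y 0 = F x0 \<delta> \<and>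
        y \<tau> = F (x \<tau>) \<delta> \<and> x0 * x \<tau> > 0 \<and>
        (\<forall>t. 0 < t \<and> t < \<tau> \<longrightarrow> \<not> (y t = F (x t) \<delta> \<and> x0 * x t > 0)) \<and>
        x1 = x \<tau>)"

definition return_map ::
    "(real \<Rightarrow> real \<Rightarrow> real^'m \<Rightarrow> real) \<Rightarrow> (real \<Rightarrow> real \<Rightarrow> real^'m \<Rightarrow> real) \<Rightarrow>
     (real \<Rightarrow> real^'m \<Rightarrow> real) \<Rightarrow> real^'m \<Rightarrow> real \<Rightarrow> real" where
  "return_map X Y F \<delta> x0 = (if x0 = 0 then 0 else (THE x1. first_return X Y F \<delta> x0 x1))"

text \<open>
  Taylor series at \<open>0\<close> of the analytic function germ that coincides with the return map for small
  \<open>x\<^sub>0 > 0\<close>. For \<open>x\<^sub>0 < 0\<close> this germ may differ from the return map.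
\<close>
definition return_series ::
    "(real \<Rightarrow> real \<Rightarrow> real^'m \<Rightarrow> real) \<Rightarrow> (real \<Rightarrow> real \<Rightarrow> real^'m \<Rightarrow> real) \<Rightarrow>
     (real \<Rightarrow> real^'m \<Rightarrow> real) \<Rightarrow> real^'m \<Rightarrow> real fps" where
  "return_series X Y F \<delta> =
     (THE p. \<exists>Pbar. Pbar has_fps_expansion p \<and>
        (\<forall>\<^sub>F x0 in at_right 0. Pbar x0 = return_map X Y F \<delta> x0))"

definition v_coeff ::
    "(real \<Rightarrow> real \<Rightarrow> real^'m \<Rightarrow> real) \<Rightarrow> (real \<Rightarrow> real \<Rightarrow> real^'m \<Rightarrow> real) \<Rightarrow>
     (real \<Rightarrow> real^'m \<Rightarrow> real) \<Rightarrow> nat \<Rightarrow> real^'m \<Rightarrow> real" where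
  "v_coeff X Y F j \<delta> = fps_nth (return_series X Y F \<delta> - fps_X) j"

definition p_shift :: "nat \<Rightarrow> nat" where
  "p_shift n = nat ((1 + (-1 :: int) ^ n) div 2)"

text \<open>Orbits are sets of points of the phase plane; equilibria are not periodic orbits.\<close>
definition periodic_orbit ::
    "(real \<Rightarrow> real \<Rightarrow> real^'m \<Rightarrow> real) \<Rightarrow> (real \<Rightarrow> real \<Rightarrow> real^'m \<Rightarrow> real) \<Rightarrow> real^'m \<Rightarrow>
     (real \<times> real) set \<Rightarrow> bool" where
  "periodic_orbit X Y \<delta> \<gamma> \<longleftrightarrow>
     (\<exists>x y T. T > 0 \<and> solution_on X Y \<delta> UNIV x y \<and>
        (\<forall>t. x (t + T) = x t \<and> y (t + T) = y t) \<and>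
        (\<exists>t. (x t, y t) \<noteq> (x 0, y 0)) \<and>
        \<gamma> = range (\<lambda>t. (x t, y t)))"

definition limit_cycle ::
    "(real \<Rightarrow> real \<Rightarrow> real^'m \<Rightarrow> real) \<Rightarrow> (real \<Rightarrow> real \<Rightarrow> real^'m \<Rightarrow> real) \<Rightarrow> real^'m \<Rightarrow>
     (real \<times> real) set \<Rightarrow> bool" where
  "limit_cycle X Y \<delta> \<gamma> \<longleftrightarrow>
     periodic_orbit X Y \<delta> \<gamma> \<and>
     (\<exists>W. open W \<and> \<gamma> \<subseteq> W \<and> (\<forall>\<gamma>'. periodic_orbit X Y \<delta> \<gamma>' \<and> \<gamma>' \<subseteq> W \<longrightarrow> \<gamma>' = \<gamma>))"

definition limit_cycles_in ::
    "(real \<Rightarrow> real \<Rightarrow> real^'m \<Rightarrow> real) \<Rightarrow> (real \<Rightarrow> real \<Rightarrow> real^'m \<Rightarrow> real) \<Rightarrow> real^'m \<Rightarrow>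
     (real \<times> real) set \<Rightarrow> (real \<times> real) set set" where
  "limit_cycles_in X Y \<delta> U = {\<gamma>. limit_cycle X Y \<delta> \<gamma> \<and> \<gamma> \<subseteq> U}"

definition gradient_at :: "(real^'m \<Rightarrow> real) \<Rightarrow> real^'m \<Rightarrow> real^'m" where
  "gradient_at w \<delta> = (\<chi> i. deriv (\<lambda>s. w (\<delta> + s *\<^sub>R axis i 1)) 0)"

text \<open>
  Rank at \<open>\<delta>\<close> of the Jacobian matrix of \<open>(w\<^sub>1, \<dots>, w\<^sub>k)\<close>. The number \<open>k\<close> of rows is a
  natural number and not a type, so the library's \<open>rank A = dim (rows A)\<close> is written out.
\<close>
definition jacobian_rank :: "nat \<Rightarrow> (nat \<Rightarrow> real^'m \<Rightarrow> real) \<Rightarrow> real^'m \<Rightarrow> nat" where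
  "jacobian_rank k w \<delta> = dim ((\<lambda>j. gradient_at (w j) \<delta>) ` {1..k})"

end

theory Submission
  imports Defs "HOL-Complex_Analysis.Complex_Analysis"
begin

text \<open>
  In the weighted polar coordinates \<open>x = r cos \<phi>\<close>, \<open>y - F(x, \<delta>) = - r\<^sup>n sin \<phi>\<close> the system becomes
  \<open>dr/d\<phi> = R(\<phi>, r, \<delta>)\<close>, where \<open>R\<close> is analytic in \<open>(r, \<delta>)\<close> also at \<open>r = 0\<close>, because the discriminant
  condition keeps the angular velocity away from zero. Extending \<open>r\<close> and \<open>\<delta>\<close> to complex values and solving
  by Picard iteration shows that the return map of the angle \<open>2\<pi>\<close> is analytic in \<open>(r, \<delta>)\<close>; it is
  the map \<open>P\<close> extended to negative \<open>r\<close>.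

  A reflection of \<open>(r, \<phi>)\<close> conjugates this map, or its inverse, to itself on negative radii. It pairs the
  positive fixed points with the negative ones, and it forces the first nonvanishing coefficient of the displacement
  to have index \<open>2j - 1 + p\<^sub>n\<close>. If this index is \<open>2j - 1 + p\<^sub>n\<close>, then Rolle's theorem, applied to the displacement
  divided by a power of \<open>r\<close>, bounds the nonzero fixed points by \<open>2(j - 1)\<close>, hence the closed orbits by \<open>j - 1\<close>,
  uniformly near a given parameter; compactness of \<open>D\<close> gives the first part. For the second part the rank condition
  lets \<open>v\<^sub>1\<^sub>+\<^sub>p, \<dots>, v\<^sub>2\<^sub>k\<^sub>-\<^sub>1\<^sub>+\<^sub>p\<close> be prescribed freely near \<open>\<delta>\<^sub>0\<close>, and \<open>k\<close> sign changes of the displacement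
  are created one after the other.
\<close>

text \<open>The expansions of \<open>g\<close> and \<open>f\<close> are given only for
  \<open>\<delta> \<in> D\<close>, and \<open>D\<close> may have empty interior, so no order of
  vanishing at \<open>x = 0\<close> or \<open>r = 0\<close> is available at nearby complex
  parameters. Division by a power is therefore realised by the integral operator
  \<open>divx\<close>: its values are holomorphic in all variables and at every parameter, and they
  become true quotients at those parameters where the lower coefficients vanish. The same operator
  yields Taylor coefficients, so that on \<open>D\<close> the functions \<open>v_coeff\<close> are
  restrictions of holomorphic functions of the parameter. Holomorphy, and not real power series,
  carries the analysis because it survives uniform limits: multi-index sums, Riemann sums,
  contraction iterates and Picard iterates all go through the one closure theorem
  \<open>cdiff_uniform_limit\<close>. A further obstacle is that a closed orbit near the origin is
  given only as a set. It has to be shown that it crosses the section at all and that it does so in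
  a fixed point of the return map. Isolation is then easy: finitely many closed orbits are compact
  and pairwise disjoint, hence limit cycles.\<close>

unbundle no fps_syntax

section \<open>Complex differentiability in several variables\<close>

text \<open>Complex scalars are added to a real Euclidean space, and \<open>cs_of_real\<close> and
  \<open>norm_cs\<close> tie the two structures together. Complex numbers, pairs and vectors then
  share one class, and the real Frechet calculus, compactness and integration of the library apply
  unchanged.\<close>

class cspace = euclidean_space +
  fixes cs :: "complex \<Rightarrow> 'a \<Rightarrow> 'a"  (infixr "*\<^sub>C" 75)
  assumes cs_add_right: "c *\<^sub>C (x + y) = c *\<^sub>C x + c *\<^sub>C y"
    and cs_add_left: "(c + d) *\<^sub>C x = c *\<^sub>C x + d *\<^sub>C x"
    and cs_cs [simp]: "c *\<^sub>C (d *\<^sub>C x) = (c * d) *\<^sub>C x"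
    and cs_of_real: "complex_of_real r *\<^sub>C x = r *\<^sub>R x"
    and norm_cs [simp]: "norm (c *\<^sub>C x) = norm c * norm x"

instantiation complex :: cspace
begin
definition cs_complex_def [simp]: "c *\<^sub>C (x::complex) = c * x"
instance by standard (auto simp: algebra_simps norm_mult scaleR_conv_of_real)
end

instantiation prod :: (cspace, cspace) cspace
begin
definition cs_prod_def [simp]: "c *\<^sub>C x = (c *\<^sub>C fst x, c *\<^sub>C snd x)"
instance
proof
  fix c :: complex and x :: "'a \<times> 'b"
  have "sqrt ((cmod c * norm (fst x))\<^sup>2 + (cmod c * norm (snd x))\<^sup>2) =
      sqrt ((cmod c)\<^sup>2 * ((norm (fst x))\<^sup>2 + (norm (snd x))\<^sup>2))"
    by (simp add: algebra_simps power_mult_distrib)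
  also have "\<dots> = cmod c * sqrt ((norm (fst x))\<^sup>2 + (norm (snd x))\<^sup>2)"
    by (simp add: real_sqrt_mult)
  finally show "norm (c *\<^sub>C x) = cmod c * norm x"
    by (simp add: norm_prod_def)
qed (auto simp: cs_add_right cs_add_left cs_of_real scaleR_prod_def)
end

instantiation vec :: (cspace, finite) cspace
begin
definition cs_vec_def: "c *\<^sub>C x = (\<chi> i. c *\<^sub>C (x $ i))"
instance
proof
  fix c :: complex and x :: "'a ^ 'b"
  show "norm (c *\<^sub>C x) = cmod c * norm x"
    by (simp add: cs_vec_def norm_vec_def L2_set_def power_mult_distrib real_sqrt_mult
        flip: sum_distrib_left)
qed (auto simp: cs_vec_def vec_eq_iff cs_add_right cs_add_left cs_of_real)
end

lemma cs_vec_nth [simp]: "(c *\<^sub>C x) $ i = c *\<^sub>C (x $ i)"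
  by (simp add: cs_vec_def)

lemma bounded_linear_cs_left: "bounded_linear (\<lambda>c. c *\<^sub>C (x::'a::cspace))"
proof (rule bounded_linear_intro)
  fix r c
  have "(r *\<^sub>R c) *\<^sub>C x = of_real r *\<^sub>C (c *\<^sub>C x)"
    by (simp add: scaleR_conv_of_real)
  then show "(r *\<^sub>R c) *\<^sub>C x = r *\<^sub>R (c *\<^sub>C x)"
    by (simp add: cs_of_real del: cs_cs)
qed (auto simp: cs_add_left)

lemma bounded_linear_cs_right: "bounded_linear (\<lambda>x::'a::cspace. c *\<^sub>C x)"
proof (rule bounded_linear_intro[where K = "cmod c"])
  fix r and x :: 'a
  have "c *\<^sub>C (of_real r *\<^sub>C x) = of_real r *\<^sub>C (c *\<^sub>C x)"
    by (simp add: mult.commute)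
  then show "c *\<^sub>C (r *\<^sub>R x) = r *\<^sub>R (c *\<^sub>C x)"
    by (simp add: cs_of_real del: cs_cs)
qed (auto simp: cs_add_right mult.commute[of _ "cmod c"])

lemma cs_zero [simp]: "0 *\<^sub>C x = 0" "c *\<^sub>C 0 = (0::'a::cspace)" "1 *\<^sub>C x = (x::'a::cspace)"
  using cs_of_real[of 0 x] cs_of_real[of 1 x] bounded_linear_cs_right[of c, THEN bounded_linear.linear, THEN linear_0]
  by auto

text \<open>Holomorphy in several variables as real Frechet differentiability with a
  complex-homogeneous derivative. The derivative is taken at full neighbourhoods of the points,
  which makes the notion local and inherited by arbitrary subsets.\<close>

definition cdiff_on :: "('a::cspace \<Rightarrow> 'b::cspace) \<Rightarrow> 'a set \<Rightarrow> bool"  (infix "cdiff'_on" 50) where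
  "f cdiff_on S \<longleftrightarrow>
     (\<forall>v\<in>S. \<exists>D. (f has_derivative D) (at v) \<and> (\<forall>c h. D (c *\<^sub>C h) = c *\<^sub>C D h))"

text \<open>The derivative along the complex line through \<open>v\<close> in direction
  \<open>e\<close>; on such a line Cauchy's one-variable theory is available.\<close>

definition dd :: "'a::cspace \<Rightarrow> ('a \<Rightarrow> complex) \<Rightarrow> 'a \<Rightarrow> complex" where
  "dd e f v = deriv (\<lambda>z. f (v + z *\<^sub>C e)) 0"

lemma cdiff_onI:
  "(\<And>v. v \<in> S \<Longrightarrow> (f has_derivative D v) (at v)) \<Longrightarrow>
   (\<And>v c h. v \<in> S \<Longrightarrow> D v (c *\<^sub>C h) = c *\<^sub>C D v h) \<Longrightarrow> f cdiff_on S"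
  unfolding cdiff_on_def by blast

lemma cdiff_onE:
  assumes "f cdiff_on S" "v \<in> S"
  obtains D where "(f has_derivative D) (at v)" "\<And>c h. D (c *\<^sub>C h) = c *\<^sub>C D h"
  using assms unfolding cdiff_on_def by blast

lemma cdiff_on_subset: "f cdiff_on S \<Longrightarrow> T \<subseteq> S \<Longrightarrow> f cdiff_on T"
  unfolding cdiff_on_def by blast

lemma cdiff_on_local:
  "(\<And>v. v \<in> S \<Longrightarrow> \<exists>T. v \<in> T \<and> f cdiff_on T) \<Longrightarrow> f cdiff_on S"
  unfolding cdiff_on_def by blast

lemma cdiff_on_cong:
  assumes "f cdiff_on S" "open S" "\<And>v. v \<in> S \<Longrightarrow> f v = g v"
  shows "g cdiff_on S"
  unfolding cdiff_on_def
proof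
  fix v assume v: "v \<in> S"
  obtain D where D: "(f has_derivative D) (at v)" "\<And>c h. D (c *\<^sub>C h) = c *\<^sub>C D h"
    using assms(1) v by (rule cdiff_onE) blast
  have "(g has_derivative D) (at v)"
    using D(1) assms(2) v assms(3) by (rule has_derivative_transform_within_open) auto
  with D(2) show "\<exists>D. (g has_derivative D) (at v) \<and> (\<forall>c h. D (c *\<^sub>C h) = c *\<^sub>C D h)" by blast
qed

lemma cdiff_on_isCont: "f cdiff_on S \<Longrightarrow> v \<in> S \<Longrightarrow> isCont f v"
  by (meson cdiff_onE has_derivative_continuous)

lemma cdiff_on_continuous_on: "f cdiff_on S \<Longrightarrow> continuous_on S f"
  by (simp add: cdiff_on_isCont continuous_at_imp_continuous_on)

lemma cdiff_on_linear:
  assumes "bounded_linear L" "\<And>c h. L (c *\<^sub>C h) = c *\<^sub>C L h"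
  shows "L cdiff_on S"
  by (rule cdiff_onI[where D = "\<lambda>_. L"]) (use assms in \<open>auto intro: bounded_linear_imp_has_derivative\<close>)

lemma cdiff_on_compose:
  assumes "f cdiff_on S" "g cdiff_on T" "\<And>v. v \<in> S \<Longrightarrow> f v \<in> T"
  shows "(\<lambda>v. g (f v)) cdiff_on S"
  unfolding cdiff_on_def
proof
  fix v assume v: "v \<in> S"
  obtain D where D: "(f has_derivative D) (at v)" "\<And>c h. D (c *\<^sub>C h) = c *\<^sub>C D h"
    using assms(1) v by (rule cdiff_onE) blast
  obtain E where E: "(g has_derivative E) (at (f v))" "\<And>c h. E (c *\<^sub>C h) = c *\<^sub>C E h"
    using assms(2) assms(3)[OF v] by (rule cdiff_onE) blast
  have "((\<lambda>v. g (f v)) has_derivative (\<lambda>h. E (D h))) (at v)"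
    using has_derivative_compose[OF D(1) E(1)] .
  with D(2) E(2) show "\<exists>D. ((\<lambda>v. g (f v)) has_derivative D) (at v) \<and> (\<forall>c h. D (c *\<^sub>C h) = c *\<^sub>C D h)"
    by (intro exI[of _ "\<lambda>h. E (D h)"]) auto
qed

lemma cdiff_on_const [simp]: "(\<lambda>v. a) cdiff_on S"
  by (rule cdiff_onI[where D = "\<lambda>_ _. 0"]) auto

lemma cdiff_on_id [simp]: "(\<lambda>v. v) cdiff_on S"
  by (rule cdiff_on_linear) auto

lemma cdiff_on_Pair:
  assumes "f cdiff_on S" "g cdiff_on S"
  shows "(\<lambda>v. (f v, g v)) cdiff_on S"
  unfolding cdiff_on_def
proof
  fix v assume v: "v \<in> S"
  obtain D where D: "(f has_derivative D) (at v)" "\<And>c h. D (c *\<^sub>C h) = c *\<^sub>C D h"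
    using assms(1) v by (rule cdiff_onE) blast
  obtain E where E: "(g has_derivative E) (at v)" "\<And>c h. E (c *\<^sub>C h) = c *\<^sub>C E h"
    using assms(2) v by (rule cdiff_onE) blast
  show "\<exists>D. ((\<lambda>v. (f v, g v)) has_derivative D) (at v) \<and> (\<forall>c h. D (c *\<^sub>C h) = c *\<^sub>C D h)"
    using has_derivative_Pair[OF D(1) E(1)] D(2) E(2)
    by (intro exI[of _ "\<lambda>h. (D h, E h)"]) auto
qed

lemma cdiff_on_fst: "f cdiff_on S \<Longrightarrow> (\<lambda>v. fst (f v)) cdiff_on S"
  by (rule cdiff_on_compose[where T = UNIV and g = fst])
     (auto intro!: cdiff_on_linear bounded_linear_fst)

lemma cdiff_on_snd: "f cdiff_on S \<Longrightarrow> (\<lambda>v. snd (f v)) cdiff_on S"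
  by (rule cdiff_on_compose[where T = UNIV and g = snd])
     (auto intro!: cdiff_on_linear bounded_linear_snd)

lemma cdiff_on_vec_nth: "f cdiff_on S \<Longrightarrow> (\<lambda>v. f v $ i) cdiff_on S"
  by (rule cdiff_on_compose[where T = UNIV and g = "\<lambda>x. x $ i"])
     (auto intro!: cdiff_on_linear bounded_linear_vec_nth)

lemma cdiff_on_add:
  assumes "f cdiff_on S" "g cdiff_on S"
  shows "(\<lambda>v. f v + g v) cdiff_on S"
proof -
  have "(\<lambda>p. fst p + snd p :: 'b) cdiff_on UNIV"
    by (rule cdiff_on_linear)
       (auto simp: cs_add_right intro!: bounded_linear_add bounded_linear_fst bounded_linear_snd)
  from cdiff_on_compose[OF cdiff_on_Pair[OF assms] this] show ?thesis by simp
qed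

lemma cdiff_on_cs:
  assumes "f cdiff_on S"
  shows "(\<lambda>v. c *\<^sub>C f v) cdiff_on S"
  by (rule cdiff_on_compose[OF assms, where T = UNIV and g = "\<lambda>x. c *\<^sub>C x"])
     (auto intro!: cdiff_on_linear bounded_linear_cs_right simp: mult.commute)

lemma cdiff_on_cs_left:
  assumes "f cdiff_on S"
  shows "(\<lambda>v. f v *\<^sub>C e) cdiff_on S"
  by (rule cdiff_on_compose[OF assms, where T = UNIV and g = "\<lambda>x. x *\<^sub>C e"])
     (auto intro!: cdiff_on_linear bounded_linear_cs_left)

lemma cdiff_on_uminus: "f cdiff_on S \<Longrightarrow> (\<lambda>v. - f v) cdiff_on S"
  using cdiff_on_cs[of f S "-1"] by (simp add: cs_of_real[of "-1", simplified] del: cs_complex_def)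

lemma cdiff_on_diff: "f cdiff_on S \<Longrightarrow> g cdiff_on S \<Longrightarrow> (\<lambda>v. f v - g v) cdiff_on S"
  using cdiff_on_add[OF _ cdiff_on_uminus, of f S g] by simp

lemma cdiff_on_field:
  assumes "f cdiff_on S" "\<And>z. z \<in> T \<Longrightarrow> g field_differentiable at z" "\<And>v. v \<in> S \<Longrightarrow> f v \<in> T"
  shows "(\<lambda>v. (g (f v) :: complex)) cdiff_on S"
proof (rule cdiff_on_compose[OF assms(1) _ assms(3)])
  show "g cdiff_on T"
    by (rule cdiff_onI[where D = "\<lambda>v h. deriv g v * h"])
       (use assms(2) in \<open>auto simp: field_differentiable_derivI has_field_derivative_imp_has_derivative\<close>)
qed auto

lemma cdiff_on_mult:
  assumes "f cdiff_on S" "g cdiff_on S"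
  shows "(\<lambda>v. f v * g v :: complex) cdiff_on S"
  unfolding cdiff_on_def
proof
  fix v assume v: "v \<in> S"
  obtain D where D: "(f has_derivative D) (at v)" "\<And>c h. D (c *\<^sub>C h) = c *\<^sub>C D h"
    using assms(1) v by (rule cdiff_onE) blast
  obtain E where E: "(g has_derivative E) (at v)" "\<And>c h. E (c *\<^sub>C h) = c *\<^sub>C E h"
    using assms(2) v by (rule cdiff_onE) blast
  show "\<exists>D. ((\<lambda>v. f v * g v) has_derivative D) (at v) \<and> (\<forall>c h. D (c *\<^sub>C h) = c *\<^sub>C D h)"
    using has_derivative_mult[OF D(1) E(1)] D(2) E(2)
    by (intro exI[of _ "\<lambda>h. f v * E h + D h * g v"]) (auto simp: algebra_simps)
qed

lemma cdiff_on_power: "f cdiff_on S \<Longrightarrow> (\<lambda>v. f v ^ n :: complex) cdiff_on S"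
  by (induction n) (auto intro: cdiff_on_mult)

lemma cdiff_on_sum: "(\<And>i. i \<in> A \<Longrightarrow> f i cdiff_on S) \<Longrightarrow> (\<lambda>v. \<Sum>i\<in>A. f i v) cdiff_on S"
  by (induction A rule: infinite_finite_induct) (auto intro: cdiff_on_add)

lemma cdiff_on_prod: "(\<And>i. i \<in> A \<Longrightarrow> f i cdiff_on S) \<Longrightarrow> (\<lambda>v. \<Prod>i\<in>A. f i v :: complex) cdiff_on S"
  by (induction A rule: infinite_finite_induct) (auto intro: cdiff_on_mult)

lemma cdiff_on_inverse:
  "f cdiff_on S \<Longrightarrow> (\<And>v. v \<in> S \<Longrightarrow> f v \<noteq> 0) \<Longrightarrow> (\<lambda>v. inverse (f v) :: complex) cdiff_on S"
  by (rule cdiff_on_field[where T = "- {0}" and g = inverse])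
     (auto intro!: derivative_intros)

lemma cdiff_on_divide:
  "f cdiff_on S \<Longrightarrow> g cdiff_on S \<Longrightarrow> (\<And>v. v \<in> S \<Longrightarrow> g v \<noteq> 0) \<Longrightarrow> (\<lambda>v. f v / g v :: complex) cdiff_on S"
  unfolding divide_inverse by (intro cdiff_on_mult cdiff_on_inverse)

lemmas cdiff_intros = cdiff_on_const cdiff_on_id cdiff_on_Pair cdiff_on_fst cdiff_on_snd
  cdiff_on_vec_nth cdiff_on_add cdiff_on_uminus cdiff_on_diff cdiff_on_cs cdiff_on_cs_left
  cdiff_on_mult cdiff_on_power cdiff_on_sum cdiff_on_prod

lemma cdiff_line:
  assumes "f cdiff_on S" "v + z *\<^sub>C e \<in> S"
  shows "((\<lambda>z. f (v + z *\<^sub>C e)) has_field_derivative dd e f (v + z *\<^sub>C e)) (at z)"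
proof -
  obtain D where D: "(f has_derivative D) (at (v + z *\<^sub>C e))" "\<And>c h. D (c *\<^sub>C h) = c *\<^sub>C D h"
    using assms by (rule cdiff_onE) blast
  have "((\<lambda>z. v + z *\<^sub>C e) has_derivative (\<lambda>z. z *\<^sub>C e)) (at w)" for w
    by (auto intro!: derivative_eq_intros bounded_linear_imp_has_derivative bounded_linear_cs_left)
  from has_derivative_compose[OF this D(1)]
  have 1: "((\<lambda>z. f (v + z *\<^sub>C e)) has_field_derivative D e) (at z)"
    by (simp add: has_field_derivative_def D(2) mult_commute_abs)
  have "((\<lambda>u. f (v + (z + u) *\<^sub>C e)) has_field_derivative D e) (at 0)"
    using 1 DERIV_shift[of "\<lambda>z. f (v + z *\<^sub>C e)" "D e" 0 z] by (simp add: add.commute)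
  then have "dd e f (v + z *\<^sub>C e) = D e"
    unfolding dd_def by (intro DERIV_imp_deriv) (simp add: cs_add_left add_ac)
  with 1 show ?thesis by simp
qed

text \<open>Complex homogeneity turns the derivative on a complex line into multiplication by
  \<open>D e\<close>, so every derivative \<open>D\<close> coincides with \<open>dd\<close>, and no
  abstract witness has to be carried along.\<close>

lemma has_derivative_dd:
  assumes "f cdiff_on S" "v \<in> S"
  shows "(f has_derivative (\<lambda>h. dd h f v)) (at v)" "dd (c *\<^sub>C h) f v = c * dd h f v"
proof -
  obtain D where D: "(f has_derivative D) (at v)" "\<And>c h. D (c *\<^sub>C h) = c *\<^sub>C D h"
    using assms by (rule cdiff_onE) blast
  have "dd h f v = D h" for h
  proof -
    have "((\<lambda>z. v + z *\<^sub>C h) has_derivative (\<lambda>z. z *\<^sub>C h)) (at w)" for w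
      by (auto intro!: derivative_eq_intros bounded_linear_imp_has_derivative bounded_linear_cs_left)
    from has_derivative_compose[OF this[of 0], of f D] D(1)
    have 1: "((\<lambda>z. f (v + z *\<^sub>C h)) has_field_derivative D h) (at 0)"
      by (simp add: has_field_derivative_def D(2) mult_commute_abs)
    then show ?thesis unfolding dd_def by (rule DERIV_imp_deriv)
  qed
  with D show "(f has_derivative (\<lambda>h. dd h f v)) (at v)" "dd (c *\<^sub>C h) f v = c * dd h f v"
    by auto
qed

text \<open>Cauchy's inequality on the disc that the complex line cuts out of
  \<open>cball v \<rho>\<close>; measured in the line parameter its radius is
  \<open>\<rho> / norm e\<close>.\<close>

lemma dd_bound:
  fixes f :: "'a::cspace \<Rightarrow> complex"
  assumes "f cdiff_on S" "cball v \<rho> \<subseteq> S" "\<rho> > 0" "\<And>x. x \<in> cball v \<rho> \<Longrightarrow> norm (f x) \<le> B"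
  shows "norm (dd e f v) \<le> B / \<rho> * norm e"
proof (cases "e = 0")
  case True
  then show ?thesis by (simp add: dd_def)
next
  case False
  define r where "r = \<rho> / norm e"
  have r: "r > 0" using False assms by (simp add: r_def)
  have in_c: "v + z *\<^sub>C e \<in> cball v \<rho>" if "norm z \<le> r" for z
    using that False by (simp add: r_def dist_norm field_simps)
  have d: "((\<lambda>z. f (v + z *\<^sub>C e)) has_field_derivative dd e f (v + z *\<^sub>C e)) (at z)" if "norm z \<le> r" for z
    using assms(1) by (rule cdiff_line) (use in_c[OF that] assms(2) in auto)
  have "norm ((deriv ^^ 1) (\<lambda>z. f (v + z *\<^sub>C e)) 0) \<le> fact 1 * B / r ^ 1"
  proof (rule Cauchy_inequality)
    show "(\<lambda>z. f (v + z *\<^sub>C e)) holomorphic_on ball 0 r"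
      unfolding holomorphic_on_def field_differentiable_def
    proof
      fix z assume "z \<in> ball (0::complex) r"
      then show "\<exists>f'. ((\<lambda>z. f (v + z *\<^sub>C e)) has_field_derivative f') (at z within ball 0 r)"
        using has_field_derivative_at_within[OF d[of z]] by fastforce
    qed
    show "continuous_on (cball 0 r) (\<lambda>z. f (v + z *\<^sub>C e))"
      using DERIV_isCont[OF d] by (intro continuous_at_imp_continuous_on) simp
  qed (use r in_c assms in \<open>auto simp: norm_minus_commute\<close>)
  then show ?thesis using False by (simp add: dd_def r_def)
qed

text \<open>Weierstrass' theorem. Cauchy estimates for the differences turn uniform convergence of
  the functions into uniform convergence of the derivatives on a smaller ball, and complex
  homogeneity survives the pointwise limit.\<close>

lemma cdiff_uniform_limit:
  fixes f :: "nat \<Rightarrow> 'a::cspace \<Rightarrow> complex"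
  assumes S: "open S" and f: "\<And>n. f n cdiff_on S" and lim: "uniform_limit S f g sequentially"
  shows "g cdiff_on S"
proof (rule cdiff_on_local)
  fix v assume "v \<in> S"
  with S obtain \<rho> where \<rho>: "\<rho> > 0" "ball v (2 * \<rho>) \<subseteq> S"
    by (metis half_gt_zero open_contains_ball_eq mult.commute nonzero_mult_div_cancel_left 
        times_divide_eq_left zero_neq_numeral)
  define T where "T = ball v \<rho>"
  \<comment> \<open>Every point of the inner ball keeps a distance \<open>\<rho> / 2\<close> inside
    \<open>S\<close>, so a single Cauchy radius serves the whole ball.\<close>
  have cT: "cball x (\<rho>/2) \<subseteq> S" if "x \<in> T" for x
  proof -
    have "cball x (\<rho>/2) \<subseteq> ball v (2 * \<rho>)"
      using that \<rho>(1) unfolding T_def cball_subset_ball_iff by (auto simp: dist_commute)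
    then show ?thesis using \<rho>(2) by blast
  qed
  have TS: "T \<subseteq> S" using \<rho> unfolding T_def by (auto simp: subset_iff)
  have est: "\<forall>\<^sub>F n in sequentially. \<forall>m\<ge>n. \<forall>x\<in>T. \<forall>h. norm (dd h (f n) x - dd h (f m) x) \<le> e * norm h"
    if e: "e > 0" for e
  proof -
    have "\<exists>N. \<forall>n\<ge>N. \<forall>x\<in>S. dist (f n x) (g x) < e * \<rho> / 4"
      using lim e \<rho>(1) unfolding uniform_limit_iff eventually_sequentially
      by (meson divide_pos_pos mult_pos_pos zero_less_numeral)
    then obtain N where N: "\<And>n x. n \<ge> N \<Longrightarrow> x \<in> S \<Longrightarrow> dist (f n x) (g x) < e * \<rho> / 4" by blast
    have "norm (dd h (f n) x - dd h (f m) x) \<le> e * norm h" if nm: "n \<ge> N" "m \<ge> n" "x \<in> T" for n m x h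
    proof -
      have xS: "x \<in> S" using nm TS by auto
      have "norm (dd h (\<lambda>x. f n x - f m x) x) \<le> (e * \<rho> / 2) / (\<rho> / 2) * norm h"
      proof (rule dd_bound[OF _ cT[OF nm(3)]])
        show "(\<lambda>x. f n x - f m x) cdiff_on S" by (intro cdiff_intros f)
        fix y assume "y \<in> cball x (\<rho> / 2)"
        then have "y \<in> S" using cT[OF nm(3)] by auto
        then have "dist (f n y) (g y) < e * \<rho> / 4" "dist (f m y) (g y) < e * \<rho> / 4"
          using N nm by auto
        then have "dist (f n y) (f m y) \<le> e * \<rho> / 4 + e * \<rho> / 4"
          using dist_triangle2[of "f n y" "f m y" "g y"] by linarith
        then show "cmod (f n y - f m y) \<le> e * \<rho> / 2" by (simp add: dist_norm mult.commute)
      qed (use \<rho> in auto)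
      moreover have "dd h (\<lambda>x. f n x - f m x) x = dd h (f n) x - dd h (f m) x"
      proof -
        have "((\<lambda>x. f n x - f m x) has_derivative (\<lambda>h. dd h (f n) x - dd h (f m) x)) (at x)"
          by (intro derivative_intros has_derivative_dd(1)[OF f xS])
        moreover have "((\<lambda>x. f n x - f m x) has_derivative (\<lambda>h. dd h (\<lambda>x. f n x - f m x) x)) (at x)"
          by (rule has_derivative_dd(1)[OF _ xS]) (intro cdiff_intros f)
        ultimately have "(\<lambda>h. dd h (f n) x - dd h (f m) x) = (\<lambda>h. dd h (\<lambda>x. f n x - f m x) x)"
          by (rule has_derivative_unique)
        then show ?thesis by (rule fun_cong[THEN sym])
      qed
      ultimately show ?thesis using \<rho>(1) by simp
    qed
    then show ?thesis unfolding eventually_sequentially by blast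
  qed
  define g' where "g' x h = lim (\<lambda>n. dd h (f n) x)" for x h
  have conv: "(\<lambda>n. dd h (f n) x) \<longlonglongrightarrow> g' x h" if xT: "x \<in> T" for x h
  proof -
    have "Cauchy (\<lambda>n. dd h (f n) x)"
    proof (rule metric_CauchyI)
      fix e :: real assume e: "e > 0"
      \<comment> \<open>The summand 1 in the denominator covers \<open>h = 0\<close>.\<close>
      define e' where "e' = e / (2 * (norm h + 1))"
      have nh: "norm h + 1 > 0" using norm_ge_zero[of h] by linarith
      have e': "e' > 0" using e nh by (simp add: e'_def)
      have "e' * norm h \<le> e' * (norm h + 1)" using e' by simp
      also have "\<dots> = e / 2" using nh by (simp add: e'_def field_simps)
      finally have le: "e' * norm h \<le> e / 2" .
      have "\<exists>M. \<forall>m\<ge>M. \<forall>n\<ge>m. norm (dd h (f m) x - dd h (f n) x) \<le> e' * norm h"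
        using est[OF e'] xT unfolding eventually_sequentially by blast
      then obtain M where M: "\<And>m n. m \<ge> M \<Longrightarrow> n \<ge> m \<Longrightarrow> norm (dd h (f m) x - dd h (f n) x) \<le> e' * norm h"
        by blast
      have "e' * norm h < e"
        using le e by linarith
      have lt: "dist (dd h (f m) x) (dd h (f n) x) < e" if "m \<ge> M" "n \<ge> m" for m n
        using M[OF that] \<open>e' * norm h < e\<close> by (simp only: dist_norm)
      have "dist (dd h (f m) x) (dd h (f n) x) < e" if "m \<ge> M" "n \<ge> M" for m n
        using lt[OF that(1), of n] lt[OF that(2), of m] linear[of m n] by (metis dist_commute)
      then show "\<exists>M. \<forall>m\<ge>M. \<forall>n\<ge>M. dist (dd h (f m) x) (dd h (f n) x) < e" by blast
    qed
    then show ?thesis unfolding g'_def using Cauchy_convergent convergent_LIMSEQ_iff by blast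
  qed
  have "\<exists>l. \<forall>x\<in>T. (\<lambda>n. f n x) \<longlonglongrightarrow> l x \<and> (l has_derivative g' x) (at x within T)"
  proof (rule has_derivative_sequence)
    show "convex T" by (simp add: T_def)
    show "v \<in> T" using \<rho> by (simp add: T_def)
    show "(\<lambda>n. f n v) \<longlonglongrightarrow> g v"
      using lim \<open>v \<in> S\<close> by (rule tendsto_uniform_limitI)
    show "(f n has_derivative (\<lambda>h. dd h (f n) x)) (at x within T)" if "x \<in> T" for n x
      using has_derivative_dd(1)[OF f] that TS by (blast intro: has_derivative_at_withinI)
    fix e :: real assume e: "e > 0"
    show "\<forall>\<^sub>F n in sequentially. \<forall>x\<in>T. \<forall>h. cmod (dd h (f n) x - g' x h) \<le> e * norm h"
      using est[OF e]
    proof eventually_elim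
      case (elim n)
      show ?case
      proof (intro ballI allI)
        fix x h assume x: "x \<in> T"
        have "(\<lambda>m. norm (dd h (f n) x - dd h (f m) x)) \<longlonglongrightarrow> norm (dd h (f n) x - g' x h)"
          by (intro tendsto_intros conv x)
        then show "cmod (dd h (f n) x - g' x h) \<le> e * norm h"
          using elim x by (intro Lim_bounded[where M = n]) auto
      qed
    qed
  qed
  then obtain l where l: "\<And>x. x \<in> T \<Longrightarrow> (\<lambda>n. f n x) \<longlonglongrightarrow> l x"
     "\<And>x. x \<in> T \<Longrightarrow> (l has_derivative g' x) (at x within T)" by blast
  have "open T" by (simp add: T_def)
  have lc: "l cdiff_on T"
  proof (rule cdiff_onI)
    show "(l has_derivative g' x) (at x)" if "x \<in> T" for x
      using l(2)[OF that] at_within_open[OF that \<open>open T\<close>] by simp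
    show "g' x (c *\<^sub>C h) = c *\<^sub>C g' x h" if "x \<in> T" for x c h
    proof (rule LIMSEQ_unique[OF conv[OF that]])
      have "dd (c *\<^sub>C h) (f n) x = c * dd h (f n) x" for n
        using has_derivative_dd(2)[OF f] that TS by blast
      then show "(\<lambda>n. dd (c *\<^sub>C h) (f n) x) \<longlonglongrightarrow> c *\<^sub>C g' x h"
        by (simp add: tendsto_mult_left conv[OF that])
    qed
  qed
  have "g cdiff_on T"
    using lc \<open>open T\<close>
  proof (rule cdiff_on_cong)
    fix x assume "x \<in> T"
    then show "l x = g x"
      using l(1) tendsto_uniform_limitI[OF lim, of x] TS LIMSEQ_unique by blast
  qed
  then show "\<exists>T. v \<in> T \<and> g cdiff_on T" using \<rho> by (intro exI[of _ T]) (simp add: T_def)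
qed

section \<open>Parameter integrals, complex directional derivatives and division by a variable\<close>

text \<open>The error depends only on the oscillation of \<open>f\<close> at scale
  \<open>1 / N\<close>. This explicit form lets Riemann sums converge uniformly in a
  parameter.\<close>

lemma riemann_sum_bound:
  fixes f :: "real \<Rightarrow> complex"
  assumes cont: "continuous_on {0..1} f" and N: "N > 0"
    and osc: "\<And>s t. s \<in> {0..1} \<Longrightarrow> t \<in> {0..1} \<Longrightarrow> \<bar>s - t\<bar> \<le> 1 / real N \<Longrightarrow> norm (f s - f t) \<le> e"
  shows "norm (integral {0..1} f - (\<Sum>i<N. f (real i / N)) / N) \<le> e"
proof -
  have "norm (integral {0..k / N} f - (\<Sum>i<k. f (real i / N)) / N) \<le> k * (e / N)" if "k \<le> N" for k
    using that
  proof (induction k)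
    case 0
    then show ?case by simp
  next
    case (Suc k)
    define a b where "a = real k / N" and "b = real (Suc k) / N"
    have ab: "0 \<le> a" "a \<le> b" "b \<le> 1" "b - a = 1 / N" 
      using Suc.prems N by (auto simp: a_def b_def field_simps)
    have c: "continuous_on {0..b} f" "continuous_on {a..b} f"
      using cont by (rule continuous_on_subset; use ab in auto)+
    have "integral {0..b} f = integral {0..a} f + integral {a..b} f"
      by (rule Henstock_Kurzweil_Integration.integral_combine[symmetric])
         (use ab c in \<open>auto intro!: integrable_continuous_interval\<close>)
    moreover have "integral {a..b} (\<lambda>t. f t - f a) = integral {a..b} f - f a / N"
      using c(2) ab N by (subst Henstock_Kurzweil_Integration.integral_diff)
         (auto intro!: integrable_continuous_interval simp: scaleR_conv_of_real divide_inverse mult.commute)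
    moreover have "norm (integral {a..b} (\<lambda>t. f t - f a)) \<le> e * (b - a)"
      using ab c(2) osc by (intro integral_bound) (auto intro!: continuous_intros)
    ultimately have 1: "norm (integral {0..b} f - integral {0..a} f - f a / N) \<le> e / N"
      using ab by simp
    have 2: "norm (integral {0..a} f - (\<Sum>i<k. f (real i / N)) / N) \<le> k * (e / N)"
      using Suc by (simp add: a_def)
    have "integral {0..b} f - (\<Sum>i<Suc k. f (real i / N)) / N =
       (integral {0..b} f - integral {0..a} f - f a / N) + (integral {0..a} f - (\<Sum>i<k. f (real i / N)) / N)"
      by (simp add: a_def add_divide_distrib)
    then have "norm (integral {0..b} f - (\<Sum>i<Suc k. f (real i / N)) / N) \<le> e / N + k * (e / N)"
      using norm_triangle_mono[OF 1 2] by metis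
    then show ?case by (simp add: b_def algebra_simps add_divide_distrib)
  qed
  from this[of N] N show ?thesis by simp
qed

text \<open>Riemann sums are finite combinations of holomorphic functions, and uniform continuity on
  compact sets makes them converge locally uniformly. The integral is never differentiated
  directly.\<close>

lemma cdiff_integral:
  fixes f :: "'a::cspace \<Rightarrow> real \<Rightarrow> complex"
  assumes S: "open S" and cont: "continuous_on (S \<times> {0..1}) (\<lambda>(v, t). f v t)"
    and f: "\<And>t. t \<in> {0..1} \<Longrightarrow> (\<lambda>v. f v t) cdiff_on S"
  shows "(\<lambda>v. integral {0..1} (f v)) cdiff_on S"
proof (rule cdiff_on_local)
  fix v assume "v \<in> S"
  with S obtain \<rho> where \<rho>: "\<rho> > 0" "cball v \<rho> \<subseteq> S"
    using open_contains_cball by blast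
  define K where "K = cball v \<rho> \<times> {0..1::real}"
  have "uniformly_continuous_on K (\<lambda>(v, t). f v t)"
    unfolding K_def using \<rho>
    by (intro compact_uniformly_continuous continuous_on_subset[OF cont] compact_Times) auto
  then have uc: "\<exists>d>0. \<forall>x s t. x \<in> cball v \<rho> \<longrightarrow> s \<in> {0..1} \<longrightarrow> t \<in> {0..1} \<longrightarrow> \<bar>s - t\<bar> < d \<longrightarrow>
      norm (f x s - f x t) < e" if "e > 0" for e
    using that unfolding uniformly_continuous_on_def K_def
    by (fastforce simp: dist_Pair_Pair dist_norm)
  define F where "F n x = (\<Sum>i<Suc n. f x (real i / Suc n)) / Suc n" for n x
  have "(\<lambda>v. integral {0..1} (f v)) cdiff_on ball v \<rho>"
  proof (rule cdiff_uniform_limit)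
    show "F n cdiff_on ball v \<rho>" for n
    proof -
      have "(\<lambda>x. (\<Sum>i<Suc n. f x (real i / Suc n)) * (1 / Suc n)) cdiff_on S"
        by (intro cdiff_intros f) (auto simp: field_simps)
      moreover have "F n = (\<lambda>x. (\<Sum>i<Suc n. f x (real i / Suc n)) * (1 / Suc n))"
        by (simp add: F_def fun_eq_iff)
      ultimately have "F n cdiff_on S" by simp
      then show ?thesis
        by (rule cdiff_on_subset) (use \<rho>(2) ball_subset_cball in blast)
    qed
    show "uniform_limit (ball v \<rho>) F (\<lambda>v. integral {0..1} (f v)) sequentially"
    proof (rule uniform_limitI)
      fix e :: real assume e: "e > 0"
      obtain d where d: "d > 0" "\<And>x s t. x \<in> cball v \<rho> \<Longrightarrow> s \<in> {0..1} \<Longrightarrow> t \<in> {0..1} \<Longrightarrow> \<bar>s - t\<bar> < d \<Longrightarrow>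
          norm (f x s - f x t) < e / 2"
        using uc[of "e/2"] e by auto
      have "\<forall>\<^sub>F n in sequentially. 1 / real (Suc n) < d"
        using order_tendstoD(2)[OF LIMSEQ_inverse_real_of_nat d(1)] by (simp add: field_simps)
      then show "\<forall>\<^sub>F n in sequentially. \<forall>x\<in>ball v \<rho>. dist (F n x) (integral {0..1} (f x)) < e"
      proof eventually_elim
        case (elim n)
        show ?case
        proof
          fix x assume x: "x \<in> ball v \<rho>"
          have "norm (integral {0..1} (f x) - (\<Sum>i<Suc n. f x (real i / Suc n)) / Suc n) \<le> e / 2"
          proof (rule riemann_sum_bound)
            have "continuous_on {0..1} (\<lambda>t. (\<lambda>(v,t). f v t) (x, t))"
              by (rule continuous_on_compose2[OF cont]) (use x \<rho> in \<open>auto intro!: continuous_intros\<close>)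
            then show "continuous_on {0..1} (f x)" by simp
            fix s t :: real assume "s \<in> {0..1}" "t \<in> {0..1}" "\<bar>s - t\<bar> \<le> 1 / real (Suc n)"
            then show "norm (f x s - f x t) \<le> e / 2"
              using d(2)[of x s t] x elim by fastforce
          qed auto
          then show "dist (F n x) (integral {0..1} (f x)) < e"
            using e by (simp add: F_def dist_norm norm_minus_commute)
        qed
      qed
    qed
  qed auto
  then show "\<exists>T. v \<in> T \<and> (\<lambda>v. integral {0..1} (f v)) cdiff_on T" using \<rho> by (intro exI[of _ "ball v \<rho>"]) auto
qed

text \<open>Cauchy's formula for the first derivative over a circle of radius
  \<open>\<epsilon>\<close> in the complex line. Writing \<open>dd\<close> as a parameter integral
  reduces its holomorphy to \<open>cdiff_integral\<close>.\<close>

lemma dd_integral: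
  assumes f: "f cdiff_on S" and "cball x (\<epsilon> * norm e) \<subseteq> S" and \<epsilon>: "\<epsilon> > 0"
  shows "dd e f x = integral {0..1} (\<lambda>t::real. f (x + (\<epsilon> * exp (2 * pi * \<i> * t)) *\<^sub>C e) / (\<epsilon> * exp (2 * pi * \<i> * t)))"
proof -
  define h where "h z = f (x + z *\<^sub>C e)" for z
  have h: "(h has_field_derivative dd e f (x + z *\<^sub>C e)) (at z)" if "norm z \<le> \<epsilon>" for z
    unfolding h_def
    by (rule cdiff_line[OF f]) (use assms that in \<open>auto simp: subset_iff dist_norm mult_right_mono\<close>)
  have dh: "deriv h 0 = dd e f x" unfolding dd_def h_def[abs_def] ..
  have "((\<lambda>u. h u / (u - 0) ^ Suc 1) has_contour_integral (2 * pi * \<i> / fact 1 * (deriv ^^ 1) h 0)) (circlepath 0 \<epsilon>)"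
  proof (rule Cauchy_has_contour_integral_higher_derivative_circlepath)
    show "continuous_on (cball 0 \<epsilon>) h"
      using DERIV_isCont[OF h] by (intro continuous_at_imp_continuous_on) simp
    show "h holomorphic_on ball 0 \<epsilon>"
      unfolding holomorphic_on_def field_differentiable_def
    proof
      fix z assume "z \<in> ball (0::complex) \<epsilon>"
      then show "\<exists>f'. (h has_field_derivative f') (at z within ball 0 \<epsilon>)"
        using has_field_derivative_at_within[OF h[of z]] by fastforce
    qed
  qed (use \<epsilon> in auto)
  then have "((\<lambda>t. h (circlepath 0 \<epsilon> t) / (circlepath 0 \<epsilon> t)\<^sup>2 * vector_derivative (circlepath 0 \<epsilon>) (at t within {0..1}))
       has_integral (2 * pi * \<i> * dd e f x)) {0..1}"
    unfolding has_contour_integral_def by (simp add: dh power2_eq_square)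
  then have "((\<lambda>t::real. (2 * pi * \<i>) * (h (\<epsilon> * exp (2 * pi * \<i> * t)) / (\<epsilon> * exp (2 * pi * \<i> * t))))
       has_integral (2 * pi * \<i> * dd e f x)) {0..1}"
  proof (rule has_integral_eq[rotated])
    fix t :: real assume t: "t \<in> {0..1}"
    have vd: "vector_derivative (circlepath 0 \<epsilon>) (at t within {0..1}) = 2 * pi * \<i> * \<epsilon> * exp (2 * pi * \<i> * t)"
      using t by (simp add: vector_derivative_circlepath01)
    have cp: "circlepath 0 \<epsilon> t = \<epsilon> * exp (2 * pi * \<i> * t)"
      by (simp add: circlepath)
    show "h (circlepath 0 \<epsilon> t) / (circlepath 0 \<epsilon> t)\<^sup>2 * vector_derivative (circlepath 0 \<epsilon>) (at t within {0..1}) =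
        (2 * pi * \<i>) * (h (\<epsilon> * exp (2 * pi * \<i> * t)) / (\<epsilon> * exp (2 * pi * \<i> * t)))"
      unfolding vd cp using \<epsilon> by (simp add: power2_eq_square)
  qed
  from has_integral_mult_right[OF this, of "1 / (2 * pi * \<i>)"]
  have "((\<lambda>t::real. h (\<epsilon> * exp (2 * pi * \<i> * t)) / (\<epsilon> * exp (2 * pi * \<i> * t)))
       has_integral dd e f x) {0..1}"
    by simp
  then show ?thesis unfolding h_def by (simp add: integral_unique)
qed

lemma cdiff_dd:
  assumes f: "f cdiff_on S" and S: "open S"
  shows "dd e f cdiff_on S"
proof (rule cdiff_on_local)
  fix v assume "v \<in> S"
  with S obtain \<rho> where \<rho>: "\<rho> > 0" "ball v \<rho> \<subseteq> S"
    using open_contains_ball by blast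
  \<comment> \<open>The circle then moves points by at most \<open>\<rho> / 4\<close>; the summand 1
    covers \<open>e = 0\<close>.\<close>
  define \<epsilon> where "\<epsilon> = \<rho> / 4 / (norm e + 1)"
  have ne: "norm e + 1 > 0" using norm_ge_zero[of e] by linarith
  have \<epsilon>: "\<epsilon> > 0" using \<rho> ne by (simp add: \<epsilon>_def)
  have "\<epsilon> * norm e \<le> \<epsilon> * (norm e + 1)" using \<epsilon> by simp
  also have "\<dots> = \<rho> / 4" using ne \<epsilon>_def by (metis eq_divide_eq less_irrefl)
  finally have \<epsilon>e: "\<epsilon> * norm e \<le> \<rho> / 4" .
  define g where "g x t = f (x + (\<epsilon> * exp (2 * pi * \<i> * t)) *\<^sub>C e) * inverse (\<epsilon> * exp (2 * pi * \<i> * t))" for x and t :: real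
  have inS: "x + (\<epsilon> * exp (2 * pi * \<i> * t)) *\<^sub>C e \<in> S" if "x \<in> ball v (\<rho>/2)" for x and t :: real
  proof -
    have "norm ((\<epsilon> * exp (2 * pi * \<i> * t)) *\<^sub>C e) \<le> \<rho> / 4"
      using \<epsilon>e \<epsilon> by (simp add: norm_mult)
    then have "dist (x + (\<epsilon> * exp (2 * pi * \<i> * t)) *\<^sub>C e) x \<le> \<rho> / 4"
      by (simp add: dist_norm)
    moreover have "dist v x < \<rho> / 2" using that by simp
    moreover have "dist v (x + (\<epsilon> * exp (2 * pi * \<i> * t)) *\<^sub>C e) \<le>
        dist v x + dist (x + (\<epsilon> * exp (2 * pi * \<i> * t)) *\<^sub>C e) x"
      by (metis dist_commute dist_triangle)
    ultimately have "dist v (x + (\<epsilon> * exp (2 * pi * \<i> * t)) *\<^sub>C e) < \<rho>"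
      using \<rho>(1) by linarith
    then show ?thesis using \<rho>(2) by auto
  qed
  have "(\<lambda>x. integral {0..1} (g x)) cdiff_on ball v (\<rho>/2)"
  proof (rule cdiff_integral)
    show "(\<lambda>x. g x t) cdiff_on ball v (\<rho>/2)" if "t \<in> {0..1}" for t
      unfolding g_def
      by (intro cdiff_on_mult cdiff_on_const cdiff_on_compose[where T = S, OF _ f] cdiff_intros inS)
    show "continuous_on (ball v (\<rho>/2) \<times> {0..1}) (\<lambda>(x, t). g x t)"
      unfolding g_def split_beta using \<epsilon> inS
      by (intro continuous_intros continuous_on_compose2[OF cdiff_on_continuous_on[OF f]]
           bounded_linear.continuous_on[OF bounded_linear_cs_left]) auto
  qed auto
  moreover have "integral {0..1} (g x) = dd e f x" if "x \<in> ball v (\<rho>/2)" for x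
  proof -
    have "cball x (\<epsilon> * norm e) \<subseteq> ball v \<rho>"
      using that \<epsilon>e \<rho>(1) unfolding cball_subset_ball_iff by (auto simp: dist_commute)
    then show ?thesis
      using \<rho>(2) dd_integral[OF f _ \<epsilon>, of x e] by (simp add: g_def[abs_def] divide_inverse)
  qed
  ultimately have "dd e f cdiff_on ball v (\<rho>/2)" using cdiff_on_cong[OF _ open_ball] by blast
  then show "\<exists>T. v \<in> T \<and> dd e f cdiff_on T" using \<rho> by (intro exI[of _ "ball v (\<rho>/2)"]) simp
qed

lemma dd_cong:
  assumes "open S" "v \<in> S" "\<And>x. x \<in> S \<Longrightarrow> f x = g x"
  shows "dd e f v = dd e g v"
proof -
  have "open ((\<lambda>z. v + z *\<^sub>C e) -` S)"
    by (rule open_vimage[OF assms(1)])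
       (intro continuous_intros bounded_linear.continuous_on[OF bounded_linear_cs_left])
  then have "\<forall>\<^sub>F z in nhds 0. z \<in> (\<lambda>z. v + z *\<^sub>C e) -` S"
    by (rule eventually_nhds_in_open) (simp add: assms)
  then show ?thesis unfolding dd_def
    by (intro deriv_cong_ev) (auto elim!: eventually_mono simp: assms)
qed

text \<open>A function that is real along a real line has constant imaginary part there, so its
  derivative in that direction is real. This links the complex extensions to the real derivatives in
  \<open>f_fun\<close> and \<open>gradient_at\<close>.\<close>

lemma dd_real:
  assumes f: "f cdiff_on S" and v: "v \<in> S"
    and real: "\<forall>\<^sub>F s in nhds (0::real). f (v + of_real s *\<^sub>C e) = of_real (g s)"
  shows "(g has_real_derivative Re (dd e f v)) (at 0)" "dd e f v \<in> \<real>"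
proof -
  have "((\<lambda>z. f (v + z *\<^sub>C e)) has_field_derivative dd e f v) (at (of_real 0))"
    using cdiff_line[OF f, of v 0 e] v by simp
  then have 1: "((\<lambda>s. f (v + of_real s *\<^sub>C e)) has_vector_derivative dd e f v) (at 0)"
    by (rule has_vector_derivative_real_field)
  have "f v = of_real (g 0)" using eventually_nhds_x_imp_x[OF real] by simp
  with 1 have 2: "((\<lambda>s. of_real (g s) :: complex) has_vector_derivative dd e f v) (at 0)"
    unfolding has_vector_derivative_def
    by (elim has_derivative_transform_eventually)
       (use real in \<open>auto simp: eventually_at_filter elim: eventually_mono\<close>)
  from bounded_linear.has_vector_derivative[OF bounded_linear_Re 2]
  show "(g has_real_derivative Re (dd e f v)) (at 0)"
    by (simp add: has_real_derivative_iff_has_vector_derivative)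
  from bounded_linear.has_vector_derivative[OF bounded_linear_Im 2]
  have "((\<lambda>s. 0 :: real) has_real_derivative Im (dd e f v)) (at 0)"
    by (simp add: has_real_derivative_iff_has_vector_derivative)
  then have "Im (dd e f v) = 0" using DERIV_unique[OF _ DERIV_const] by blast
  then show "dd e f v \<in> \<real>" by (simp add: complex_is_Real_iff)
qed

text \<open>Hadamard's quotient \<open>(f (r, p) - f (0, p)) / r\<close>, written as an average of
  the derivative so that it extends holomorphically over \<open>r = 0\<close>. The iterates
  \<open>divx ^^ i\<close> at \<open>r = 0\<close> are the Taylor coefficients in
  \<open>r\<close>.\<close>

definition divx :: "(complex \<times> 'p::cspace \<Rightarrow> complex) \<Rightarrow> complex \<times> 'p \<Rightarrow> complex" where
  "divx f v = integral {0..1} (\<lambda>t. dd (1, 0) f (of_real t * fst v, snd v))"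

text \<open>Star-shapedness towards \<open>r = 0\<close> for each fixed \<open>p\<close>: exactly
  the segments over which \<open>divx\<close> integrates.\<close>

definition radial :: "(complex \<times> 'p::cspace) set \<Rightarrow> bool" where
  "radial S \<longleftrightarrow> (\<forall>r p t. (r, p) \<in> S \<longrightarrow> 0 \<le> t \<longrightarrow> t \<le> (1::real) \<longrightarrow> (of_real t * r, p) \<in> S)"

lemma radialD: "radial S \<Longrightarrow> (r, p) \<in> S \<Longrightarrow> 0 \<le> t \<Longrightarrow> t \<le> (1::real) \<Longrightarrow> (of_real t * r, p) \<in> S"
  unfolding radial_def by blast

lemma radial_Times: "radial (ball 0 a \<times> Q)"
proof -
  have "t * cmod r < a" if "cmod r < a" "0 \<le> t" "t \<le> 1" for t r
    using that mult_left_le_one_le[of "cmod r" t] by auto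
  then show ?thesis by (auto simp: radial_def norm_mult)
qed

lemma cdiff_divx:
  assumes f: "f cdiff_on S" and S: "open S" "radial S"
  shows "divx f cdiff_on S"
proof -
  have "(\<lambda>v. integral {0..1} (\<lambda>t. dd (1, 0) f (of_real t * fst v, snd v))) cdiff_on S"
  proof (rule cdiff_integral)
    have [simp]: "(of_real t * fst v, snd v) \<in> S" if "v \<in> S" "t \<in> {0..1}" for v and t :: real
      using S(2) that radialD[of S "fst v" "snd v" t] by auto
    show "(\<lambda>v. dd (1, 0) f (complex_of_real t * fst v, snd v)) cdiff_on S" if "t \<in> {0..1}" for t
      by (rule cdiff_on_compose[OF _ cdiff_dd[OF f S(1)]]) (use that in \<open>auto intro!: cdiff_intros\<close>)
    show "continuous_on (S \<times> {0..1}) (\<lambda>(v, t). dd (1, 0) f (complex_of_real t * fst v, snd v))"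
      unfolding split_beta
      by (intro continuous_on_compose2[OF cdiff_on_continuous_on[OF cdiff_dd[OF f S(1)]]] continuous_intros)
         (auto intro: radialD[OF S(2)])
  qed fact
  then show ?thesis unfolding divx_def[abs_def] .
qed

lemma cdiff_divx_pow:
  assumes f: "f cdiff_on S" and S: "open S" "radial S"
  shows "(divx ^^ i) f cdiff_on S"
  by (induction i) (auto intro: cdiff_divx S f)

lemma dd_fst:
  assumes f: "f cdiff_on S" and "(r, p) \<in> S"
  shows "((\<lambda>r. f (r, p)) has_field_derivative dd (1, 0) f (r, p)) (at r)"
  using cdiff_line[OF f, of "(0, p)" r "(1, 0)"] assms by simp

lemma dd_fst_deriv: "dd (1, 0) f (r, p) = deriv (\<lambda>z. f (z, p)) r"
proof -
  have "deriv (\<lambda>z. f (r + z, p)) 0 = deriv (\<lambda>z. f (z, p)) (r + 0)"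
    unfolding deriv_def
    by (intro arg_cong[where f = Eps] ext)
       (use DERIV_shift[of "\<lambda>z. f (z, p)" _ 0 r] in \<open>simp add: add.commute\<close>)
  then show ?thesis by (simp add: dd_def)
qed

lemma deriv_pow_fst: "(deriv ^^ n) (\<lambda>z. f (z, p)) r = (dd (1, 0) ^^ n) f (r, p)"
proof (induction n arbitrary: r)
  case (Suc n)
  have "(deriv ^^ n) (\<lambda>z. f (z, p)) = (\<lambda>z. (dd (1, 0) ^^ n) f (z, p))" by (rule ext) (rule Suc)
  then show ?case by (simp add: dd_fst_deriv)
qed simp

lemma divx_eq:
  assumes f: "f cdiff_on S" and S: "radial S" "(r, p) \<in> S"
  shows "f (r, p) = f (0, p) + r * divx f (r, p)"
proof -
  have "((\<lambda>t. r * dd (1, 0) f (of_real t * r, p)) has_integral f (of_real 1 * r, p) - f (of_real 0 * r, p)) {0..1}"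
  proof (rule fundamental_theorem_of_calculus)
    fix t :: real assume "t \<in> {0..1}"
    then have "(of_real t * r, p) \<in> S" using S by (auto intro: radialD)
    from dd_fst[OF f this]
    have "((\<lambda>r. f (r, p)) \<circ> (\<lambda>t. of_real t * r) has_vector_derivative r * dd (1, 0) f (of_real t * r, p)) (at t)"
      by (intro field_vector_diff_chain_at) (auto intro!: derivative_eq_intros simp: has_vector_derivative_def scaleR_conv_of_real)
    then have "((\<lambda>t. f (of_real t * r, p)) has_vector_derivative r * dd (1, 0) f (of_real t * r, p)) (at t)"
      by (simp add: o_def)
    then show "((\<lambda>t. f (of_real t * r, p)) has_vector_derivative r * dd (1, 0) f (of_real t * r, p)) (at t within {0..1})"
      by (rule has_vector_derivative_at_within)
  qed auto
  then have "integral {0..1} (\<lambda>t. r * dd (1, 0) f (of_real t * r, p)) = f (r, p) - f (0, p)"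
    by (drule_tac integral_unique) simp
  then show ?thesis by (simp add: divx_def)
qed

text \<open>The lower coefficients have to vanish at the single parameter \<open>p\<close> only,
  whereas the quotient \<open>(divx ^^ m) f\<close> is holomorphic in all parameters.\<close>

lemma divx_pow_zero:
  assumes f: "f cdiff_on S" and S: "open S" "radial S" "(r, p) \<in> S"
    and "\<And>i. i < m \<Longrightarrow> (divx ^^ i) f (0, p) = 0"
  shows "f (r, p) = r ^ m * (divx ^^ m) f (r, p)"
  using assms(5)
proof (induction m)
  case (Suc m)
  then have "f (r, p) = r ^ m * (divx ^^ m) f (r, p)" by simp
  also have "(divx ^^ m) f (r, p) = r * (divx ^^ Suc m) f (r, p)"
    using divx_eq[OF cdiff_divx_pow[OF f S(1,2)] S(2,3), of m] Suc.prems by simp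
  finally show ?case by simp
qed auto

lemma tendsto_at_right_cdiff:
  assumes f: "f cdiff_on S" and "(0, p) \<in> S"
  shows "((\<lambda>x::real. f (of_real x, p)) \<longlongrightarrow> f (0, p)) (at_right 0)"
proof -
  have "((\<lambda>x::real. f (of_real x, p)) \<longlongrightarrow> f (of_real 0, p)) (at_right 0)"
  proof (rule isCont_tendsto_compose[where g = f])
    show "isCont f (of_real 0, p)" using assms by (auto intro!: cdiff_on_isCont)
  qed (intro tendsto_intros)
  then show ?thesis by simp
qed

text \<open>Reads the order of vanishing and the leading Taylor coefficient off a one-sided real
  limit, the form into which the hypotheses on \<open>g\<close> and \<open>f\<close> are
  brought.\<close>

lemma divx_pow_limit:
  assumes f: "f cdiff_on S" and S: "open S" "radial S" "(0, p) \<in> S"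
    and lim: "((\<lambda>x::real. f (of_real x, p) / of_real x ^ m) \<longlongrightarrow> c) (at_right 0)"
  shows "(divx ^^ m) f (0, p) = c" "i < m \<Longrightarrow> (divx ^^ i) f (0, p) = 0"
proof -
  have "(divx ^^ m) f (0, p) = c \<and> (\<forall>i<m. (divx ^^ i) f (0, p) = 0)"
    using f lim
  proof (induction m arbitrary: f)
    case 0
    then show ?case
      using tendsto_unique[OF _ tendsto_at_right_cdiff[OF 0(1) S(3)], of c] by simp
  next
    case (Suc m)
    \<comment> \<open>A finite limit after division by a positive power forces
      \<open>f (0, p) = 0\<close>; one factor can then be removed, and the induction continues with
      \<open>divx f\<close>.\<close>
    have "((\<lambda>x::real. f (of_real x, p) / of_real x ^ Suc m * of_real x ^ Suc m) \<longlongrightarrow> c * of_real 0 ^ Suc m) (at_right 0)"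
      by (intro tendsto_intros Suc.prems)
    then have "((\<lambda>x::real. f (of_real x, p)) \<longlongrightarrow> c * of_real 0 ^ Suc m) (at_right 0)"
      by (rule Lim_transform_eventually) (auto simp: eventually_at_filter)
    then have "((\<lambda>x::real. f (of_real x, p)) \<longlongrightarrow> 0) (at_right 0)"
      by simp
    then have f0: "f (0, p) = 0"
      using tendsto_unique[OF _ tendsto_at_right_cdiff[OF Suc.prems(1) S(3)]] by simp
    have "open ((\<lambda>x::real. (of_real x :: complex, p)) -` S)"
      by (rule open_vimage[OF S(1)]) (intro continuous_intros)
    then have "\<forall>\<^sub>F x in nhds (0::real). x \<in> (\<lambda>x::real. (of_real x :: complex, p)) -` S"
      by (rule eventually_nhds_in_open) (use S in simp)
    then have ev: "\<forall>\<^sub>F x in at_right (0::real). (of_real x, p) \<in> S \<and> x \<noteq> 0"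
      by (auto simp: eventually_at_filter elim: eventually_mono)
    have "((\<lambda>x::real. divx f (of_real x, p) / of_real x ^ m) \<longlongrightarrow> c) (at_right 0)"
      using Suc.prems(2)
    proof (rule Lim_transform_eventually)
      show "\<forall>\<^sub>F x in at_right 0. f (of_real x, p) / of_real x ^ Suc m = divx f (of_real x, p) / of_real x ^ m"
        using ev
      proof eventually_elim
        case (elim x)
        then show ?case using divx_eq[OF Suc.prems(1) S(2), of "of_real x" p] f0 by simp
      qed
    qed
    from Suc.IH[OF cdiff_divx[OF Suc.prems(1) S(1,2)] this]
    have "(divx ^^ m) (divx f) (0, p) = c" "\<forall>i<m. (divx ^^ i) (divx f) (0, p) = 0" by auto
    then show ?case using f0
      by (auto simp: less_Suc_eq_0_disj funpow_swap1 simp del: funpow.simps(2) simp add: funpow_Suc_right)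
  qed
  then show "(divx ^^ m) f (0, p) = c" "i < m \<Longrightarrow> (divx ^^ i) f (0, p) = 0" by auto
qed

text \<open>The set \<open>P\<close> collects the parameters that count as real, since an arbitrary
  complex space has no distinguished real part.\<close>

definition real_on :: "(complex \<times> 'p::cspace) set \<Rightarrow> 'p set \<Rightarrow> (complex \<times> 'p \<Rightarrow> complex) \<Rightarrow> bool" where
  "real_on S P f \<longleftrightarrow> (\<forall>r p. p \<in> P \<longrightarrow> (complex_of_real r, p) \<in> S \<longrightarrow> f (of_real r, p) \<in> \<real>)"

lemma real_on_dd:
  assumes f: "f cdiff_on S" and S: "open S" and r: "real_on S P f"
  shows "real_on S P (dd (1, 0) f)"
  unfolding real_on_def
proof (intro allI impI)
  fix r p assume p: "p \<in> P" "(complex_of_real r, p) \<in> S"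
  have "open ((\<lambda>x::real. (of_real r + of_real x :: complex, p)) -` S)"
    by (rule open_vimage[OF S(1)]) (intro continuous_intros)
  then have "\<forall>\<^sub>F x in nhds (0::real). x \<in> (\<lambda>x::real. (of_real r + of_real x :: complex, p)) -` S"
    by (rule eventually_nhds_in_open) (use p in simp)
  then have "\<forall>\<^sub>F s in nhds (0::real). f ((of_real r, p) + of_real s *\<^sub>C (1, 0)) = of_real (Re (f (of_real (r + s), p)))"
  proof eventually_elim
    case (elim s)
    then have "f (of_real (r + s), p) \<in> \<real>" using r p(1) unfolding real_on_def by (metis of_real_add vimageD)
    then show ?case by (simp add: of_real_Re)
  qed
  from dd_real(2)[OF f p(2) this] show "dd (1, 0) f (of_real r, p) \<in> \<real>" .
qed

lemma integral_Reals:
  fixes f :: "real \<Rightarrow> complex"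
  assumes "f integrable_on A" "\<And>t. t \<in> A \<Longrightarrow> f t \<in> \<real>"
  shows "integral A f \<in> \<real>"
proof -
  have "Im (integral A f) = integral A (\<lambda>t. Im (f t))"
    using integral_linear[OF assms(1) bounded_linear_Im] by (simp add: o_def)
  also have "\<dots> = integral A (\<lambda>t. 0)"
    by (rule Henstock_Kurzweil_Integration.integral_cong) (use assms(2) in \<open>auto simp: complex_is_Real_iff\<close>)
  finally show ?thesis by (simp add: complex_is_Real_iff)
qed

lemma real_on_divx:
  assumes f: "f cdiff_on S" and S: "open S" "radial S" and r: "real_on S P f"
  shows "real_on S P (divx f)"
  unfolding real_on_def divx_def
proof (intro allI impI integral_Reals integrable_continuous_interval)
  fix r p assume p: "p \<in> P" "(complex_of_real r, p) \<in> S"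
  then have in_S: "(complex_of_real t * complex_of_real r, p) \<in> S" if "t \<in> {0..1}" for t :: real
    using that S by (auto intro: radialD)
  show "continuous_on {0..1} (\<lambda>t. dd (1, 0) f (complex_of_real t * fst (complex_of_real r, p), snd (complex_of_real r, p)))"
    using in_S
    by (intro continuous_on_compose2[OF cdiff_on_continuous_on[OF cdiff_dd[OF f S(1)]]] continuous_intros) auto
  fix t :: real assume "t \<in> {0..1}"
  then show "dd (1, 0) f (complex_of_real t * fst (complex_of_real r, p), snd (complex_of_real r, p)) \<in> \<real>"
    using real_on_dd[OF f S(1) r] p in_S[of t] unfolding real_on_def by (simp flip: of_real_mult)
qed

lemma real_on_divx_pow:
  assumes f: "f cdiff_on S" and S: "open S" "radial S" and r: "real_on S P f"
  shows "real_on S P ((divx ^^ i) f)"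
  by (induction i) (auto intro!: real_on_divx cdiff_divx_pow assms)

lemma cdiff_dd_pow:
  assumes f: "f cdiff_on S" and S: "open S"
  shows "(dd e ^^ i) f cdiff_on S"
  by (induction i) (auto intro: cdiff_dd S f)

lemma dd_pow_cong:
  assumes "open S" "v \<in> S" "\<And>x. x \<in> S \<Longrightarrow> f x = g x"
  shows "(dd e ^^ i) f v = (dd e ^^ i) g v"
  using assms(2) by (induction i arbitrary: v) (auto intro!: dd_cong assms)

lemma dd_pow_times:
  assumes g: "g cdiff_on S" and S: "open S" and "(r, p) \<in> S"
  shows "(dd (1, 0) ^^ Suc i) (\<lambda>v. fst v * g v) (r, p) =
    r * (dd (1, 0) ^^ Suc i) g (r, p) + of_nat (Suc i) * (dd (1, 0) ^^ i) g (r, p)"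
  using assms(3)
proof (induction i arbitrary: r)
  case 0
  have "((\<lambda>r. r * g (r, p)) has_field_derivative dd (1, 0) (\<lambda>v. fst v * g v) (r, p)) (at r)"
    using dd_fst[of "\<lambda>v. fst v * g v" S r p] 0 by (simp add: cdiff_intros g)
  moreover have "((\<lambda>r. r * g (r, p)) has_field_derivative r * dd (1, 0) g (r, p) + g (r, p)) (at r)"
    by (auto intro!: derivative_eq_intros dd_fst[OF g 0])
  ultimately show ?case by (simp add: DERIV_unique)
next
  case (Suc i)
  let ?G = "\<lambda>v. fst v * (dd (1, 0) ^^ Suc i) g v + of_nat (Suc i) * (dd (1, 0) ^^ i) g v"
  have "(dd (1, 0) ^^ Suc (Suc i)) (\<lambda>v. fst v * g v) (r, p) = dd (1, 0) ((dd (1, 0) ^^ Suc i) (\<lambda>v. fst v * g v)) (r, p)"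
    by simp
  also have "\<dots> = deriv (\<lambda>z. (dd (1, 0) ^^ Suc i) (\<lambda>v. fst v * g v) (z, p)) r"
    by (rule dd_fst_deriv)
  also have "\<dots> = deriv (\<lambda>z. ?G (z, p)) r"
  proof (rule deriv_cong_ev[OF _ refl])
    have "open ((\<lambda>x. (x, p)) -` S)" by (rule open_vimage[OF S(1)]) (intro continuous_intros)
    then have "\<forall>\<^sub>F x in nhds r. x \<in> (\<lambda>x. (x, p)) -` S"
      by (rule eventually_nhds_in_open) (use Suc.prems in simp)
    then show "\<forall>\<^sub>F x in nhds r. (dd (1, 0) ^^ Suc i) (\<lambda>v. fst v * g v) (x, p) = ?G (x, p)"
      by eventually_elim (use Suc.IH in auto)
  qed
  also have "((\<lambda>z. ?G (z, p)) has_field_derivative (r * (dd (1, 0) ^^ Suc (Suc i)) g (r, p) + (dd (1, 0) ^^ Suc i) g (r, p)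
      + of_nat (Suc i) * (dd (1, 0) ^^ Suc i) g (r, p))) (at r)"
    using dd_fst[OF cdiff_dd_pow[OF g S, of i "(1,0)"] Suc.prems] dd_fst[OF cdiff_dd_pow[OF g S, of "Suc i" "(1,0)"] Suc.prems]
    by (auto intro!: derivative_eq_intros)
  then have "deriv (\<lambda>z. ?G (z, p)) r = (r * (dd (1, 0) ^^ Suc (Suc i)) g (r, p) + (dd (1, 0) ^^ Suc i) g (r, p)
      + of_nat (Suc i) * (dd (1, 0) ^^ Suc i) g (r, p))" by (rule DERIV_imp_deriv)
  finally show ?case by (simp add: algebra_simps)
qed

text \<open>Differentiating \<open>f = f (0, p) + r * divx f\<close> by the Leibniz rule
  \<open>dd_pow_times\<close> lowers the order by one and leaves the factor \<open>Suc i\<close> at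
  \<open>r = 0\<close>.\<close>

lemma dd_pow_divx:
  assumes f: "f cdiff_on S" and S: "open S" "radial S" "(0, p) \<in> S"
  shows "(dd (1, 0) ^^ i) f (0, p) = fact i * (divx ^^ i) f (0, p)"
  using f
proof (induction i arbitrary: f)
  case (Suc i)
  have eq: "f v = f (0, snd v) + fst v * divx f v" if "v \<in> S" for v
    using divx_eq[OF Suc.prems S(2), of "fst v" "snd v"] that by simp
  have S0: "(0, snd v) \<in> S" if "v \<in> S" for v
    using radialD[OF S(2), of "fst v" "snd v" 0] that by simp
  have "(\<lambda>v. f (0, snd v)) cdiff_on S"
    by (rule cdiff_on_compose[OF _ Suc.prems]) (auto intro!: cdiff_intros S0)
  have 1: "(dd (1,0) ^^ Suc i) f (0, p) = (dd (1,0) ^^ Suc i) (\<lambda>v. fst v * divx f v) (0, p)"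
  proof -
    have d: "dd (1, 0) f v = dd (1, 0) (\<lambda>v. fst v * divx f v) v" if v: "v \<in> S" for v
    proof -
      have v': "(fst v, snd v) \<in> S" using v by simp
      have "((\<lambda>r. f (r, snd v)) has_field_derivative dd (1, 0) f v) (at (fst v))"
        using dd_fst[OF Suc.prems v'] by simp
      moreover have "((\<lambda>r. fst (r, snd v) * divx f (r, snd v)) has_field_derivative dd (1, 0) (\<lambda>v. fst v * divx f v) v) (at (fst v))"
        using dd_fst[OF _ v', of "\<lambda>v. fst v * divx f v"] by (simp add: cdiff_intros cdiff_divx[OF Suc.prems S(1,2)])
      then have "((\<lambda>r. f (0, snd v) + fst (r, snd v) * divx f (r, snd v)) has_field_derivative dd (1, 0) (\<lambda>v. fst v * divx f v) v) (at (fst v))"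
        using DERIV_add[OF DERIV_const[of "f (0, snd v)"]] by fastforce
      then have "((\<lambda>r. f (r, snd v)) has_field_derivative dd (1, 0) (\<lambda>v. fst v * divx f v) v) (at (fst v))"
      proof (rule has_field_derivative_transform_within_open)
        show "open ((\<lambda>r. (r, snd v)) -` S)" by (rule open_vimage[OF S(1)]) (intro continuous_intros)
        show "fst v \<in> (\<lambda>r. (r, snd v)) -` S" using v by simp
        show "f (0, snd v) + fst (r, snd v) * divx f (r, snd v) = f (r, snd v)" if "r \<in> (\<lambda>r. (r, snd v)) -` S" for r
          using eq[of "(r, snd v)"] that by simp
      qed
      ultimately show ?thesis by (rule DERIV_unique)
    qed
    have "(dd (1,0) ^^ i) (dd (1, 0) f) (0, p) = (dd (1,0) ^^ i) (dd (1, 0) (\<lambda>v. fst v * divx f v)) (0, p)"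
      by (rule dd_pow_cong[OF S(1,3) d])
    then show ?thesis by (simp add: funpow_swap1)
  qed
  also have "\<dots> = of_nat (Suc i) * (dd (1, 0) ^^ i) (divx f) (0, p)"
    using dd_pow_times[OF cdiff_divx[OF Suc.prems S(1,2)] S(1,3), of i] by simp
  also have "\<dots> = of_nat (Suc i) * (fact i * (divx ^^ i) (divx f) (0, p))"
    using Suc.IH[OF cdiff_divx[OF Suc.prems S(1,2)]] by simp
  finally show ?case by (simp add: funpow_swap1)
qed auto

section \<open>Complexification, limits and an analytic implicit function theorem\<close>

text \<open>Multi-index series converge along the net of finite index sets, while
  \<open>cdiff_uniform_limit\<close> is stated for sequences.\<close>

lemma uniform_limit_subsequence:
  fixes f :: "'i \<Rightarrow> 'a \<Rightarrow> 'b::metric_space"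
  assumes "uniform_limit S f g F" "F \<noteq> bot"
  obtains A where "uniform_limit S (\<lambda>n. f (A n)) g sequentially"
proof -
  have "\<exists>i. \<forall>x\<in>S. dist (f i x) (g x) < 1 / real (Suc n)" for n
    using uniform_limitD[OF assms(1), of "1 / real (Suc n)"] eventually_happens'[OF assms(2)] by simp
  then obtain A where A: "\<And>n x. x \<in> S \<Longrightarrow> dist (f (A n) x) (g x) < 1 / real (Suc n)" by metis
  have "uniform_limit S (\<lambda>n. f (A n)) g sequentially"
  proof (rule uniform_limitI)
    fix e :: real assume "e > 0"
    have "\<forall>\<^sub>F n in sequentially. 1 / real (Suc n) < e"
      using order_tendstoD(2)[OF LIMSEQ_inverse_real_of_nat \<open>e > 0\<close>] by (simp add: field_simps)
    then show "\<forall>\<^sub>F n in sequentially. \<forall>x\<in>S. dist (f (A n) x) (g x) < e"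
      by eventually_elim (use A less_trans in blast)
  qed
  then show ?thesis using that by blast
qed

text \<open>The real series converges absolutely at a corner of a small cube around
  \<open>p\<close>, and its absolute values there majorise the series on the complex polydisc. The
  maps \<open>\<kappa> e\<close> supply the complex coordinates, so the complex space may arrange
  its variables in another order.\<close>

lemma real_analytic_complexify:
  fixes h :: "'a::euclidean_space \<Rightarrow> real" and \<kappa> :: "'a \<Rightarrow> 'v::cspace \<Rightarrow> complex"
  assumes h: "real_analytic_at h p" and \<kappa>: "\<And>e. e \<in> Basis \<Longrightarrow> \<kappa> e cdiff_on UNIV"
  obtains t and hc :: "'v \<Rightarrow> complex" where "t > 0" "open {v. \<forall>e\<in>Basis. norm (\<kappa> e v - of_real (p \<bullet> e)) < t}"
    "hc cdiff_on {v. \<forall>e\<in>Basis. norm (\<kappa> e v - of_real (p \<bullet> e)) < t}"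
    "\<And>z v. (\<And>e. e \<in> Basis \<Longrightarrow> \<kappa> e v = of_real (z \<bullet> e)) \<Longrightarrow> (\<And>e. e \<in> Basis \<Longrightarrow> \<bar>(z - p) \<bullet> e\<bar> < t) \<Longrightarrow>
        hc v = of_real (h z)"
proof -
  obtain r c where r: "r > 0" and hs: "\<And>z. z \<in> ball p r \<Longrightarrow>
      ((\<lambda>\<alpha>. c \<alpha> * (\<Prod>e\<in>Basis. ((z - p) \<bullet> e) ^ \<alpha> e)) has_sum h z) (Basis \<rightarrow>\<^sub>E UNIV)"
    using h unfolding real_analytic_at_def by blast
  define I where "I = ((Basis :: 'a set) \<rightarrow>\<^sub>E (UNIV :: nat set))"
  \<comment> \<open>The cube of half-side \<open>t\<close> fits into the ball because the norm is at
    most the sum of the absolute coordinates.\<close>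
  define t where "t = r / (DIM('a) + 1)"
  have t: "t > 0" using r by (simp add: t_def)
  have tr: "DIM('a) * t < r"
    using r by (simp add: t_def field_simps)
  define z0 where "z0 = p + (\<Sum>e\<in>Basis. t *\<^sub>R e)"
  have z0: "(z0 - p) \<bullet> e = t" if "e \<in> Basis" for e
    using that by (simp add: z0_def)
  have near_p: "z \<in> ball p r" if "\<And>e. e \<in> Basis \<Longrightarrow> \<bar>(z - p) \<bullet> e\<bar> \<le> t" for z
  proof -
    have "norm (z - p) \<le> (\<Sum>e\<in>Basis. \<bar>(z - p) \<bullet> e\<bar>)" by (rule norm_le_l1)
    also have "\<dots> \<le> (\<Sum>e\<in>(Basis::'a set). t)" by (rule sum_mono) (use that in auto)
    also have "\<dots> < r" using tr by simp
    finally show ?thesis by (simp add: dist_norm norm_minus_commute)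
  qed
  define M where "M \<alpha> = \<bar>c \<alpha>\<bar> * (\<Prod>e\<in>Basis. t ^ \<alpha> e)" for \<alpha>
  have "(\<lambda>\<alpha>. c \<alpha> * (\<Prod>e\<in>Basis. ((z0 - p) \<bullet> e) ^ \<alpha> e)) summable_on I"
  proof -
    have "z0 \<in> ball p r" by (rule near_p) (use z0 t in simp)
    then show ?thesis unfolding I_def by (rule has_sum_imp_summable[OF hs])
  qed
  \<comment> \<open>For real terms unconditional convergence is absolute convergence.\<close>
  then have "(\<lambda>\<alpha>. norm (c \<alpha> * (\<Prod>e\<in>Basis. ((z0 - p) \<bullet> e) ^ \<alpha> e))) summable_on I"
    by (rule summable_on_iff_abs_summable_on_real[THEN iffD1])
  moreover have "norm (c \<alpha> * (\<Prod>e\<in>Basis. ((z0 - p) \<bullet> e) ^ \<alpha> e)) = M \<alpha>" for \<alpha>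
  proof -
    have "(\<Prod>e\<in>Basis. ((z0 - p) \<bullet> e) ^ \<alpha> e) = (\<Prod>e\<in>Basis. t ^ \<alpha> e)"
      by (rule prod.cong) (simp_all add: z0)
    moreover have "(\<Prod>e\<in>(Basis :: 'a set). t ^ \<alpha> e) \<ge> 0" using t by (intro prod_nonneg) auto
    ultimately show ?thesis by (simp add: M_def abs_mult)
  qed
  ultimately have M: "M summable_on I" by simp
  define F where "F \<alpha> v = of_real (c \<alpha>) * (\<Prod>e\<in>Basis. (\<kappa> e v - of_real (p \<bullet> e)) ^ \<alpha> e)" for \<alpha> v
  define V where "V = {v. \<forall>e\<in>Basis. norm (\<kappa> e v - of_real (p \<bullet> e)) < t}"
  have "open (\<Inter>e\<in>Basis. (\<lambda>v. norm (\<kappa> e v - of_real (p \<bullet> e))) -` {..<t})"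
    by (intro open_INT finite_Basis ballI open_vimage open_lessThan continuous_intros cdiff_on_continuous_on \<kappa>)
  moreover have "V = (\<Inter>e\<in>Basis. (\<lambda>v. norm (\<kappa> e v - of_real (p \<bullet> e))) -` {..<t})"
    by (auto simp: V_def)
  ultimately have V: "open V" by simp
  have "uniform_limit V (\<lambda>A v. \<Sum>\<alpha>\<in>A. F \<alpha> v) (\<lambda>v. \<Sum>\<^sub>\<infinity>\<alpha>\<in>I. F \<alpha> v) (finite_subsets_at_top I)"
  proof (rule Weierstrass_m_test_general[OF _ M])
    fix \<alpha> v assume "v \<in> V"
    then have "(\<Prod>e\<in>Basis. norm (\<kappa> e v - of_real (p \<bullet> e)) ^ \<alpha> e) \<le> (\<Prod>e\<in>Basis. t ^ \<alpha> e)"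
      by (intro prod_mono) (simp add: V_def power_mono less_imp_le)
    then show "norm (F \<alpha> v) \<le> M \<alpha>"
      by (simp add: F_def M_def norm_mult prod_norm[symmetric] norm_power mult_left_mono)
  qed
  then obtain A where A: "uniform_limit V (\<lambda>n v. \<Sum>\<alpha>\<in>A n. F \<alpha> v) (\<lambda>v. \<Sum>\<^sub>\<infinity>\<alpha>\<in>I. F \<alpha> v) sequentially"
    by (rule uniform_limit_subsequence) auto
  have "(\<lambda>v. \<Sum>\<^sub>\<infinity>\<alpha>\<in>I. F \<alpha> v) cdiff_on V"
    using V _ A
  proof (rule cdiff_uniform_limit)
    show "(\<lambda>v. \<Sum>\<alpha>\<in>A n. F \<alpha> v) cdiff_on V" for n
      unfolding F_def by (intro cdiff_intros cdiff_on_subset[OF \<kappa>]) auto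
  qed
  moreover have "(\<Sum>\<^sub>\<infinity>\<alpha>\<in>I. F \<alpha> v) = of_real (h z)"
    if "\<And>e. e \<in> Basis \<Longrightarrow> \<kappa> e v = of_real (z \<bullet> e)" "\<And>e. e \<in> Basis \<Longrightarrow> \<bar>(z - p) \<bullet> e\<bar> < t" for z v
  proof -
    have z: "z \<in> ball p r" by (rule near_p) (use that(2) in \<open>auto intro: less_imp_le\<close>)
    have "F \<alpha> v = of_real (c \<alpha> * (\<Prod>e\<in>Basis. ((z - p) \<bullet> e) ^ \<alpha> e))" for \<alpha>
      unfolding F_def using that(1) by (simp add: inner_diff_left)
    moreover have "((\<lambda>\<alpha>. complex_of_real (c \<alpha> * (\<Prod>e\<in>Basis. ((z - p) \<bullet> e) ^ \<alpha> e))) has_sum of_real (h z)) I"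
      using has_sum_of_real[OF hs[OF z]] unfolding I_def .
    ultimately have "((\<lambda>\<alpha>. F \<alpha> v) has_sum of_real (h z)) I" by simp
    then show ?thesis by (rule infsumI)
  qed
  ultimately show ?thesis using that[OF t] V unfolding V_def by blast
qed

definition cvec :: "real^'m \<Rightarrow> complex^'m" where
  "cvec d = (\<chi> i. of_real (d $ i))"

lemma cvec_nth [simp]: "cvec d $ i = of_real (d $ i)"
  by (simp add: cvec_def)

lemma norm_cvec [simp]: "norm (cvec d) = norm d"
  by (simp add: norm_vec_def)

lemma cvec_diff: "cvec (d - e) = cvec d - cvec e" "cvec (d + e) = cvec d + cvec e"
  by (simp_all add: vec_eq_iff)

lemma cvec_scale: "cvec (s *\<^sub>R d) = of_real s *\<^sub>C cvec d"
  by (simp add: vec_eq_iff)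

lemma dist_cvec [simp]: "dist (cvec d) (cvec e) = dist d e"
  by (simp add: dist_norm flip: cvec_diff)

text \<open>The variable \<open>y\<close> comes first, so that \<open>dd (1, 0)\<close> and
  \<open>divx\<close> act on \<open>y\<close> while \<open>x\<close> and the parameter together play
  the role of \<open>p\<close>.\<close>

lemma perturbation_complexify:
  fixes X :: "real \<Rightarrow> real \<Rightarrow> real^'m \<Rightarrow> real"
  assumes "real_analytic_at (\<lambda>(x, y, d). X x y d) (0, 0, \<delta>)"
  obtains S and Xc :: "complex \<times> complex \<times> (complex^'m) \<Rightarrow> complex" where "open S" "(0, (0, cvec \<delta>)) \<in> S" "Xc cdiff_on S"
    "\<And>x y d. (of_real y, (of_real x, cvec d)) \<in> S \<Longrightarrow>
        Xc (of_real y, (of_real x, cvec d)) = of_real (X x y d)"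
proof -
  \<comment> \<open>The inner product with the basis vector \<open>e\<close>, extended
    complex-linearly, without conjugation, to remain holomorphic.\<close>
  define \<kappa> :: "real \<times> real \<times> (real^'m) \<Rightarrow> complex \<times> complex \<times> (complex^'m) \<Rightarrow> complex" where
    "\<kappa> e v = of_real (fst e) * fst (snd v) + of_real (fst (snd e)) * fst v +
       (\<Sum>i\<in>UNIV. of_real (snd (snd e) $ i) * (snd (snd v) $ i))" for e v
  have \<kappa>: "\<kappa> e cdiff_on UNIV" for e
    unfolding \<kappa>_def by (intro cdiff_intros)
  have \<kappa>_real: "\<kappa> e (of_real y, (of_real x, cvec d)) = of_real ((x, y, d) \<bullet> e)" for e x y d
    by (cases e) (simp add: \<kappa>_def inner_vec_def mult.commute)
  obtain t and hc :: "complex \<times> complex \<times> (complex^'m) \<Rightarrow> complex" where t: "t > 0" "open {v. \<forall>e\<in>Basis. norm (\<kappa> e v - of_real ((0, 0, \<delta>) \<bullet> e)) < t}"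
    "hc cdiff_on {v. \<forall>e\<in>Basis. norm (\<kappa> e v - of_real ((0, 0, \<delta>) \<bullet> e)) < t}"
    "\<And>z v. (\<And>e. e \<in> Basis \<Longrightarrow> \<kappa> e v = of_real (z \<bullet> e)) \<Longrightarrow> (\<And>e. e \<in> Basis \<Longrightarrow> \<bar>(z - (0, 0, \<delta>)) \<bullet> e\<bar> < t) \<Longrightarrow>
        hc v = of_real ((\<lambda>(x, y, d). X x y d) z)"
    by (rule real_analytic_complexify[where \<kappa> = \<kappa>, OF assms \<kappa>]) blast
  show ?thesis
  proof (rule that[OF t(2) _ t(3)])
    show "(0, 0, cvec \<delta>) \<in> {v. \<forall>e\<in>Basis. cmod (\<kappa> e v - complex_of_real ((0, 0, \<delta>) \<bullet> e)) < t}"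
      using t(1) \<kappa>_real[of _ 0 0 \<delta>] by simp
    fix x y d
    assume A: "(complex_of_real y, complex_of_real x, cvec d) \<in> {v. \<forall>e\<in>Basis. cmod (\<kappa> e v - complex_of_real ((0, 0, \<delta>) \<bullet> e)) < t}"
    have "\<bar>((x, y, d) - (0, 0, \<delta>)) \<bullet> e\<bar> < t" if "e \<in> Basis" for e
    proof -
      have "cmod (of_real ((x, y, d) \<bullet> e) - complex_of_real ((0, 0, \<delta>) \<bullet> e)) < t"
        using A that by (simp only: \<kappa>_real mem_Collect_eq)
      then show ?thesis by (simp only: inner_diff_left flip: of_real_diff norm_of_real[where 'a = complex]) 
    qed
    from t(4)[OF \<kappa>_real this] show "hc (complex_of_real y, complex_of_real x, cvec d) = complex_of_real (X x y d)"
      by simp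
  qed
qed

lemma uniform_limit_geometric:
  fixes u :: "nat \<Rightarrow> 'a \<Rightarrow> complex"
  assumes "\<And>i x. x \<in> S \<Longrightarrow> norm (u (Suc i) x - u i x) \<le> C * (1/2) ^ i"
  obtains g where "uniform_limit S u g sequentially"
proof -
  have "uniform_limit S (\<lambda>n x. \<Sum>i<n. u (Suc i) x - u i x) (\<lambda>x. \<Sum>i. u (Suc i) x - u i x) sequentially"
    by (rule Weierstrass_m_test[OF assms]) (auto intro!: summable_mult summable_geometric)
  from uniform_limit_add[OF this uniform_limit_const, of "u 0"]
  have "uniform_limit S (\<lambda>n x. (\<Sum>i<n. u (Suc i) x - u i x) + u 0 x) (\<lambda>x. (\<Sum>i. u (Suc i) x - u i x) + u 0 x) sequentially" .
  moreover have "(\<lambda>n x. (\<Sum>i<n. u (Suc i) x - u i x) + u 0 x) = u"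
  proof (intro ext)
    fix n x show "(\<Sum>i<n. u (Suc i) x - u i x) + u 0 x = u n x"
      using sum_lessThan_telescope[of "\<lambda>i. u i x" n] by simp
  qed
  ultimately have "uniform_limit S u (\<lambda>x. (\<Sum>i. u (Suc i) x - u i x) + u 0 x) sequentially"
    by simp
  then show ?thesis using that by blast
qed

text \<open>The map \<open>w \<mapsto> - G (w, p)\<close> contracts with factor 1/2 because the
  derivative of \<open>G\<close> in \<open>w\<close> vanishes at the base point. Its iterates from 0
  are holomorphic in \<open>p\<close> and real for real \<open>p\<close>; both properties pass to
  the limit.\<close>

lemma implicit_cdiff:
  fixes G :: "complex \<times> 'p::cspace \<Rightarrow> complex"
  assumes G: "G cdiff_on S" and S: "open S" "(0, p0) \<in> S" and G0: "G (0, p0) = 0"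
    and dG0: "dd (1, 0) G (0, p0) = 0" and real: "real_on S P G"
  obtains \<alpha> \<beta> Fc where "\<alpha> > 0" "\<beta> > 0" "ball 0 \<beta> \<times> ball p0 \<alpha> \<subseteq> S" "Fc cdiff_on ball p0 \<alpha>"
    "\<And>p. p \<in> ball p0 \<alpha> \<Longrightarrow> norm (Fc p) < \<beta>"
    "\<And>p. p \<in> ball p0 \<alpha> \<Longrightarrow> Fc p + G (Fc p, p) = 0"
    "\<And>p w. p \<in> ball p0 \<alpha> \<Longrightarrow> norm w < \<beta> \<Longrightarrow> w + G (w, p) = 0 \<Longrightarrow> w = Fc p"
    "\<And>p. p \<in> ball p0 \<alpha> \<Longrightarrow> p \<in> P \<Longrightarrow> Fc p \<in> \<real>"
proof -
  have "isCont (dd (1, 0) G) (0, p0)" using cdiff_on_isCont[OF cdiff_dd[OF G S(1)] S(2)] .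
  then obtain \<rho>1 where \<rho>1: "\<rho>1 > 0" "\<And>v. dist v (0, p0) < \<rho>1 \<Longrightarrow> norm (dd (1, 0) G v) < 1/2"
    unfolding continuous_at_eps_delta using dG0
    by (metis (no_types, lifting) dist_norm diff_zero half_gt_zero zero_less_one)
  obtain \<rho>2 where \<rho>2: "\<rho>2 > 0" "ball (0, p0) \<rho>2 \<subseteq> S" using S open_contains_ball by blast
  define \<beta> where "\<beta> = min \<rho>1 \<rho>2 / 2"
  have \<beta>: "\<beta> > 0" using \<rho>1 \<rho>2 by (simp add: \<beta>_def)
  have near: "dist (w, p) (0, p0) < min \<rho>1 \<rho>2" if "norm w < \<beta>" "p \<in> ball p0 \<beta>" for w p
  proof -
    have "dist (w, p) (0, p0) \<le> norm w + dist p p0"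
      using norm_Pair_le[of w "p - p0"] by (simp add: dist_norm)
    also have "\<dots> < \<beta> + \<beta>" using that by (simp add: dist_commute)
    finally show ?thesis by (simp add: \<beta>_def)
  qed
  have sub: "ball 0 \<beta> \<times> ball p0 \<beta> \<subseteq> S"
    using near \<rho>2(2) by (auto simp: dist_commute subset_iff)
  have lip: "norm (G (w, p) - G (w', p)) \<le> 1/2 * norm (w - w')"
    if "norm w < \<beta>" "norm w' < \<beta>" "p \<in> ball p0 \<beta>" for w w' p
  proof (rule field_differentiable_bound[where S = "ball 0 \<beta>" and f' = "\<lambda>w. dd (1, 0) G (w, p)"])
    fix z :: complex assume z: "z \<in> ball 0 \<beta>"
    then have "(z, p) \<in> S" using sub that by auto
    then show "((\<lambda>w. G (w, p)) has_field_derivative dd (1, 0) G (z, p)) (at z within ball 0 \<beta>)"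
      using dd_fst[OF G] has_field_derivative_at_within by blast
    show "norm (dd (1, 0) G (z, p)) \<le> 1/2" using \<rho>1(2)[of "(z, p)"] near[of z p] z that by fastforce
  qed (use that in auto)
  have "isCont (\<lambda>p. G (0, p)) p0"
    by (rule isCont_o2[where f = "\<lambda>p. (0, p)" and g = G])
       (auto intro!: continuous_intros cdiff_on_isCont[OF G S(2)])
  \<comment> \<open>The bound \<open>\<beta> / 4\<close> keeps the iterates in the ball of radius
    \<open>\<beta> / 2\<close>: one half of \<open>\<beta> / 2\<close> plus
    \<open>\<beta> / 4\<close> is again \<open>\<beta> / 2\<close>.\<close>
  then obtain \<alpha>1 where \<alpha>1: "\<alpha>1 > 0" "\<And>p. dist p p0 < \<alpha>1 \<Longrightarrow> norm (G (0, p)) < \<beta> / 4"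
    unfolding continuous_at_eps_delta using G0 \<beta>
    by (metis dist_norm diff_zero divide_pos_pos zero_less_numeral)
  define \<alpha> where "\<alpha> = min \<alpha>1 \<beta>"
  have \<alpha>: "\<alpha> > 0" "ball p0 \<alpha> \<subseteq> ball p0 \<beta>" using \<alpha>1 \<beta> by (auto simp: \<alpha>_def)
  define u where "u i p = ((\<lambda>w. - G (w, p)) ^^ i) 0" for i p
  have u0: "u 0 p = 0" and uSuc: "u (Suc i) p = - G (u i p, p)" for i p by (simp_all add: u_def)
  have ub: "norm (u i p) \<le> \<beta> / 2" if "p \<in> ball p0 \<alpha>" for i p
  proof (induction i)
    case (Suc i)
    then have lt: "norm (u i p) < \<beta>" using \<beta> by linarith
    have "norm (G (u i p, p)) \<le> norm (G (u i p, p) - G (0, p)) + norm (G (0, p))"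
      by (metis diff_add_cancel norm_triangle_ineq)
    also have "norm (G (u i p, p) - G (0, p)) \<le> 1/2 * norm (u i p - 0)"
      using lip[OF lt, of 0 p] that \<alpha>(2) \<beta> by auto
    also have "norm (G (0, p)) \<le> \<beta> / 4" using \<alpha>1(2)[of p] that by (simp add: \<alpha>_def dist_commute)
    finally show ?case using Suc by (simp add: uSuc)
  qed (use \<beta> in \<open>simp add: u0\<close>)
  have ub': "norm (u i p) < \<beta>" if "p \<in> ball p0 \<alpha>" for i p
    using ub[OF that, of i] \<beta> by linarith
  have "norm (u (Suc i) p - u i p) \<le> \<beta> * (1/2) ^ i" if p: "p \<in> ball p0 \<alpha>" for i p
  proof (induction i)
    case 0
    then show ?case using ub'[OF p, of 1] by (simp add: u0)
  next
    case (Suc i)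
    have "norm (u (Suc (Suc i)) p - u (Suc i) p) = norm (G (u (Suc i) p, p) - G (u i p, p))"
      by (simp add: uSuc norm_minus_commute)
    also have "\<dots> \<le> 1/2 * norm (u (Suc i) p - u i p)"
      by (rule lip) (use ub'[OF p] p \<alpha>(2) in auto)
    finally show ?case using Suc by simp
  qed
  then obtain Fc where Fc: "uniform_limit (ball p0 \<alpha>) u Fc sequentially"
    by (rule uniform_limit_geometric)
  have inS: "(u i p, p) \<in> S" if "p \<in> ball p0 \<alpha>" for i p
  proof -
    have "p \<in> ball p0 \<beta>" using that \<alpha>(2) by blast
    then have "(u i p, p) \<in> ball 0 \<beta> \<times> ball p0 \<beta>" using ub'[OF that, of i] by simp
    then show ?thesis using sub by blast
  qed
  have ucd: "u i cdiff_on ball p0 \<alpha>" for i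
  proof (induction i)
    case (Suc i)
    have "(\<lambda>p. - G (u i p, p)) cdiff_on ball p0 \<alpha>"
      by (intro cdiff_on_uminus cdiff_on_compose[OF _ G] cdiff_intros Suc)
         (rule inS)
    then show ?case by (simp add: uSuc[abs_def])
  qed (simp add: u0[abs_def])
  have lim: "(\<lambda>i. u i p) \<longlonglongrightarrow> Fc p" if "p \<in> ball p0 \<alpha>" for p
    using Fc that by (rule tendsto_uniform_limitI)
  have Fb: "norm (Fc p) < \<beta>" if p: "p \<in> ball p0 \<alpha>" for p
  proof -
    have "norm (Fc p) \<le> \<beta> / 2"
      using tendsto_norm[OF lim[OF p]] by (rule Lim_bounded) (use ub[OF p] in auto)
    then show ?thesis using \<beta> by linarith
  qed
  have fix_eq: "Fc p + G (Fc p, p) = 0" if p: "p \<in> ball p0 \<alpha>" for p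
  proof -
    have "p \<in> ball p0 \<beta>" using p \<alpha>(2) by blast
    then have "(Fc p, p) \<in> ball 0 \<beta> \<times> ball p0 \<beta>" using Fb[OF p] by simp
    then have "(Fc p, p) \<in> S" using sub by blast
    then have "(\<lambda>i. - G (u i p, p)) \<longlonglongrightarrow> - G (Fc p, p)"
      by (intro tendsto_minus isCont_tendsto_compose[OF cdiff_on_isCont[OF G]] tendsto_Pair lim p tendsto_const)
    moreover have "(\<lambda>i. - G (u i p, p)) \<longlonglongrightarrow> Fc p"
      using LIMSEQ_Suc[OF lim[OF p]] by (simp add: uSuc)
    ultimately have "- G (Fc p, p) = Fc p" by (rule LIMSEQ_unique)
    then show ?thesis by (metis add.right_inverse minus_minus)
  qed
  show ?thesis
  proof (rule that[OF \<alpha>(1) \<beta>, of Fc])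
    show "ball 0 \<beta> \<times> ball p0 \<alpha> \<subseteq> S" using sub \<alpha>(2) by auto
    show "Fc cdiff_on ball p0 \<alpha>" using cdiff_uniform_limit[OF _ ucd Fc] by simp
    show "w = Fc p" if p: "p \<in> ball p0 \<alpha>" and w: "norm w < \<beta>" "w + G (w, p) = 0" for p w
    proof -
      have "w - Fc p = G (Fc p, p) - G (w, p)"
        using w(2) fix_eq[OF p] by (metis add_diff_cancel_left add_diff_cancel_right' diff_add_eq diff_minus_eq_add eq_neg_iff_add_eq_0 minus_diff_eq)
      then have "norm (w - Fc p) \<le> 1/2 * norm (Fc p - w)"
        using lip[OF Fb[OF p] w(1), of p] p \<alpha>(2) by auto
      then show ?thesis by (simp add: norm_minus_commute)
    qed
    show "Fc p \<in> \<real>" if p: "p \<in> ball p0 \<alpha>" "p \<in> P" for p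
    proof (rule closed_sequentially[OF closed_complex_Reals _ lim[OF p(1)]])
      show "u i p \<in> \<real>" for i
      proof (induction i)
          case (Suc i)
          then obtain r where r: "u i p = of_real r" by (auto elim: Reals_cases)
          moreover have "(u i p, p) \<in> S" using inS[OF p(1)] .
          ultimately have "G (u i p, p) \<in> \<real>" using real p(2) unfolding real_on_def by auto
          then show ?case by (simp add: uSuc)
      qed (simp add: u0)
    qed
  qed (use Fb fix_eq in auto)
qed

text \<open>Moves a variable upper limit into the integrand, so that Picard integrals fit the fixed
  interval of \<open>cdiff_integral\<close>.\<close>

lemma integral_rescale:
  fixes f :: "real \<Rightarrow> complex"
  assumes "a \<ge> 0" and cont: "continuous_on {0..a} f"
  shows "integral {0..a} f = of_real a * integral {0..1} (\<lambda>t. f (t * a))"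
proof -
  have "((\<lambda>t. a *\<^sub>R f (t * a)) has_integral integral {0..1 * a} f - integral {0..0 * a} f) {0..1}"
  proof (rule fundamental_theorem_of_calculus)
    fix t :: real assume t: "t \<in> {0..1}"
    then have ta: "t * a \<in> {0..a}" using assms(1) mult_left_le_one_le[of a t] by auto
    have 1: "((\<lambda>t. t * a) has_vector_derivative a) (at t within {0..1})"
      by (auto intro!: derivative_eq_intros)
    have 2: "((\<lambda>x. integral {0..x} f) has_vector_derivative f (t * a)) (at (t * a) within (\<lambda>t. t * a) ` {0..1})"
      by (rule has_vector_derivative_within_subset[OF integral_has_vector_derivative[OF cont ta]])
         (use assms(1) mult_left_le_one_le[of a] in auto)
    show "((\<lambda>t. integral {0..t * a} f) has_vector_derivative a *\<^sub>R f (t * a)) (at t within {0..1})"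
      using vector_diff_chain_within[OF 1 2] by (simp add: o_def)
  qed auto
  then show ?thesis by (auto dest!: integral_unique simp: scaleR_conv_of_real)
qed

section \<open>Analytic dependence of flows on initial values and parameters\<close>

text \<open>Used twice in the flow construction: with the exponent \<open>K\<close> for the size of
  the iterates and with \<open>2 * K\<close> for their differences.\<close>

lemma exp_integral_bound:
  fixes f :: "real \<Rightarrow> complex"
  assumes cont: "continuous_on {0..1} f" and "\<phi> \<ge> 0" and K: "K > 0"
    and b: "\<And>t. t \<in> {0..1} \<Longrightarrow> norm (f t) \<le> B * exp (K * (t * \<phi>))"
  shows "norm (of_real \<phi> * integral {0..1} f) \<le> B / K * (exp (K * \<phi>) - 1)"
proof (cases "\<phi> = 0")
  case False
  have i: "((\<lambda>t. B * exp (K * (t * \<phi>))) has_integral B / (K * \<phi>) * exp (K * (1 * \<phi>)) - B / (K * \<phi>) * exp (K * (0 * \<phi>))) {0..1}"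
  proof (rule fundamental_theorem_of_calculus)
    fix t :: real assume "t \<in> {0..1}"
    have "((\<lambda>t. B / (K * \<phi>) * exp (K * (t * \<phi>))) has_real_derivative B * exp (K * (t * \<phi>))) (at t within {0..1})"
      using K False by (auto intro!: derivative_eq_intros)
    then show "((\<lambda>t. B / (K * \<phi>) * exp (K * (t * \<phi>))) has_vector_derivative B * exp (K * (t * \<phi>))) (at t within {0..1})"
      by (simp add: has_real_derivative_iff_has_vector_derivative)
  qed auto
  have "norm (integral {0..1} f) \<le> integral {0..1} (\<lambda>t. B * exp (K * (t * \<phi>)))"
    by (rule integral_norm_bound_integral) (use cont b has_integral_integrable[OF i] in \<open>auto intro!: integrable_continuous_interval\<close>)
  also have "\<dots> = B / (K * \<phi>) * (exp (K * \<phi>) - 1)"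
    using integral_unique[OF i] by (simp add: algebra_simps)
  finally have "\<phi> * norm (integral {0..1} f) \<le> \<phi> * (B / (K * \<phi>) * (exp (K * \<phi>) - 1))"
    using assms(2) by (rule mult_left_mono)
  then show ?thesis using assms(2) False by (simp add: norm_mult)
qed simp

text \<open>Picard iteration in exponentially weighted norms. The weight
  \<open>exp (2 * K * \<phi>)\<close> makes the iteration contract by 1/2 on all of
  \<open>{0..L}\<close> at once, so no short pieces have to be glued, and holomorphy in initial
  value and parameter follows from uniform convergence. Shrinking the initial radius by
  \<open>exp (- (K * L))\<close> keeps all iterates in the domain of \<open>R\<close>.\<close>

lemma cdiff_ode_flow:
  fixes R :: "real \<Rightarrow> complex \<times> 'p::cspace \<Rightarrow> complex"
  assumes L: "L > 0" and K: "K > 0" and \<epsilon>: "\<epsilon> > 0" and Q: "open Q"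
    and cont: "continuous_on ({0..L} \<times> (ball 0 \<epsilon> \<times> Q)) (\<lambda>(\<phi>, v). R \<phi> v)"
    and cd: "\<And>\<phi>. \<phi> \<in> {0..L} \<Longrightarrow> R \<phi> cdiff_on (ball 0 \<epsilon> \<times> Q)"
    and lip: "\<And>\<phi> p r s. \<phi> \<in> {0..L} \<Longrightarrow> p \<in> Q \<Longrightarrow> norm r < \<epsilon> \<Longrightarrow> norm s < \<epsilon> \<Longrightarrow>
        norm (R \<phi> (r, p) - R \<phi> (s, p)) \<le> K * norm (r - s)"
    and zero: "\<And>\<phi> p. \<phi> \<in> {0..L} \<Longrightarrow> p \<in> Q \<Longrightarrow> R \<phi> (0, p) = 0"
    and real: "\<And>\<phi>. \<phi> \<in> {0..L} \<Longrightarrow> real_on (ball 0 \<epsilon> \<times> Q) P (R \<phi>)"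
  defines "S \<equiv> ball 0 (\<epsilon> * exp (- (K * L))) \<times> Q"
  obtains \<rho> where
    "\<And>\<phi>. \<phi> \<in> {0..L} \<Longrightarrow> \<rho> \<phi> cdiff_on S"
    "continuous_on ({0..L} \<times> S) (\<lambda>(\<phi>, v). \<rho> \<phi> v)"
    "\<And>\<phi> v. \<phi> \<in> {0..L} \<Longrightarrow> v \<in> S \<Longrightarrow> norm (\<rho> \<phi> v) \<le> norm (fst v) * exp (K * \<phi>)"
    "\<And>v. v \<in> S \<Longrightarrow> \<rho> 0 v = fst v"
    "\<And>\<phi> v. \<phi> \<in> {0..L} \<Longrightarrow> v \<in> S \<Longrightarrow>
       ((\<lambda>\<phi>. \<rho> \<phi> v) has_vector_derivative R \<phi> (\<rho> \<phi> v, snd v)) (at \<phi> within {0..L})"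
    "\<And>\<phi>. \<phi> \<in> {0..L} \<Longrightarrow> real_on S P (\<rho> \<phi>)"
proof -
  \<comment> \<open>Picard's operator with the integral rescaled to \<open>{0..1}\<close>, so that
    for fixed \<open>\<phi>\<close> the integrand is a holomorphic family over a fixed
    interval.\<close>
  define u where "u = rec_nat (\<lambda>\<phi> v. fst v) (\<lambda>_ w \<phi> v. fst v + of_real \<phi> *
     integral {0..1} (\<lambda>t. R (t * \<phi>) (w (t * \<phi>) v, snd v)))"
  have u0: "u 0 \<phi> v = fst v" for \<phi> v by (simp add: u_def)
  have uS: "u (Suc i) \<phi> v = fst v + of_real \<phi> * integral {0..1} (\<lambda>t. R (t * \<phi>) (u i (t * \<phi>) v, snd v))" for i \<phi> v
    by (simp add: u_def)
  have S: "open S" unfolding S_def by (intro open_Times Q open_ball)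
  have t\<phi>: "t * \<phi> \<in> {0..L}" if "t \<in> {0..1}" "\<phi> \<in> {0..L}" for t \<phi>
    using that mult_left_le_one_le[of \<phi> t] by auto
  have small: "norm (fst v) * exp (K * \<phi>) < \<epsilon>" if "v \<in> S" "\<phi> \<in> {0..L}" for v \<phi>
  proof -
    have "norm (fst v) * exp (K * \<phi>) \<le> norm (fst v) * exp (K * L)"
      using that K by (intro mult_left_mono) auto
    also have "norm (fst v) < \<epsilon> * exp (- (K * L))" using that by (auto simp: S_def)
    then have "norm (fst v) * exp (K * L) < \<epsilon> * exp (- (K * L)) * exp (K * L)"
      by (rule mult_strict_right_mono) simp
    also have "\<dots> = \<epsilon>" by (simp flip: exp_add)
    finally show ?thesis .
  qed
  have sndQ: "snd v \<in> Q" if "v \<in> S" for v using that by (auto simp: S_def)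
  have Rb: "norm (R \<phi> (r, p)) \<le> K * norm r" if "\<phi> \<in> {0..L}" "p \<in> Q" "norm r < \<epsilon>" for \<phi> p r
    using lip[OF that(1,2,3), of 0] zero[OF that(1,2)] \<epsilon> by simp
  have Rcont: "continuous_on T (\<lambda>x. R (a x) (b x, c x))"
    if "continuous_on T a" "continuous_on T b" "continuous_on T c"
      "\<And>x. x \<in> T \<Longrightarrow> a x \<in> {0..L} \<and> norm (b x) < \<epsilon> \<and> c x \<in> Q" for T :: "'t::topological_space set" and a b c
  proof -
    have "continuous_on T (\<lambda>x. (\<lambda>(\<phi>, v). R \<phi> v) (a x, (b x, c x)))"
      by (rule continuous_on_compose2[OF cont]) (use that in \<open>auto intro!: continuous_intros\<close>)
    then show ?thesis by simp
  qed
  \<comment> \<open>The four properties are proved together because the size bound is what allows an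
    iterate to be substituted into \<open>R\<close>.\<close>
  have inv: "(\<forall>\<phi>\<in>{0..L}. \<forall>v\<in>S. norm (u i \<phi> v) \<le> norm (fst v) * exp (K * \<phi>)) \<and>
     continuous_on ({0..L} \<times> S) (\<lambda>(\<phi>, v). u i \<phi> v) \<and> (\<forall>\<phi>\<in>{0..L}. u i \<phi> cdiff_on S) \<and>
     (\<forall>\<phi>\<in>{0..L}. \<forall>v\<in>S. fst v \<in> \<real> \<longrightarrow> snd v \<in> P \<longrightarrow> u i \<phi> v \<in> \<real>)" for i
  proof (induction i)
    case 0
    have "norm (fst v) \<le> norm (fst v) * exp (K * \<phi>)" if "\<phi> \<ge> 0" for v :: "complex \<times> 'p" and \<phi>
      using that K by (simp add: mult_le_cancel_left1)
    then show ?case by (auto simp: u0 u0[abs_def] split_beta intro!: continuous_intros cdiff_intros)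
  next
    case (Suc i)
    have ib: "norm (u i \<phi> v) \<le> norm (fst v) * exp (K * \<phi>)" "norm (u i \<phi> v) < \<epsilon>" if "\<phi> \<in> {0..L}" "v \<in> S" for \<phi> v
      using Suc that small[of v \<phi>] by force+
    have ic: "continuous_on ({0..L} \<times> S) (\<lambda>(\<phi>, v). u i \<phi> v)" using Suc by blast
    have c1: "continuous_on (({0..L} \<times> S) \<times> {0..1}) (\<lambda>(x, t). R (t * fst x) (u i (t * fst x) (snd x), snd (snd x)))"
      unfolding split_beta
    proof (rule Rcont)
      have "continuous_on (({0..L} \<times> S) \<times> {0..1}) (\<lambda>x. (\<lambda>(\<phi>, v). u i \<phi> v) (snd x * fst (fst x), snd (fst x)))"
        by (rule continuous_on_compose2[OF ic]) (use t\<phi> in \<open>auto intro!: continuous_intros\<close>)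
      then show "continuous_on (({0..L} \<times> S) \<times> {0..1}) (\<lambda>x. u i (snd x * fst (fst x)) (snd (fst x)))" by simp
    qed (use t\<phi> ib sndQ in \<open>auto intro!: continuous_intros\<close>)
    have c2: "continuous_on {0..1} (\<lambda>t. R (t * \<phi>) (u i (t * \<phi>) v, snd v))" if "\<phi> \<in> {0..L}" "v \<in> S" for \<phi> v
    proof -
      have "continuous_on {0..1} (\<lambda>t. (\<lambda>(x, t). R (t * fst x) (u i (t * fst x) (snd x), snd (snd x))) ((\<phi>, v), t))"
        by (rule continuous_on_compose2[OF c1]) (use that in \<open>auto intro!: continuous_intros\<close>)
      then show ?thesis by simp
    qed
    have 1: "norm (u (Suc i) \<phi> v) \<le> norm (fst v) * exp (K * \<phi>)" if v: "\<phi> \<in> {0..L}" "v \<in> S" for \<phi> v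
    proof -
      have "norm (of_real \<phi> * integral {0..1} (\<lambda>t. R (t * \<phi>) (u i (t * \<phi>) v, snd v))) \<le> (K * norm (fst v)) / K * (exp (K * \<phi>) - 1)"
      proof (rule exp_integral_bound[OF c2[OF v]])
        fix t :: real assume t: "t \<in> {0..1}"
        have "norm (R (t * \<phi>) (u i (t * \<phi>) v, snd v)) \<le> K * norm (u i (t * \<phi>) v)"
          by (rule Rb[OF t\<phi>[OF t v(1)] sndQ[OF v(2)] ib(2)[OF t\<phi>[OF t v(1)] v(2)]])
        also have "\<dots> \<le> K * (norm (fst v) * exp (K * (t * \<phi>)))"
          using ib(1)[OF t\<phi>[OF t v(1)] v(2)] K by simp
        finally show "norm (R (t * \<phi>) (u i (t * \<phi>) v, snd v)) \<le> K * norm (fst v) * exp (K * (t * \<phi>))" by simp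
      qed (use v K in auto)
      then have "norm (of_real \<phi> * integral {0..1} (\<lambda>t. R (t * \<phi>) (u i (t * \<phi>) v, snd v))) \<le> norm (fst v) * exp (K * \<phi>) - norm (fst v)"
        using K by (simp add: algebra_simps)
      then show ?thesis unfolding uS by (smt (verit) norm_triangle_ineq)
    qed
    have "continuous_on ({0..L} \<times> S) (\<lambda>x. integral (cbox 0 1) (\<lambda>t. R (t * fst x) (u i (t * fst x) (snd x), snd (snd x))))"
      by (rule integral_continuous_on_param) (use c1 in simp)
    then have 2: "continuous_on ({0..L} \<times> S) (\<lambda>(\<phi>, v). u (Suc i) \<phi> v)"
      unfolding uS split_beta by (auto intro!: continuous_intros)
    have 3: "u (Suc i) \<phi> cdiff_on S" if \<phi>: "\<phi> \<in> {0..L}" for \<phi>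
    proof -
      have "(\<lambda>v. integral {0..1} (\<lambda>t. R (t * \<phi>) (u i (t * \<phi>) v, snd v))) cdiff_on S"
      proof (rule cdiff_integral[OF S])
        have "continuous_on (S \<times> {0..1}) (\<lambda>y. (\<lambda>(x, t). R (t * fst x) (u i (t * fst x) (snd x), snd (snd x))) ((\<phi>, fst y), snd y))"
          by (rule continuous_on_compose2[OF c1]) (use \<phi> in \<open>auto intro!: continuous_intros\<close>)
        then show "continuous_on (S \<times> {0..1}) (\<lambda>(v, t). R (t * \<phi>) (u i (t * \<phi>) v, snd v))" by (simp add: split_beta)
        fix t :: real assume t: "t \<in> {0..1}"
        show "(\<lambda>v. R (t * \<phi>) (u i (t * \<phi>) v, snd v)) cdiff_on S"
          by (rule cdiff_on_compose[OF _ cd[OF t\<phi>[OF t \<phi>]]])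
             (use Suc t\<phi>[OF t \<phi>] ib sndQ in \<open>auto intro!: cdiff_intros\<close>)
      qed
      then show ?thesis unfolding uS[abs_def] by (intro cdiff_intros)
    qed
    have 4: "u (Suc i) \<phi> v \<in> \<real>" if v: "\<phi> \<in> {0..L}" "v \<in> S" "fst v \<in> \<real>" "snd v \<in> P" for \<phi> v
      unfolding uS
    proof (intro Reals_add Reals_mult Reals_of_real v integral_Reals integrable_continuous_interval c2)
      fix t :: real assume t: "t \<in> {0..1}"
      have "u i (t * \<phi>) v \<in> \<real>" using Suc t\<phi>[OF t v(1)] v by blast
      then obtain r where "u i (t * \<phi>) v = of_real r" by (auto elim: Reals_cases)
      then show "R (t * \<phi>) (u i (t * \<phi>) v, snd v) \<in> \<real>"
        using real[OF t\<phi>[OF t v(1)]] ib(2)[OF t\<phi>[OF t v(1)] v(2)] sndQ[OF v(2)] v(4)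
        unfolding real_on_def by simp
    qed
    show ?case using 1 2 3 4 by blast
  qed
  have ub: "norm (u i \<phi> v) \<le> norm (fst v) * exp (K * \<phi>)" "norm (u i \<phi> v) < \<epsilon>" if "\<phi> \<in> {0..L}" "v \<in> S" for i \<phi> v
    using inv[of i] that small[of v \<phi>] by force+
  have uc: "continuous_on {0..1} (\<lambda>t. R (t * \<phi>) (u i (t * \<phi>) v, snd v))" if v: "\<phi> \<in> {0..L}" "v \<in> S" for i \<phi> v
  proof (rule Rcont)
    have "continuous_on {0..1} (\<lambda>t. (\<lambda>(\<phi>, v). u i \<phi> v) (t * \<phi>, v))"
      by (rule continuous_on_compose2[OF inv[of i, THEN conjunct2, THEN conjunct1]])
         (use v t\<phi> in \<open>auto intro!: continuous_intros\<close>)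
    then show "continuous_on {0..1} (\<lambda>t. u i (t * \<phi>) v)" by simp
  qed (use v t\<phi> ub sndQ in \<open>auto intro!: continuous_intros\<close>)
  \<comment> \<open>The factor 1/2 arises from integrating \<open>K * exp (2 * K * t)\<close>, which
    is at most \<open>exp (2 * K * \<phi>) / 2\<close>.\<close>
  have diff: "norm (u (Suc i) \<phi> v - u i \<phi> v) \<le> norm (fst v) * (1/2) ^ i * exp (2 * K * \<phi>)"
    if "\<phi> \<in> {0..L}" "v \<in> S" for i \<phi> v
    using that
  proof (induction i arbitrary: \<phi>)
    case 0
    have "norm (of_real \<phi> * integral {0..1} (\<lambda>t. R (t * \<phi>) (u 0 (t * \<phi>) v, snd v))) \<le> (K * norm (fst v)) / K * (exp (K * \<phi>) - 1)"
    proof (rule exp_integral_bound[OF uc[OF 0]])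
      fix t :: real assume t: "t \<in> {0..1}"
      have "norm (R (t * \<phi>) (u 0 (t * \<phi>) v, snd v)) \<le> K * norm (u 0 (t * \<phi>) v)"
        by (rule Rb[OF t\<phi>[OF t 0(1)] sndQ[OF 0(2)] ub(2)[OF t\<phi>[OF t 0(1)] 0(2)]])
      also have "\<dots> \<le> K * (norm (fst v) * exp (K * (t * \<phi>)))"
        using ub(1)[OF t\<phi>[OF t 0(1)] 0(2), of 0] K by simp
      finally show "norm (R (t * \<phi>) (u 0 (t * \<phi>) v, snd v)) \<le> K * norm (fst v) * exp (K * (t * \<phi>))" by simp
    qed (use 0 K in auto)
    also have "\<dots> \<le> norm (fst v) * exp (2 * K * \<phi>)"
    proof -
      have "exp (K * \<phi>) \<le> exp (2 * K * \<phi>)" using 0 K by simp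
      then have "exp (K * \<phi>) - 1 \<le> exp (2 * K * \<phi>)" by linarith
      then show ?thesis using K by (simp add: mult_left_mono)
    qed
    finally show ?case by (simp add: uS u0)
  next
    case (Suc i)
    have "u (Suc (Suc i)) \<phi> v - u (Suc i) \<phi> v = of_real \<phi> * integral {0..1}
       (\<lambda>t. R (t * \<phi>) (u (Suc i) (t * \<phi>) v, snd v) - R (t * \<phi>) (u i (t * \<phi>) v, snd v))"
      unfolding uS[of "Suc i"] uS[of i \<phi>]
      by (subst Henstock_Kurzweil_Integration.integral_diff)
         (use uc[OF Suc.prems] in \<open>auto intro!: integrable_continuous_interval simp: algebra_simps\<close>)
    also have "norm \<dots> \<le> (K * (norm (fst v) * (1/2) ^ i)) / (2 * K) * (exp (2 * K * \<phi>) - 1)"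
    proof (rule exp_integral_bound)
      fix t :: real assume t: "t \<in> {0..1}"
      have "norm (R (t * \<phi>) (u (Suc i) (t * \<phi>) v, snd v) - R (t * \<phi>) (u i (t * \<phi>) v, snd v)) \<le>
         K * norm (u (Suc i) (t * \<phi>) v - u i (t * \<phi>) v)"
        using t\<phi>[OF t Suc.prems(1)] Suc.prems(2) by (intro lip sndQ ub)
      also have "\<dots> \<le> K * (norm (fst v) * (1/2) ^ i * exp (2 * K * (t * \<phi>)))"
        using Suc.IH[OF t\<phi>[OF t Suc.prems(1)] Suc.prems(2)] K by simp
      finally show "norm (R (t * \<phi>) (u (Suc i) (t * \<phi>) v, snd v) - R (t * \<phi>) (u i (t * \<phi>) v, snd v)) \<le>
         K * (norm (fst v) * (1/2) ^ i) * exp (2 * K * (t * \<phi>))" by (simp add: mult_ac)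
    qed (use Suc.prems uc[OF Suc.prems] K in \<open>auto intro!: continuous_intros\<close>)
    also have "\<dots> = norm (fst v) * (1/2) ^ Suc i * (exp (2 * K * \<phi>) - 1)" using K by simp
    also have "\<dots> \<le> norm (fst v) * (1/2) ^ Suc i * exp (2 * K * \<phi>)"
      by (rule mult_left_mono) auto
    finally show ?case .
  qed
  have "norm ((case x of (\<phi>, v) \<Rightarrow> u (Suc i) \<phi> v) - (case x of (\<phi>, v) \<Rightarrow> u i \<phi> v)) \<le>
      \<epsilon> * exp (2 * K * L) * (1/2) ^ i" if x: "x \<in> {0..L} \<times> S" for x i
  proof -
    obtain \<phi> v where xv: "x = (\<phi>, v)" "\<phi> \<in> {0..L}" "v \<in> S" using x by auto
    have "norm (u (Suc i) \<phi> v - u i \<phi> v) \<le> norm (fst v) * (1/2) ^ i * exp (2 * K * \<phi>)"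
      by (rule diff[OF xv(2,3)])
    also have "\<dots> \<le> \<epsilon> * (1/2) ^ i * exp (2 * K * L)"
    proof (intro mult_mono)
      show "norm (fst v) \<le> \<epsilon>" using small[OF xv(3), of 0] L by simp
    qed (use xv(2) K \<epsilon> in auto)
    finally show ?thesis by (simp add: xv(1) mult_ac)
  qed
  then obtain \<rho>' where \<rho>': "uniform_limit ({0..L} \<times> S) (\<lambda>i (\<phi>, v). u i \<phi> v) \<rho>' sequentially"
    by (rule uniform_limit_geometric[of "{0..L} \<times> S" "\<lambda>i (\<phi>, v). u i \<phi> v"])
  define \<rho> where "\<rho> \<phi> v = \<rho>' (\<phi>, v)" for \<phi> v
  have lim: "(\<lambda>i. u i \<phi> v) \<longlonglongrightarrow> \<rho> \<phi> v" if "\<phi> \<in> {0..L}" "v \<in> S" for \<phi> v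
    using tendsto_uniform_limitI[OF \<rho>', of "(\<phi>, v)"] that by (simp add: \<rho>_def)
  have \<rho>b: "norm (\<rho> \<phi> v) \<le> norm (fst v) * exp (K * \<phi>)" if v: "\<phi> \<in> {0..L}" "v \<in> S" for \<phi> v
    using tendsto_norm[OF lim[OF v]] by (rule Lim_bounded) (use ub(1)[OF v] in auto)
  have \<rho>c: "continuous_on ({0..L} \<times> S) (\<lambda>(\<phi>, v). \<rho> \<phi> v)"
  proof -
    have "continuous_on ({0..L} \<times> S) \<rho>'"
      by (rule uniform_limit_theorem[OF _ \<rho>']) (use inv in auto)
    then show ?thesis by (simp add: \<rho>_def split_beta')
  qed
  have \<rho>cont: "continuous_on {0..L} (\<lambda>\<psi>. R \<psi> (\<rho> \<psi> v, snd v))" if v: "v \<in> S" for v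
  proof (rule Rcont)
    have "continuous_on {0..L} (\<lambda>t. (\<lambda>(\<phi>, v). \<rho> \<phi> v) (t, v))"
      by (rule continuous_on_compose2[OF \<rho>c]) (use v in \<open>auto intro!: continuous_intros\<close>)
    then show "continuous_on {0..L} (\<lambda>t. \<rho> t v)" by simp
    show "x \<in> {0..L} \<and> cmod (\<rho> x v) < \<epsilon> \<and> snd v \<in> Q" if "x \<in> {0..L}" for x
      using that \<rho>b[OF that v] small[OF v that] sndQ[OF v] by simp
  qed (auto intro!: continuous_intros)
  have int_eq: "\<rho> \<phi> v = fst v + integral {0..\<phi>} (\<lambda>\<psi>. R \<psi> (\<rho> \<psi> v, snd v))" if v: "\<phi> \<in> {0..L}" "v \<in> S" for \<phi> v
  proof -
    have c: "continuous_on {0..1} (\<lambda>t. R (t * \<phi>) (\<rho> (t * \<phi>) v, snd v))"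
      by (rule continuous_on_compose2[OF \<rho>cont[OF v(2)], of "{0..1}" "\<lambda>t. t * \<phi>"])
         (use v t\<phi> in \<open>auto intro!: continuous_intros\<close>)
    \<comment> \<open>The Lipschitz bound transfers uniform convergence from the iterates to the
      integrals, so the limit solves the integral equation.\<close>
    have "(\<lambda>i. integral {0..1} (\<lambda>t. R (t * \<phi>) (u i (t * \<phi>) v, snd v))) \<longlonglongrightarrow>
       integral {0..1} (\<lambda>t. R (t * \<phi>) (\<rho> (t * \<phi>) v, snd v))"
    proof (rule LIMSEQ_I)
      fix e :: real assume e: "e > 0"
      have "\<forall>\<^sub>F i in sequentially. \<forall>x\<in>{0..L} \<times> S. dist (case x of (\<phi>, v) \<Rightarrow> u i \<phi> v) (\<rho>' x) < e / (2 * K)"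
        using uniform_limitD[OF \<rho>', of "e / (2 * K)"] e K by simp
      then obtain N where N: "\<And>i \<phi> v. i \<ge> N \<Longrightarrow> \<phi> \<in> {0..L} \<Longrightarrow> v \<in> S \<Longrightarrow> dist (u i \<phi> v) (\<rho> \<phi> v) < e / (2 * K)"
        unfolding eventually_sequentially \<rho>_def by fastforce
      have "norm (integral {0..1} (\<lambda>t. R (t * \<phi>) (u i (t * \<phi>) v, snd v)) -
          integral {0..1} (\<lambda>t. R (t * \<phi>) (\<rho> (t * \<phi>) v, snd v))) < e" if i: "i \<ge> N" for i
      proof -
        have "norm (integral {0..1} (\<lambda>t. R (t * \<phi>) (u i (t * \<phi>) v, snd v) - R (t * \<phi>) (\<rho> (t * \<phi>) v, snd v))) \<le> e / 2 * (1 - 0)"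
        proof (rule integral_bound)
          fix t :: real assume t: "t \<in> {0..1}"
          note t' = t\<phi>[OF t v(1)]
          have "norm (\<rho> (t * \<phi>) v) < \<epsilon>" using \<rho>b[OF t' v(2)] small[OF v(2) t'] by simp
          then have "norm (R (t * \<phi>) (u i (t * \<phi>) v, snd v) - R (t * \<phi>) (\<rho> (t * \<phi>) v, snd v)) \<le>
             K * norm (u i (t * \<phi>) v - \<rho> (t * \<phi>) v)"
            by (intro lip t' sndQ v ub)
          also have "\<dots> \<le> K * (e / (2 * K))"
            using N[OF i t' v(2)] K by (intro mult_left_mono) (auto simp: dist_norm)
          finally show "norm (R (t * \<phi>) (u i (t * \<phi>) v, snd v) - R (t * \<phi>) (\<rho> (t * \<phi>) v, snd v)) \<le> e / 2"
            using K by simp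
        qed (use c uc[OF v] in \<open>auto intro!: continuous_intros\<close>)
        then show ?thesis using e
          by (subst (asm) Henstock_Kurzweil_Integration.integral_diff)
             (use c uc[OF v] in \<open>auto intro!: integrable_continuous_interval\<close>)
      qed
      then show "\<exists>no. \<forall>n\<ge>no. norm (integral {0..1} (\<lambda>t. R (t * \<phi>) (u n (t * \<phi>) v, snd v)) -
          integral {0..1} (\<lambda>t. R (t * \<phi>) (\<rho> (t * \<phi>) v, snd v))) < e" by blast
    qed
    then have "(\<lambda>i. u (Suc i) \<phi> v) \<longlonglongrightarrow> fst v + of_real \<phi> * integral {0..1} (\<lambda>t. R (t * \<phi>) (\<rho> (t * \<phi>) v, snd v))"
      unfolding uS by (intro tendsto_intros)
    then have "\<rho> \<phi> v = fst v + of_real \<phi> * integral {0..1} (\<lambda>t. R (t * \<phi>) (\<rho> (t * \<phi>) v, snd v))"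
      using LIMSEQ_Suc[OF lim[OF v]] LIMSEQ_unique by blast
    also have "of_real \<phi> * integral {0..1} (\<lambda>t. R (t * \<phi>) (\<rho> (t * \<phi>) v, snd v)) = integral {0..\<phi>} (\<lambda>\<psi>. R \<psi> (\<rho> \<psi> v, snd v))"
      by (rule integral_rescale[symmetric]) (use v in \<open>auto intro: continuous_on_subset[OF \<rho>cont]\<close>)
    finally show ?thesis .
  qed
  show ?thesis
  proof (rule that[of \<rho>])
    show "\<rho> \<phi> cdiff_on S" if "\<phi> \<in> {0..L}" for \<phi>
    proof (rule cdiff_uniform_limit[OF S])
      show "u i \<phi> cdiff_on S" for i using inv that by blast
      show "uniform_limit S (\<lambda>i. u i \<phi>) (\<rho> \<phi>) sequentially"
        using \<rho>' that unfolding uniform_limit_iff \<rho>_def by (auto elim!: eventually_mono)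
    qed
    show "\<rho> 0 v = fst v" if "v \<in> S" for v using int_eq[of 0 v] that L by simp
    show "((\<lambda>\<phi>. \<rho> \<phi> v) has_vector_derivative R \<phi> (\<rho> \<phi> v, snd v)) (at \<phi> within {0..L})"
      if v: "\<phi> \<in> {0..L}" "v \<in> S" for \<phi> v
    proof -
      have "((\<lambda>\<phi>. fst v + integral {0..\<phi>} (\<lambda>\<psi>. R \<psi> (\<rho> \<psi> v, snd v))) has_vector_derivative 0 + R \<phi> (\<rho> \<phi> v, snd v)) (at \<phi> within {0..L})"
        by (intro has_vector_derivative_add has_vector_derivative_const
            integral_has_vector_derivative[OF \<rho>cont[OF v(2)] v(1)])
      then have d: "((\<lambda>\<phi>. fst v + integral {0..\<phi>} (\<lambda>\<psi>. R \<psi> (\<rho> \<psi> v, snd v))) has_vector_derivative R \<phi> (\<rho> \<phi> v, snd v)) (at \<phi> within {0..L})"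
        by simp
      show ?thesis
        by (rule has_vector_derivative_transform[OF v(1) _ d]) (use int_eq v(2) in auto)
    qed
    show "real_on S P (\<rho> \<phi>)" if "\<phi> \<in> {0..L}" for \<phi>
      unfolding real_on_def
    proof (intro allI impI)
      fix r p assume rp: "p \<in> P" "(complex_of_real r, p) \<in> S"
      show "\<rho> \<phi> (of_real r, p) \<in> \<real>"
        by (rule closed_sequentially[OF closed_complex_Reals _ lim[OF that rp(2)]])
           (use inv that rp in force)
    qed
  qed (use \<rho>b \<rho>c in auto)
qed

section \<open>Uniqueness, zeros of displacement functions and submersions\<close>

text \<open>The weighted square \<open>(d t \<bullet> d t) * exp (- (2 * K * t))\<close> starts at 0
  and cannot increase.\<close>

lemma gronwall_zero_forward:
  fixes d :: "real \<Rightarrow> 'a::real_inner"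
  assumes d: "\<And>t. t \<in> {a..b} \<Longrightarrow> (d has_vector_derivative d' t) (at t within {a..b})"
    and K: "\<And>t. t \<in> {a..b} \<Longrightarrow> norm (d' t) \<le> K * norm (d t)"
    and "d a = 0" and t: "t \<in> {a..b}"
  shows "d t = 0"
proof -
  define q where "q t = (d t \<bullet> d t) * exp (- (2 * K * t))" for t
  define q' where "q' t = (d t \<bullet> d' t + d' t \<bullet> d t) * exp (- (2 * K * t)) + (d t \<bullet> d t) * (exp (- (2 * K * t)) * - (2 * K))" for t
  have "(q has_vector_derivative q' s) (at s within {a..t})" if s: "s \<in> {a..t}" for s
  proof -
    have "(d has_vector_derivative d' s) (at s within {a..t})"
      by (rule has_vector_derivative_within_subset[OF d]) (use s t in auto)
    from bounded_bilinear.has_vector_derivative[OF bounded_bilinear_inner this this]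
    have 1: "((\<lambda>t. d t \<bullet> d t) has_real_derivative d s \<bullet> d' s + d' s \<bullet> d s) (at s within {a..t})"
      by (simp add: has_real_derivative_iff_has_vector_derivative)
    have 2: "((\<lambda>t. exp (- (2 * K * t))) has_real_derivative exp (- (2 * K * s)) * - (2 * K)) (at s within {a..t})"
      by (auto intro!: derivative_eq_intros)
    from DERIV_mult[OF 1 2] show ?thesis
      unfolding q_def q'_def has_real_derivative_iff_has_vector_derivative[symmetric]
      by (simp add: algebra_simps)
  qed
  then have i: "(q' has_integral q t - q a) {a..t}"
    using t by (intro fundamental_theorem_of_calculus) auto
  have le: "q' s \<le> 0" if s: "s \<in> {a..t}" for s
  proof -
    have "d s \<bullet> d' s \<le> norm (d s) * norm (d' s)" by (rule norm_cauchy_schwarz)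
    also have "\<dots> \<le> norm (d s) * (K * norm (d s))"
      using K[of s] s t by (intro mult_left_mono) auto
    also have "\<dots> = K * (d s \<bullet> d s)" by (simp add: power2_norm_eq_inner[symmetric] power2_eq_square)
    finally have "(d s \<bullet> d' s + d' s \<bullet> d s - 2 * K * (d s \<bullet> d s)) * exp (- (2 * K * s)) \<le> 0"
      by (intro mult_nonpos_nonneg) (auto simp: inner_commute)
    then show ?thesis by (simp add: q'_def algebra_simps)
  qed
  have "q t - q a \<le> 0"
    using has_integral_le[OF i has_integral_0] le by blast
  then have "(d t \<bullet> d t) * exp (- (2 * K * t)) \<le> 0" using assms(3) by (simp add: q_def)
  then have "d t \<bullet> d t \<le> 0" by (simp add: mult_le_0_iff)
  then show ?thesis by (metis inner_ge_zero inner_eq_zero_iff order_antisym)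
qed

text \<open>Times before \<open>t0\<close> are reached by reversing time.\<close>

lemma gronwall_zero:
  fixes d :: "real \<Rightarrow> 'a::real_inner"
  assumes d: "\<And>t. t \<in> {a..b} \<Longrightarrow> (d has_vector_derivative d' t) (at t within {a..b})"
    and K: "\<And>t. t \<in> {a..b} \<Longrightarrow> norm (d' t) \<le> K * norm (d t)"
    and t0: "t0 \<in> {a..b}" "d t0 = 0" and t: "t \<in> {a..b}"
  shows "d t = 0"
proof (cases "t0 \<le> t")
  case True
  show ?thesis
    by (rule gronwall_zero_forward[of t0 t d d' K])
       (use True t t0 K in \<open>auto intro: has_vector_derivative_within_subset[OF d]\<close>)
next
  case False
  define e where "e s = d (- s)" for s
  have "e (- t) = 0"
  proof (rule gronwall_zero_forward[of "- t0" "- t" e "\<lambda>s. - d' (- s)" K])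
    fix s assume s: "s \<in> {- t0..- t}"
    have 1: "(uminus has_vector_derivative - 1) (at s within {- t0..- t})"
      by (auto intro!: derivative_eq_intros)
    have 2: "(d has_vector_derivative d' (- s)) (at (- s) within uminus ` {- t0..- t})"
      by (rule has_vector_derivative_within_subset[OF d]) (use s t t0 in auto)
    from vector_diff_chain_within[OF 1 2]
    show "(e has_vector_derivative - d' (- s)) (at s within {- t0..- t})"
      by (simp add: o_def e_def[abs_def])
    show "norm (- d' (- s)) \<le> K * norm (e s)" using K[of "- s"] s t t0 by (simp add: e_def)
  qed (use False t0 in \<open>auto simp: e_def\<close>)
  then show ?thesis by (simp add: e_def)
qed

text \<open>Only \<open>x\<close> is assumed to stay in the Lipschitz region. Near a time of
  agreement the open region contains \<open>y\<close> as well, so the set of agreement is open and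
  closed in the interval.\<close>

lemma ode_unique:
  fixes x y :: "real \<Rightarrow> 'a::real_inner"
  assumes I: "is_interval I"
    and x: "\<And>t. t \<in> I \<Longrightarrow> (x has_vector_derivative f (x t)) (at t within I)"
    and y: "\<And>t. t \<in> I \<Longrightarrow> (y has_vector_derivative f (y t)) (at t within I)"
    and G: "open G" "\<And>t. t \<in> I \<Longrightarrow> x t \<in> G"
    and lip: "\<And>u v. u \<in> G \<Longrightarrow> v \<in> G \<Longrightarrow> norm (f u - f v) \<le> K * norm (u - v)"
    and t0: "t0 \<in> I" "x t0 = y t0" and t: "t \<in> I"
  shows "x t = y t"
proof -
  define A where "A = {t \<in> I. x t - y t = 0}"
  have xc: "continuous_on I x" and yc: "continuous_on I y"
    using x y by (auto intro: has_vector_derivative_continuous simp: continuous_on_eq_continuous_within)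
  have "closedin (top_of_set I) A"
    unfolding A_def by (intro continuous_closedin_preimage_constant continuous_intros xc yc)
  moreover have "openin (top_of_set I) A"
    unfolding openin_euclidean_subtopology_iff
  proof (intro conjI ballI)
    fix t1 assume t1: "t1 \<in> A"
    then have "t1 \<in> I" "y t1 \<in> G" using G(2)[of t1] by (auto simp: A_def)
    then obtain e where e: "e > 0" "ball (y t1) e \<subseteq> G" using G(1) open_contains_ball by blast
    obtain r where r: "r > 0" "\<And>t. t \<in> I \<Longrightarrow> dist t t1 < r \<Longrightarrow> dist (y t) (y t1) < e"
      using yc \<open>t1 \<in> I\<close> e(1) unfolding continuous_on_iff by blast
    have "t \<in> A" if t: "t \<in> I" "dist t t1 < r" for t
    proof -
      have sub: "{min t t1..max t t1} \<subseteq> I"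
      proof
        fix s assume s: "s \<in> {min t t1..max t t1}"
        have m: "min t t1 \<in> I" "max t t1 \<in> I" using t(1) \<open>t1 \<in> I\<close> unfolding min_def max_def by presburger+
        show "s \<in> I" by (rule mem_is_interval_1_I[OF I m]) (use s in simp_all)
      qed
      have "x t - y t = 0"
      proof (rule gronwall_zero[of "min t t1" "max t t1" "\<lambda>t. x t - y t" "\<lambda>t. f (x t) - f (y t)" K t1])
        fix s assume s: "s \<in> {min t t1..max t t1}"
        show "((\<lambda>t. x t - y t) has_vector_derivative f (x s) - f (y s)) (at s within {min t t1..max t t1})"
          using s sub by (intro has_vector_derivative_diff has_vector_derivative_within_subset[OF x sub]
             has_vector_derivative_within_subset[OF y sub]) auto
        have "dist s t1 < r" using s t(2) by (auto simp: dist_real_def)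
        moreover have "s \<in> I" using s sub by blast
        ultimately have "y s \<in> ball (y t1) e" using r(2)[of s] by (simp add: dist_commute)
        then have "y s \<in> G" using e(2) by blast
        then show "norm (f (x s) - f (y s)) \<le> K * norm (x s - y s)"
          using s sub G(2) by (intro lip) auto
      qed (use t1 in \<open>auto simp: A_def\<close>)
      then show ?thesis using t by (simp add: A_def)
    qed
    then show "\<exists>e>0. \<forall>x'\<in>I. dist x' t1 < e \<longrightarrow> x' \<in> A" using r(1) by blast
  qed (auto simp: A_def)
  moreover have "connected I" using I by (rule is_interval_connected)
  moreover have "A \<noteq> {}" using t0 by (auto simp: A_def)
  ultimately have "A = I" unfolding connected_clopen by blast
  then show ?thesis using t by (auto simp: A_def)
qed

text \<open>Each zero except the largest is sent to a zero of the derivative strictly between it and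
  its successor \<open>nx\<close>. These images are distinct, so a differentiation loses at most one
  zero.\<close>

lemma rolle_card:
  fixes f :: "nat \<Rightarrow> real \<Rightarrow> real"
  assumes "\<And>i x. i < m \<Longrightarrow> \<bar>x\<bar> < e \<Longrightarrow> (f i has_real_derivative f (Suc i) x) (at x)"
    and "\<And>x. \<bar>x\<bar> < e \<Longrightarrow> f m x \<noteq> 0"
    and "finite Z" "\<And>z. z \<in> Z \<Longrightarrow> \<bar>z\<bar> < e \<and> f 0 z = 0"
  shows "card Z \<le> m"
  using assms
proof (induction m arbitrary: f Z)
  case 0
  then have "Z = {}" by auto
  then show ?case by simp
next
  case (Suc m)
  show ?case
  proof (cases "Z = {}")
    case False
    define W where "W = Z - {Max Z}"
    define nx where "nx z = Min {w \<in> Z. z < w}" for z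
    have nx: "nx z \<in> Z" "z < nx z" "\<And>w. w \<in> Z \<Longrightarrow> z < w \<Longrightarrow> nx z \<le> w" if "z \<in> W" for z
    proof -
      have "z < Max Z" using that Suc.prems(3) unfolding W_def
        by (metis DiffD1 DiffD2 Max_ge insertI1 order_less_le)
      then have "Max Z \<in> {w \<in> Z. z < w}" using Suc.prems(3) False by simp
      then have "{w \<in> Z. z < w} \<noteq> {}" by blast
      then have "nx z \<in> {w \<in> Z. z < w}" unfolding nx_def using Suc.prems(3) by (intro Min_in) auto
      then show "nx z \<in> Z" "z < nx z" by auto
      show "nx z \<le> w" if "w \<in> Z" "z < w" for w
        unfolding nx_def using Suc.prems(3) that by (intro Min_le) auto
    qed
    have "\<exists>c. z < c \<and> c < nx z \<and> f 1 c = 0" if z: "z \<in> W" for z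
    proof -
      have ze: "\<bar>z\<bar> < e" "f 0 z = 0" "\<bar>nx z\<bar> < e" "f 0 (nx z) = 0"
        using Suc.prems(4) nx(1)[OF z] z by (auto simp: W_def)
      have d: "(f 0 has_real_derivative f (Suc 0) x) (at x)" if "z \<le> x" "x \<le> nx z" for x
        by (rule Suc.prems(1)) (use that ze in auto)
      have "continuous_on {z..nx z} (f 0)"
        by (rule DERIV_continuous_on[where D = "f (Suc 0)"]) (use d in \<open>auto intro: has_field_derivative_at_within\<close>)
      then have "\<exists>c. z < c \<and> c < nx z \<and> DERIV (f 0) c :> 0"
        using nx(2)[OF z] ze d by (intro Rolle) (auto simp: real_differentiable_def intro: less_imp_le)
      then obtain c where c: "z < c" "c < nx z" "DERIV (f 0) c :> 0" by blast
      moreover have "f (Suc 0) c = 0" using d[of c] c DERIV_unique by auto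
      ultimately show ?thesis by auto
    qed
    then obtain c where c: "\<And>z. z \<in> W \<Longrightarrow> z < c z" "\<And>z. z \<in> W \<Longrightarrow> c z < nx z" "\<And>z. z \<in> W \<Longrightarrow> f 1 (c z) = 0"
      by metis
    have "inj_on c W"
    proof (rule linorder_inj_onI)
      fix z w assume "z < w" "z \<in> W" "w \<in> W"
      then have "c z < c w"
        using c(2)[of z] nx(3)[of z w] c(1)[of w] by (auto simp: W_def)
      then show "c z \<noteq> c w" by simp
    qed auto
    have "card (c ` W) \<le> m"
    proof (rule Suc.IH[of "\<lambda>i. f (Suc i)"])
      show "finite (c ` W)" using Suc.prems(3) by (simp add: W_def)
      fix y assume "y \<in> c ` W"
      then obtain z where z: "z \<in> W" "y = c z" by blast
      have "\<bar>z\<bar> < e" "\<bar>nx z\<bar> < e" using Suc.prems(4) nx(1)[OF z(1)] z by (auto simp: W_def)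
      then show "\<bar>y\<bar> < e \<and> f (Suc 0) y = 0" using c[OF z(1)] z(2) by auto
    qed (use Suc.prems in auto)
    then have "card W \<le> m" using card_image[OF \<open>inj_on c W\<close>] by simp
    then show ?thesis using Suc.prems(3) False by (simp add: W_def)
  qed auto
qed

text \<open>A nonzero difference, divided by its lowest power, would be nonzero near 0, so agreement
  on the positive side alone determines the series. This is the uniqueness behind the definite
  description in \<open>return_series\<close>.\<close>

lemma fps_eq_at_right:
  fixes F G :: "real fps"
  assumes "f has_fps_expansion F" "g has_fps_expansion G" "\<forall>\<^sub>F x in at_right 0. f x = g x"
  shows "F = G"
proof (rule ccontr)
  assume "F \<noteq> G"
  define H where "H = F - G"
  define m where "m = subdegree H"
  have H: "H \<noteq> 0" using \<open>F \<noteq> G\<close> by (simp add: H_def)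
  have h: "(\<lambda>x. f x - g x) has_fps_expansion H"
    unfolding H_def using assms by (intro has_fps_expansion_diff)
  then have R: "fps_conv_radius H > 0" and ev: "\<forall>\<^sub>F x in nhds 0. eval_fps H x = f x - g x"
    by (auto simp: has_fps_expansion_def)
  define H' where "H' = fps_shift m H"
  have R': "fps_conv_radius H' > 0" using R by (simp add: H'_def fps_conv_radius_shift)
  have "isCont (eval_fps H') 0"
    by (rule has_fps_expansion_imp_continuous[OF eval_fps_has_fps_expansion[OF R']])
  moreover have "eval_fps H' 0 \<noteq> 0"
    using H by (simp add: eval_fps_at_0 H'_def m_def)
  ultimately have "\<forall>\<^sub>F x in nhds 0. eval_fps H' x \<noteq> 0"
    by (simp add: continuous_at_imp_continuous_within isCont_def tendsto_imp_eventually_ne eventually_nhds_conv_at)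
  moreover have "\<forall>\<^sub>F x in nhds (0::real). x \<in> eball 0 (fps_conv_radius H)"
    by (rule eventually_nhds_in_open) (use R in \<open>auto simp flip: zero_ereal_def\<close>)
  ultimately have "\<forall>\<^sub>F x in nhds 0. x \<noteq> 0 \<longrightarrow> f x - g x \<noteq> 0"
    using ev
  proof eventually_elim
    case (elim x)
    show ?case
    proof
      assume "x \<noteq> 0"
      have "eval_fps H' x = eval_fps H x / x ^ m"
        using elim \<open>x \<noteq> 0\<close> unfolding H'_def by (subst eval_fps_shift) (auto simp: m_def)
      then show "f x - g x \<noteq> 0" using elim by auto
    qed
  qed
  then have "\<forall>\<^sub>F x in at_right 0. f x - g x \<noteq> 0"
    unfolding eventually_at_filter by (rule eventually_mono) auto
  with assms(3) have "\<forall>\<^sub>F x in at_right (0::real). False"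
    by eventually_elim auto
  then show False by simp
qed

lemma cdiff_real_fps_expansion:
  assumes f: "f cdiff_on S" and S: "open S" "radial S" "(0, p) \<in> S"
  shows "(\<lambda>x. Re (f (of_real x, p))) has_fps_expansion Abs_fps (\<lambda>j. Re ((divx ^^ j) f (0, p)))"
proof -
  have "open ((\<lambda>x. (x, p)) -` S)" by (rule open_vimage[OF S(1)]) (intro continuous_intros)
  then obtain e where e: "e > 0" "ball 0 e \<subseteq> (\<lambda>x. (x, p)) -` S"
    using S(3) unfolding open_contains_ball by (auto simp: subset_iff vimage_def)
  have hol: "(\<lambda>z. f (z, p)) holomorphic_on ball 0 e"
    unfolding holomorphic_on_def field_differentiable_def
  proof
    fix z :: complex assume "z \<in> ball 0 e"
    then have "(z, p) \<in> S" using e by blast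
    then show "\<exists>f'. ((\<lambda>z. f (z, p)) has_field_derivative f') (at z within ball 0 e)"
      using dd_fst[OF f] has_field_derivative_at_within by blast
  qed
  have sums: "(\<lambda>n. Re ((divx ^^ n) f (0, p)) * x ^ n) sums Re (f (of_real x, p))" if "\<bar>x\<bar> < e" for x :: real
  proof -
    have "(\<lambda>n. (deriv ^^ n) (\<lambda>z. f (z, p)) 0 / fact n * (of_real x - 0) ^ n) sums f (of_real x, p)"
      by (rule holomorphic_power_series[OF hol]) (use that in simp)
    moreover have "(deriv ^^ n) (\<lambda>z. f (z, p)) 0 / fact n = (divx ^^ n) f (0, p)" for n
      using dd_pow_divx[OF f S, of n] by (simp add: deriv_pow_fst)
    ultimately have "(\<lambda>n. (divx ^^ n) f (0, p) * of_real (x ^ n)) sums f (of_real x, p)" by simp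
    from sums_Re[OF this] show ?thesis by simp
  qed
  define F where "F = Abs_fps (\<lambda>j. Re ((divx ^^ j) f (0, p)))"
  have le: "ereal (norm (e / 2)) \<le> fps_conv_radius F"
    unfolding fps_conv_radius_def
  proof (rule conv_radius_geI)
    have "\<bar>e / 2\<bar> < e" using e(1) by simp
    from sums_summable[OF sums[OF this]] show "summable (\<lambda>n. fps_nth F n * (e / 2) ^ n)"
      by (simp add: F_def)
  qed
  have "0 < ereal (norm (e / 2))" using e(1) by simp
  from this le have R: "fps_conv_radius F > 0" by (rule less_le_trans)
  moreover have "\<forall>\<^sub>F x in nhds 0. eval_fps F x = Re (f (of_real x, p))"
  proof -
    have "\<forall>\<^sub>F x in nhds (0::real). x \<in> ball 0 e" by (rule eventually_nhds_in_open) (use e in auto)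
    then show ?thesis
      by eventually_elim (use sums in \<open>auto simp: eval_fps_def F_def sums_iff\<close>)
  qed
  ultimately show ?thesis unfolding has_fps_expansion_def F_def by blast
qed

text \<open>The gradients are completed to a basis, and the inverse function theorem is applied to
  the map that records the \<open>V j\<close> along the gradients and linear coordinates along the
  other basis vectors. In the image space a step along \<open>w j x0\<close> then changes
  \<open>V j\<close> alone.\<close>

lemma submersion_right_inverse:
  fixes V :: "nat \<Rightarrow> 'a::euclidean_space \<Rightarrow> real" and w :: "nat \<Rightarrow> 'a \<Rightarrow> 'a"
  assumes Ob: "open Ob" "x0 \<in> Ob"
    and V: "\<And>j x. j \<in> {1..k} \<Longrightarrow> x \<in> Ob \<Longrightarrow> (V j has_derivative (\<lambda>h. w j x \<bullet> h)) (at x)"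
    and w: "\<And>j. j \<in> {1..k} \<Longrightarrow> continuous_on Ob (w j)"
    and V0: "\<And>j. j \<in> {1..k} \<Longrightarrow> V j x0 = 0"
    and dim: "dim ((\<lambda>j. w j x0) ` {1..k}) = k"
  obtains W g y0 where "open W" "y0 \<in> W" "continuous_on W g" "g y0 = x0" "\<And>y. y \<in> W \<Longrightarrow> g y \<in> Ob"
    "\<And>c i. i \<in> {1..k} \<Longrightarrow> y0 + (\<Sum>j=1..k. c j *\<^sub>R w j x0) \<in> W \<Longrightarrow>
        V i (g (y0 + (\<Sum>j=1..k. c j *\<^sub>R w j x0))) = c i"
proof -
  define u where "u j = w j x0" for j
  define U where "U = u ` {1..k}"
  have dimU: "dim U = k" using dim by (simp add: U_def u_def[abs_def])
  have finU: "finite U" by (simp add: U_def)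
  \<comment> \<open>Rank \<open>k\<close> forces the \<open>k\<close> gradients to be distinct and
    independent.\<close>
  have "card U \<le> k" unfolding U_def using card_image_le[of "{1..k}" u] by simp
  moreover have "k \<le> card U" using dim_le_card'[OF finU] dimU by simp
  ultimately have cU: "card U = k" by simp
  then have inj: "inj_on u {1..k}" unfolding U_def by (intro eq_card_imp_inj_on) auto
  have indU: "independent U"
    by (rule card_le_dim_spanning[of U U]) (simp_all only: finU cU dimU order_refl span_superset)
  obtain B where B0: "U \<subseteq> B" "independent B" "UNIV \<subseteq> span B"
    using maximal_independent_subset_extend[OF subset_UNIV indU] by metis
  then have B: "U \<subseteq> B" "independent B" "span B = UNIV" by blast+
  have finB: "finite B" using B(2) independent_imp_finite by blast
  have sumU: "(\<Sum>j=1..k. h j *\<^sub>R u j) = (\<Sum>b\<in>U. h (the_inv_into {1..k} u b) *\<^sub>R b)" for h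
    unfolding U_def
    by (subst sum.reindex[OF inj], rule sum.cong) (simp_all add: the_inv_into_f_f[OF inj] del: One_nat_def)
  have coeff0: "(\<forall>j\<in>{1..k}. h j = 0) \<and> (\<forall>b\<in>B-U. h' b = 0)"
    if "(\<Sum>j=1..k. h j *\<^sub>R u j) + (\<Sum>b\<in>B-U. h' b *\<^sub>R b) = 0" for h h'
  proof -
    define q where "q b = (if b \<in> U then h (the_inv_into {1..k} u b) else h' b)" for b
    have "(\<Sum>b\<in>B. q b *\<^sub>R b) = (\<Sum>b\<in>U. q b *\<^sub>R b) + (\<Sum>b\<in>B-U. q b *\<^sub>R b)"
      using sum.subset_diff[OF B(1) finB] by (simp add: add.commute)
    also have "\<dots> = 0" using that unfolding sumU q_def by simp
    finally have q0: "q b = 0" if "b \<in> B" for b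
      using B(2) finB that independent_explicit by blast
    have "h j = 0" if "j \<in> {1..k}" for j
    proof -
      have "u j \<in> U" using that by (auto simp: U_def)
      then have "q (u j) = 0" "q (u j) = h j"
        using q0[of "u j"] B(1) the_inv_into_f_f[OF inj that] by (auto simp: q_def)
      then show ?thesis by simp
    qed
    moreover have "h' b = 0" if "b \<in> B - U" for b using q0[of b] that by (simp add: q_def)
    ultimately show ?thesis by blast
  qed
  define \<Phi> where "\<Phi> x = (\<Sum>j=1..k. V j x *\<^sub>R u j) + (\<Sum>b\<in>B-U. (b \<bullet> x) *\<^sub>R b)" for x
  define L where "L x h = (\<Sum>j=1..k. (w j x \<bullet> h) *\<^sub>R u j) + (\<Sum>b\<in>B-U. (b \<bullet> h) *\<^sub>R b)" for x h
  have Lb: "bounded_linear (L x)" for x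
    unfolding L_def
    by (intro bounded_linear_add bounded_linear_sum bounded_linear_scaleR_const bounded_linear_inner_right)
  have \<Phi>: "(\<Phi> has_derivative blinfun_apply (Blinfun (L x))) (at x)" if "x \<in> Ob" for x
  proof -
    have "(\<Phi> has_derivative L x) (at x)"
      unfolding \<Phi>_def[abs_def] L_def[abs_def]
      by (intro has_derivative_add has_derivative_sum has_derivative_scaleR_left V that
          has_derivative_inner_right has_derivative_ident)
    then show ?thesis by (simp add: bounded_linear_Blinfun_apply[OF Lb])
  qed
  have cont: "continuous_on Ob (\<lambda>x. Blinfun (L x))"
  proof (rule continuous_on_blinfun_componentwise)
    fix i :: 'a
    show "continuous_on Ob (\<lambda>x. blinfun_apply (Blinfun (L x)) i)"
      unfolding bounded_linear_Blinfun_apply[OF Lb] unfolding L_def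
      by (intro continuous_intros w)
  qed
  \<comment> \<open>A vector in the kernel is orthogonal to the whole basis, hence to
    itself.\<close>
  have "inj (L x0)"
  proof (rule linear_injective_0[OF bounded_linear.linear[OF Lb], THEN iffD2], intro allI impI)
    fix h assume "L x0 h = 0"
    then have "(\<Sum>j=1..k. (u j \<bullet> h) *\<^sub>R u j) + (\<Sum>b\<in>B-U. (b \<bullet> h) *\<^sub>R b) = 0"
      by (simp add: L_def u_def)
    from coeff0[OF this] have "\<forall>b\<in>B. b \<bullet> h = 0" unfolding U_def by auto
    then have "orthogonal h x" if "x \<in> span B" for x
      using that by (intro orthogonal_to_span[of x B h]) (auto simp: orthogonal_def inner_commute)
    then have "orthogonal h h" using B(3) by auto
    then show "h = 0" by (simp add: orthogonal_def)
  qed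
  then obtain L' where L': "linear L'" "L' \<circ> L x0 = id"
    using linear_injective_left_inverse[OF bounded_linear.linear[OF Lb]] by blast
  have "Blinfun L' o\<^sub>L Blinfun (L x0) = id_blinfun"
    by (rule blinfun_eqI)
       (use L' in \<open>simp add: bounded_linear_Blinfun_apply Lb linear_conv_bounded_linear pointfree_idE\<close>)
  then obtain U' W g where "open U'" "U' \<subseteq> Ob" and W: "open W" "\<Phi> x0 \<in> W" "homeomorphism U' W \<Phi> g" "x0 \<in> U'"
    using inverse_function_theorem[OF Ob(1) \<Phi> cont Ob(2), of "Blinfun L'"] by metis
  show ?thesis
  proof (rule that[OF W(1,2), of g])
    show "continuous_on W g" using W(3) by (simp add: homeomorphism_def)
    show "g (\<Phi> x0) = x0" using W(3,4) by (auto simp: homeomorphism_def)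
    show gO: "g y \<in> Ob" if "y \<in> W" for y
      using W(3) that \<open>U' \<subseteq> Ob\<close> unfolding homeomorphism_def by blast
    fix c :: "nat \<Rightarrow> real" and i
    assume i: "i \<in> {1..k}" and y: "\<Phi> x0 + (\<Sum>j=1..k. c j *\<^sub>R w j x0) \<in> W"
    define x where "x = g (\<Phi> x0 + (\<Sum>j=1..k. c j *\<^sub>R w j x0))"
    have "\<Phi> x = \<Phi> x0 + (\<Sum>j=1..k. c j *\<^sub>R u j)"
      using W(3) y by (simp add: x_def homeomorphism_def u_def)
    then have "(\<Sum>j=1..k. (V j x - c j) *\<^sub>R u j) + (\<Sum>b\<in>B-U. (b \<bullet> (x - x0)) *\<^sub>R b) = 0"
      using V0 by (simp add: \<Phi>_def scaleR_left_diff_distrib sum_subtractf inner_diff_right algebra_simps)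
    from coeff0[OF this] show "V i (g (\<Phi> x0 + (\<Sum>j=1..k. c j *\<^sub>R w j x0))) = c i"
      using i by (simp add: x_def)
  qed
qed

section \<open>Coordinates straightening the curve \<open>y = F(x, \<delta>)\<close>\<close>

text \<open>Cauchy estimates on a ball of half the radius give the constant. It is the source of
  uniqueness for solutions of the planar system.\<close>

lemma cdiff_lipschitz:
  fixes f :: "'a::cspace \<Rightarrow> complex"
  assumes f: "f cdiff_on S" and S: "open S" "v0 \<in> S"
  obtains \<rho> K where "\<rho> > 0" "K > 0" "ball v0 \<rho> \<subseteq> S"
    "\<And>u v. u \<in> ball v0 \<rho> \<Longrightarrow> v \<in> ball v0 \<rho> \<Longrightarrow> norm (f u - f v) \<le> K * norm (u - v)"
proof -
  obtain r where r: "r > 0" "cball v0 r \<subseteq> S" using S open_contains_cball by blast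
  have "compact (f ` cball v0 r)"
    by (intro compact_continuous_image continuous_on_subset[OF cdiff_on_continuous_on[OF f]] r compact_cball)
  then obtain B where B: "B > 0" "\<And>x. x \<in> cball v0 r \<Longrightarrow> norm (f x) \<le> B"
    using compact_imp_bounded bounded_pos by (metis imageI)
  show ?thesis
  proof (rule that[of "r/2" "B / (r/2)"])
    show "ball v0 (r/2) \<subseteq> S" using r by (auto simp: subset_iff)
    fix u v assume uv: "u \<in> ball v0 (r/2)" "v \<in> ball v0 (r/2)"
    show "norm (f u - f v) \<le> B / (r/2) * norm (u - v)"
    proof (rule differentiable_bound[where S = "ball v0 (r/2)" and f' = "\<lambda>x h. dd h f x"])
      fix x assume x: "x \<in> ball v0 (r/2)"
      have "x \<in> S" using x r by (auto simp: subset_iff)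
      then show "(f has_derivative (\<lambda>h. dd h f x)) (at x within ball v0 (r/2))"
        using has_derivative_dd(1)[OF f] has_derivative_at_withinI by blast
      show "onorm (\<lambda>h. dd h f x) \<le> B / (r/2)"
      proof (rule onorm_le)
        fix h
        have sub: "cball x (r/2) \<subseteq> cball v0 r"
          using x r(1) by (intro order_trans[OF _ ball_subset_cball]) (auto simp: cball_subset_ball_iff dist_commute)
        show "norm (dd h f x) \<le> B / (r/2) * norm h"
          by (rule dd_bound[OF f]) (use sub r B in auto)
      qed
    qed (use uv in auto)
  qed (use r B in auto)
qed

text \<open>Together with \<open>bigo_leading_term\<close> this turns the hypotheses on
  \<open>f\<close> and \<open>g\<close> into limits of quotients, the input of
  \<open>divx_pow_limit\<close>.\<close>

lemma has_sum_leading_term: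
  fixes f :: "real \<Rightarrow> real" and b :: "nat \<Rightarrow> real"
  assumes "\<forall>\<^sub>F x in nhds 0. ((\<lambda>j. b j * x ^ j) has_sum f x) {m..}"
  shows "((\<lambda>x. f x / x ^ m) \<longlongrightarrow> b m) (at 0)"
proof -
  obtain s where s: "s > 0" "\<And>x. \<bar>x\<bar> < s \<Longrightarrow> ((\<lambda>j. b j * x ^ j) has_sum f x) {m..}"
    using assms unfolding eventually_nhds_metric by (auto simp: dist_real_def)
  define h where "h x = (if x = 0 then b m else f x / x ^ m)" for x
  have "(\<lambda>i. b (i + m) * x ^ i) sums h x" if x: "norm x < s" for x
  proof (cases "x = 0")
    case True
    have "(\<lambda>i. if i = 0 then b m else 0) sums b m"
      using sums_If_finite_set[of "{0}" "\<lambda>_. b m"] by simp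
    also have "(\<lambda>i. if i = 0 then b m else 0) = (\<lambda>i. b (i + m) * x ^ i)"
      using True by (auto simp: fun_eq_iff power_0_left)
    finally show ?thesis using True by (simp add: h_def)
  next
    case False
    have "bij_betw (\<lambda>i. i + m) UNIV {m..}"
      by (rule bij_betwI[where g = "\<lambda>i. i - m"]) auto
    from has_sum_reindex_bij_betw[OF this, of "\<lambda>j. b j * x ^ j" "f x"] s(2)[of x] x
    have "((\<lambda>i. b (i + m) * x ^ (i + m)) has_sum f x) UNIV" by simp
    then have "(\<lambda>i. b (i + m) * x ^ (i + m)) sums f x" by (rule has_sum_imp_sums)
    then have "(\<lambda>i. b (i + m) * x ^ (i + m) / x ^ m) sums (f x / x ^ m)" by (rule sums_divide)
    then show ?thesis using False by (simp add: h_def power_add)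
  qed
  from powser_limit_0[OF s(1) this] have "(h \<longlongrightarrow> b (0 + m)) (at 0)" .
  then have "(h \<longlongrightarrow> b m) (at 0)" by simp
  then show ?thesis
    by (rule Lim_transform_eventually) (auto simp: h_def eventually_at_filter)
qed

lemma bigo_leading_term:
  fixes g :: "real \<Rightarrow> real"
  assumes "(\<lambda>x. g x - a * x ^ m) \<in> O[at 0](\<lambda>x. x ^ Suc m)"
  shows "((\<lambda>x. g x / x ^ m) \<longlongrightarrow> a) (at 0)"
proof -
  obtain c where c: "\<forall>\<^sub>F x in at 0. norm (g x - a * x ^ m) \<le> c * norm (x ^ Suc m)"
    using assms by (auto elim: landau_o.bigE)
  have "((\<lambda>x. g x / x ^ m - a) \<longlongrightarrow> 0) (at 0)"
  proof (rule Lim_null_comparison)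
    show "((\<lambda>x. c * \<bar>x\<bar>) \<longlongrightarrow> 0) (at (0::real))"
      by (rule tendsto_eq_intros refl | simp)+
    have "\<forall>\<^sub>F x in at (0::real). x \<noteq> 0" by (simp add: eventually_at_filter)
    with c show "\<forall>\<^sub>F x in at 0. norm (g x / x ^ m - a) \<le> c * \<bar>x\<bar>"
    proof eventually_elim
      case (elim x)
      then have "g x / x ^ m - a = (g x - a * x ^ m) / x ^ m" by (simp add: diff_divide_distrib)
      then have "norm (g x / x ^ m - a) = norm (g x - a * x ^ m) / norm (x ^ m)"
        by (simp only: norm_divide)
      also have "\<dots> \<le> c * norm (x ^ Suc m) / norm (x ^ m)"
        using elim by (intro divide_right_mono) auto
      also have "\<dots> = c * \<bar>x\<bar>" using elim by (simp add: abs_mult)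
      finally show ?case .
    qed
  qed
  then show ?thesis by (simp add: LIM_zero_iff)
qed

section \<open>The planar system in straightened coordinates\<close>

definition vfield :: "(real \<Rightarrow> real \<Rightarrow> 'd \<Rightarrow> real) \<Rightarrow> (real \<Rightarrow> real \<Rightarrow> 'd \<Rightarrow> real) \<Rightarrow> 'd \<Rightarrow> real \<times> real \<Rightarrow> real \<times> real" where
  "vfield X Y d = (\<lambda>(x, y). (y + X x y d, Y x y d))"

text \<open>
  The system in the coordinates \<open>x\<close> and \<open>w = y - F(x, \<delta>)\<close>, near \<open>\<delta>0\<close>: it reads \<open>x' = w U\<close> and
  \<open>w' = - x\<^sup>2\<^sup>n\<^sup>-\<^sup>1 gt - x\<^sup>n\<^sup>-\<^sup>1 ft w + w\<^sup>2 H\<close>, where all coefficients are extended to complex arguments.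
\<close>
locale weighted_form =
  fixes X Y :: "real \<Rightarrow> real \<Rightarrow> real^'m \<Rightarrow> real" and D :: "(real^'m) set" and n :: nat
    and \<delta>0 :: "real^'m" and \<epsilon> K a0 b0 :: real
    and Fc gt ft :: "complex \<times> (complex^'m) \<Rightarrow> complex"
    and U H :: "complex \<times> complex \<times> (complex^'m) \<Rightarrow> complex"
  assumes n: "n \<ge> 2" and \<epsilon>: "\<epsilon> > 0" and K: "K > 0"
    and Fc_cd: "Fc cdiff_on ball 0 \<epsilon> \<times> ball (cvec \<delta>0) \<epsilon>"
    and gt_cd: "gt cdiff_on ball 0 \<epsilon> \<times> ball (cvec \<delta>0) \<epsilon>"
    and ft_cd: "ft cdiff_on ball 0 \<epsilon> \<times> ball (cvec \<delta>0) \<epsilon>"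
    and U_cd: "U cdiff_on ball 0 \<epsilon> \<times> (ball 0 \<epsilon> \<times> ball (cvec \<delta>0) \<epsilon>)"
    and H_cd: "H cdiff_on ball 0 \<epsilon> \<times> (ball 0 \<epsilon> \<times> ball (cvec \<delta>0) \<epsilon>)"
    and Fc_real: "\<And>x d. dist d \<delta>0 < \<epsilon> \<Longrightarrow> \<bar>x\<bar> < \<epsilon> \<Longrightarrow> Fc (of_real x, cvec d) \<in> \<real>"
    and gt_real: "\<And>x d. dist d \<delta>0 < \<epsilon> \<Longrightarrow> \<bar>x\<bar> < \<epsilon> \<Longrightarrow> gt (of_real x, cvec d) \<in> \<real>"
    and ft_real: "\<And>x d. dist d \<delta>0 < \<epsilon> \<Longrightarrow> \<bar>x\<bar> < \<epsilon> \<Longrightarrow> ft (of_real x, cvec d) \<in> \<real>"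
    and U_real: "\<And>w x d. dist d \<delta>0 < \<epsilon> \<Longrightarrow> \<bar>x\<bar> < \<epsilon> \<Longrightarrow> \<bar>w\<bar> < \<epsilon> \<Longrightarrow> U (of_real w, of_real x, cvec d) \<in> \<real>"
    and H_real: "\<And>w x d. dist d \<delta>0 < \<epsilon> \<Longrightarrow> \<bar>x\<bar> < \<epsilon> \<Longrightarrow> \<bar>w\<bar> < \<epsilon> \<Longrightarrow> H (of_real w, of_real x, cvec d) \<in> \<real>"
    and U0: "U (0, 0, cvec \<delta>0) = 1" and gt0: "gt (0, cvec \<delta>0) = of_real a0" and ft0: "ft (0, cvec \<delta>0) = of_real b0"
    and a0: "a0 > 0" and b0: "b0\<^sup>2 - 4 * real n * a0 < 0"
    and Fc0: "\<And>d. d \<in> D \<Longrightarrow> dist d \<delta>0 < \<epsilon> \<Longrightarrow> Fc (0, cvec d) = 0"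
    and xdot: "\<And>d x w. d \<in> D \<Longrightarrow> dist d \<delta>0 < \<epsilon> \<Longrightarrow> \<bar>x\<bar> < \<epsilon> \<Longrightarrow> \<bar>w\<bar> < \<epsilon> \<Longrightarrow>
        of_real (Re (Fc (of_real x, cvec d)) + w + X x (Re (Fc (of_real x, cvec d)) + w) d) =
        of_real w * U (of_real w, of_real x, cvec d)"
    and ydot: "\<And>d x w. d \<in> D \<Longrightarrow> dist d \<delta>0 < \<epsilon> \<Longrightarrow> \<bar>x\<bar> < \<epsilon> \<Longrightarrow> \<bar>w\<bar> < \<epsilon> \<Longrightarrow>
        of_real (Y x (Re (Fc (of_real x, cvec d)) + w) d) -
          dd (1, 0) Fc (of_real x, cvec d) * (of_real w * U (of_real w, of_real x, cvec d)) =
        - (of_real x ^ (2 * n - 1) * gt (of_real x, cvec d)) - of_real x ^ (n - 1) * ft (of_real x, cvec d) * of_real w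
          + (of_real w)\<^sup>2 * H (of_real w, of_real x, cvec d)"
    and lip: "\<And>d u v. dist d \<delta>0 < \<epsilon> \<Longrightarrow> norm u < \<epsilon> \<Longrightarrow> norm v < \<epsilon> \<Longrightarrow>
        norm (vfield X Y d u - vfield X Y d v) \<le> K * norm (u - v)"

text \<open>The velocity of \<open>x\<close> vanishes on \<open>w = 0\<close> and is divided once by
  \<open>w\<close>; the velocity of \<open>w\<close> is expanded to second order in
  \<open>w\<close>. The two lower coefficients of the latter are \<open>- g\<close> and
  \<open>- f\<close>, and \<open>divx\<close> takes out their powers of \<open>x\<close> at the
  parameters in \<open>D\<close>.\<close>

lemma weighted_form_exists:
  fixes X Y :: "real \<Rightarrow> real \<Rightarrow> real^'m \<Rightarrow> real"
    and D :: "(real^'m) set"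
    and F :: "real \<Rightarrow> real^'m \<Rightarrow> real"
    and a :: "real^'m \<Rightarrow> real"
    and b :: "nat \<Rightarrow> real^'m \<Rightarrow> real"
  assumes AX: "admissible_perturbation X D" and AY: "admissible_perturbation Y D"
    and F: "is_implicit_solution X D F" and n: "n \<ge> 2"
    and g: "\<And>\<delta>. \<delta> \<in> D \<Longrightarrow>
           (\<lambda>x. g_fun Y F x \<delta> - a \<delta> * x ^ (2 * n - 1)) \<in> O[at 0](\<lambda>x. x ^ (2 * n))"
    and a: "\<And>\<delta>. \<delta> \<in> D \<Longrightarrow> a \<delta> > 0"
    and f: "\<And>\<delta>. \<delta> \<in> D \<Longrightarrow>
           \<forall>\<^sub>F x in nhds 0. ((\<lambda>j. b j \<delta> * x ^ j) has_sum f_fun X Y F x \<delta>) {n - 1..}"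
    and ab: "\<And>\<delta>. \<delta> \<in> D \<Longrightarrow> (b (n - 1) \<delta>)\<^sup>2 - 4 * real n * a \<delta> < 0"
    and \<delta>0: "\<delta>0 \<in> D"
  obtains \<epsilon> K a0 b0 Fc gt ft U H where
    "weighted_form X Y D n \<delta>0 \<epsilon> K a0 b0 Fc gt ft U H"
    "\<And>d. d \<in> D \<Longrightarrow> dist d \<delta>0 < \<epsilon> \<Longrightarrow> \<forall>\<^sub>F x in nhds 0. F x d = Re (Fc (of_real x, cvec d))"
proof -
  have anX: "real_analytic_at (\<lambda>(x, y, d). X x y d) (0, 0, \<delta>0)"
    and anY: "real_analytic_at (\<lambda>(x, y, d). Y x y d) (0, 0, \<delta>0)"
    using AX AY \<delta>0 by (auto simp: admissible_perturbation_def)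
  obtain CX rX where rX: "rX > 0" "\<And>\<delta> x y. \<delta> \<in> D \<Longrightarrow> norm (x, y) < rX \<Longrightarrow> \<bar>X x y \<delta>\<bar> \<le> CX * (norm (x, y))\<^sup>2"
    using AX unfolding admissible_perturbation_def by blast
  have X00: "X 0 0 d = 0" if "d \<in> D" for d
    using rX(2)[OF that, of 0 0] rX(1) by simp
  \<comment> \<open>The quadratic bound removes the linear term in \<open>y\<close>, as the
    contraction in \<open>implicit_cdiff\<close> requires.\<close>
  have X_y0: "((\<lambda>s. X 0 s d) has_real_derivative 0) (at 0)" if "d \<in> D" for d
  proof -
    have "((\<lambda>s. X 0 s d / s) \<longlongrightarrow> 0) (at 0)"
    proof (rule Lim_null_comparison)
      show "((\<lambda>s. \<bar>CX\<bar> * \<bar>s\<bar>) \<longlongrightarrow> 0) (at (0::real))"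
        by (rule tendsto_eq_intros refl | simp)+
      have "\<forall>\<^sub>F s in at (0::real). \<bar>s\<bar> < rX"
        unfolding eventually_at using rX(1) by (auto simp: dist_real_def)
      moreover have "\<forall>\<^sub>F s in at (0::real). s \<noteq> 0" by (simp add: eventually_at_filter)
      ultimately show "\<forall>\<^sub>F s in at 0. norm (X 0 s d / s) \<le> \<bar>CX\<bar> * \<bar>s\<bar>"
      proof eventually_elim
        case (elim s)
        have "\<bar>X 0 s d\<bar> \<le> CX * (norm (0::real, s))\<^sup>2" by (rule rX(2)[OF that]) (use elim in \<open>simp add: norm_Pair\<close>)
        also have "\<dots> \<le> \<bar>CX\<bar> * (\<bar>s\<bar> * \<bar>s\<bar>)"
          by (simp add: norm_Pair power2_eq_square mult_right_mono)
        finally show ?case using elim by (simp add: abs_divide divide_le_eq mult.assoc)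
      qed
    qed
    then show ?thesis by (simp add: has_field_derivative_iff X00[OF that])
  qed
  obtain SX and Xc :: "complex \<times> complex \<times> (complex^'m) \<Rightarrow> complex" where SX: "open SX" "(0, (0, cvec \<delta>0)) \<in> SX" and Xc: "Xc cdiff_on SX"
    and Xc_eq: "\<And>x y d. (of_real y, (of_real x, cvec d)) \<in> SX \<Longrightarrow> Xc (of_real y, (of_real x, cvec d)) = of_real (X x y d)"
    by (rule perturbation_complexify[OF anX]) blast
  obtain SY and Yc :: "complex \<times> complex \<times> (complex^'m) \<Rightarrow> complex" where SY: "open SY" "(0, (0, cvec \<delta>0)) \<in> SY" and Yc: "Yc cdiff_on SY"
    and Yc_eq: "\<And>x y d. (of_real y, (of_real x, cvec d)) \<in> SY \<Longrightarrow> Yc (of_real y, (of_real x, cvec d)) = of_real (Y x y d)"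
    by (rule perturbation_complexify[OF anY]) blast
  define p0 where "p0 = (0 :: complex, cvec \<delta>0)"
  define P where "P = range (\<lambda>(x, d). (complex_of_real x, cvec d :: complex^'m))"
  have P_iff: "(complex_of_real x, cvec d) \<in> P" for x and d :: "real^'m" by (auto simp: P_def)
  have dX0: "dd (1, 0) Xc (0, p0) = 0"
  proof -
    have "open ((\<lambda>s::real. (complex_of_real s, p0)) -` SX)"
      by (rule open_vimage[OF SX(1)]) (intro continuous_intros)
    then have "\<forall>\<^sub>F s in nhds (0::real). s \<in> (\<lambda>s::real. (complex_of_real s, p0)) -` SX"
      by (rule eventually_nhds_in_open) (use SX in \<open>simp add: p0_def\<close>)
    then have ev: "\<forall>\<^sub>F s in nhds (0::real). Xc ((0, p0) + of_real s *\<^sub>C (1, 0)) = of_real (X 0 s \<delta>0)"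
    proof eventually_elim
      case (elim s)
      then show ?case using Xc_eq[of s 0 \<delta>0] by (simp add: p0_def)
    qed
    have "Re (dd (1, 0) Xc (0, p0)) = 0"
      using dd_real(1)[OF Xc _ ev] X_y0[OF \<delta>0] SX(2) DERIV_unique unfolding p0_def by blast
    moreover have "dd (1, 0) Xc (0, p0) \<in> \<real>"
      using dd_real(2)[OF Xc _ ev] SX(2) by (simp add: p0_def)
    ultimately show ?thesis by (simp add: complex_is_Real_iff complex_eq_iff)
  qed
  have Xc0: "Xc (0, p0) = 0" using Xc_eq[of 0 0 \<delta>0] SX(2) X00[OF \<delta>0] by (simp add: p0_def)
  have realX: "real_on SX P Xc" unfolding real_on_def P_def using Xc_eq by auto
  obtain \<alpha> \<beta> Fc where ab': "\<alpha> > 0" "\<beta> > 0" "ball 0 \<beta> \<times> ball p0 \<alpha> \<subseteq> SX" and Fc: "Fc cdiff_on ball p0 \<alpha>"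
    and Fb: "\<And>p. p \<in> ball p0 \<alpha> \<Longrightarrow> norm (Fc p) < \<beta>"
    and Feq: "\<And>p. p \<in> ball p0 \<alpha> \<Longrightarrow> Fc p + Xc (Fc p, p) = 0"
    and Funiq: "\<And>p w. p \<in> ball p0 \<alpha> \<Longrightarrow> norm w < \<beta> \<Longrightarrow> w + Xc (w, p) = 0 \<Longrightarrow> w = Fc p"
    and Freal: "\<And>p. p \<in> ball p0 \<alpha> \<Longrightarrow> p \<in> P \<Longrightarrow> Fc p \<in> \<real>"
    using implicit_cdiff[OF Xc SX(1) _ Xc0 dX0 realX] SX(2) unfolding p0_def[symmetric] by blast
  have Fp0: "Fc p0 = 0" using Funiq[of p0 0] ab' Xc0 by simp
  define S0 where "S0 = SX \<inter> SY"
  have S0: "open S0" "(0, p0) \<in> S0" using SX SY by (auto simp: S0_def p0_def)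
  define T where "T = {v \<in> UNIV \<times> ball p0 \<alpha>. (Fc (snd v) + fst v, snd v) \<in> S0}"
  have "open T"
  proof -
    have "open ((UNIV \<times> ball p0 \<alpha>) \<inter> (\<lambda>v. (Fc (snd v) + fst v, snd v)) -` S0)"
      by (rule continuous_open_preimage)
         (auto intro!: open_Times S0 continuous_intros continuous_on_compose2[OF cdiff_on_continuous_on[OF Fc]])
    then show ?thesis by (simp add: T_def Int_def vimage_def)
  qed
  moreover have "(0, p0) \<in> T" using S0 ab' by (simp add: T_def Fp0)
  ultimately obtain e1 where e1: "e1 > 0" "ball (0, p0) e1 \<subseteq> T" using open_contains_ball by blast
  obtain \<rho>x Kx where \<rho>x: "\<rho>x > 0" "Kx > 0" "ball (0, p0) \<rho>x \<subseteq> SX"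
    "\<And>u v. u \<in> ball (0, p0) \<rho>x \<Longrightarrow> v \<in> ball (0, p0) \<rho>x \<Longrightarrow> norm (Xc u - Xc v) \<le> Kx * norm (u - v)"
    using cdiff_lipschitz[OF Xc SX(1)] SX(2) unfolding p0_def by blast
  obtain \<rho>y Ky where \<rho>y: "\<rho>y > 0" "Ky > 0" "ball (0, p0) \<rho>y \<subseteq> SY"
    "\<And>u v. u \<in> ball (0, p0) \<rho>y \<Longrightarrow> v \<in> ball (0, p0) \<rho>y \<Longrightarrow> norm (Yc u - Yc v) \<le> Ky * norm (u - v)"
    using cdiff_lipschitz[OF Yc SY(1)] SY(2) unfolding p0_def by blast
  \<comment> \<open>One third, because \<open>near\<close> adds the sizes of three
    coordinates.\<close>
  define \<epsilon> where "\<epsilon> = min (min e1 \<alpha>) (min \<rho>x \<rho>y) / 3"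
  have \<epsilon>: "\<epsilon> > 0" "3 * \<epsilon> \<le> e1" "3 * \<epsilon> \<le> \<alpha>" "3 * \<epsilon> \<le> \<rho>x" "3 * \<epsilon> \<le> \<rho>y"
    using e1 ab' \<rho>x \<rho>y by (auto simp: \<epsilon>_def)
  have near: "dist (0, p0) (w, x, d) < 3 * \<epsilon>" if "norm w < \<epsilon>" "norm x < \<epsilon>" "dist (cvec \<delta>0) d < \<epsilon>" for w :: complex and x d
  proof -
    have "dist (0, p0) (w, x, d) \<le> norm w + (norm x + dist (cvec \<delta>0) d)"
      using norm_Pair_le[of w "(x, d - cvec \<delta>0)"] norm_Pair_le[of x "d - cvec \<delta>0"]
      by (simp add: dist_norm p0_def norm_minus_commute dist_commute norm_Pair)
    then show ?thesis using that by linarith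
  qed
  define Q where "Q = ball (cvec \<delta>0) \<epsilon>"
  define E2 where "E2 = ball (0::complex) \<epsilon> \<times> Q"
  define E3 where "E3 = ball (0::complex) \<epsilon> \<times> E2"
  have op: "open E2" "open E3" by (auto simp: E2_def E3_def Q_def intro!: open_Times)
  have rad: "radial E2" "radial E3" unfolding E2_def E3_def by (rule radial_Times)+
  have E3T: "v \<in> T" if "v \<in> E3" for v
    using near[of "fst v" "fst (snd v)" "snd (snd v)"] that \<epsilon>(2) e1(2)
    by (auto simp: E3_def E2_def Q_def subset_iff)
  have E2\<alpha>: "E2 \<subseteq> ball p0 \<alpha>"
  proof
    fix v assume "v \<in> E2"
    then have "(0, v) \<in> E3" using \<epsilon> by (simp add: E3_def)
    then show "v \<in> ball p0 \<alpha>" using E3T[of "(0, v)"] by (simp add: T_def)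
  qed
  have Fc2: "Fc cdiff_on E2" using Fc E2\<alpha> by (rule cdiff_on_subset)
  define FX where "FX v = Fc (snd v) + fst v" for v :: "complex \<times> complex \<times> (complex^'m)"
  have FX_cd: "FX cdiff_on E3" unfolding FX_def
    by (intro cdiff_on_add cdiff_on_fst cdiff_on_id cdiff_on_compose[OF _ Fc2] cdiff_on_snd) (auto simp: E3_def)
  have inS: "(FX v, snd v) \<in> SX" "(FX v, snd v) \<in> SY" if "v \<in> E3" for v
    using E3T[OF that] by (auto simp: T_def S0_def FX_def)
  \<comment> \<open>This is the velocity of \<open>x\<close>, and \<open>Bf\<close> below is that of
    \<open>w = y - F\<close>, by the chain rule.\<close>
  define A where "A v = FX v + Xc (FX v, snd v)" for v
  define dF where "dF = dd (1, 0) Fc"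
  have dF_cd: "dF cdiff_on E2" unfolding dF_def by (rule cdiff_dd[OF Fc2 op(1)])
  define Bf where "Bf v = Yc (FX v, snd v) - dF (snd v) * A v" for v
  have A_cd: "A cdiff_on E3" unfolding A_def[abs_def]
    by (intro cdiff_on_add FX_cd cdiff_on_compose[OF _ Xc] cdiff_on_Pair cdiff_on_snd cdiff_on_id inS)
  have B_cd: "Bf cdiff_on E3" unfolding Bf_def[abs_def]
    by (intro cdiff_on_diff cdiff_on_mult A_cd cdiff_on_compose[OF _ Yc] cdiff_on_compose[OF _ dF_cd]
         FX_cd cdiff_on_Pair cdiff_on_snd cdiff_on_id inS) (auto simp: E3_def)
  have E30: "(0, p) \<in> E3" if "p \<in> E2" for p using that \<epsilon> by (simp add: E3_def)
  have A0: "A (0, p) = 0" if "p \<in> E2" for p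
    using Feq[of p] that E2\<alpha> by (auto simp: A_def FX_def)
  define U where "U = divx A"
  define H where "H = divx (divx Bf)"
  define gc where "gc p = - Bf (0, p)" for p
  define fc where "fc p = - divx Bf (0, p)" for p
  define gt where "gt = (divx ^^ (2 * n - 1)) gc"
  define ft where "ft = (divx ^^ (n - 1)) fc"
  have U_cd: "U cdiff_on E3" unfolding U_def by (rule cdiff_divx[OF A_cd op(2) rad(2)])
  have B1_cd: "divx Bf cdiff_on E3" by (rule cdiff_divx[OF B_cd op(2) rad(2)])
  have H_cd: "H cdiff_on E3" unfolding H_def by (rule cdiff_divx[OF B1_cd op(2) rad(2)])
  have gc_cd: "gc cdiff_on E2" unfolding gc_def[abs_def]
    by (intro cdiff_on_uminus cdiff_on_compose[OF _ B_cd] cdiff_intros) (use E30 in auto)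
  have fc_cd: "fc cdiff_on E2" unfolding fc_def[abs_def]
    by (intro cdiff_on_uminus cdiff_on_compose[OF _ B1_cd] cdiff_intros) (use E30 in auto)
  have gt_cd: "gt cdiff_on E2" unfolding gt_def by (rule cdiff_divx_pow[OF gc_cd op(1) rad(1)])
  have ft_cd: "ft cdiff_on E2" unfolding ft_def by (rule cdiff_divx_pow[OF fc_cd op(1) rad(1)])
  define PQ where "PQ = range (cvec :: real^'m \<Rightarrow> complex^'m)"
  have FcR: "Fc (of_real x, cvec d) \<in> \<real>" if "(of_real x, cvec d) \<in> E2" for x d
    using Freal[of "(of_real x, cvec d)"] that E2\<alpha> P_iff by blast
  have FcRe: "Fc (of_real x, cvec d) = of_real (Re (Fc (of_real x, cvec d)))" if "(of_real x, cvec d) \<in> E2" for x d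
    using FcR[OF that] by simp
  have FX_eq: "FX (of_real w, of_real x, cvec d) = of_real (Re (Fc (of_real x, cvec d)) + w)"
    if "(of_real x, cvec d) \<in> E2" for w x d
    using FcRe[OF that] by (simp add: FX_def)
  have A_eq: "A (of_real w, of_real x, cvec d) = of_real (Re (Fc (of_real x, cvec d)) + w + X x (Re (Fc (of_real x, cvec d)) + w) d)"
    if v: "(of_real w, of_real x, cvec d) \<in> E3" for w x d
  proof -
    have "(of_real x, cvec d) \<in> E2" using v by (simp add: E3_def)
    then show ?thesis using Xc_eq[of "Re (Fc (of_real x, cvec d)) + w" x d] inS(1)[OF v] FX_eq[of x d w]
      by (simp add: A_def)
  qed
  have Yc_eq': "Yc (FX (of_real w, of_real x, cvec d), of_real x, cvec d) = of_real (Y x (Re (Fc (of_real x, cvec d)) + w) d)"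
    if v: "(of_real w, of_real x, cvec d) \<in> E3" for w x d
  proof -
    have "(of_real x, cvec d) \<in> E2" using v by (simp add: E3_def)
    then show ?thesis using Yc_eq[of "Re (Fc (of_real x, cvec d)) + w" x d] inS(2)[OF v] FX_eq[of x d w]
      by simp
  qed
  have FrE2: "real_on E2 PQ Fc" unfolding real_on_def PQ_def using FcR by auto
  have dFr: "real_on E2 PQ dF" unfolding dF_def by (rule real_on_dd[OF Fc2 op(1) FrE2])
  have Ar: "real_on E3 P A" unfolding real_on_def P_def using A_eq by auto
  have Br: "real_on E3 P Bf"
    unfolding real_on_def P_def
  proof (intro allI impI)
    fix w p assume p: "p \<in> range (\<lambda>(x, d). (complex_of_real x, cvec d))" "(complex_of_real w, p) \<in> E3"
    then obtain x d where xd: "p = (complex_of_real x, cvec d)" by auto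
    have "(of_real x, cvec d) \<in> E2" using p(2) xd by (simp add: E3_def)
    then have "dF p \<in> \<real>" using dFr xd unfolding real_on_def PQ_def by blast
    then show "Bf (complex_of_real w, p) \<in> \<real>"
      using A_eq[of w x d] Yc_eq'[of w x d] p(2) unfolding xd Bf_def by (auto intro!: Reals_diff Reals_mult)
  qed
  have Ur: "real_on E3 P U" unfolding U_def by (rule real_on_divx[OF A_cd op(2) rad(2) Ar])
  have B1r: "real_on E3 P (divx Bf)" by (rule real_on_divx[OF B_cd op(2) rad(2) Br])
  have Hr: "real_on E3 P H" unfolding H_def by (rule real_on_divx[OF B1_cd op(2) rad(2) B1r])
  have gcr: "real_on E2 PQ gc" unfolding real_on_def PQ_def gc_def
    using Br E30 P_iff unfolding real_on_def by (metis Reals_minus_iff imageE of_real_0)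
  have fcr: "real_on E2 PQ fc" unfolding real_on_def PQ_def fc_def
    using B1r E30 P_iff unfolding real_on_def by (metis Reals_minus_iff imageE of_real_0)
  have gtr: "real_on E2 PQ gt" unfolding gt_def by (rule real_on_divx_pow[OF gc_cd op(1) rad(1) gcr])
  have ftr: "real_on E2 PQ ft" unfolding ft_def by (rule real_on_divx_pow[OF fc_cd op(1) rad(1) fcr])
  have QI: "cvec d \<in> Q" if "dist d \<delta>0 < \<epsilon>" for d using that by (simp add: Q_def dist_commute)
  have E2I: "(of_real x, cvec d) \<in> E2" if "dist d \<delta>0 < \<epsilon>" "\<bar>x\<bar> < \<epsilon>" for x d
    using that QI by (simp add: E2_def)
  have E3I: "(of_real w, of_real x, cvec d) \<in> E3" if "dist d \<delta>0 < \<epsilon>" "\<bar>x\<bar> < \<epsilon>" "\<bar>w\<bar> < \<epsilon>" for w x d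
    using that E2I by (simp add: E3_def)
  \<comment> \<open>Continuity at 0 brings the given \<open>F\<close> into the uniqueness ball of
    the implicit function, so the two branches agree near 0.\<close>
  have FF: "\<forall>\<^sub>F x in nhds 0. F x d = Re (Fc (of_real x, cvec d))" if d: "d \<in> D" "dist d \<delta>0 < \<epsilon>" for d
  proof -
    have Fd: "F 0 d = 0" "isCont (\<lambda>x. F x d) 0" "\<forall>\<^sub>F x in nhds 0. F x d + X x (F x d) d = 0"
      using F d(1) by (auto simp: is_implicit_solution_def)
    have "\<forall>\<^sub>F x in nhds 0. F x d \<in> ball 0 \<beta>"
    proof -
      have "((\<lambda>x. F x d) \<longlongrightarrow> 0) (nhds 0)" using Fd(1,2) tendsto_at_iff_tendsto_nhds[of "\<lambda>x. F x d" 0] by (simp add: isCont_def)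
      then show ?thesis by (rule topological_tendstoD) (use ab' in auto)
    qed
    moreover have "\<forall>\<^sub>F x in nhds (0::real). x \<in> ball 0 \<epsilon>" by (rule eventually_nhds_in_open) (use \<epsilon> in auto)
    ultimately show ?thesis using Fd(3)
    proof eventually_elim
      case (elim x)
      then have x: "(of_real x, cvec d) \<in> E2" using E2I d(2) by simp
      then have p: "(of_real x, cvec d) \<in> ball p0 \<alpha>" using E2\<alpha> by blast
      have "(complex_of_real (F x d), (of_real x, cvec d)) \<in> ball 0 \<beta> \<times> ball p0 \<alpha>"
        using elim(1) p by simp
      then have "(complex_of_real (F x d), (of_real x, cvec d)) \<in> SX" using ab'(3) by blast
      then have "Xc (complex_of_real (F x d), (of_real x, cvec d)) = of_real (X x (F x d) d)" by (rule Xc_eq)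
      then have "of_real (F x d) + Xc (complex_of_real (F x d), (of_real x, cvec d)) = 0"
        using elim(3) by (metis of_real_0 of_real_add)
      from Funiq[OF p _ this] elim(1) show ?case by (metis Re_complex_of_real dist_0_norm mem_ball norm_of_real real_norm_def)
    qed
  qed
  have gc_eq: "\<forall>\<^sub>F x in nhds 0. gc (of_real x, cvec d) = of_real (g_fun Y F x d)" if d: "d \<in> D" "dist d \<delta>0 < \<epsilon>" for d
  proof -
    have "\<forall>\<^sub>F x in nhds (0::real). x \<in> ball 0 \<epsilon>" by (rule eventually_nhds_in_open) (use \<epsilon> in auto)
    with FF[OF d] show ?thesis
    proof eventually_elim
      case (elim x)
      then have x: "(of_real x, cvec d) \<in> E2" using E2I d(2) by simp
      show ?case using Yc_eq'[of 0 x d] E30[OF x] A0[OF x] elim(1) by (simp add: gc_def Bf_def g_fun_def)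
    qed
  qed
  have fc_eq: "\<forall>\<^sub>F x in nhds 0. fc (of_real x, cvec d) = of_real (f_fun X Y F x d)" if d: "d \<in> D" "dist d \<delta>0 < \<epsilon>" for d
  proof -
    have "\<forall>\<^sub>F x in nhds (0::real). x \<in> ball 0 \<epsilon>" by (rule eventually_nhds_in_open) (use \<epsilon> in auto)
    with FF[OF d] show ?thesis
    proof eventually_elim
      case (elim x)
      define p where "p = (complex_of_real x, cvec d)"
      have x: "p \<in> E2" using E2I d(2) elim(2) by (simp add: p_def)
      note x3 = E30[OF x]
      define y where "y = Re (Fc p)"
      have y: "Fc p = of_real y" "F x d = y" using FcRe[of x d] x elim(1) by (simp_all add: p_def y_def)
      have sX: "(of_real y, p) \<in> SX" "(of_real y, p) \<in> SY" using inS[OF x3] y(1) by (simp_all add: FX_def)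
      have lin: "dd (c, h) Xc (of_real y, p) = c * dd (1, 0) Xc (of_real y, p) + dd (0, h) Xc (of_real y, p)" for c h
      proof -
        have "linear (\<lambda>h. dd h Xc (of_real y, p))"
          using has_derivative_dd(1)[OF Xc sX(1)] has_derivative_linear by blast
        then have "dd ((c, 0) + (0, h)) Xc (of_real y, p) = dd (c, 0) Xc (of_real y, p) + dd (0, h) Xc (of_real y, p)"
          by (rule linear_add)
        moreover have "dd (c *\<^sub>C (1, 0)) Xc (of_real y, p) = c * dd (1, 0) Xc (of_real y, p)"
          by (rule has_derivative_dd(2)[OF Xc sX(1)])
        moreover have "(c, 0) + (0, h) = (c, h)" "c *\<^sub>C (1, 0) = (c, 0 :: complex \<times> (complex^'m))"
          by (simp, simp add: zero_prod_def)
        ultimately show ?thesis by (simp only:)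
      qed
      \<comment> \<open>Differentiating \<open>F + X(F, p) = 0\<close> in \<open>x\<close> eliminates \<open>F'\<close> from the coefficient of \<open>w\<close>.\<close>
      have impl: "dF p + (dF p * dd (1, 0) Xc (of_real y, p) + dd (0, (1, 0)) Xc (of_real y, p)) = 0"
      proof -
        have d1: "((\<lambda>u. Fc (u, cvec d)) has_field_derivative dF p) (at (of_real x))"
          unfolding dF_def p_def by (rule dd_fst[OF Fc2]) (use x in \<open>simp add: p_def\<close>)
        have "((\<lambda>u. (Fc (u, cvec d), (u, cvec d))) has_derivative (\<lambda>h. (dF p * h, (h, 0)))) (at (of_real x))"
          using d1 unfolding has_field_derivative_def
          by (intro has_derivative_Pair has_derivative_ident has_derivative_const)
        from has_derivative_compose[OF this, of Xc "\<lambda>h. dd h Xc (of_real y, p)"]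
        have "((\<lambda>u. Xc (Fc (u, cvec d), (u, cvec d))) has_derivative (\<lambda>h. dd (dF p * h, (h, 0)) Xc (of_real y, p))) (at (of_real x))"
          using has_derivative_dd(1)[OF Xc sX(1)] y(1) by (simp add: p_def)
        moreover have "dd (dF p * h, (h, 0)) Xc (of_real y, p) = dd (dF p, (1, 0)) Xc (of_real y, p) * h" for h
          using has_derivative_dd(2)[OF Xc sX(1), of h "(dF p, (1, 0))"] by (simp add: mult.commute)
        ultimately have "((\<lambda>u. Xc (Fc (u, cvec d), (u, cvec d))) has_field_derivative dd (dF p, (1, 0)) Xc (of_real y, p)) (at (of_real x))"
          by (simp add: has_field_derivative_def)
        from DERIV_add[OF d1 this]
        have d2: "((\<lambda>u. Fc (u, cvec d) + Xc (Fc (u, cvec d), (u, cvec d))) has_field_derivative dF p + dd (dF p, (1, 0)) Xc (of_real y, p)) (at (of_real x))" .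
        have "((\<lambda>u. 0 :: complex) has_field_derivative dF p + dd (dF p, (1, 0)) Xc (of_real y, p)) (at (of_real x))"
        proof (rule has_field_derivative_transform_within_open[OF d2])
          show "open ((\<lambda>u. (u, cvec d)) -` E2)" by (rule open_vimage[OF op(1)]) (intro continuous_intros)
          show "of_real x \<in> (\<lambda>u. (u, cvec d)) -` E2" using x by (simp add: p_def)
          show "Fc (u, cvec d) + Xc (Fc (u, cvec d), (u, cvec d)) = 0" if "u \<in> (\<lambda>u. (u, cvec d)) -` E2" for u
            using Feq[of "(u, cvec d)"] that E2\<alpha> by blast
        qed
        then have "dF p + dd (dF p, (1, 0)) Xc (of_real y, p) = 0"
          using DERIV_unique DERIV_const by blast
        then show ?thesis using lin[of "dF p" "(1, 0)"] by simp
      qed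
      have dB: "dd (1, 0) Bf (0, p) = dd (1, 0) Yc (of_real y, p) - dF p * (1 + dd (1, 0) Xc (of_real y, p))"
      proof -
        have s: "((\<lambda>w. of_real y + w) has_field_derivative 1) (at (0::complex))" by (auto intro!: derivative_eq_intros)
        have "((\<lambda>w. Yc (of_real y + w, p)) has_field_derivative dd (1, 0) Yc (of_real y, p) * 1) (at 0)"
          using DERIV_chain2[where f = "\<lambda>u. Yc (u, p)", OF _ s] dd_fst[OF Yc sX(2)] by simp
        moreover have "((\<lambda>w. Xc (of_real y + w, p)) has_field_derivative dd (1, 0) Xc (of_real y, p) * 1) (at 0)"
          using DERIV_chain2[where f = "\<lambda>u. Xc (u, p)", OF _ s] dd_fst[OF Xc sX(1)] by simp
        ultimately have "((\<lambda>w. Yc (of_real y + w, p) - dF p * ((of_real y + w) + Xc (of_real y + w, p))) has_field_derivative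
           dd (1, 0) Yc (of_real y, p) - dF p * (1 + dd (1, 0) Xc (of_real y, p))) (at 0)"
          by (auto intro!: derivative_eq_intros)
        moreover have "(\<lambda>w. Bf (w, p)) = (\<lambda>w. Yc (of_real y + w, p) - dF p * ((of_real y + w) + Xc (of_real y + w, p)))"
          by (simp add: Bf_def A_def FX_def y(1))
        ultimately show ?thesis using DERIV_unique[OF dd_fst[OF B_cd x3]] by simp
      qed
      have "fc p = - dd (1, 0) Bf (0, p)"
        using dd_pow_divx[OF B_cd op(2) rad(2) x3, of 1] by (simp add: fc_def)
      also have "\<dots> = - (dd (0, (1, 0)) Xc (of_real y, p) + dd (1, 0) Yc (of_real y, p))"
      proof -
        have "dF p * (1 + dd (1, 0) Xc (of_real y, p)) = - dd (0, (1, 0)) Xc (of_real y, p)"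
          using impl by (simp only: distrib_left mult_1_right eq_neg_iff_add_eq_0 add.assoc)
        then show ?thesis unfolding dB by simp
      qed
      finally have fc1: "fc p = - (dd (0, (1, 0)) Xc (of_real y, p) + dd (1, 0) Yc (of_real y, p))" .
      have evX: "\<forall>\<^sub>F s in nhds (0::real). Xc ((of_real y, p) + of_real s *\<^sub>C (0, (1, 0))) = of_real (X (x + s) y d)"
      proof -
        have "open ((\<lambda>s::real. (complex_of_real y, complex_of_real x + of_real s, cvec d)) -` SX)"
          by (rule open_vimage[OF SX(1)]) (intro continuous_intros)
        then have "\<forall>\<^sub>F s in nhds (0::real). s \<in> (\<lambda>s::real. (complex_of_real y, complex_of_real x + of_real s, cvec d)) -` SX"
          by (rule eventually_nhds_in_open) (use sX in \<open>simp add: p_def\<close>)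
        then show ?thesis
        proof eventually_elim
          case (elim s)
          then show ?case using Xc_eq[of y "x + s" d] by (simp add: p_def)
        qed
      qed
      have evY: "\<forall>\<^sub>F s in nhds (0::real). Yc ((of_real y, p) + of_real s *\<^sub>C (1, 0)) = of_real (Y x (y + s) d)"
      proof -
        have "open ((\<lambda>s::real. (complex_of_real y + of_real s, complex_of_real x, cvec d)) -` SY)"
          by (rule open_vimage[OF SY(1)]) (intro continuous_intros)
        then have "\<forall>\<^sub>F s in nhds (0::real). s \<in> (\<lambda>s::real. (complex_of_real y + of_real s, complex_of_real x, cvec d)) -` SY"
          by (rule eventually_nhds_in_open) (use sX in \<open>simp add: p_def\<close>)
        then show ?thesis
        proof eventually_elim
          case (elim s)
          then show ?case using Yc_eq[of "y + s" x d] by (simp add: p_def)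
        qed
      qed
      have "((\<lambda>s. X (x + s) y d) has_real_derivative Re (dd (0, (1, 0)) Xc (of_real y, p))) (at 0)"
        using dd_real(1)[OF Xc sX(1) evX] .
      then have "((\<lambda>u. X u y d) has_real_derivative Re (dd (0, (1, 0)) Xc (of_real y, p))) (at x)"
        using DERIV_shift[of "\<lambda>u. X u y d" _ 0 x] by (simp add: add.commute)
      then have 1: "deriv (\<lambda>u. X u y d) x = Re (dd (0, (1, 0)) Xc (of_real y, p))" by (rule DERIV_imp_deriv)
      have "((\<lambda>s. Y x (y + s) d) has_real_derivative Re (dd (1, 0) Yc (of_real y, p))) (at 0)"
        using dd_real(1)[OF Yc sX(2) evY] .
      then have "((\<lambda>u. Y x u d) has_real_derivative Re (dd (1, 0) Yc (of_real y, p))) (at y)"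
        using DERIV_shift[of "\<lambda>u. Y x u d" _ 0 y] by (simp add: add.commute)
      then have 2: "deriv (\<lambda>u. Y x u d) y = Re (dd (1, 0) Yc (of_real y, p))" by (rule DERIV_imp_deriv)
      have "f_fun X Y F x d = - (Re (dd (0, (1, 0)) Xc (of_real y, p)) + Re (dd (1, 0) Yc (of_real y, p)))"
        by (simp add: f_fun_def y(2) 1 2)
      then show ?case
        using dd_real(2)[OF Xc sX(1) evX] dd_real(2)[OF Yc sX(2) evY] fc1
        by (simp add: p_def complex_is_Real_iff complex_eq_iff)
    qed
  qed
  have lim_gc: "((\<lambda>x::real. gc (of_real x, cvec d) / of_real x ^ (2 * n - 1)) \<longlongrightarrow> of_real (a d)) (at_right 0)"
    if d: "d \<in> D" "dist d \<delta>0 < \<epsilon>" for d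
  proof -
    have "((\<lambda>x. g_fun Y F x d / x ^ (2 * n - 1)) \<longlongrightarrow> a d) (at 0)"
      using g[OF d(1)] n by (intro bigo_leading_term) (simp add: Suc_diff_1)
    then have "((\<lambda>x. g_fun Y F x d / x ^ (2 * n - 1)) \<longlongrightarrow> a d) (at_right 0)"
      by (rule tendsto_within_subset) simp
    from tendsto_of_real[OF this, where 'a = complex]
    show ?thesis
    proof (rule Lim_transform_eventually)
      have "\<forall>\<^sub>F x in at_right 0. gc (of_real x, cvec d) = of_real (g_fun Y F x d)"
        using gc_eq[OF d] by (auto simp: eventually_at_filter elim: eventually_mono)
      then show "\<forall>\<^sub>F x in at_right 0. complex_of_real (g_fun Y F x d / x ^ (2 * n - 1)) = gc (complex_of_real x, cvec d) / complex_of_real x ^ (2 * n - 1)"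
        by eventually_elim simp
    qed
  qed
  have lim_fc: "((\<lambda>x::real. fc (of_real x, cvec d) / of_real x ^ (n - 1)) \<longlongrightarrow> of_real (b (n - 1) d)) (at_right 0)"
    if d: "d \<in> D" "dist d \<delta>0 < \<epsilon>" for d
  proof -
    have "((\<lambda>x. f_fun X Y F x d / x ^ (n - 1)) \<longlongrightarrow> b (n - 1) d) (at 0)"
      using has_sum_leading_term[OF f[OF d(1)]] .
    then have "((\<lambda>x. f_fun X Y F x d / x ^ (n - 1)) \<longlongrightarrow> b (n - 1) d) (at_right 0)"
      by (rule tendsto_within_subset) simp
    from tendsto_of_real[OF this, where 'a = complex]
    show ?thesis
    proof (rule Lim_transform_eventually)
      have "\<forall>\<^sub>F x in at_right 0. fc (of_real x, cvec d) = of_real (f_fun X Y F x d)"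
        using fc_eq[OF d] by (auto simp: eventually_at_filter elim: eventually_mono)
      then show "\<forall>\<^sub>F x in at_right 0. complex_of_real (f_fun X Y F x d / x ^ (n - 1)) = fc (complex_of_real x, cvec d) / complex_of_real x ^ (n - 1)"
        by eventually_elim simp
    qed
  qed
  have E20: "(0, cvec d) \<in> E2" if "dist d \<delta>0 < \<epsilon>" for d using E2I[OF that, of 0] \<epsilon> by simp
  \<comment> \<open>The order of vanishing is known at parameters in \<open>D\<close> only;
    \<open>gt\<close> itself is holomorphic around \<open>\<delta>0\<close> regardless.\<close>
  have gc_pow: "gc (of_real x, cvec d) = of_real x ^ (2 * n - 1) * gt (of_real x, cvec d)"
    if d: "d \<in> D" "dist d \<delta>0 < \<epsilon>" "\<bar>x\<bar> < \<epsilon>" for d x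
    unfolding gt_def
    by (rule divx_pow_zero[OF gc_cd op(1) rad(1) E2I[OF d(2,3)]])
       (rule divx_pow_limit(2)[OF gc_cd op(1) rad(1) E20[OF d(2)] lim_gc[OF d(1,2)]])
  have fc_pow: "fc (of_real x, cvec d) = of_real x ^ (n - 1) * ft (of_real x, cvec d)"
    if d: "d \<in> D" "dist d \<delta>0 < \<epsilon>" "\<bar>x\<bar> < \<epsilon>" for d x
    unfolding ft_def
    by (rule divx_pow_zero[OF fc_cd op(1) rad(1) E2I[OF d(2,3)]])
       (rule divx_pow_limit(2)[OF fc_cd op(1) rad(1) E20[OF d(2)] lim_fc[OF d(1,2)]])
  have \<delta>0\<epsilon>: "dist \<delta>0 \<delta>0 < \<epsilon>" using \<epsilon> by simp
  have wf: "weighted_form X Y D n \<delta>0 \<epsilon> (1 + Kx + Ky) (a \<delta>0) (b (n - 1) \<delta>0) Fc gt ft U H"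
  proof (unfold_locales, goal_cases)
    case 4 show ?case using Fc2 by (simp add: E2_def Q_def)
  next
    case 5 show ?case using gt_cd by (simp add: E2_def Q_def)
  next
    case 6 show ?case using ft_cd by (simp add: E2_def Q_def)
  next
    case 7 show ?case using U_cd by (simp add: E2_def E3_def Q_def)
  next
    case 8 show ?case using H_cd by (simp add: E2_def E3_def Q_def)
  next
    case (9 x d) then show ?case using FcR E2I by blast
  next
    case (10 x d) then show ?case using gtr E2I unfolding real_on_def PQ_def by blast
  next
    case (11 x d) then show ?case using ftr E2I unfolding real_on_def PQ_def by blast
  next
    case (12 w x d) then show ?case using Ur E3I P_iff unfolding real_on_def by blast
  next
    case (13 w x d) then show ?case using Hr E3I P_iff unfolding real_on_def by blast
  next
    case 14
    have p0E: "p0 \<in> E2" using E20[OF \<delta>0\<epsilon>] by (simp add: p0_def)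
    have "((\<lambda>w. w + Xc (w, p0)) has_field_derivative 1 + 0) (at 0)"
      using dd_fst[OF Xc, of 0 p0] SX(2) dX0 by (intro DERIV_add DERIV_ident) (simp add: p0_def)
    moreover have "(\<lambda>w. A (w, p0)) = (\<lambda>w. w + Xc (w, p0))" by (simp add: A_def FX_def Fp0)
    ultimately have "dd (1, 0) A (0, p0) = 1 + 0"
      using DERIV_unique[OF dd_fst[OF A_cd E30[OF p0E]], of "1 + 0"] by simp
    then show ?case using dd_pow_divx[OF A_cd op(2) rad(2) E30[OF p0E], of 1] by (simp add: U_def p0_def)
  next
    case 15 show ?case unfolding gt_def
      by (rule divx_pow_limit(1)[OF gc_cd op(1) rad(1) E20[OF \<delta>0\<epsilon>] lim_gc[OF \<delta>0 \<delta>0\<epsilon>]])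
  next
    case 16 show ?case unfolding ft_def
      by (rule divx_pow_limit(1)[OF fc_cd op(1) rad(1) E20[OF \<delta>0\<epsilon>] lim_fc[OF \<delta>0 \<delta>0\<epsilon>]])
  next
    case (19 d)
    have p: "(0, cvec d) \<in> ball p0 \<alpha>" using E20[OF 19(2)] E2\<alpha> by blast
    have "(0, (0, cvec d)) \<in> ball 0 \<beta> \<times> ball p0 \<alpha>" using p ab' by simp
    then have "(0, (0, cvec d)) \<in> SX" using ab'(3) by blast
    then have "Xc (0, (0, cvec d)) = 0" using Xc_eq[of 0 0 d] X00[OF 19(1)] by simp
    then show ?case using Funiq[OF p, of 0] ab' by simp
  next
    case (20 d x w)
    have v: "(of_real w, of_real x, cvec d) \<in> E3" using 20 E3I by blast
    then have "A (0, of_real x, cvec d) = 0" using A0 by (simp add: E3_def)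
    then show ?case using divx_eq[OF A_cd rad(2) v] A_eq[OF v] by (simp add: U_def)
  next
    case (21 d x w)
    have v: "(of_real w, of_real x, cvec d) \<in> E3" using 21 E3I by blast
    then have "A (0, of_real x, cvec d) = 0" using A0 by (simp add: E3_def)
    then have A1: "A (of_real w, of_real x, cvec d) = of_real w * U (of_real w, of_real x, cvec d)"
      using divx_eq[OF A_cd rad(2) v] by (simp add: U_def)
    have "Bf (of_real w, of_real x, cvec d) = - gc (of_real x, cvec d) + of_real w * (- fc (of_real x, cvec d) + of_real w * H (of_real w, of_real x, cvec d))"
      using divx_eq[OF B_cd rad(2) v] divx_eq[OF B1_cd rad(2) v] by (simp add: gc_def fc_def H_def)
    moreover have "Bf (of_real w, of_real x, cvec d) = of_real (Y x (Re (Fc (of_real x, cvec d)) + w) d) -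
          dd (1, 0) Fc (of_real x, cvec d) * (of_real w * U (of_real w, of_real x, cvec d))"
      using Yc_eq'[OF v] A1 by (simp add: Bf_def dF_def)
    ultimately show ?case using gc_pow[OF 21(1-3)] fc_pow[OF 21(1-3)]
      by (simp add: algebra_simps power2_eq_square)
  next
    case (22 d u v)
    obtain x y where u: "u = (x, y)" by fastforce
    obtain x' y' where v: "v = (x', y')" by fastforce
    have in': "(complex_of_real y, complex_of_real x, cvec d) \<in> ball (0, p0) (3 * \<epsilon>)" "(complex_of_real y', complex_of_real x', cvec d) \<in> ball (0, p0) (3 * \<epsilon>)"
      using near[of "complex_of_real y" "complex_of_real x" "cvec d"] near[of "complex_of_real y'" "complex_of_real x'" "cvec d"] 22
        norm_fst_le[of x y] norm_snd_le[of y x] norm_fst_le[of x' y'] norm_snd_le[of y' x']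
      by (auto simp: u v dist_commute)
    have nn: "norm ((complex_of_real y, complex_of_real x, cvec d) - (complex_of_real y', complex_of_real x', cvec d)) = norm (u - v)"
      by (simp add: u v norm_Pair add.commute flip: of_real_diff)
    have inX: "(complex_of_real y, complex_of_real x, cvec d) \<in> ball (0, p0) \<rho>x" "(complex_of_real y', complex_of_real x', cvec d) \<in> ball (0, p0) \<rho>x"
      using in' \<epsilon>(4) by auto
    have inY: "(complex_of_real y, complex_of_real x, cvec d) \<in> ball (0, p0) \<rho>y" "(complex_of_real y', complex_of_real x', cvec d) \<in> ball (0, p0) \<rho>y"
      using in' \<epsilon>(5) by auto
    have 1: "\<bar>X x y d - X x' y' d\<bar> \<le> Kx * norm (u - v)"
    proof -
      have "norm (Xc (of_real y, of_real x, cvec d) - Xc (of_real y', of_real x', cvec d)) \<le> Kx * norm (u - v)"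
        using \<rho>x(4)[OF inX] nn by simp
      moreover have "Xc (of_real y, of_real x, cvec d) = of_real (X x y d)" "Xc (of_real y', of_real x', cvec d) = of_real (X x' y' d)"
        using inX \<rho>x(3) Xc_eq by blast+
      ultimately show ?thesis by (simp flip: of_real_diff)
    qed
    have 2: "\<bar>Y x y d - Y x' y' d\<bar> \<le> Ky * norm (u - v)"
    proof -
      have "norm (Yc (of_real y, of_real x, cvec d) - Yc (of_real y', of_real x', cvec d)) \<le> Ky * norm (u - v)"
        using \<rho>y(4)[OF inY] nn by simp
      moreover have "Yc (of_real y, of_real x, cvec d) = of_real (Y x y d)" "Yc (of_real y', of_real x', cvec d) = of_real (Y x' y' d)"
        using inY \<rho>y(3) Yc_eq by blast+
      ultimately show ?thesis by (simp flip: of_real_diff)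
    qed
    have 3: "\<bar>y - y'\<bar> \<le> norm (u - v)" using norm_snd_le[of "y - y'" "x - x'"] by (simp add: u v)
    have "norm (vfield X Y d u - vfield X Y d v) \<le> \<bar>(y + X x y d) - (y' + X x' y' d)\<bar> + \<bar>Y x y d - Y x' y' d\<bar>"
      using norm_Pair_le[of "(y + X x y d) - (y' + X x' y' d)" "Y x y d - Y x' y' d"] by (simp add: vfield_def u v)
    also have "\<dots> \<le> norm (u - v) + Kx * norm (u - v) + Ky * norm (u - v)"
      using 1 2 3 by linarith
    finally show ?case by (simp add: algebra_simps)
  qed (use n \<epsilon> \<rho>x \<rho>y a[OF \<delta>0] ab[OF \<delta>0] in auto)
  show ?thesis using that[OF wf FF] by blast
qed

section \<open>Weighted polar coordinates\<close>

lemma uniform_tube: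
  fixes f :: "real \<Rightarrow> 'a::euclidean_space \<Rightarrow> complex"
  assumes "continuous_on ({a..b} \<times> S) (\<lambda>(t, v). f t v)" "open S" "v0 \<in> S" "e > 0"
  obtains d where "d > 0" "ball v0 d \<subseteq> S" "\<And>t v. t \<in> {a..b} \<Longrightarrow> v \<in> ball v0 d \<Longrightarrow> dist (f t v) (f t v0) < e"
proof -
  obtain r where r: "r > 0" "cball v0 r \<subseteq> S" using assms open_contains_cball by blast
  have "uniformly_continuous_on ({a..b} \<times> cball v0 r) (\<lambda>(t, v). f t v)"
    using r by (intro compact_uniformly_continuous continuous_on_subset[OF assms(1)] compact_Times) auto
  then obtain d where d: "d > 0" "\<And>x y. x \<in> {a..b} \<times> cball v0 r \<Longrightarrow> y \<in> {a..b} \<times> cball v0 r \<Longrightarrow> dist y x < d \<Longrightarrow>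
      dist ((\<lambda>(t, v). f t v) y) ((\<lambda>(t, v). f t v) x) < e"
    using assms(4) unfolding uniformly_continuous_on_def by meson
  show ?thesis
  proof (rule that[of "min d r"])
    fix t v assume "t \<in> {a..b}" "v \<in> ball v0 (min d r)"
    then show "dist (f t v) (f t v0) < e"
      using d(2)[of "(t, v0)" "(t, v)"] r(1) by (simp add: dist_Pair_Pair dist_commute)
  qed (use d r in \<open>auto simp: subset_iff\<close>)
qed

context weighted_form
begin

abbreviation "E2 \<equiv> ball (0::complex) \<epsilon> \<times> ball (cvec \<delta>0) \<epsilon>"
abbreviation "E3 \<equiv> ball (0::complex) \<epsilon> \<times> E2"

text \<open>The order of components matches the arguments of \<open>U\<close> and \<open>H\<close>.
  The minus sign in \<open>w\<close> makes the angle increase with time.\<close>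

definition arg3 :: "real \<Rightarrow> complex \<times> (complex^'m) \<Rightarrow> complex \<times> complex \<times> (complex^'m)" where
  "arg3 \<phi> v = (- (fst v ^ n * of_real (sin \<phi>)), fst v * of_real (cos \<phi>), snd v)"

text \<open>The velocity of \<open>x\<close> divided by \<open>r ^ n\<close>.\<close>

definition xi :: "real \<Rightarrow> complex \<times> (complex^'m) \<Rightarrow> complex" where
  "xi \<phi> v = - (of_real (sin \<phi>) * U (arg3 \<phi> v))"

text \<open>The velocity of \<open>w\<close> divided by \<open>r ^ (2 * n - 1)\<close>. The weight
  of \<open>w\<close> is chosen so that the terms with \<open>gt\<close> and \<open>ft\<close> share
  this order, while the term with \<open>H\<close> has one more factor \<open>r\<close>.\<close>

definition eta :: "real \<Rightarrow> complex \<times> (complex^'m) \<Rightarrow> complex" where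
  "eta \<phi> v = - (of_real (cos \<phi>) ^ (2 * n - 1) * gt (snd (arg3 \<phi> v))) +
     of_real (cos \<phi>) ^ (n - 1) * of_real (sin \<phi>) * ft (snd (arg3 \<phi> v)) +
     fst v * (of_real (sin \<phi>))\<^sup>2 * H (arg3 \<phi> v)"

text \<open>The velocities of \<open>x\<close> and \<open>w\<close> are linear in those of
  \<open>r\<close> and \<open>\<phi>\<close>, with determinant \<open>\<Delta>\<close> up to powers
  of \<open>r\<close>; \<open>num\<close> and \<open>den\<close> are the numerators of Cramer's
  rule.\<close>

definition num :: "real \<Rightarrow> complex \<times> (complex^'m) \<Rightarrow> complex" where
  "num \<phi> v = of_real (cos \<phi>) * xi \<phi> v - of_real (sin \<phi>) * eta \<phi> v"

definition den :: "real \<Rightarrow> complex \<times> (complex^'m) \<Rightarrow> complex" where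
  "den \<phi> v = - (of_real (cos \<phi>) * eta \<phi> v + of_nat n * of_real (sin \<phi>) * xi \<phi> v)"

text \<open>
  In the weighted polar coordinates \<open>x = r cos \<phi>\<close>, \<open>w = - r\<^sup>n sin \<phi>\<close> one has \<open>r' = r\<^sup>n num / \<Delta>\<close> and
  \<open>\<phi>' = r\<^sup>n\<^sup>-\<^sup>1 den / \<Delta>\<close> with \<open>\<Delta> = cos\<^sup>2 \<phi> + n sin\<^sup>2 \<phi>\<close>.
\<close>
definition R :: "real \<Rightarrow> complex \<times> (complex^'m) \<Rightarrow> complex" where
  "R \<phi> v = fst v * num \<phi> v / den \<phi> v"

abbreviation "E \<equiv> ball (0::complex) (min \<epsilon> 1) \<times> ball (cvec \<delta>0) \<epsilon>"

lemma norm_rn: "norm (r ^ n * of_real (sin \<phi>)) \<le> norm r" if "norm r < 1" for r :: complex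
proof -
  have "norm r ^ n \<le> norm r ^ 1" using n that by (intro power_decreasing) auto
  moreover have "norm r ^ n * \<bar>sin \<phi>\<bar> \<le> norm r ^ n * 1" by (intro mult_left_mono) auto
  ultimately show ?thesis by (simp add: norm_mult norm_power)
qed

lemma norm_rc: "norm (r * of_real (cos \<phi>)) \<le> norm r" for r :: complex
  using mult_left_mono[of "\<bar>cos \<phi>\<bar>" 1 "norm r"] by (simp add: norm_mult)

lemma arg3_in: "v \<in> E \<Longrightarrow> arg3 \<phi> v \<in> E3" "v \<in> E \<Longrightarrow> snd (arg3 \<phi> v) \<in> E2"
  using norm_rn[of "fst v" \<phi>] norm_rc[of "fst v" \<phi>] by (auto simp: arg3_def)

lemma arg3_cont: "continuous_on (T \<times> E) (\<lambda>(\<phi>, v). arg3 \<phi> v)"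
  unfolding arg3_def split_beta by (intro continuous_intros)

lemma arg3_cd: "arg3 \<phi> cdiff_on E"
  unfolding arg3_def[abs_def] by (intro cdiff_intros)

lemma arg3_image: "(\<lambda>x. arg3 (fst x) (snd x)) ` (T \<times> E) \<subseteq> E3"
  "(\<lambda>x. snd (arg3 (fst x) (snd x))) ` (T \<times> E) \<subseteq> E2"
proof -
  have "snd x \<in> E" if "x \<in> T \<times> E" for x :: "real \<times> complex \<times> (complex^'m)"
    using that by (rule mem_Times_iff[THEN iffD1, THEN conjunct2])
  then show "(\<lambda>x. arg3 (fst x) (snd x)) ` (T \<times> E) \<subseteq> E3"
    "(\<lambda>x. snd (arg3 (fst x) (snd x))) ` (T \<times> E) \<subseteq> E2"
    by (intro image_subsetI arg3_in; blast)+
qed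

lemma arg3_cont': "continuous_on (T \<times> E) (\<lambda>x. arg3 (fst x) (snd x))"
  using arg3_cont[of T] by (simp add: split_beta)

lemmas cont_U = continuous_on_compose2[OF cdiff_on_continuous_on[OF U_cd] arg3_cont' arg3_image(1)]
  and cont_H = continuous_on_compose2[OF cdiff_on_continuous_on[OF H_cd] arg3_cont' arg3_image(1)]
  and cont_gt = continuous_on_compose2[OF cdiff_on_continuous_on[OF gt_cd] continuous_on_snd[OF arg3_cont'] arg3_image(2)]
  and cont_ft = continuous_on_compose2[OF cdiff_on_continuous_on[OF ft_cd] continuous_on_snd[OF arg3_cont'] arg3_image(2)]

lemma cont_den: "continuous_on (T \<times> E) (\<lambda>(\<phi>, v). den \<phi> v)"
  and cont_num: "continuous_on (T \<times> E) (\<lambda>(\<phi>, v). num \<phi> v)"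
  unfolding den_def num_def xi_def eta_def split_beta
  by (intro continuous_intros cont_U cont_H cont_gt cont_ft)+

lemma cd_xi: "xi \<phi> cdiff_on E"
  unfolding xi_def[abs_def]
  by (intro cdiff_on_uminus cdiff_on_mult cdiff_on_const cdiff_on_compose[OF arg3_cd U_cd] arg3_in)

lemma cd_eta: "eta \<phi> cdiff_on E"
  unfolding eta_def[abs_def]
  by (intro cdiff_on_add cdiff_on_uminus cdiff_on_mult cdiff_on_const cdiff_on_fst cdiff_on_id
       cdiff_on_compose[OF arg3_cd H_cd] cdiff_on_compose[OF cdiff_on_snd[OF arg3_cd] gt_cd]
       cdiff_on_compose[OF cdiff_on_snd[OF arg3_cd] ft_cd] arg3_in)

lemma cd_num: "num \<phi> cdiff_on E" and cd_den: "den \<phi> cdiff_on E"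
  unfolding num_def[abs_def] den_def[abs_def] by (intro cdiff_intros cd_xi cd_eta)+

lemma arg3_real: "arg3 \<phi> (of_real r, p) = (of_real (- (r ^ n * sin \<phi>)), of_real (r * cos \<phi>), p)"
  by (simp add: arg3_def)

lemma abs_rn: "\<bar>r\<bar> < 1 \<Longrightarrow> \<bar>r ^ n * sin \<phi>\<bar> \<le> \<bar>r\<bar>" for r :: real
  using norm_rn[of "of_real r" \<phi>] by (simp add: norm_mult norm_power abs_mult power_abs)

lemma abs_rc: "\<bar>r * cos \<phi>\<bar> \<le> \<bar>r\<bar>" for r :: real
  using norm_rc[of "of_real r" \<phi>] by (simp add: norm_mult abs_mult)

lemma xi_eta_real:
  assumes "\<bar>r\<bar> < min \<epsilon> 1" "dist d \<delta>0 < \<epsilon>"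
  shows "xi \<phi> (of_real r, cvec d) \<in> \<real>" "eta \<phi> (of_real r, cvec d) \<in> \<real>"
proof -
  have *: "\<bar>r * cos \<phi>\<bar> < \<epsilon>" "\<bar>- (r ^ n * sin \<phi>)\<bar> < \<epsilon>"
    using abs_rc[of r \<phi>] abs_rn[of r \<phi>] assms(1) by auto
  show "xi \<phi> (of_real r, cvec d) \<in> \<real>" "eta \<phi> (of_real r, cvec d) \<in> \<real>"
    unfolding xi_def eta_def arg3_real snd_conv fst_conv
    using U_real[OF assms(2) *] H_real[OF assms(2) *] gt_real[OF assms(2) *(1)] ft_real[OF assms(2) *(1)]
    by (auto intro!: Reals_mult Reals_add Reals_power simp del: of_real_mult of_real_minus of_real_power)
qed

lemma num_den_real:
  assumes "\<bar>r\<bar> < min \<epsilon> 1" "dist d \<delta>0 < \<epsilon>"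
  shows "num \<phi> (of_real r, cvec d) \<in> \<real>" "den \<phi> (of_real r, cvec d) \<in> \<real>"
  unfolding num_def den_def using xi_eta_real[OF assms] by (auto intro!: Reals_mult Reals_add Reals_diff)

lemma R_real:
  assumes "\<bar>r\<bar> < min \<epsilon> 1" "dist d \<delta>0 < \<epsilon>"
  shows "R \<phi> (of_real r, cvec d) \<in> \<real>"
  unfolding R_def using num_den_real[OF assms] by (auto intro!: Reals_mult Reals_divide)

text \<open>At \<open>r = 0\<close> the value is the quadratic form
  \<open>u\<^sup>2 * a0 - u * s * b0 + n * s\<^sup>2\<close> in \<open>u = cos \<phi> ^ n\<close>
  and \<open>s = sin \<phi>\<close>. The discriminant condition makes it positive definite, and
  \<open>u\<close> and \<open>s\<close> never vanish together.\<close>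

lemma den_pos0: "Re (den \<phi> (0, cvec \<delta>0)) > 0" "den \<phi> (0, cvec \<delta>0) \<in> \<real>"
proof -
  define u s where "u = cos \<phi> ^ n" and "s = sin \<phi>"
  have 1: "cos \<phi> * cos \<phi> ^ (2 * n - 1) = u\<^sup>2"
    using n by (simp add: u_def flip: power_Suc power_mult) (simp add: mult.commute)
  have 2: "cos \<phi> * cos \<phi> ^ (n - 1) = u" using n by (simp add: u_def flip: power_Suc)
  have "den \<phi> (0, cvec \<delta>0) = of_real (cos \<phi> * cos \<phi> ^ (2 * n - 1) * a0 - cos \<phi> * cos \<phi> ^ (n - 1) * sin \<phi> * b0 + n * (sin \<phi>)\<^sup>2)"
    using n by (simp add: den_def xi_def eta_def arg3_def U0 gt0 ft0 power_0_left power2_eq_square algebra_simps)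
  then have d: "den \<phi> (0, cvec \<delta>0) = of_real (u\<^sup>2 * a0 - u * s * b0 + n * s\<^sup>2)"
    unfolding 1 2 by (simp add: s_def)
  have "4 * a0 * (u\<^sup>2 * a0 - u * s * b0 + n * s\<^sup>2) = (2 * a0 * u - b0 * s)\<^sup>2 + (4 * n * a0 - b0\<^sup>2) * s\<^sup>2"
    by (simp add: power2_eq_square algebra_simps)
  moreover have "\<dots> > 0"
  proof (cases "s = 0")
    case True
    then have "u \<noteq> 0" using sin_zero_abs_cos_one[of \<phi>] by (auto simp: u_def s_def)
    then show ?thesis using True a0 by (simp add: zero_less_mult_iff)
  next
    case False
    then have "(4 * n * a0 - b0\<^sup>2) * s\<^sup>2 > 0" using b0 by simp
    then show ?thesis by (simp add: add_nonneg_pos)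
  qed
  ultimately have "4 * a0 * (u\<^sup>2 * a0 - u * s * b0 + n * s\<^sup>2) > 0" by simp
  then have "u\<^sup>2 * a0 - u * s * b0 + n * s\<^sup>2 > 0" by (rule zero_less_mult_pos) (use a0 in simp)
  then show "Re (den \<phi> (0, cvec \<delta>0)) > 0" "den \<phi> (0, cvec \<delta>0) \<in> \<real>" by (simp_all add: d)
qed

text \<open>Compactness of the angle interval spreads positivity from \<open>(0, \<delta>0)\<close>
  to a neighbourhood, complex radii and parameters included.\<close>

lemma den_lower_bound:
  obtains m \<kappa> where "m > 0" "\<kappa> > 0" "\<kappa> \<le> min \<epsilon> 1"
    "\<And>\<phi> r p. \<phi> \<in> {0..4*pi} \<Longrightarrow> norm r < \<kappa> \<Longrightarrow> dist (cvec \<delta>0) p < \<kappa> \<Longrightarrow> Re (den \<phi> (r, p)) > m"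
proof -
  have E: "open E" "(0, cvec \<delta>0) \<in> E" using \<epsilon> by (auto intro: open_Times)
  have "continuous_on {0..4*pi} (\<lambda>\<phi>. (\<lambda>(\<phi>, v). den \<phi> v) (\<phi>, (0, cvec \<delta>0)))"
    by (rule continuous_on_compose2[OF cont_den[of "{0..4*pi}"]]) (use E in \<open>auto intro!: continuous_intros\<close>)
  then have "continuous_on {0..4*pi} (\<lambda>\<phi>. Re (den \<phi> (0, cvec \<delta>0)))"
    by (intro continuous_intros) simp
  then obtain \<phi>0 where \<phi>0: "\<forall>\<phi>\<in>{0..4*pi}. Re (den \<phi>0 (0, cvec \<delta>0)) \<le> Re (den \<phi> (0, cvec \<delta>0))"
    using continuous_attains_inf[of "{0..4*pi}" "\<lambda>\<phi>. Re (den \<phi> (0, cvec \<delta>0))"] by auto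
  define m where "m = Re (den \<phi>0 (0, cvec \<delta>0)) / 2"
  have m: "m > 0" using den_pos0[of \<phi>0] by (simp add: m_def)
  obtain d where d: "d > 0" "ball (0, cvec \<delta>0) d \<subseteq> E"
    "\<And>t v. t \<in> {0..4*pi} \<Longrightarrow> v \<in> ball (0, cvec \<delta>0) d \<Longrightarrow> dist (den t v) (den t (0, cvec \<delta>0)) < m"
    using uniform_tube[OF cont_den E m] by blast
  show ?thesis
  proof (rule that[OF m, of "min (d / 2) (min \<epsilon> 1)"])
    fix \<phi> p and r :: complex assume *: "\<phi> \<in> {0..4*pi}" "norm r < min (d / 2) (min \<epsilon> 1)" "dist (cvec \<delta>0) p < min (d / 2) (min \<epsilon> 1)"
    have "dist (0, cvec \<delta>0) (r, p) \<le> norm r + dist (cvec \<delta>0) p"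
      using norm_Pair_le[of r "p - cvec \<delta>0"] by (simp add: dist_norm norm_minus_commute norm_Pair)
    then have "(r, p) \<in> ball (0, cvec \<delta>0) d" using * by simp
    from d(3)[OF *(1) this] have "norm (den \<phi> (r, p) - den \<phi> (0, cvec \<delta>0)) < m" by (simp add: dist_norm)
    then have "\<bar>Re (den \<phi> (r, p) - den \<phi> (0, cvec \<delta>0))\<bar> < m"
      using abs_Re_le_cmod le_less_trans by blast
    moreover have "2 * m \<le> Re (den \<phi> (0, cvec \<delta>0))" using \<phi>0 *(1) by (simp add: m_def)
    ultimately show "Re (den \<phi> (r, p)) > m" by simp
  qed (use d \<epsilon> in auto)
qed

lemma R_periodic: "R (\<phi> + 2 * pi) v = R \<phi> v"
  by (simp add: R_def num_def den_def xi_def eta_def arg3_def)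

text \<open>For odd \<open>n\<close> the pairs \<open>(r, \<phi>)\<close> and
  \<open>(- r, \<phi> + pi)\<close> name the same point, hence have the same
  \<open>arg3\<close>.\<close>

lemma R_odd:
  assumes "odd n"
  shows "R (\<phi> + pi) (- r, p) = - R \<phi> (r, p)"
proof -
  have o: "odd (2 * n - 1)" "even (n - 1)" using n assms by auto
  have a: "arg3 (\<phi> + pi) (- r, p) = arg3 \<phi> (r, p)"
    using assms by (simp add: arg3_def)
  have x: "xi (\<phi> + pi) (- r, p) = - xi \<phi> (r, p)" by (simp add: xi_def a)
  have e: "eta (\<phi> + pi) (- r, p) = - eta \<phi> (r, p)"
    using o by (simp add: eta_def a)
  show ?thesis by (simp add: R_def num_def den_def x e)
qed

text \<open>For even \<open>n\<close> the same point is named by \<open>(- r, pi - \<phi>)\<close>.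
  The extra \<open>2 * pi\<close> keeps the reflected angles of \<open>{0..2*pi}\<close> inside
  \<open>{0..4*pi}\<close>.\<close>

lemma R_even:
  assumes "even n"
  shows "R (3 * pi - \<phi>) (- r, p) = R \<phi> (r, p)"
proof -
  have o: "odd (2 * n - 1)" "odd (n - 1)" using n assms by auto
  have 3: "3 * pi - \<phi> = (pi - \<phi>) + 2 * pi" by simp
  have sc: "sin (3 * pi - \<phi>) = sin \<phi>" "cos (3 * pi - \<phi>) = - cos \<phi>" by (simp_all only: 3 sin_periodic cos_periodic sin_pi_minus cos_pi_minus)
  have a: "arg3 (3 * pi - \<phi>) (- r, p) = arg3 \<phi> (r, p)"
    using assms by (simp add: arg3_def sc)
  have x: "xi (3 * pi - \<phi>) (- r, p) = xi \<phi> (r, p)" by (simp add: xi_def a sc)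
  have e: "eta (3 * pi - \<phi>) (- r, p) = - eta \<phi> (r, p)"
    using o by (simp add: eta_def a sc)
  have N: "num (3 * pi - \<phi>) (- r, p) = - num \<phi> (r, p)" by (simp add: num_def x e sc)
  have D: "den (3 * pi - \<phi>) (- r, p) = den \<phi> (r, p)" by (simp add: den_def x e sc)
  show ?thesis by (simp add: R_def N D)
qed

end

text \<open>\<open>\<kappa>\<close> bounds the radii where the polar equation is controlled,
  \<open>\<kappa>'\<close> the initial radii whose solutions stay there, and \<open>M\<close> their
  growth. Angles run beyond \<open>2 * pi\<close> because the reflections compare a first turn with
  solutions up to angle \<open>3 * pi\<close>.\<close>

locale polar_flow = weighted_form X Y D n \<delta>0 \<epsilon> K a0 b0 Fc gt ft U H
  for X Y :: "real \<Rightarrow> real \<Rightarrow> real^'m \<Rightarrow> real" and D :: "(real^'m) set" and n :: nat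
    and \<delta>0 :: "real^'m" and \<epsilon> K a0 b0 :: real
    and Fc gt ft :: "complex \<times> (complex^'m) \<Rightarrow> complex"
    and U H :: "complex \<times> complex \<times> (complex^'m) \<Rightarrow> complex" +
  fixes \<kappa> \<kappa>' M KR :: real and \<rho> :: "real \<Rightarrow> complex \<times> (complex^'m) \<Rightarrow> complex"
  assumes \<kappa>: "\<kappa> > 0" "\<kappa> \<le> min \<epsilon> 1" and \<kappa>': "\<kappa>' > 0" "\<kappa>' \<le> \<kappa>" and M: "M \<ge> 1"
    and den_pos: "\<And>\<phi> r d. \<phi> \<in> {0..4*pi} \<Longrightarrow> \<bar>r\<bar> < \<kappa> \<Longrightarrow> dist d \<delta>0 < \<kappa> \<Longrightarrow> Re (den \<phi> (of_real r, cvec d)) > 0"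
    and R_lip: "\<And>\<phi> r s d. \<phi> \<in> {0..4*pi} \<Longrightarrow> \<bar>r\<bar> < \<kappa> \<Longrightarrow> \<bar>s\<bar> < \<kappa> \<Longrightarrow> dist d \<delta>0 < \<kappa> \<Longrightarrow>
        norm (R \<phi> (of_real r, cvec d) - R \<phi> (of_real s, cvec d)) \<le> KR * \<bar>r - s\<bar>"
    and \<rho>_cd: "\<And>\<phi>. \<phi> \<in> {0..4*pi} \<Longrightarrow> \<rho> \<phi> cdiff_on ball 0 \<kappa>' \<times> ball (cvec \<delta>0) \<kappa>"
    and \<rho>_bound: "\<And>\<phi> v. \<phi> \<in> {0..4*pi} \<Longrightarrow> v \<in> ball 0 \<kappa>' \<times> ball (cvec \<delta>0) \<kappa> \<Longrightarrow> norm (\<rho> \<phi> v) \<le> M * norm (fst v)"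
    and \<rho>_less: "\<And>\<phi> v. \<phi> \<in> {0..4*pi} \<Longrightarrow> v \<in> ball 0 \<kappa>' \<times> ball (cvec \<delta>0) \<kappa> \<Longrightarrow> norm (\<rho> \<phi> v) < \<kappa>"
    and \<rho>_0: "\<And>v. v \<in> ball 0 \<kappa>' \<times> ball (cvec \<delta>0) \<kappa> \<Longrightarrow> \<rho> 0 v = fst v"
    and \<rho>_deriv: "\<And>\<phi> v. \<phi> \<in> {0..4*pi} \<Longrightarrow> v \<in> ball 0 \<kappa>' \<times> ball (cvec \<delta>0) \<kappa> \<Longrightarrow>
       ((\<lambda>\<phi>. \<rho> \<phi> v) has_vector_derivative R \<phi> (\<rho> \<phi> v, snd v)) (at \<phi> within {0..4*pi})"
    and \<rho>_real: "\<And>\<phi> r d. \<phi> \<in> {0..4*pi} \<Longrightarrow> \<bar>r\<bar> < \<kappa>' \<Longrightarrow> dist d \<delta>0 < \<kappa> \<Longrightarrow> \<rho> \<phi> (of_real r, cvec d) \<in> \<real>"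

lemma (in weighted_form) polar_flow_exists:
  obtains \<kappa> \<kappa>' M KR \<rho> where "polar_flow X Y D n \<delta>0 \<epsilon> K a0 b0 Fc gt ft U H \<kappa> \<kappa>' M KR \<rho>"
proof -
  obtain m \<kappa>1 where m: "m > 0" and \<kappa>1: "\<kappa>1 > 0" "\<kappa>1 \<le> min \<epsilon> 1"
    and den: "\<And>\<phi> r p. \<phi> \<in> {0..4*pi} \<Longrightarrow> norm r < \<kappa>1 \<Longrightarrow> dist (cvec \<delta>0) p < \<kappa>1 \<Longrightarrow> Re (den \<phi> (r, p)) > m"
    using den_lower_bound by blast
  \<comment> \<open>A quarter leaves room in \<open>S\<close> for closed balls of radius
    \<open>\<kappa>\<close> around all points of the small domain; the Cauchy bound
    \<open>B / \<kappa>\<close> needs them.\<close>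
  define \<kappa> where "\<kappa> = \<kappa>1 / 4"
  have \<kappa>: "\<kappa> > 0" "\<kappa> \<le> min \<epsilon> 1" using \<kappa>1 by (auto simp: \<kappa>_def)
  define S where "S = ball (0::complex) \<kappa>1 \<times> ball (cvec \<delta>0) \<kappa>1"
  have SE: "S \<subseteq> E" using \<kappa>1 by (auto simp: S_def)
  have S: "open S" unfolding S_def by (intro open_Times open_ball)
  have dn: "den \<phi> v \<noteq> 0" if "\<phi> \<in> {0..4*pi}" "v \<in> S" for \<phi> v
    using den[OF that(1), of "fst v" "snd v"] that(2) m by (auto simp: S_def)
  have Rcd: "R \<phi> cdiff_on S" if "\<phi> \<in> {0..4*pi}" for \<phi>
    unfolding R_def[abs_def]
    by (intro cdiff_on_divide cdiff_on_mult cdiff_on_fst cdiff_on_id dn that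
        cdiff_on_subset[OF cd_num SE] cdiff_on_subset[OF cd_den SE])
  have Rcont: "continuous_on ({0..4*pi} \<times> S) (\<lambda>(\<phi>, v). R \<phi> v)"
  proof -
    have "continuous_on ({0..4*pi} \<times> S) (\<lambda>(\<phi>, v). num \<phi> v)" "continuous_on ({0..4*pi} \<times> S) (\<lambda>(\<phi>, v). den \<phi> v)"
      using SE by (auto intro!: continuous_on_subset[OF cont_num[of "{0..4*pi}"]] continuous_on_subset[OF cont_den[of "{0..4*pi}"]])
    then show ?thesis unfolding R_def split_beta by (intro continuous_intros) (use dn in auto)
  qed
  define C where "C = cball (0::complex) (2 * \<kappa>) \<times> cball (cvec \<delta>0) (2 * \<kappa>)"
  have CS: "C \<subseteq> S" using \<kappa>1 by (auto simp: C_def S_def \<kappa>_def)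
  have "compact ((\<lambda>(\<phi>, v). R \<phi> v) ` ({0..4*pi} \<times> C))"
    by (intro compact_continuous_image continuous_on_subset[OF Rcont] compact_Times)
       (use CS in \<open>auto simp: C_def intro!: compact_Times\<close>)
  then obtain B where B: "B > 0" "\<And>x. x \<in> (\<lambda>(\<phi>, v). R \<phi> v) ` ({0..4*pi} \<times> C) \<Longrightarrow> norm x \<le> B"
    using compact_imp_bounded bounded_pos by metis
  have RB: "norm (R \<phi> v) \<le> B" if "\<phi> \<in> {0..4*pi}" "v \<in> C" for \<phi> v
    using B(2)[of "R \<phi> v"] that by force
  define KR where "KR = B / \<kappa>"
  have KR: "KR > 0" using B \<kappa> by (simp add: KR_def)
  have sub: "ball 0 \<kappa> \<times> ball (cvec \<delta>0) \<kappa> \<subseteq> S" using \<kappa>1 by (auto simp: S_def \<kappa>_def)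
  have lip: "norm (R \<phi> (r, p) - R \<phi> (s, p)) \<le> KR * norm (r - s)"
    if "\<phi> \<in> {0..4*pi}" "p \<in> ball (cvec \<delta>0) \<kappa>" "norm r < \<kappa>" "norm s < \<kappa>" for \<phi> p r s
  proof (rule field_differentiable_bound[where S = "ball 0 \<kappa>" and f' = "\<lambda>w. dd (1, 0) (R \<phi>) (w, p)"])
    fix z :: complex assume z: "z \<in> ball 0 \<kappa>"
    then have zS: "(z, p) \<in> S" using sub that by auto
    show "((\<lambda>w. R \<phi> (w, p)) has_field_derivative dd (1, 0) (R \<phi>) (z, p)) (at z within ball 0 \<kappa>)"
      using dd_fst[OF Rcd[OF that(1)] zS] has_field_derivative_at_within by blast
    have cC: "cball (z, p) \<kappa> \<subseteq> C"
    proof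
      fix v assume v: "v \<in> cball (z, p) \<kappa>"
      have "dist z (fst v) \<le> \<kappa>" "dist p (snd v) \<le> \<kappa>"
        using v dist_fst_le[of "(z, p)" v] dist_snd_le[of "(z, p)" v] by auto
      moreover have "dist 0 z < \<kappa>" "dist (cvec \<delta>0) p < \<kappa>" using z that by auto
      ultimately have "dist 0 (fst v) \<le> 2 * \<kappa>" "dist (cvec \<delta>0) (snd v) \<le> 2 * \<kappa>"
        using dist_triangle[of 0 "fst v" z] dist_triangle[of "cvec \<delta>0" "snd v" p] by linarith+
      then show "v \<in> C" unfolding C_def by (simp add: mem_Times_iff)
    qed
    have "norm (dd (1, 0) (R \<phi>) (z, p)) \<le> B / \<kappa> * norm (1 :: complex, 0 :: complex^'m)"
      by (rule dd_bound[OF Rcd[OF that(1)]]) (use cC CS \<kappa> RB[OF that(1)] in auto)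
    then show "norm (dd (1, 0) (R \<phi>) (z, p)) \<le> KR" by (simp add: KR_def norm_Pair)
  qed (use that in auto)
  define P where "P = range (cvec :: real^'m \<Rightarrow> complex^'m)"
  \<comment> \<open>The exponential is the reciprocal of the growth factor \<open>M\<close> below,
    so \<open>M * \<kappa>' = \<kappa>\<close> and solutions cannot leave the domain.\<close>
  define \<kappa>' where "\<kappa>' = \<kappa> * exp (- (KR * (4 * pi)))"
  have \<kappa>': "\<kappa>' > 0" "\<kappa>' \<le> \<kappa>" using \<kappa> KR by (simp_all add: \<kappa>'_def mult_le_cancel_left1)
  have Rreal: "real_on (ball 0 \<kappa> \<times> ball (cvec \<delta>0) \<kappa>) P (R \<phi>)" for \<phi>
    unfolding real_on_def P_def using \<kappa>(2) by (auto intro!: R_real simp: dist_commute)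
  have Rz: "R \<phi> (0, p) = 0" for \<phi> p by (simp add: R_def)
  have Rcont': "continuous_on ({0..4*pi} \<times> (ball 0 \<kappa> \<times> ball (cvec \<delta>0) \<kappa>)) (\<lambda>(\<phi>, v). R \<phi> v)"
    by (rule continuous_on_subset[OF Rcont]) (use sub in blast)
  obtain \<rho> where \<rho>: "\<And>\<phi>. \<phi> \<in> {0..4*pi} \<Longrightarrow> \<rho> \<phi> cdiff_on ball 0 \<kappa>' \<times> ball (cvec \<delta>0) \<kappa>"
    "\<And>\<phi> v. \<phi> \<in> {0..4*pi} \<Longrightarrow> v \<in> ball 0 \<kappa>' \<times> ball (cvec \<delta>0) \<kappa> \<Longrightarrow> norm (\<rho> \<phi> v) \<le> norm (fst v) * exp (KR * \<phi>)"
    "\<And>v. v \<in> ball 0 \<kappa>' \<times> ball (cvec \<delta>0) \<kappa> \<Longrightarrow> \<rho> 0 v = fst v"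
    "\<And>\<phi> v. \<phi> \<in> {0..4*pi} \<Longrightarrow> v \<in> ball 0 \<kappa>' \<times> ball (cvec \<delta>0) \<kappa> \<Longrightarrow>
       ((\<lambda>\<phi>. \<rho> \<phi> v) has_vector_derivative R \<phi> (\<rho> \<phi> v, snd v)) (at \<phi> within {0..4*pi})"
    "\<And>\<phi>. \<phi> \<in> {0..4*pi} \<Longrightarrow> real_on (ball 0 \<kappa>' \<times> ball (cvec \<delta>0) \<kappa>) P (\<rho> \<phi>)"
    by (rule cdiff_ode_flow[of "4*pi" KR \<kappa> "ball (cvec \<delta>0) \<kappa>" R P, folded \<kappa>'_def])
       (use KR \<kappa> lip Rreal Rz Rcont' cdiff_on_subset[OF Rcd sub] in auto)
  define M where "M = exp (KR * (4 * pi))"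
  have M: "M \<ge> 1" using KR by (simp add: M_def)
  have b: "norm (\<rho> \<phi> v) \<le> M * norm (fst v)" if "\<phi> \<in> {0..4*pi}" "v \<in> ball 0 \<kappa>' \<times> ball (cvec \<delta>0) \<kappa>" for \<phi> v
  proof -
    have "norm (\<rho> \<phi> v) \<le> norm (fst v) * exp (KR * \<phi>)" by (rule \<rho>(2)[OF that])
    also have "\<dots> \<le> norm (fst v) * M" unfolding M_def using that KR by (intro mult_left_mono) auto
    finally show ?thesis by (simp add: mult.commute)
  qed
  have l: "norm (\<rho> \<phi> v) < \<kappa>" if "\<phi> \<in> {0..4*pi}" "v \<in> ball 0 \<kappa>' \<times> ball (cvec \<delta>0) \<kappa>" for \<phi> v
  proof -
    have "M * norm (fst v) < M * \<kappa>'" using that M by (auto simp: mem_Times_iff)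
    also have "M * \<kappa>' = \<kappa>" by (simp add: M_def \<kappa>'_def mult.left_commute flip: exp_add)
    finally show ?thesis using b[OF that] by simp
  qed
  have "polar_flow X Y D n \<delta>0 \<epsilon> K a0 b0 Fc gt ft U H \<kappa> \<kappa>' M KR \<rho>"
  proof (unfold_locales, goal_cases)
    case (6 \<phi> r d)
    have "Re (den \<phi> (of_real r, cvec d)) > m" by (rule den) (use 6 \<kappa>1 in \<open>auto simp: \<kappa>_def dist_commute\<close>)
    then show ?case using m by simp
  next
    case (7 \<phi> r s d)
    then show ?case using lip[of \<phi> "cvec d" "of_real r" "of_real s"] by (simp add: dist_commute flip: of_real_diff)
  next
    case (13 \<phi> r d)
    then show ?case using \<rho>(5)[of \<phi>] unfolding real_on_def P_def by (simp add: dist_commute)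
  qed (use \<kappa> \<kappa>' M \<rho> b l in auto)
  then show ?thesis using that by blast
qed

section \<open>The return map of the polar equation\<close>

text \<open>The passage from angle to time: \<open>T\<close> integrates the density \<open>q\<close>
  of time per angle, and along its inverse \<open>\<theta>\<close> the curve \<open>z\<close> solves
  the autonomous equation.\<close>

lemma time_change:
  fixes z :: "real \<Rightarrow> 'a::real_normed_vector" and q :: "real \<Rightarrow> real"
  assumes b: "b > 0" and q: "continuous_on {0..b} q" "\<And>s. s \<in> {0..b} \<Longrightarrow> q s > 0"
    and z: "\<And>s. s \<in> {0..b} \<Longrightarrow> (z has_vector_derivative q s *\<^sub>R f (z s)) (at s within {0..b})"
  obtains \<tau> \<theta> where "\<tau> > 0" "\<theta> 0 = 0" "\<theta> \<tau> = b" "\<And>t. t \<in> {0..\<tau>} \<Longrightarrow> \<theta> t \<in> {0..b}"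
    "\<And>t. 0 < t \<Longrightarrow> t < \<tau> \<Longrightarrow> 0 < \<theta> t \<and> \<theta> t < b" "\<theta> ` {0..\<tau>} = {0..b}"
    "\<And>t. t \<in> {0..\<tau>} \<Longrightarrow> ((\<lambda>t. z (\<theta> t)) has_vector_derivative f (z (\<theta> t))) (at t within {0..\<tau>})"
proof -
  \<comment> \<open>Constant continuation of \<open>q\<close> beyond the interval gives the inverse
    of \<open>T\<close> two-sided derivatives at both end points.\<close>
  define qh where "qh s = q (max 0 (min b s))" for s
  have cl: "max 0 (min b s) \<in> {0..b}" for s using b by auto
  have qc: "continuous_on A qh" for A
    unfolding qh_def by (rule continuous_on_compose2[OF q(1)]) (use cl in \<open>auto intro!: continuous_intros\<close>)
  have qpos: "qh s > 0" for s unfolding qh_def by (rule q(2)[OF cl])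
  define T where "T s = integral {-1..s} qh - integral {-1..0} qh" for s
  have dT: "(T has_real_derivative qh s) (at s)" if "-1 < s" "s < b + 1" for s
  proof -
    have "((\<lambda>s. integral {-1..s} qh) has_real_derivative qh s) (at s within {-1..b+1})"
      by (rule integral_has_real_derivative[OF qc]) (use that in auto)
    moreover have "at s within {-1..b+1} = at s" by (rule at_within_interior) (use that in auto)
    ultimately show ?thesis unfolding T_def by (auto intro!: derivative_eq_intros)
  qed
  have mono: "T s < T t" if "-1 < s" "s < t" "t < b + 1" for s t
  proof (rule DERIV_pos_imp_increasing[OF that(2)])
    fix x assume "s \<le> x" "x \<le> t"
    then show "\<exists>y. (T has_real_derivative y) (at x) \<and> 0 < y" using dT[of x] qpos that by auto
  qed
  define lo hi where "lo = (-1/2 :: real)" and "hi = b + 1/2"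
  have lohi: "-1 < lo" "lo < 0" "b < hi" "hi < b + 1" using b by (auto simp: lo_def hi_def)
  have inj: "inj_on T {lo..hi}"
  proof (rule linorder_inj_onI)
    fix x y assume "x < y" "x \<in> {lo..hi}" "y \<in> {lo..hi}"
    then have "T x < T y" using lohi by (intro mono) auto
    then show "T x \<noteq> T y" by simp
  qed auto
  define \<theta> where "\<theta> = the_inv_into {lo..hi} T"
  have \<theta>T: "\<theta> (T s) = s" if "s \<in> {lo..hi}" for s
    unfolding \<theta>_def by (rule the_inv_into_f_f[OF inj that])
  have contT: "continuous_on {lo..hi} T"
    using lohi by (intro continuous_at_imp_continuous_on ballI DERIV_isCont[OF dT]) auto
  have surj: "\<exists>s\<in>{lo..hi}. T s = y" if "T lo \<le> y" "y \<le> T hi" for y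
  proof -
    have "\<exists>s. lo \<le> s \<and> s \<le> hi \<and> T s = y"
      by (rule IVT') (use that lohi b contT in auto)
    then show ?thesis by auto
  qed
  have T\<theta>: "T (\<theta> y) = y" "\<theta> y \<in> {lo..hi}" if "T lo \<le> y" "y \<le> T hi" for y
    using surj[OF that] \<theta>T by auto
  have T0: "T 0 = 0" by (simp add: T_def)
  define \<tau> where "\<tau> = T b"
  have \<tau>: "\<tau> > 0" using mono[of 0 b] b T0 by (simp add: \<tau>_def)
  have lt: "T lo < 0" "\<tau> < T hi" using mono[of lo 0] mono[of b hi] lohi b T0 by (simp_all add: \<tau>_def)
  have d\<theta>: "(\<theta> has_real_derivative inverse (qh (\<theta> t))) (at t)" if t: "t \<in> {0..\<tau>}" for t
  proof (rule DERIV_inverse_function[of T _ _ _ "T lo" "T hi"])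
    have t': "T lo < t" "t < T hi" using t lt by auto
    then have \<theta>in: "lo \<le> \<theta> t" "\<theta> t \<le> hi" using T\<theta>[of t] by auto
    have ne: "\<theta> t \<noteq> lo" "\<theta> t \<noteq> hi" using T\<theta>(1)[of t] t' by auto
    show "(T has_real_derivative qh (\<theta> t)) (at (\<theta> t))" using dT \<theta>in lohi by auto
    show "qh (\<theta> t) \<noteq> 0" using qpos[of "\<theta> t"] by simp
    show "T lo < t" "t < T hi" by fact+
    show "T (\<theta> y) = y" if "T lo < y" "y < T hi" for y using T\<theta> that by auto
    define e where "e = min (\<theta> t - lo) (hi - \<theta> t)"
    have e: "e > 0" using \<theta>in ne by (auto simp: e_def)
    have "isCont \<theta> (T (\<theta> t))"
    proof (rule isCont_inverse_function[where f = T and x = "\<theta> t", OF e])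
      fix s assume "\<bar>s - \<theta> t\<bar> \<le> e"
      then have s: "s \<in> {lo..hi}" by (auto simp: e_def)
      then show "\<theta> (T s) = s" by (rule \<theta>T)
      show "isCont T s" using dT[of s] s lohi by (auto intro!: DERIV_isCont)
    qed
    then show "isCont \<theta> t" using T\<theta>(1)[of t] t' by simp
  qed
  have Tle: "T s \<le> T t \<longleftrightarrow> s \<le> t" if "s \<in> {lo..hi}" "t \<in> {lo..hi}" for s t
    using mono[of s t] mono[of t s] that lohi by (cases s t rule: linorder_cases) auto
  have in0b: "\<theta> t \<in> {0..b}" if t: "t \<in> {0..\<tau>}" for t
    using Tle[of 0 "\<theta> t"] Tle[of "\<theta> t" b] T\<theta>[of t] t lt lohi b T0 by (auto simp: \<tau>_def)
  have \<theta>0: "\<theta> 0 = 0" "\<theta> \<tau> = b" using \<theta>T[of 0] \<theta>T[of b] lohi b by (auto simp: T0 \<tau>_def)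
  show ?thesis
  proof (rule that[OF \<tau> \<theta>0 in0b])
    show "0 < \<theta> t \<and> \<theta> t < b" if "0 < t" "t < \<tau>" for t
    proof -
      have "\<theta> t \<noteq> 0" "\<theta> t \<noteq> b" using T\<theta>(1)[of t] that lt T0 by (auto simp: \<tau>_def)
      then show ?thesis using in0b[of t] that by auto
    qed
    show "\<theta> ` {0..\<tau>} = {0..b}"
    proof (intro equalityI subsetI)
      fix s assume s: "s \<in> {0..b}"
      then have "T s \<in> {0..\<tau>}" using Tle[of 0 s] Tle[of s b] lohi b T0 by (auto simp: \<tau>_def)
      moreover have "\<theta> (T s) = s" using \<theta>T[of s] s lohi by auto
      ultimately show "s \<in> \<theta> ` {0..\<tau>}" by force
    qed (use in0b in auto)
    fix t assume t: "t \<in> {0..\<tau>}"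
    have 1: "(\<theta> has_vector_derivative inverse (qh (\<theta> t))) (at t within {0..\<tau>})"
      using d\<theta>[OF t] by (simp add: has_real_derivative_iff_has_vector_derivative has_vector_derivative_at_within)
    have 2: "(z has_vector_derivative q (\<theta> t) *\<^sub>R f (z (\<theta> t))) (at (\<theta> t) within \<theta> ` {0..\<tau>})"
      by (rule has_vector_derivative_within_subset[OF z[OF in0b[OF t]]]) (use in0b in auto)
    have "max 0 (min b (\<theta> t)) = \<theta> t" using in0b[OF t] by auto
    then have "inverse (qh (\<theta> t)) * q (\<theta> t) = 1" using q(2)[OF in0b[OF t]] by (simp add: qh_def)
    then show "((\<lambda>t. z (\<theta> t)) has_vector_derivative f (z (\<theta> t))) (at t within {0..\<tau>})"
      using vector_diff_chain_within[OF 1 2] by (simp add: o_def)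
  qed
qed

lemma has_vector_derivative_Un:
  assumes "(f has_vector_derivative D) (at t within A)" "(f has_vector_derivative D) (at t within B)"
  shows "(f has_vector_derivative D) (at t within A \<union> B)"
  using assms unfolding has_vector_derivative_def has_derivative_within
  by (auto simp: at_within_union intro: filterlim_sup)

text \<open>At multiples of \<open>\<tau>\<close> the one-sided derivatives agree, because the field
  is autonomous and the two end values coincide.\<close>

lemma periodic_extension:
  fixes z :: "real \<Rightarrow> 'a::real_normed_vector"
  assumes \<tau>: "\<tau> > 0" and z: "\<And>t. t \<in> {0..\<tau>} \<Longrightarrow> (z has_vector_derivative f (z t)) (at t within {0..\<tau>})"
    and eq: "z 0 = z \<tau>"
  obtains zz where "\<And>t. (zz has_vector_derivative f (zz t)) (at t)" "\<And>t. zz (t + \<tau>) = zz t"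
    "\<And>t. t \<in> {0..\<tau>} \<Longrightarrow> zz t = z t" "range zz = z ` {0..\<tau>}"
proof -
  define zz where "zz t = z (t - \<tau> * of_int \<lfloor>t / \<tau>\<rfloor>)" for t
  have piece: "zz t = z (t - \<tau> * of_int k)" if "t \<in> {\<tau> * of_int k..\<tau> * of_int (k + 1)}" for t k
  proof (cases "t = \<tau> * of_int (k + 1)")
    case True
    then have "\<lfloor>t / \<tau>\<rfloor> = k + 1" using \<tau> by simp
    then show ?thesis using True eq by (simp add: zz_def algebra_simps)
  next
    case False
    then have "of_int k \<le> t / \<tau>" "t / \<tau> < of_int k + 1" using that \<tau> by (auto simp: field_simps)
    then have "\<lfloor>t / \<tau>\<rfloor> = k" by linarith
    then show ?thesis by (simp add: zz_def)
  qed
  have dpiece: "(zz has_vector_derivative f (zz t)) (at t within {\<tau> * of_int k..\<tau> * of_int (k + 1)})"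
    if t: "t \<in> {\<tau> * of_int k..\<tau> * of_int (k + 1)}" for t k
  proof -
    let ?A = "{\<tau> * of_int k..\<tau> * of_int (k + 1)}"
    have in0: "s - \<tau> * of_int k \<in> {0..\<tau>}" if "s \<in> ?A" for s using that by (auto simp: algebra_simps)
    have 1: "((\<lambda>s. s - \<tau> * of_int k) has_vector_derivative 1) (at t within ?A)"
      by (auto intro!: derivative_eq_intros)
    have 2: "(z has_vector_derivative f (z (t - \<tau> * of_int k))) (at (t - \<tau> * of_int k) within (\<lambda>s. s - \<tau> * of_int k) ` ?A)"
      by (rule has_vector_derivative_within_subset[OF z[OF in0[OF t]]]) (use in0 in auto)
    have "((\<lambda>s. z (s - \<tau> * of_int k)) has_vector_derivative f (z (t - \<tau> * of_int k))) (at t within ?A)"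
      using vector_diff_chain_within[OF 1 2] by (simp add: o_def)
    from has_vector_derivative_transform[OF t _ this, of zz] piece
    have "(zz has_vector_derivative f (z (t - \<tau> * of_int k))) (at t within ?A)" by blast
    then show ?thesis using piece[OF t] by simp
  qed
  have dzz: "(zz has_vector_derivative f (zz t)) (at t)" for t
  proof -
    define k where "k = \<lfloor>t / \<tau>\<rfloor>"
    have "of_int k \<le> t / \<tau>" "t / \<tau> < of_int k + 1" unfolding k_def by linarith+
    then have k: "\<tau> * of_int k \<le> t" "t < \<tau> * of_int (k + 1)" using \<tau> by (auto simp: field_simps)
    show ?thesis
    proof (cases "t = \<tau> * of_int k")
      case True
      have "t \<in> {\<tau> * of_int (k - 1)..\<tau> * of_int (k - 1 + 1)}" "t \<in> {\<tau> * of_int k..\<tau> * of_int (k + 1)}"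
        using True k \<tau> by (auto simp: algebra_simps)
      from has_vector_derivative_Un[OF dpiece[OF this(1)] dpiece[OF this(2)]]
      have "(zz has_vector_derivative f (zz t)) (at t within {\<tau> * of_int (k - 1)..\<tau> * of_int (k + 1)})"
      proof -
        have "{\<tau> * of_int (k - 1)..\<tau> * of_int (k - 1 + 1)} \<union> {\<tau> * of_int k..\<tau> * of_int (k + 1)} =
            {\<tau> * of_int (k - 1)..\<tau> * of_int (k + 1)}"
          using \<tau> by (auto simp: algebra_simps)
        then show ?thesis using \<open>(zz has_vector_derivative f (zz t)) (at t within _ \<union> _)\<close> by simp
      qed
      moreover have "at t within {\<tau> * of_int (k - 1)..\<tau> * of_int (k + 1)} = at t"
        by (rule at_within_interior) (use True k \<tau> in \<open>auto simp: algebra_simps\<close>)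
      ultimately show ?thesis by simp
    next
      case False
      then have "at t within {\<tau> * of_int k..\<tau> * of_int (k + 1)} = at t"
        using k by (intro at_within_interior) auto
      then show ?thesis using dpiece[of t k] k by simp
    qed
  qed
  have per: "zz (t + \<tau>) = zz t" for t
  proof -
    have "(t + \<tau>) / \<tau> = t / \<tau> + 1" using \<tau> by (simp add: field_simps)
    then have "\<lfloor>(t + \<tau>) / \<tau>\<rfloor> = \<lfloor>t / \<tau>\<rfloor> + 1" by simp
    then show ?thesis by (simp add: zz_def algebra_simps)
  qed
  have zz0: "zz t = z t" if "t \<in> {0..\<tau>}" for t using piece[of t 0] that by simp
  have "range zz = z ` {0..\<tau>}"
  proof (intro equalityI subsetI)
    fix p assume "p \<in> range zz"
    then obtain t where t: "p = zz t" by blast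
    have "of_int \<lfloor>t / \<tau>\<rfloor> * \<tau> \<le> t / \<tau> * \<tau>" "t / \<tau> * \<tau> < (of_int \<lfloor>t / \<tau>\<rfloor> + 1) * \<tau>"
      using \<tau> by (intro mult_right_mono mult_strict_right_mono; linarith)+
    then have "\<tau> * of_int \<lfloor>t / \<tau>\<rfloor> \<le> t" "t < \<tau> * (of_int \<lfloor>t / \<tau>\<rfloor> + 1)"
      using \<tau> by (simp_all add: mult.commute)
    then have "t - \<tau> * of_int \<lfloor>t / \<tau>\<rfloor> \<in> {0..\<tau>}" by (simp add: algebra_simps)
    then show "p \<in> z ` {0..\<tau>}" using t by (auto simp: zz_def)
  next
    fix p assume "p \<in> z ` {0..\<tau>}"
    then obtain t where "t \<in> {0..\<tau>}" "p = zz t" using zz0 by (metis imageE)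
    then show "p \<in> range zz" by blast
  qed
  then show ?thesis using that dzz per zz0 by blast
qed

lemma DERIV_chain_image:
  fixes f g :: "real \<Rightarrow> real"
  assumes "(g has_real_derivative Db) (at x within s)" "(f has_real_derivative Da) (at (g x) within g ` s)"
  shows "((\<lambda>x. f (g x)) has_real_derivative Da * Db) (at x within s)"
  using DERIV_image_chain[OF assms(2,1)] by (simp add: o_def)

lemma solution_on_vfield:
  "solution_on X Y d I x y \<longleftrightarrow>
    (\<forall>t\<in>I. ((\<lambda>t. (x t, y t)) has_vector_derivative vfield X Y d (x t, y t)) (at t within I))"
proof -
  have "((\<lambda>t. (x t, y t)) has_vector_derivative (a, b)) (at t within I) \<longleftrightarrow>
     (x has_real_derivative a) (at t within I) \<and> (y has_real_derivative b) (at t within I)" for a b t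
  proof
    assume *: "((\<lambda>t. (x t, y t)) has_vector_derivative (a, b)) (at t within I)"
    show "(x has_real_derivative a) (at t within I) \<and> (y has_real_derivative b) (at t within I)"
      using bounded_linear.has_vector_derivative[OF bounded_linear_fst *]
        bounded_linear.has_vector_derivative[OF bounded_linear_snd *]
      by (simp add: has_real_derivative_iff_has_vector_derivative)
  qed (auto simp: has_real_derivative_iff_has_vector_derivative intro: has_vector_derivative_Pair)
  then show ?thesis by (simp add: solution_on_def vfield_def)
qed

section \<open>The polar flow on real radii and its reflections\<close>

context polar_flow
begin

definition rr :: "real \<Rightarrow> real \<Rightarrow> real^'m \<Rightarrow> real" where
  "rr \<phi> r d = Re (\<rho> \<phi> (of_real r, cvec d))"

definition RR :: "real \<Rightarrow> real \<Rightarrow> real^'m \<Rightarrow> real" where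
  "RR \<phi> r d = Re (R \<phi> (of_real r, cvec d))"

lemma in_dom: "\<bar>r\<bar> < \<kappa>' \<Longrightarrow> dist d \<delta>0 < \<kappa> \<Longrightarrow> (complex_of_real r, cvec d) \<in> ball 0 \<kappa>' \<times> ball (cvec \<delta>0) \<kappa>"
  by (simp add: dist_commute)

lemma rr_eq: "\<phi> \<in> {0..4*pi} \<Longrightarrow> \<bar>r\<bar> < \<kappa>' \<Longrightarrow> dist d \<delta>0 < \<kappa> \<Longrightarrow> \<rho> \<phi> (of_real r, cvec d) = of_real (rr \<phi> r d)"
  using \<rho>_real[of \<phi> r d] by (simp add: rr_def)

lemma RR_eq: "\<bar>r\<bar> < \<kappa> \<Longrightarrow> dist d \<delta>0 < \<kappa> \<Longrightarrow> R \<phi> (of_real r, cvec d) = of_real (RR \<phi> r d)"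
  using R_real[of r d \<phi>] \<kappa> by (simp add: RR_def)

lemma rr_0: "\<bar>r\<bar> < \<kappa>' \<Longrightarrow> dist d \<delta>0 < \<kappa> \<Longrightarrow> rr 0 r d = r"
  using \<rho>_0[OF in_dom] by (simp add: rr_def)

lemma rr_bound: "\<phi> \<in> {0..4*pi} \<Longrightarrow> \<bar>r\<bar> < \<kappa>' \<Longrightarrow> dist d \<delta>0 < \<kappa> \<Longrightarrow> \<bar>rr \<phi> r d\<bar> \<le> M * \<bar>r\<bar>"
  using \<rho>_bound[OF _ in_dom, of \<phi> r d] rr_eq[of \<phi> r d] by simp

lemma rr_less: "\<phi> \<in> {0..4*pi} \<Longrightarrow> \<bar>r\<bar> < \<kappa>' \<Longrightarrow> dist d \<delta>0 < \<kappa> \<Longrightarrow> \<bar>rr \<phi> r d\<bar> < \<kappa>"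
  using \<rho>_less[OF _ in_dom, of \<phi> r d] rr_eq[of \<phi> r d] by simp

lemma rr_deriv:
  assumes "\<phi> \<in> {0..4*pi}" "\<bar>r\<bar> < \<kappa>'" "dist d \<delta>0 < \<kappa>"
  shows "((\<lambda>\<phi>. rr \<phi> r d) has_real_derivative RR \<phi> (rr \<phi> r d) d) (at \<phi> within {0..4*pi})"
  using bounded_linear.has_vector_derivative[OF bounded_linear_Re \<rho>_deriv[OF assms(1) in_dom[OF assms(2,3)]]]
  by (simp add: has_real_derivative_iff_has_vector_derivative rr_eq[OF assms] RR_def flip: rr_def)

lemma rr_deriv_sub:
  "A \<subseteq> {0..4*pi} \<Longrightarrow> \<phi> \<in> A \<Longrightarrow> \<bar>r\<bar> < \<kappa>' \<Longrightarrow> dist d \<delta>0 < \<kappa> \<Longrightarrow>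
    ((\<lambda>\<phi>. rr \<phi> r d) has_real_derivative RR \<phi> (rr \<phi> r d) d) (at \<phi> within A)"
  by (rule DERIV_subset[OF rr_deriv]) auto

lemma RR_lip:
  assumes "\<phi> \<in> {0..4*pi}" "\<bar>r\<bar> < \<kappa>" "\<bar>s\<bar> < \<kappa>" "dist d \<delta>0 < \<kappa>"
  shows "\<bar>RR \<phi> r d - RR \<phi> s d\<bar> \<le> KR * \<bar>r - s\<bar>"
  using R_lip[OF assms] by (simp add: RR_eq assms flip: of_real_diff)

lemma RR_unique:
  assumes "0 \<le> a" "b \<le> 4 * pi" and d: "dist d \<delta>0 < \<kappa>"
    and s1: "\<And>\<phi>. \<phi> \<in> {a..b} \<Longrightarrow> (s1 has_real_derivative RR \<phi> (s1 \<phi>) d) (at \<phi> within {a..b}) \<and> \<bar>s1 \<phi>\<bar> < \<kappa>"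
    and s2: "\<And>\<phi>. \<phi> \<in> {a..b} \<Longrightarrow> (s2 has_real_derivative RR \<phi> (s2 \<phi>) d) (at \<phi> within {a..b}) \<and> \<bar>s2 \<phi>\<bar> < \<kappa>"
    and t: "t0 \<in> {a..b}" "s1 t0 = s2 t0" "t \<in> {a..b}"
  shows "s1 t = s2 t"
proof -
  have "s1 t - s2 t = 0"
  proof (rule gronwall_zero[of a b "\<lambda>t. s1 t - s2 t" "\<lambda>t. RR t (s1 t) d - RR t (s2 t) d" KR t0])
    fix \<phi> assume \<phi>: "\<phi> \<in> {a..b}"
    show "((\<lambda>t. s1 t - s2 t) has_vector_derivative RR \<phi> (s1 \<phi>) d - RR \<phi> (s2 \<phi>) d) (at \<phi> within {a..b})"
      using s1[OF \<phi>] s2[OF \<phi>] unfolding has_real_derivative_iff_has_vector_derivative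
      by (intro has_vector_derivative_diff) auto
    show "norm (RR \<phi> (s1 \<phi>) d - RR \<phi> (s2 \<phi>) d) \<le> KR * norm (s1 \<phi> - s2 \<phi>)"
      using RR_lip[of \<phi> "s1 \<phi>" "s2 \<phi>" d] s1[OF \<phi>] s2[OF \<phi>] \<phi> assms(1,2) d by auto
  qed (use t in auto)
  then show ?thesis by simp
qed

lemma rr_cont: "\<bar>r\<bar> < \<kappa>' \<Longrightarrow> dist d \<delta>0 < \<kappa> \<Longrightarrow> continuous_on {0..4*pi} (\<lambda>\<phi>. rr \<phi> r d)"
  by (rule DERIV_continuous_on[OF rr_deriv])

text \<open>Solutions cannot cross: a violated order gives an angle where they meet, and uniqueness
  carries the equality back to angle 0.\<close>

lemma rr_mono:
  assumes "\<phi> \<in> {0..4*pi}" "\<bar>r\<bar> < \<kappa>'" "\<bar>s\<bar> < \<kappa>'" "dist d \<delta>0 < \<kappa>" "r < s"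
  shows "rr \<phi> r d < rr \<phi> s d"
proof (rule ccontr)
  assume "\<not> rr \<phi> r d < rr \<phi> s d"
  then have "\<exists>\<psi>\<ge>0. \<psi> \<le> \<phi> \<and> rr \<psi> s d - rr \<psi> r d = 0"
    using assms by (intro IVT2') (auto intro!: continuous_intros continuous_on_subset[OF rr_cont] simp: rr_0)
  then obtain \<psi> where "\<psi> \<ge> 0" "\<psi> \<le> \<phi>" "rr \<psi> s d - rr \<psi> r d = 0" by blast
  then have \<psi>: "\<psi> \<in> {0..4*pi}" "rr \<psi> s d = rr \<psi> r d" using assms(1) by auto
  have "rr 0 s d = rr 0 r d"
    by (rule RR_unique[of 0 "4*pi" d "\<lambda>\<phi>. rr \<phi> s d" "\<lambda>\<phi>. rr \<phi> r d" \<psi>]) (use assms \<psi> in \<open>auto intro!: rr_deriv rr_less\<close>)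
  then show False using assms by (simp add: rr_0)
qed

lemma rr_zero: "\<phi> \<in> {0..4*pi} \<Longrightarrow> dist d \<delta>0 < \<kappa> \<Longrightarrow> rr \<phi> 0 d = 0"
  using rr_bound[of \<phi> 0 d] \<kappa>' by simp

lemma rr_pos: "\<phi> \<in> {0..4*pi} \<Longrightarrow> 0 < r \<Longrightarrow> r < \<kappa>' \<Longrightarrow> dist d \<delta>0 < \<kappa> \<Longrightarrow> 0 < rr \<phi> r d"
  using rr_mono[of \<phi> 0 r d] rr_zero[of \<phi> d] \<kappa>' by simp

text \<open>The equation is \<open>2 * pi\<close>-periodic, so a second turn is a first turn from
  the returned radius.\<close>

lemma rr_period:
  assumes "\<phi> \<in> {0..2*pi}" "\<bar>r\<bar> < \<kappa>'" "\<bar>rr (2 * pi) r d\<bar> < \<kappa>'" "dist d \<delta>0 < \<kappa>"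
  shows "rr (\<phi> + 2 * pi) r d = rr \<phi> (rr (2 * pi) r d) d"
proof (rule RR_unique[of 0 "2*pi" d "\<lambda>\<phi>. rr (\<phi> + 2 * pi) r d" "\<lambda>\<phi>. rr \<phi> (rr (2 * pi) r d) d" 0])
  fix \<psi> assume \<psi>: "\<psi> \<in> {0..2*pi}"
  have im: "(\<lambda>\<phi>. \<phi> + 2 * pi) ` {0..2*pi} \<subseteq> {0..4*pi}" by auto
  have "((\<lambda>\<phi>. rr (\<phi> + 2 * pi) r d) has_real_derivative RR (\<psi> + 2 * pi) (rr (\<psi> + 2 * pi) r d) d * 1) (at \<psi> within {0..2*pi})"
    by (rule DERIV_chain_image[OF _ rr_deriv_sub[OF im]])
       (use \<psi> assms in \<open>auto intro!: derivative_eq_intros\<close>)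
  moreover have "\<bar>rr (\<psi> + 2 * pi) r d\<bar> < \<kappa>" using \<psi> assms by (intro rr_less) auto
  ultimately show "((\<lambda>\<phi>. rr (\<phi> + 2 * pi) r d) has_real_derivative RR \<psi> (rr (\<psi> + 2 * pi) r d) d) (at \<psi> within {0..2*pi}) \<and>
      \<bar>rr (\<psi> + 2 * pi) r d\<bar> < \<kappa>" by (simp add: RR_def R_periodic)
  show "((\<lambda>\<phi>. rr \<phi> (rr (2 * pi) r d) d) has_real_derivative RR \<psi> (rr \<psi> (rr (2 * pi) r d) d) d) (at \<psi> within {0..2*pi}) \<and>
      \<bar>rr \<psi> (rr (2 * pi) r d) d\<bar> < \<kappa>"
    using \<psi> assms by (intro conjI rr_less rr_deriv_sub) auto
qed (use assms in \<open>auto simp: rr_0\<close>)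

lemma RR_odd: "odd n \<Longrightarrow> RR (\<phi> + pi) (- r) d = - RR \<phi> r d"
  using R_odd[of \<phi> "of_real r" "cvec d"] by (simp add: RR_def)

lemma RR_even: "even n \<Longrightarrow> RR (3 * pi - \<phi>) (- r) d = RR \<phi> r d"
  using R_even[of \<phi> "of_real r" "cvec d"] by (simp add: RR_def)

text \<open>Two flow maps in succession enlarge a radius by at most \<open>M\<^sup>2\<close>, so
  \<open>Pm\<close>, \<open>hm\<close> and \<open>hm\<close> after \<open>Pm\<close> remain below
  \<open>\<kappa>'\<close>.\<close>

definition \<sigma> :: real where "\<sigma> = \<kappa>' / M\<^sup>2"

lemma \<sigma>: "\<sigma> > 0" "\<sigma> \<le> \<kappa>'" "M * \<sigma> \<le> \<kappa>'" "M * (M * \<sigma>) = \<kappa>'"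
proof -
  have M0: "M > 0" using M by simp
  show "\<sigma> > 0" using \<kappa>' M0 by (simp add: \<sigma>_def)
  show 4: "M * (M * \<sigma>) = \<kappa>'" using M0 by (simp add: \<sigma>_def power2_eq_square)
  have "1 * (M * \<sigma>) \<le> M * (M * \<sigma>)" using M \<open>\<sigma> > 0\<close> by (intro mult_right_mono) auto
  then show 3: "M * \<sigma> \<le> \<kappa>'" using 4 by simp
  have "1 * \<sigma> \<le> M * \<sigma>" using M \<open>\<sigma> > 0\<close> by (intro mult_right_mono) auto
  then show "\<sigma> \<le> \<kappa>'" using 3 by simp
qed

definition Pm :: "real \<Rightarrow> real^'m \<Rightarrow> real" where "Pm r d = rr (2 * pi) r d"
text \<open>For \<open>r > 0\<close> the orbit meets the curve \<open>y = F\<close> at angle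
  \<open>pi\<close> with \<open>x = - hm r\<close>; thus \<open>- hm r\<close> is the negative
  radius paired with \<open>r\<close>.\<close>

definition hm :: "real \<Rightarrow> real^'m \<Rightarrow> real" where "hm r d = rr pi r d"

lemma map_bounds:
  assumes r: "\<bar>r\<bar> < \<sigma>" and d: "dist d \<delta>0 < \<kappa>"
  shows "\<bar>r\<bar> < \<kappa>'" "\<bar>Pm r d\<bar> \<le> M * \<bar>r\<bar>" "\<bar>hm r d\<bar> \<le> M * \<bar>r\<bar>" "\<bar>Pm r d\<bar> < \<kappa>'" "\<bar>hm r d\<bar> < \<kappa>'" "\<bar>hm (Pm r d) d\<bar> < \<kappa>'"
proof -
  show r': "\<bar>r\<bar> < \<kappa>'" using r \<sigma> by simp
  show P: "\<bar>Pm r d\<bar> \<le> M * \<bar>r\<bar>" unfolding Pm_def by (rule rr_bound[OF _ r' d]) auto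
  show h: "\<bar>hm r d\<bar> \<le> M * \<bar>r\<bar>" unfolding hm_def by (rule rr_bound[OF _ r' d]) auto
  have l: "M * \<bar>r\<bar> < M * \<sigma>" using r M by simp
  then show P': "\<bar>Pm r d\<bar> < \<kappa>'" "\<bar>hm r d\<bar> < \<kappa>'" using P h \<sigma>(3) by linarith+
  have "\<bar>hm (Pm r d) d\<bar> \<le> M * \<bar>Pm r d\<bar>" unfolding hm_def by (rule rr_bound[OF _ P'(1) d]) auto
  also have "\<dots> \<le> M * (M * \<bar>r\<bar>)" using P M by (intro mult_left_mono) auto
  also have "\<dots> < M * (M * \<sigma>)" using l M by (intro mult_strict_left_mono) auto
  finally show "\<bar>hm (Pm r d) d\<bar> < \<kappa>'" using \<sigma>(4) by simp
qed

lemma rr_3pi: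
  assumes r: "\<bar>r\<bar> < \<sigma>" and d: "dist d \<delta>0 < \<kappa>"
  shows "rr (3 * pi) r d = hm (Pm r d) d"
  using rr_period[of pi r d] map_bounds[OF r d] d by (simp add: Pm_def hm_def)

text \<open>
  For odd \<open>n\<close> the reflection \<open>(r, \<phi>) \<mapsto> (- r, \<phi> + \<pi>)\<close> fixes the phase plane pointwise, for even \<open>n\<close> the
  reflection \<open>(r, \<phi>) \<mapsto> (- r, \<pi> - \<phi>)\<close> does. This determines the return map on negative radii.
\<close>
lemma Pm_odd:
  assumes n: "odd n" and r: "\<bar>r\<bar> < \<sigma>" and d: "dist d \<delta>0 < \<kappa>"
  shows "Pm (- hm r d) d = - hm (Pm r d) d"
proof -
  note mb = map_bounds[OF r d]
  have "rr (2 * pi) (- hm r d) d = - rr (2 * pi + pi) r d"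
  proof (rule RR_unique[of 0 "2*pi" d "\<lambda>\<phi>. rr \<phi> (- hm r d) d" "\<lambda>\<phi>. - rr (\<phi> + pi) r d" 0])
    fix \<psi> assume \<psi>: "\<psi> \<in> {0..2*pi}"
    show "((\<lambda>\<phi>. rr \<phi> (- hm r d) d) has_real_derivative RR \<psi> (rr \<psi> (- hm r d) d) d) (at \<psi> within {0..2*pi}) \<and>
        \<bar>rr \<psi> (- hm r d) d\<bar> < \<kappa>"
      using \<psi> mb d by (intro conjI rr_less rr_deriv_sub) auto
    have im: "(\<lambda>\<phi>. \<phi> + pi) ` {0..2*pi} \<subseteq> {0..4*pi}" by auto
    have "((\<lambda>\<phi>. rr (\<phi> + pi) r d) has_real_derivative RR (\<psi> + pi) (rr (\<psi> + pi) r d) d * 1) (at \<psi> within {0..2*pi})"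
      by (rule DERIV_chain_image[OF _ rr_deriv_sub[OF im]])
         (use \<psi> mb d in \<open>auto intro!: derivative_eq_intros\<close>)
    from DERIV_minus[OF this]
    have "((\<lambda>\<phi>. - rr (\<phi> + pi) r d) has_real_derivative RR \<psi> (- rr (\<psi> + pi) r d) d) (at \<psi> within {0..2*pi})"
      using RR_odd[OF n, of \<psi> "- rr (\<psi> + pi) r d" d] by simp
    moreover have "\<bar>rr (\<psi> + pi) r d\<bar> < \<kappa>" using \<psi> mb d by (intro rr_less) auto
    ultimately show "((\<lambda>\<phi>. - rr (\<phi> + pi) r d) has_real_derivative RR \<psi> (- rr (\<psi> + pi) r d) d) (at \<psi> within {0..2*pi}) \<and>
        \<bar>- rr (\<psi> + pi) r d\<bar> < \<kappa>" by simp
  qed (use mb d in \<open>auto simp: rr_0 hm_def\<close>)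
  then show ?thesis using rr_3pi[OF r d] by (simp add: Pm_def)
qed

text \<open>This reflection reverses the angle. The start is therefore the reflected value at angle
  \<open>3 * pi\<close>, from which the solution is followed backwards to angle
  \<open>pi\<close>.\<close>

lemma Pm_even:
  assumes n: "even n" and r: "\<bar>r\<bar> < \<sigma>" and d: "dist d \<delta>0 < \<kappa>"
  shows "Pm (- hm (Pm r d) d) d = - hm r d"
proof -
  note mb = map_bounds[OF r d]
  have "rr (2 * pi) (- hm (Pm r d) d) d = - rr (3 * pi - 2 * pi) r d"
  proof (rule RR_unique[of 0 "2*pi" d "\<lambda>\<phi>. rr \<phi> (- hm (Pm r d) d) d" "\<lambda>\<phi>. - rr (3 * pi - \<phi>) r d" 0])
    fix \<psi> assume \<psi>: "\<psi> \<in> {0..2*pi}"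
    show "((\<lambda>\<phi>. rr \<phi> (- hm (Pm r d) d) d) has_real_derivative RR \<psi> (rr \<psi> (- hm (Pm r d) d) d) d) (at \<psi> within {0..2*pi}) \<and>
        \<bar>rr \<psi> (- hm (Pm r d) d) d\<bar> < \<kappa>"
      using \<psi> mb d by (intro conjI rr_less rr_deriv_sub) auto
    have im: "(\<lambda>\<phi>. 3 * pi - \<phi>) ` {0..2*pi} \<subseteq> {0..4*pi}" by auto
    have "((\<lambda>\<phi>. rr (3 * pi - \<phi>) r d) has_real_derivative RR (3 * pi - \<psi>) (rr (3 * pi - \<psi>) r d) d * (- 1)) (at \<psi> within {0..2*pi})"
      by (rule DERIV_chain_image[OF _ rr_deriv_sub[OF im]])
         (use \<psi> mb d in \<open>auto intro!: derivative_eq_intros\<close>)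
    from DERIV_minus[OF this]
    have "((\<lambda>\<phi>. - rr (3 * pi - \<phi>) r d) has_real_derivative RR \<psi> (- rr (3 * pi - \<psi>) r d) d) (at \<psi> within {0..2*pi})"
      using RR_even[OF n, of \<psi> "- rr (3 * pi - \<psi>) r d" d] by simp
    moreover have "\<bar>rr (3 * pi - \<psi>) r d\<bar> < \<kappa>" using \<psi> mb d by (intro rr_less) auto
    ultimately show "((\<lambda>\<phi>. - rr (3 * pi - \<phi>) r d) has_real_derivative RR \<psi> (- rr (3 * pi - \<psi>) r d) d) (at \<psi> within {0..2*pi}) \<and>
        \<bar>- rr (3 * pi - \<psi>) r d\<bar> < \<kappa>" by simp
  qed (use mb d rr_3pi[OF r d] in \<open>auto simp: rr_0\<close>)
  then show ?thesis by (simp add: Pm_def hm_def)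
qed

section \<open>Phase curves traced by the polar flow\<close>

definition Fr :: "real \<Rightarrow> real^'m \<Rightarrow> real" where
  "Fr x d = Re (Fc (of_real x, cvec d))"

definition pt :: "real^'m \<Rightarrow> real \<Rightarrow> real \<Rightarrow> real \<times> real" where
  "pt d r \<phi> = (r * cos \<phi>, Fr (r * cos \<phi>) d - r ^ n * sin \<phi>)"

definition dFr :: "real \<Rightarrow> real^'m \<Rightarrow> real" where
  "dFr x d = Re (dd (1, 0) Fc (of_real x, cvec d))"

lemma Fr_deriv:
  assumes "\<bar>x\<bar> < \<epsilon>" "dist d \<delta>0 < \<epsilon>"
  shows "((\<lambda>x. Fr x d) has_real_derivative dFr x d) (at x)" "dd (1, 0) Fc (of_real x, cvec d) = of_real (dFr x d)"
proof -
  have v: "(of_real x, cvec d) \<in> E2" using assms by (simp add: dist_commute)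
  have "\<forall>\<^sub>F s in nhds (0::real). s \<in> {- \<epsilon> - x<..<\<epsilon> - x}"
    by (rule eventually_nhds_in_open) (use assms in auto)
  then have ev: "\<forall>\<^sub>F s in nhds (0::real). Fc ((of_real x, cvec d) + of_real s *\<^sub>C (1, 0)) = of_real (Fr (x + s) d)"
  proof eventually_elim
    case (elim s)
    then have "\<bar>x + s\<bar> < \<epsilon>" by auto
    then show ?case using Fc_real[OF assms(2), of "x + s"] by (simp add: Fr_def)
  qed
  show "dd (1, 0) Fc (of_real x, cvec d) = of_real (dFr x d)"
    using dd_real(2)[OF Fc_cd v ev] by (simp add: dFr_def)
  have "((\<lambda>s. Fr (x + s) d) has_real_derivative dFr x d) (at 0)"
    using dd_real(1)[OF Fc_cd v ev] by (simp add: dFr_def)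
  then show "((\<lambda>x. Fr x d) has_real_derivative dFr x d) (at x)"
    using DERIV_shift[of "\<lambda>x. Fr x d" "dFr x d" 0 x] by (simp add: add.commute)
qed

text \<open>The angular velocity in time. Its positivity at positive radii allows the angle to serve
  as a clock.\<close>

definition ang :: "real^'m \<Rightarrow> real \<Rightarrow> real \<Rightarrow> real" where
  "ang d r \<phi> = r ^ (n - 1) * Re (den \<phi> (of_real r, cvec d)) / ((cos \<phi>)\<^sup>2 + n * (sin \<phi>)\<^sup>2)"

lemma Delta_pos: "(cos \<phi>)\<^sup>2 + n * (sin \<phi>)\<^sup>2 > (0::real)"
proof -
  have "(cos \<phi>)\<^sup>2 + 1 * (sin \<phi>)\<^sup>2 \<le> (cos \<phi>)\<^sup>2 + n * (sin \<phi>)\<^sup>2"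
    using n by (intro add_left_mono mult_right_mono) auto
  then show ?thesis by simp
qed

lemma ang_pos: "\<phi> \<in> {0..4*pi} \<Longrightarrow> 0 < r \<Longrightarrow> r < \<kappa> \<Longrightarrow> dist d \<delta>0 < \<kappa> \<Longrightarrow> ang d r \<phi> > 0"
  unfolding ang_def using den_pos[of \<phi> r d] Delta_pos[of \<phi>] by (intro divide_pos_pos mult_pos_pos) auto

text \<open>The chain rule for \<open>pt\<close> with angular velocity \<open>ang\<close> and radial
  velocity \<open>ang * RR\<close>: the field is \<open>ang\<close> times the angular derivative of
  the curve.\<close>

lemma polar_vfield:
  fixes r \<phi> :: real and d :: "real^'m"
  assumes d: "d \<in> D" "dist d \<delta>0 < \<kappa>" and r: "0 < r" "r < \<kappa>" and \<phi>: "\<phi> \<in> {0..4*pi}"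
  shows "fst (vfield X Y d (pt d r \<phi>)) = ang d r \<phi> * (RR \<phi> r d * cos \<phi> - r * sin \<phi>)"
    "snd (vfield X Y d (pt d r \<phi>)) = ang d r \<phi> *
       (dFr (r * cos \<phi>) d * (RR \<phi> r d * cos \<phi> - r * sin \<phi>) - (n * r ^ (n - 1) * RR \<phi> r d * sin \<phi> + r ^ n * cos \<phi>))"
proof -
  define C S where "C = cos \<phi>" and "S = sin \<phi>"
  define xr er where "xr = Re (xi \<phi> (of_real r, cvec d))" and "er = Re (eta \<phi> (of_real r, cvec d))"
  have d\<epsilon>: "dist d \<delta>0 < \<epsilon>" "\<bar>r\<bar> < min \<epsilon> 1" using d r \<kappa> by auto
  have xe: "xi \<phi> (of_real r, cvec d) = of_real xr" "eta \<phi> (of_real r, cvec d) = of_real er"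
    using xi_eta_real[OF d\<epsilon>(2,1), of \<phi>] by (simp_all add: xr_def er_def)
  define w where "w = - (r ^ n * S)"
  have xw: "\<bar>r * C\<bar> < \<epsilon>" "\<bar>w\<bar> < \<epsilon>"
    using abs_rc[of r \<phi>] abs_rn[of r \<phi>] d\<epsilon>(2) by (auto simp: C_def S_def w_def)
  have a3: "arg3 \<phi> (of_real r, cvec d) = (of_real w, of_real (r * C), cvec d)"
    by (simp add: arg3_real w_def C_def S_def)
  have pt: "pt d r \<phi> = (r * C, Fr (r * C) d + w)" by (simp add: pt_def w_def C_def S_def)
  define A where "A = Fr (r * C) d + w + X (r * C) (Fr (r * C) d + w) d"
  have "complex_of_real A = of_real w * U (of_real w, of_real (r * C), cvec d)"
    using xdot[OF d(1) d\<epsilon>(1) xw] by (simp add: Fr_def A_def)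
  also have "\<dots> = of_real (r ^ n) * xi \<phi> (of_real r, cvec d)"
    by (simp add: xi_def a3) (simp add: w_def S_def)
  finally have A1: "complex_of_real A = of_real (r ^ n * xr)" by (simp add: xe)
  then have A: "A = r ^ n * xr" by (simp only: of_real_eq_iff)
  define B where "B = Y (r * C) (Fr (r * C) d + w) d"
  have pw: "r ^ (2 * n - 1) = r ^ (n - 1) * r ^ n" "r ^ (2 * n - 1) * r = r ^ n * r ^ n"
  proof -
    have e: "2 * n - 1 = (n - 1) + n" "Suc (2 * n - 1) = n + n" using n by simp_all
    show "r ^ (2 * n - 1) = r ^ (n - 1) * r ^ n" by (subst e(1)) (rule power_add)
    show "r ^ (2 * n - 1) * r = r ^ n * r ^ n" by (metis e(2) power_Suc2 power_add)
  qed
  have "complex_of_real B - dd (1, 0) Fc (of_real (r * C), cvec d) * of_real A =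
     - (of_real (r * C) ^ (2 * n - 1) * gt (of_real (r * C), cvec d)) - of_real (r * C) ^ (n - 1) * ft (of_real (r * C), cvec d) * of_real w
          + (of_real w)\<^sup>2 * H (of_real w, of_real (r * C), cvec d)"
    using ydot[OF d(1) d\<epsilon>(1) xw] \<open>complex_of_real A = of_real w * U (of_real w, of_real (r * C), cvec d)\<close>
    by (simp only: Fr_def B_def)
  also have "\<dots> = of_real (r ^ (2 * n - 1)) * eta \<phi> (of_real r, cvec d)"
  proof -
    have c1: "complex_of_real (r * C) ^ (2 * n - 1) = of_real (r ^ (2 * n - 1)) * of_real C ^ (2 * n - 1)"
      by (simp add: power_mult_distrib)
    have c2: "complex_of_real (r * C) ^ (n - 1) * g * of_real w = - (of_real (r ^ (2 * n - 1)) * (of_real C ^ (n - 1) * of_real S * g))" for g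
      unfolding pw(1) by (simp add: power_mult_distrib w_def)
    have c3: "(complex_of_real w)\<^sup>2 * g = of_real (r ^ (2 * n - 1)) * (of_real r * (of_real S)\<^sup>2 * g)" for g
    proof -
      have "complex_of_real (r ^ (2 * n - 1)) * of_real r = of_real (r ^ n) * of_real (r ^ n)"
        unfolding of_real_mult[symmetric] pw(2) ..
      then show ?thesis by (simp add: w_def power2_eq_square algebra_simps)
    qed
    show ?thesis unfolding eta_def a3 snd_conv fst_conv c1 c2 c3 C_def[symmetric] S_def[symmetric]
      by (simp add: algebra_simps)
  qed
  finally have "complex_of_real (B - dFr (r * C) d * A) = of_real (r ^ (2 * n - 1) * er)"
    using Fr_deriv(2)[OF xw(1) d\<epsilon>(1)] by (simp add: xe)
  then have "B - dFr (r * C) d * A = r ^ (2 * n - 1) * er" by (simp only: of_real_eq_iff)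
  then have B: "B = dFr (r * C) d * A + r ^ (2 * n - 1) * er" by simp
  define \<Delta> where "\<Delta> = C\<^sup>2 + n * S\<^sup>2"
  have \<Delta>: "\<Delta> > 0" using Delta_pos[of \<phi>] by (simp add: \<Delta>_def C_def S_def)
  define N Dn where "N = C * xr - S * er" and "Dn = - (C * er + n * S * xr)"
  have dn: "den \<phi> (of_real r, cvec d) = of_real Dn" "num \<phi> (of_real r, cvec d) = of_real N"
    by (simp_all add: den_def num_def xe Dn_def N_def C_def S_def)
  have Dn: "Dn > 0" using den_pos[OF \<phi> _ d(2), of r] r by (simp add: dn)
  have RRv: "RR \<phi> r d = r * N / Dn"
  proof -
    have "R \<phi> (of_real r, cvec d) = of_real (r * N / Dn)" by (simp add: R_def dn)
    then show ?thesis by (simp add: RR_def)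
  qed
  have ang: "ang d r \<phi> = r ^ (n - 1) * Dn / \<Delta>" by (simp add: ang_def dn \<Delta>_def C_def S_def)
  have rn: "r ^ n = r ^ (n - 1) * r" using n by (simp flip: power_Suc2)
  \<comment> \<open>Cramer's identities: \<open>N\<close> and \<open>Dn\<close> solve the linear
    system for the two velocities up to the determinant \<open>\<Delta>\<close>.\<close>
  have i1: "N * C - Dn * S = xr * \<Delta>" by (simp add: N_def Dn_def \<Delta>_def power2_eq_square algebra_simps)
  have i2: "- (n * N * S) - Dn * C = er * \<Delta>" by (simp add: N_def Dn_def \<Delta>_def power2_eq_square algebra_simps)
  have "ang d r \<phi> * (RR \<phi> r d * C - r * S) = r ^ (n - 1) * r * (N * C - Dn * S) / \<Delta>"
    using Dn \<Delta> by (simp add: ang RRv field_simps)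
  also have "\<dots> = A" unfolding i1 using \<Delta> by (simp add: A rn)
  finally have e1: "ang d r \<phi> * (RR \<phi> r d * C - r * S) = A" .
  have "ang d r \<phi> * - (n * r ^ (n - 1) * RR \<phi> r d * S + r ^ n * C) =
      r ^ (n - 1) * (r ^ (n - 1) * r) * (- (n * N * S) - Dn * C) / \<Delta>"
    using Dn \<Delta> by (simp add: ang RRv rn field_simps)
  also have "\<dots> = r ^ (2 * n - 1) * er" unfolding i2 pw(1) rn using \<Delta> by simp
  finally have e2: "ang d r \<phi> * - (n * r ^ (n - 1) * RR \<phi> r d * S + r ^ n * C) = r ^ (2 * n - 1) * er" .
  show "fst (vfield X Y d (pt d r \<phi>)) = ang d r \<phi> * (RR \<phi> r d * cos \<phi> - r * sin \<phi>)"
    using e1 by (simp add: pt vfield_def A_def C_def S_def)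
  have "snd (vfield X Y d (pt d r \<phi>)) = dFr (r * C) d * (ang d r \<phi> * (RR \<phi> r d * C - r * S)) +
      ang d r \<phi> * - (n * r ^ (n - 1) * RR \<phi> r d * S + r ^ n * C)"
    unfolding e1 e2 using B by (simp add: pt vfield_def B_def)
  then show "snd (vfield X Y d (pt d r \<phi>)) = ang d r \<phi> *
       (dFr (r * cos \<phi>) d * (RR \<phi> r d * cos \<phi> - r * sin \<phi>) - (n * r ^ (n - 1) * RR \<phi> r d * sin \<phi> + r ^ n * cos \<phi>))"
    by (simp add: C_def S_def algebra_simps)
qed

text \<open>\<open>1 / ang\<close> is the time per angle, the density handed to
  \<open>time_change\<close>.\<close>

lemma curve_deriv:
  assumes d: "d \<in> D" "dist d \<delta>0 < \<kappa>" and r: "0 < r" "r < \<kappa>'" and \<phi>: "\<phi> \<in> {0..4*pi}"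
  shows "((\<lambda>\<phi>. pt d (rr \<phi> r d) \<phi>) has_vector_derivative
     (1 / ang d (rr \<phi> r d) \<phi>) *\<^sub>R vfield X Y d (pt d (rr \<phi> r d) \<phi>)) (at \<phi> within {0..4*pi})"
proof -
  define q where "q = rr \<phi> r d"
  define q' where "q' = RR \<phi> q d"
  have r': "\<bar>r\<bar> < \<kappa>'" using r by simp
  have q: "0 < q" "q < \<kappa>" using rr_pos[OF \<phi> r d(2)] rr_less[OF \<phi> r' d(2)] by (auto simp: q_def)
  have dq: "((\<lambda>\<phi>. rr \<phi> r d) has_real_derivative q') (at \<phi> within {0..4*pi})"
    unfolding q'_def q_def by (rule rr_deriv[OF \<phi> r' d(2)])
  have dx: "((\<lambda>\<phi>. rr \<phi> r d * cos \<phi>) has_real_derivative q' * cos \<phi> - q * sin \<phi>) (at \<phi> within {0..4*pi})"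
    by (rule derivative_eq_intros dq refl)+ (simp add: q_def)
  have dw: "((\<lambda>\<phi>. rr \<phi> r d ^ n * sin \<phi>) has_real_derivative n * q ^ (n - 1) * q' * sin \<phi> + q ^ n * cos \<phi>) (at \<phi> within {0..4*pi})"
    by (rule derivative_eq_intros dq refl)+ (simp add: q_def)
  have "\<bar>q * cos \<phi>\<bar> < \<epsilon>" using abs_rc[of q \<phi>] q \<kappa> by auto
  then have "((\<lambda>x. Fr x d) has_real_derivative dFr (q * cos \<phi>) d) (at (rr \<phi> r d * cos \<phi>))"
    using Fr_deriv(1)[of "q * cos \<phi>" d] d \<kappa> by (simp add: q_def)
  from DERIV_chain2[OF this dx]
  have dF: "((\<lambda>\<phi>. Fr (rr \<phi> r d * cos \<phi>) d) has_real_derivative dFr (q * cos \<phi>) d * (q' * cos \<phi> - q * sin \<phi>)) (at \<phi> within {0..4*pi})" .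
  have "((\<lambda>\<phi>. pt d (rr \<phi> r d) \<phi>) has_vector_derivative (q' * cos \<phi> - q * sin \<phi>,
      dFr (q * cos \<phi>) d * (q' * cos \<phi> - q * sin \<phi>) - (n * q ^ (n - 1) * q' * sin \<phi> + q ^ n * cos \<phi>))) (at \<phi> within {0..4*pi})"
    unfolding pt_def
    using dx DERIV_diff[OF dF dw] by (intro has_vector_derivative_Pair) (simp_all add: has_real_derivative_iff_has_vector_derivative)
  also have "(q' * cos \<phi> - q * sin \<phi>,
      dFr (q * cos \<phi>) d * (q' * cos \<phi> - q * sin \<phi>) - (n * q ^ (n - 1) * q' * sin \<phi> + q ^ n * cos \<phi>)) =
      (1 / ang d q \<phi>) *\<^sub>R vfield X Y d (pt d q \<phi>)"
    using polar_vfield[OF d q \<phi>] ang_pos[OF \<phi> q d(2)] by (simp add: prod_eq_iff q'_def)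
  finally show ?thesis by (simp add: q_def)
qed

end

section \<open>Periodic orbits and fixed points\<close>

lemma periodic_shift:
  fixes f :: "real \<Rightarrow> 'a"
  assumes "\<And>t. f (t + T) = f t"
  shows "f (t + of_int k * T) = f t"
proof (induction k rule: int_induct[where k = 0])
  case (step1 i)
  then show ?case using assms[of "t + of_int i * T"] by (simp add: algebra_simps)
next
  case (step2 i)
  then show ?case using assms[of "t + of_int (i - 1) * T"] by (simp add: algebra_simps)
qed simp

lemma periodic_reduce:
  fixes f :: "real \<Rightarrow> 'a"
  assumes T: "T > 0" and per: "\<And>t. f (t + T) = f t"
  obtains u where "u \<in> {s..s + T}" "f u = f t"
proof -
  define k where "k = \<lfloor>(t - s) / T\<rfloor>"
  have "of_int k * T \<le> (t - s) / T * T" "(t - s) / T * T < (of_int k + 1) * T"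
    unfolding k_def using T by (intro mult_right_mono mult_strict_right_mono; linarith)+
  moreover have "(t - s) / T * T = t - s" using T by simp
  ultimately have "of_int k * T \<le> t - s" "t - s < (of_int k + 1) * T" by simp_all
  then have "t + of_int (- k) * T \<in> {s..s + T}" by (simp add: algebra_simps)
  moreover have "f (t + of_int (- k) * T) = f t" by (rule periodic_shift[where f = f, OF per])
  ultimately show ?thesis using that by blast
qed

lemma periodic_range:
  fixes f :: "real \<Rightarrow> 'a"
  assumes T: "T > 0" and per: "\<And>t. f (t + T) = f t"
  shows "range f = f ` {s..s + T}"
proof (intro equalityI subsetI)
  fix p assume "p \<in> range f"
  then obtain t where t: "p = f t" by blast
  obtain u where "u \<in> {s..s + T}" "f u = f t" by (rule periodic_reduce[where f = f and s = s and t = t, OF T per])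
  then show "p \<in> f ` {s..s + T}" using t by (metis imageI)
qed auto

text \<open>At scale \<open>\<gamma>\<close> the orbits stay in the Lipschitz ball. Positivity of
  \<open>U\<close> ties the sign of the velocity of \<open>x\<close> to that of \<open>w\<close>,
  and positivity of \<open>gt\<close> fixes the direction in which the curve \<open>w = 0\<close> is
  crossed.\<close>

locale polar_orbit = polar_flow X Y D n \<delta>0 \<epsilon> K a0 b0 Fc gt ft U H \<kappa> \<kappa>' M KR \<rho>
  for X Y :: "real \<Rightarrow> real \<Rightarrow> real^'m \<Rightarrow> real" and D :: "(real^'m) set" and n :: nat
    and \<delta>0 :: "real^'m" and \<epsilon> K a0 b0 :: real
    and Fc gt ft :: "complex \<times> (complex^'m) \<Rightarrow> complex"
    and U H :: "complex \<times> complex \<times> (complex^'m) \<Rightarrow> complex"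
    and \<kappa> \<kappa>' M KR :: real and \<rho> :: "real \<Rightarrow> complex \<times> (complex^'m) \<Rightarrow> complex" +
  fixes \<gamma> :: real
  assumes \<gamma>: "\<gamma> > 0" "\<gamma> \<le> \<sigma>" "\<gamma> \<le> \<kappa>"
    and orbit_small: "\<And>d r \<phi>. dist d \<delta>0 < \<gamma> \<Longrightarrow> 0 < r \<Longrightarrow> r < \<gamma> \<Longrightarrow> \<phi> \<in> {0..4*pi} \<Longrightarrow> norm (pt d (rr \<phi> r d) \<phi>) < \<epsilon>"
    and U_pos: "\<And>d w x. dist d \<delta>0 < \<gamma> \<Longrightarrow> \<bar>w\<bar> < \<gamma> \<Longrightarrow> \<bar>x\<bar> < \<gamma> \<Longrightarrow> Re (U (of_real w, of_real x, cvec d)) > 0"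
    and gt_pos: "\<And>d x. dist d \<delta>0 < \<gamma> \<Longrightarrow> \<bar>x\<bar> < \<gamma> \<Longrightarrow> Re (gt (of_real x, cvec d)) > 0"

context polar_flow
begin

lemma Fr_small:
  assumes \<delta>0: "\<delta>0 \<in> D" and e: "e > 0"
  obtains b where "b > 0" "\<And>x d. \<bar>x\<bar> < b \<Longrightarrow> dist d \<delta>0 < b \<Longrightarrow> \<bar>Fr x d\<bar> < e"
proof -
  have "isCont Fc (0, cvec \<delta>0)" by (rule cdiff_on_isCont[OF Fc_cd]) (use \<epsilon> in auto)
  then obtain b where b: "b > 0" "\<And>v. dist v (0, cvec \<delta>0) < b \<Longrightarrow> dist (Fc v) (Fc (0, cvec \<delta>0)) < e"
    unfolding continuous_at_eps_delta using e by meson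
  have F0: "Fc (0, cvec \<delta>0) = 0" using Fc0[OF \<delta>0] \<epsilon> by simp
  show ?thesis
  proof (rule that[of "b / 2"])
    fix x d assume *: "\<bar>x\<bar> < b / 2" "dist d \<delta>0 < b / 2"
    have "dist (complex_of_real x, cvec d) (0, cvec \<delta>0) \<le> \<bar>x\<bar> + dist d \<delta>0"
      using norm_Pair_le[of "complex_of_real x" "cvec d - cvec \<delta>0"]
      by (simp add: dist_norm flip: cvec_diff)
    then have "norm (Fc (of_real x, cvec d)) < e" using b(2)[of "(of_real x, cvec d)"] * F0 by simp
    then show "\<bar>Fr x d\<bar> < e" unfolding Fr_def using abs_Re_le_cmod le_less_trans by blast
  qed (use b in auto)
qed

lemma orbit_small_exists:
  assumes \<delta>0: "\<delta>0 \<in> D" and e: "e > 0"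
  obtains b where "b > 0" "b \<le> \<sigma>" "b \<le> \<kappa>"
    "\<And>d r \<phi>. dist d \<delta>0 < b \<Longrightarrow> 0 < r \<Longrightarrow> r < b \<Longrightarrow> \<phi> \<in> {0..4*pi} \<Longrightarrow> norm (pt d (rr \<phi> r d) \<phi>) < e"
proof -
  obtain b where b: "b > 0" "\<And>x d. \<bar>x\<bar> < b \<Longrightarrow> dist d \<delta>0 < b \<Longrightarrow> \<bar>Fr x d\<bar> < e / 3"
    using Fr_small[OF \<delta>0, of "e / 3"] e by auto
  \<comment> \<open>\<open>b / M\<close> brings the radius into the range of the bound on
    \<open>Fr\<close>, and \<open>e / (3 * M)\<close> serves the two remaining terms; three terms
    below \<open>e / 3\<close> add up.\<close>
  define b' where "b' = min (min (b / M) (e / (3 * M))) (min \<sigma> \<kappa>)"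
  have M0: "M > 0" using M by simp
  show ?thesis
  proof (rule that[of b'])
    show "b' > 0" using b e M0 \<sigma> \<kappa> by (simp add: b'_def)
    fix d r \<phi> assume *: "dist d \<delta>0 < b'" "0 < r" "r < b'" "\<phi> \<in> {0..4*pi}"
    define q where "q = rr \<phi> r d"
    have r: "\<bar>r\<bar> < \<kappa>'" "dist d \<delta>0 < \<kappa>" using * \<sigma> by (auto simp: b'_def)
    have "\<bar>q\<bar> \<le> M * r" using rr_bound[OF *(4) r] *(2) by (simp add: q_def)
    moreover have "r < b / M" "r < e / (3 * M)" using *(3) by (auto simp: b'_def)
    then have "M * r < b" "M * r < e / 3" using M0 by (simp_all add: field_simps)
    ultimately have q: "\<bar>q\<bar> < b" "\<bar>q\<bar> < e / 3" "\<bar>q\<bar> < 1"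
      using rr_less[OF *(4) r] \<kappa> by (auto simp: q_def)
    have "b / M \<le> b / 1" using b(1) M by (intro divide_left_mono) auto
    then have "dist d \<delta>0 < b" using *(1) by (simp add: b'_def)
    then have 1: "\<bar>Fr (q * cos \<phi>) d\<bar> < e / 3" using b(2) abs_rc[of q \<phi>] q(1) by simp
    have 2: "\<bar>q * cos \<phi>\<bar> < e / 3" "\<bar>q ^ n * sin \<phi>\<bar> < e / 3"
      using abs_rc[of q \<phi>] abs_rn[OF q(3), of \<phi>] q(2) by auto
    have "norm (pt d q \<phi>) \<le> \<bar>q * cos \<phi>\<bar> + \<bar>Fr (q * cos \<phi>) d - q ^ n * sin \<phi>\<bar>"
      unfolding pt_def by (rule order_trans[OF norm_Pair_le]) simp
    also have "\<dots> < e" using 1 2 by linarith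
    finally show "norm (pt d (rr \<phi> r d) \<phi>) < e" by (simp add: q_def)
  qed (auto simp: b'_def)
qed

lemma polar_orbit_exists:
  assumes \<delta>0: "\<delta>0 \<in> D"
  obtains \<gamma> where "polar_orbit X Y D n \<delta>0 \<epsilon> K a0 b0 Fc gt ft U H \<kappa> \<kappa>' M KR \<rho> \<gamma>"
proof -
  obtain b where b: "b > 0" "b \<le> \<sigma>" "b \<le> \<kappa>"
    "\<And>d r \<phi>. dist d \<delta>0 < b \<Longrightarrow> 0 < r \<Longrightarrow> r < b \<Longrightarrow> \<phi> \<in> {0..4*pi} \<Longrightarrow> norm (pt d (rr \<phi> r d) \<phi>) < \<epsilon>"
    using orbit_small_exists[OF \<delta>0 \<epsilon>] by blast
  have "isCont U (0, 0, cvec \<delta>0)" by (rule cdiff_on_isCont[OF U_cd]) (use \<epsilon> in auto)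
  then obtain u where u: "u > 0" "\<And>v. dist v (0, 0, cvec \<delta>0) < u \<Longrightarrow> dist (U v) 1 < 1"
    unfolding continuous_at_eps_delta using U0 by (metis zero_less_one)
  have "isCont gt (0, cvec \<delta>0)" by (rule cdiff_on_isCont[OF gt_cd]) (use \<epsilon> in auto)
  then obtain g where g: "g > 0" "\<And>v. dist v (0, cvec \<delta>0) < g \<Longrightarrow> dist (gt v) (of_real a0) < a0"
    unfolding continuous_at_eps_delta using gt0 a0 by metis
  define \<gamma> where "\<gamma> = min b (min (u / 3) (g / 2))"
  have n2: "dist (complex_of_real x, cvec d) (0, cvec \<delta>0) \<le> \<bar>x\<bar> + dist d \<delta>0" for x d
    using norm_Pair_le[of "complex_of_real x" "cvec d - cvec \<delta>0"] by (simp add: dist_norm flip: cvec_diff)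
  have n3: "dist (complex_of_real w, complex_of_real x, cvec d) (0, 0, cvec \<delta>0) \<le> \<bar>w\<bar> + (\<bar>x\<bar> + dist d \<delta>0)" for w x d
    using norm_Pair_le[of "complex_of_real w" "(complex_of_real x, cvec d) - (0, cvec \<delta>0)"] n2[of x d]
    by (simp add: dist_norm)
  have "polar_orbit X Y D n \<delta>0 \<epsilon> K a0 b0 Fc gt ft U H \<kappa> \<kappa>' M KR \<rho> \<gamma>"
  proof (unfold_locales, goal_cases)
    case (5 d w x)
    then have "dist (complex_of_real w, complex_of_real x, cvec d) (0, 0, cvec \<delta>0) < u"
      using n3[of w x d] by (auto simp: \<gamma>_def)
    then have "norm (U (of_real w, of_real x, cvec d) - 1) < 1" using u(2) by (simp add: dist_norm)
    then have "\<bar>Re (U (of_real w, of_real x, cvec d) - 1)\<bar> < 1" using abs_Re_le_cmod le_less_trans by blast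
    then show ?case by simp
  next
    case (6 d x)
    then have "dist (complex_of_real x, cvec d) (0, cvec \<delta>0) < g"
      using n2[of x d] by (auto simp: \<gamma>_def)
    then have "norm (gt (of_real x, cvec d) - of_real a0) < a0" using g(2) by (simp add: dist_norm)
    then have "\<bar>Re (gt (of_real x, cvec d) - of_real a0)\<bar> < a0" using abs_Re_le_cmod le_less_trans by blast
    then show ?case by simp
  qed (use b u g in \<open>auto simp: \<gamma>_def\<close>)
  then show ?thesis using that by blast
qed

end

context polar_orbit
begin

definition Gam :: "real^'m \<Rightarrow> real \<Rightarrow> (real \<times> real) set" where
  "Gam d r = (\<lambda>\<phi>. pt d (rr \<phi> r d) \<phi>) ` {0..2*pi}"

lemma dist_less: "dist d \<delta>0 < \<gamma> \<Longrightarrow> dist d \<delta>0 < \<kappa>" "dist d \<delta>0 < \<gamma> \<Longrightarrow> dist d \<delta>0 < \<epsilon>"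
  using \<gamma> \<kappa> by auto

lemma sol_unique:
  assumes "dist d \<delta>0 < \<gamma>" "is_interval I"
    and "\<And>t. t \<in> I \<Longrightarrow> (x has_vector_derivative vfield X Y d (x t)) (at t within I)"
    and "\<And>t. t \<in> I \<Longrightarrow> (y has_vector_derivative vfield X Y d (y t)) (at t within I)"
    and "\<And>t. t \<in> I \<Longrightarrow> norm (x t) < \<epsilon>"
    and "t0 \<in> I" "x t0 = y t0" "t \<in> I"
  shows "x t = y t"
  by (rule ode_unique[of I x "vfield X Y d" y "ball 0 \<epsilon>" K t0])
     (use assms dist_less(2)[OF assms(1)] lip in auto)

text \<open>Strictly between 0 and \<open>2 * pi\<close> the sine vanishes only at
  \<open>pi\<close>, where \<open>x\<close> is negative. Hence a full turn is the first
  return.\<close>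

lemma section_point:
  assumes q: "0 < q" and \<phi>: "0 < \<phi>" "\<phi> < 2 * pi"
  shows "\<not> (snd (pt d q \<phi>) = Fr (fst (pt d q \<phi>)) d \<and> fst (pt d q \<phi>) > 0)"
proof
  assume *: "snd (pt d q \<phi>) = Fr (fst (pt d q \<phi>)) d \<and> fst (pt d q \<phi>) > 0"
  then have s: "sin \<phi> = 0" and c: "cos \<phi> > 0" using q by (auto simp: pt_def zero_less_mult_iff)
  have "\<phi> = pi"
  proof (rule ccontr)
    assume "\<phi> \<noteq> pi"
    then consider "\<phi> < pi" | "pi < \<phi>" by linarith
    then show False
    proof cases
      case 1 then show False using sin_gt_zero[of \<phi>] \<phi> s by simp
    next
      case 2 then show False using sin_lt_zero[of \<phi>] \<phi> s by simp
    qed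
  qed
  then show False using c by simp
qed

text \<open>The curve over one turn of the angle, reparametrised by time. The bound
  \<open>M * r\<close> on \<open>x\<close> later keeps the orbit where the given \<open>F\<close>
  agrees with \<open>Fr\<close>.\<close>

lemma orbit:
  assumes d: "d \<in> D" "dist d \<delta>0 < \<gamma>" and r: "0 < r" "r < \<gamma>"
  obtains \<tau> z where "\<tau> > 0"
    "\<And>t. t \<in> {0..\<tau>} \<Longrightarrow> (z has_vector_derivative vfield X Y d (z t)) (at t within {0..\<tau>})"
    "z 0 = (r, Fr r d)" "z \<tau> = (Pm r d, Fr (Pm r d) d)"
    "\<And>t. t \<in> {0..\<tau>} \<Longrightarrow> norm (z t) < \<epsilon>" "\<And>t. t \<in> {0..\<tau>} \<Longrightarrow> \<bar>fst (z t)\<bar> \<le> M * r"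
    "\<And>t. 0 < t \<Longrightarrow> t < \<tau> \<Longrightarrow> \<not> (snd (z t) = Fr (fst (z t)) d \<and> fst (z t) > 0)"
    "z ` {0..\<tau>} = Gam d r"
proof -
  note d' = dist_less[OF d(2)]
  have r': "\<bar>r\<bar> < \<kappa>'" "r < \<kappa>'" using r \<gamma> \<sigma> by auto
  have sub: "{0..2*pi} \<subseteq> {0..4*pi}" by auto
  have pos: "0 < rr \<phi> r d" "rr \<phi> r d < \<kappa>" if "\<phi> \<in> {0..2*pi}" for \<phi>
    using rr_pos[of \<phi> r d] rr_less[of \<phi> r d] that sub r r' d' by auto
  define q where "q \<phi> = 1 / ang d (rr \<phi> r d) \<phi>" for \<phi>
  have qpos: "q \<phi> > 0" if "\<phi> \<in> {0..2*pi}" for \<phi>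
    using ang_pos[of \<phi> "rr \<phi> r d" d] pos[OF that] that d' by (simp add: q_def)
  have rc: "continuous_on {0..2*pi} (\<lambda>\<phi>. rr \<phi> r d)"
    by (rule continuous_on_subset[OF rr_cont[OF r'(1) d'(1)] sub])
  have "continuous_on {0..2*pi} (\<lambda>\<phi>. (\<lambda>(\<phi>, v). den \<phi> v) (\<phi>, (complex_of_real (rr \<phi> r d), cvec d)))"
  proof (rule continuous_on_compose2[OF cont_den[of "{0..2*pi}"]])
    show "(\<lambda>\<phi>. (\<phi>, (complex_of_real (rr \<phi> r d), cvec d))) ` {0..2*pi} \<subseteq> {0..2*pi} \<times> E"
      using pos \<kappa> d'(2) by (fastforce simp: dist_commute)
  qed (intro continuous_intros rc)
  then have dc: "continuous_on {0..2*pi} (\<lambda>\<phi>. Re (den \<phi> (of_real (rr \<phi> r d), cvec d)))"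
    by (intro continuous_intros) simp
  have "continuous_on {0..2*pi} (\<lambda>\<phi>. ang d (rr \<phi> r d) \<phi>)"
    unfolding ang_def by (intro continuous_intros rc dc ballI less_imp_neq[OF Delta_pos, symmetric])
  then have qc: "continuous_on {0..2*pi} q" unfolding q_def
    using qpos by (intro continuous_intros) (auto simp: q_def less_le)
  define zz where "zz \<phi> = pt d (rr \<phi> r d) \<phi>" for \<phi>
  have dz: "(zz has_vector_derivative q \<phi> *\<^sub>R vfield X Y d (zz \<phi>)) (at \<phi> within {0..2*pi})" if "\<phi> \<in> {0..2*pi}" for \<phi>
    unfolding zz_def[abs_def] q_def
    by (rule has_vector_derivative_within_subset[OF curve_deriv[OF d(1) d'(1) r(1) r'(2)] sub])
       (use that sub in auto)
  have two_pi: "2 * pi > 0" by simp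
  obtain \<tau> \<theta> where \<theta>: "\<tau> > 0" "\<theta> 0 = 0" "\<theta> \<tau> = 2 * pi" "\<And>t. t \<in> {0..\<tau>} \<Longrightarrow> \<theta> t \<in> {0..2*pi}"
    "\<And>t. 0 < t \<Longrightarrow> t < \<tau> \<Longrightarrow> 0 < \<theta> t \<and> \<theta> t < 2*pi" "\<theta> ` {0..\<tau>} = {0..2*pi}"
    "\<And>t. t \<in> {0..\<tau>} \<Longrightarrow> ((\<lambda>t. zz (\<theta> t)) has_vector_derivative vfield X Y d (zz (\<theta> t))) (at t within {0..\<tau>})"
    using time_change[OF two_pi qc qpos dz] by blast
  show ?thesis
  proof (rule that[OF \<theta>(1) \<theta>(7)])
    show "zz (\<theta> 0) = (r, Fr r d)" using rr_0[OF r'(1) d'(1)] by (simp add: \<theta>(2) zz_def pt_def)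
    show "zz (\<theta> \<tau>) = (Pm r d, Fr (Pm r d) d)" by (simp add: \<theta>(3) zz_def pt_def Pm_def)
    show "norm (zz (\<theta> t)) < \<epsilon>" if "t \<in> {0..\<tau>}" for t
      unfolding zz_def using \<theta>(4)[OF that] sub by (intro orbit_small d r) auto
    show "\<bar>fst (zz (\<theta> t))\<bar> \<le> M * r" if "t \<in> {0..\<tau>}" for t
    proof -
      have "\<bar>rr (\<theta> t) r d\<bar> \<le> M * \<bar>r\<bar>" using \<theta>(4)[OF that] sub by (intro rr_bound r' d') auto
      then show ?thesis using abs_rc[of "rr (\<theta> t) r d" "\<theta> t"] r(1) by (simp add: zz_def pt_def)
    qed
    show "\<not> (snd (zz (\<theta> t)) = Fr (fst (zz (\<theta> t))) d \<and> fst (zz (\<theta> t)) > 0)" if "0 < t" "t < \<tau>" for t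
      unfolding zz_def by (rule section_point) (use pos \<theta>(4,5) that in auto)
    show "(\<lambda>t. zz (\<theta> t)) ` {0..\<tau>} = Gam d r"
      unfolding Gam_def \<theta>(6)[symmetric] by (simp add: zz_def image_image)
  qed
qed

lemma Gam_section:
  assumes d: "dist d \<delta>0 < \<gamma>" and r: "0 < r" "r < \<gamma>" and x: "(x, Fr x d) \<in> Gam d r" "x > 0"
  shows "x = r \<or> x = Pm r d"
proof -
  note d' = dist_less[OF d]
  have r': "\<bar>r\<bar> < \<kappa>'" "r < \<kappa>'" using r \<gamma> \<sigma> by auto
  obtain \<phi> where \<phi>: "\<phi> \<in> {0..2*pi}" "(x, Fr x d) = pt d (rr \<phi> r d) \<phi>"
    using x(1) unfolding Gam_def by blast
  have "rr \<phi> r d > 0" using \<phi>(1) by (intro rr_pos r r' d') auto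
  then have "\<not> (0 < \<phi> \<and> \<phi> < 2 * pi)"
    using section_point[of "rr \<phi> r d" \<phi> d] \<phi>(2)[symmetric] x(2) by auto
  then have "\<phi> = 0 \<or> \<phi> = 2 * pi" using \<phi>(1) by auto
  then show ?thesis using \<phi>(2) rr_0[OF r'(1) d'(1)] by (auto simp: pt_def Pm_def)
qed

lemma Gam_start:
  assumes d: "dist d \<delta>0 < \<gamma>" and r: "0 < r" "r < \<gamma>"
  shows "(r, Fr r d) \<in> Gam d r"
  unfolding Gam_def
  by (rule image_eqI[of _ _ 0]) (use rr_0[of r d] dist_less[OF d] r \<gamma> \<sigma> in \<open>auto simp: pt_def\<close>)

lemma return_map_eq:
  assumes d: "d \<in> D" "dist d \<delta>0 < \<gamma>" and F: "\<forall>\<^sub>F x in nhds 0. F x d = Fr x d"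
  shows "\<forall>\<^sub>F r in at_right 0. return_map X Y F d r = Pm r d"
proof -
  obtain \<eta> where \<eta>: "\<eta> > 0" "\<And>x. \<bar>x\<bar> < \<eta> \<Longrightarrow> F x d = Fr x d"
    using F unfolding eventually_nhds_metric by (auto simp: dist_real_def)
  have M0: "M > 0" using M by simp
  have "return_map X Y F d r = Pm r d" if r: "0 < r" "r < min \<gamma> (\<eta> / M)" for r
  proof -
    have r\<gamma>: "r < \<gamma>" and Mr: "M * r < \<eta>" using r M0 by (auto simp: field_simps)
    obtain \<tau> z where z: "\<tau> > 0"
      "\<And>t. t \<in> {0..\<tau>} \<Longrightarrow> (z has_vector_derivative vfield X Y d (z t)) (at t within {0..\<tau>})"
      "z 0 = (r, Fr r d)" "z \<tau> = (Pm r d, Fr (Pm r d) d)"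
      "\<And>t. t \<in> {0..\<tau>} \<Longrightarrow> norm (z t) < \<epsilon>" "\<And>t. t \<in> {0..\<tau>} \<Longrightarrow> \<bar>fst (z t)\<bar> \<le> M * r"
      "\<And>t. 0 < t \<Longrightarrow> t < \<tau> \<Longrightarrow> \<not> (snd (z t) = Fr (fst (z t)) d \<and> fst (z t) > 0)"
      by (rule orbit[OF d r(1) r\<gamma>]) blast
    have Fz: "F (fst (z t)) d = Fr (fst (z t)) d" if "t \<in> {0..\<tau>}" for t
      using z(6)[OF that] Mr by (intro \<eta>) simp
    have zs: "F r d = Fr r d" "F (Pm r d) d = Fr (Pm r d) d"
      using Fz[of 0] Fz[of \<tau>] z(1,3,4) by auto
    have Pp: "Pm r d > 0" unfolding Pm_def
      using r\<gamma> \<gamma> \<sigma> dist_less[OF d(2)] r(1) by (intro rr_pos) auto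
    have "first_return X Y F d r (Pm r d)"
      unfolding first_return_def
    proof (intro exI conjI)
      show "\<tau> > 0" by fact
      show "solution_on X Y d {0..\<tau>} (\<lambda>t. fst (z t)) (\<lambda>t. snd (z t))"
        unfolding solution_on_vfield using z(2) by simp
      show "\<forall>t. 0 < t \<and> t < \<tau> \<longrightarrow> \<not> (snd (z t) = F (fst (z t)) d \<and> 0 < r * fst (z t))"
        using z(7) Fz r(1) by (auto simp: zero_less_mult_iff)
    qed (use z zs Pp r(1) in auto)
    moreover have "x1 = Pm r d" if fr: "first_return X Y F d r x1" for x1
    proof -
      obtain x y \<tau>' where s: "\<tau>' > 0" "solution_on X Y d {0..\<tau>'} x y" "x 0 = r" "y 0 = F r d"
        "y \<tau>' = F (x \<tau>') d" "r * x \<tau>' > 0"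
        "\<And>t. 0 < t \<Longrightarrow> t < \<tau>' \<Longrightarrow> \<not> (y t = F (x t) d \<and> r * x t > 0)" "x1 = x \<tau>'"
        using fr unfolding first_return_def by blast
      have sol: "((\<lambda>t. (x t, y t)) has_vector_derivative vfield X Y d (x t, y t)) (at t within {0..\<tau>'})"
        if "t \<in> {0..\<tau>'}" for t
        using s(2) that unfolding solution_on_vfield by blast
      have eq: "z t = (x t, y t)" if t: "t \<in> {0..min \<tau> \<tau>'}" for t
      proof (rule sol_unique[OF d(2), of "{0..min \<tau> \<tau>'}" z "\<lambda>t. (x t, y t)" 0])
        show "(z has_vector_derivative vfield X Y d (z u)) (at u within {0..min \<tau> \<tau>'})" if "u \<in> {0..min \<tau> \<tau>'}" for u
          by (rule has_vector_derivative_within_subset[OF z(2)]) (use that in auto)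
        show "((\<lambda>t. (x t, y t)) has_vector_derivative vfield X Y d (x u, y u)) (at u within {0..min \<tau> \<tau>'})"
          if "u \<in> {0..min \<tau> \<tau>'}" for u
          by (rule has_vector_derivative_within_subset[OF sol]) (use that in auto)
      qed (use z s zs t in auto)
      have "\<not> \<tau>' < \<tau>"
      proof
        assume "\<tau>' < \<tau>"
        then have "z \<tau>' = (x \<tau>', y \<tau>')" using eq[of \<tau>'] s(1) by simp
        then show False using z(7)[OF s(1) \<open>\<tau>' < \<tau>\<close>] Fz[of \<tau>'] s(1,5,6) \<open>\<tau>' < \<tau>\<close> r(1)
          by (auto simp: zero_less_mult_iff)
      qed
      moreover have "\<not> \<tau> < \<tau>'"
      proof
        assume "\<tau> < \<tau>'"
        then have "z \<tau> = (x \<tau>, y \<tau>)" using eq[of \<tau>] z(1) by simp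
        then show False using s(7)[OF z(1) \<open>\<tau> < \<tau>'\<close>] z(4) zs Pp r(1) by auto
      qed
      ultimately have "\<tau>' = \<tau>" by simp
      then show ?thesis using eq[of \<tau>] z(1,4) s(8) by simp
    qed
    ultimately have "(THE x1. first_return X Y F d r x1) = Pm r d" by (rule the_equality)
    then show ?thesis using r(1) by (simp add: return_map_def)
  qed
  then show ?thesis
    using \<gamma> \<eta>(1) M0 unfolding eventually_at_right_field by (intro exI[of _ "min \<gamma> (\<eta> / M)"]) auto
qed

lemma fixed_periodic:
  assumes d: "d \<in> D" "dist d \<delta>0 < \<gamma>" and r: "0 < r" "r < \<gamma>" and P: "Pm r d = r"
  shows "periodic_orbit X Y d (Gam d r)"
proof -
  obtain \<tau> z where z: "\<tau> > 0"
      "\<And>t. t \<in> {0..\<tau>} \<Longrightarrow> (z has_vector_derivative vfield X Y d (z t)) (at t within {0..\<tau>})"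
      "z 0 = (r, Fr r d)" "z \<tau> = (Pm r d, Fr (Pm r d) d)" "z ` {0..\<tau>} = Gam d r"
    by (rule orbit[OF d r]) blast
  have "z 0 = z \<tau>" using z P by simp
  then obtain zz where zz: "\<And>t. (zz has_vector_derivative vfield X Y d (zz t)) (at t)" "\<And>t. zz (t + \<tau>) = zz t"
    "\<And>t. t \<in> {0..\<tau>} \<Longrightarrow> zz t = z t" "range zz = z ` {0..\<tau>}"
    using periodic_extension[OF z(1,2)] by metis
  \<comment> \<open>The point at angle \<open>pi\<close> has negative \<open>x\<close>, so the
    closed solution is not constant.\<close>
  have "pt d (rr pi r d) pi \<in> Gam d r" unfolding Gam_def by (rule imageI) auto
  then obtain t where t: "zz t = pt d (rr pi r d) pi" using zz(4) z(5) by (metis imageE)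
  have "rr pi r d > 0" using r \<gamma> \<sigma> dist_less[OF d(2)] by (intro rr_pos) auto
  then have "fst (zz t) < 0" by (simp add: t pt_def)
  moreover have "fst (zz 0) = r" using zz(3)[of 0] z(1,3) by simp
  ultimately have ne: "zz t \<noteq> zz 0" using r(1) by auto
  have "solution_on X Y d UNIV (\<lambda>t. fst (zz t)) (\<lambda>t. snd (zz t))"
    unfolding solution_on_vfield using zz(1) by simp
  moreover have "\<exists>t. (fst (zz t), snd (zz t)) \<noteq> (fst (zz 0), snd (zz 0))" using ne by auto
  moreover have "Gam d r = range (\<lambda>t. (fst (zz t), snd (zz t)))" using zz(4) z(5) by simp
  moreover have "\<forall>t. fst (zz (t + \<tau>)) = fst (zz t) \<and> snd (zz (t + \<tau>)) = snd (zz t)" using zz(2) by simp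
  ultimately show ?thesis using z(1) unfolding periodic_orbit_def by blast
qed

lemma Pm_deriv:
  assumes d: "dist d \<delta>0 < \<kappa>" and r: "\<bar>r\<bar> < \<kappa>'"
  shows "isCont (\<lambda>r. Pm r d) r"
proof -
  have c: "isCont (\<rho> (2 * pi)) (complex_of_real r, cvec d)"
    by (rule cdiff_on_isCont[OF \<rho>_cd]) (use in_dom[OF r d] in auto)
  have "isCont (\<lambda>r. \<rho> (2 * pi) (complex_of_real r, cvec d)) r"
    by (rule isCont_o2[where f = "\<lambda>r. (complex_of_real r, cvec d)", OF _ c]) (intro continuous_intros)
  then show ?thesis unfolding Pm_def rr_def by (rule isCont_Re)
qed

lemma vfield_xy:
  assumes d: "d \<in> D" "dist d \<delta>0 < \<gamma>" and xw: "\<bar>x\<bar> < \<gamma>" "\<bar>y - Fr x d\<bar> < \<gamma>"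
  shows "y + X x y d = (y - Fr x d) * Re (U (of_real (y - Fr x d), of_real x, cvec d))"
    "y = Fr x d \<Longrightarrow> Y x y d = - (x ^ (2 * n - 1) * Re (gt (of_real x, cvec d)))"
proof -
  have e: "\<bar>x\<bar> < \<epsilon>" "\<bar>y - Fr x d\<bar> < \<epsilon>" using xw \<gamma> \<kappa> by auto
  note d' = dist_less[OF d(2)]
  have "complex_of_real (y + X x y d) = of_real (y - Fr x d) * U (of_real (y - Fr x d), of_real x, cvec d)"
    using xdot[OF d(1) d'(2) e] by (simp add: Fr_def)
  from arg_cong[OF this, of Re]
  show "y + X x y d = (y - Fr x d) * Re (U (of_real (y - Fr x d), of_real x, cvec d))"
    by (simp flip: of_real_diff)
  assume y: "y = Fr x d"
  have "complex_of_real (Y x y d) = - (of_real x ^ (2 * n - 1) * gt (of_real x, cvec d))"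
    using ydot[OF d(1) d'(2) e(1), of 0] \<epsilon> y by (simp add: Fr_def)
  from arg_cong[OF this, of Re] show "Y x y d = - (x ^ (2 * n - 1) * Re (gt (of_real x, cvec d)))"
    by (simp flip: of_real_power)
qed

lemma Fr_0: "d \<in> D \<Longrightarrow> dist d \<delta>0 < \<gamma> \<Longrightarrow> Fr 0 d = 0"
  using Fc0[of d] dist_less[of d] by (simp add: Fr_def)

lemma vfield_0: "d \<in> D \<Longrightarrow> dist d \<delta>0 < \<gamma> \<Longrightarrow> vfield X Y d (0, 0) = (0, 0)"
  using vfield_xy[of d 0 0] Fr_0[of d] \<gamma> n by (simp add: vfield_def)

text \<open>Where \<open>x\<close> is maximal, a closed orbit meets the section
  \<open>w = 0\<close>, \<open>x > 0\<close>. Its successive returns from there never increase, stay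
  on the compact orbit and converge to a fixed point on it; the limit is positive because the orbit
  avoids the equilibrium.\<close>

lemma periodic_fixed:
  assumes d: "d \<in> D" "dist d \<delta>0 < \<gamma>"
    and e: "e \<le> \<gamma> / 2" "\<And>x. \<bar>x\<bar> < e \<Longrightarrow> \<bar>Fr x d\<bar> < \<gamma> / 2"
    and po: "periodic_orbit X Y d Q" and Q: "Q \<subseteq> ball 0 e"
  obtains r where "0 < r" "r < e" "Pm r d = r" "Q = Gam d r"
proof -
  note d' = dist_less[OF d(2)]
  obtain x y T where T: "T > 0" and sol: "solution_on X Y d UNIV x y"
    and per: "\<And>t. x (t + T) = x t" "\<And>t. y (t + T) = y t"
    and nc: "\<exists>t. (x t, y t) \<noteq> (x 0, y 0)" and Qr: "Q = range (\<lambda>t. (x t, y t))"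
    using po unfolding periodic_orbit_def by blast
  define z where "z t = (x t, y t)" for t
  have dz: "(z has_vector_derivative vfield X Y d (z t)) (at t)" for t
    using sol unfolding solution_on_vfield z_def[abs_def] by auto
  have dx: "(x has_real_derivative y t + X (x t) (y t) d) (at t)" and dy: "(y has_real_derivative Y (x t) (y t) d) (at t)" for t
    using sol unfolding solution_on_def by auto
  have zper: "z (t + T) = z t" for t using per by (simp add: z_def)
  have Qz: "Q = range z" using Qr by (simp add: z_def[abs_def])
  have ze: "norm (z t) < e" for t
  proof -
    have "z t \<in> Q" by (simp add: Qz)
    then have "z t \<in> ball 0 e" using Q by blast
    then show ?thesis by simp
  qed
  have xe: "\<bar>x t\<bar> < e" "\<bar>y t\<bar> < e" for t
    using ze[of t] norm_fst_le[of "x t" "y t"] norm_snd_le[of "y t" "x t"] by (auto simp: z_def)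
  have small: "\<bar>x t\<bar> < \<gamma>" "\<bar>y t - Fr (x t) d\<bar> < \<gamma>" for t
    using xe[of t] e(1) e(2)[OF xe(1)[of t]] by auto
  have z\<epsilon>: "norm (z t) < \<epsilon>" for t using ze[of t] e(1) \<gamma> \<kappa> by auto
  have shift: "((\<lambda>t. z (s + t)) has_vector_derivative vfield X Y d (z (s + t))) (at t)" for s t
  proof -
    have "((\<lambda>t. s + t) has_vector_derivative 1) (at t)" by (auto intro!: derivative_eq_intros)
    from vector_diff_chain_at[OF this dz] show ?thesis by (simp add: o_def)
  qed
  have no: "z t \<noteq> (0, 0)" for t
  proof
    assume 0: "z t = (0, 0)"
    have "z s = (\<lambda>_. (0, 0)) s" for s
    proof (rule sol_unique[OF d(2), of UNIV z "\<lambda>_. (0, 0)" t])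
      show "((\<lambda>_. (0, 0)) has_vector_derivative vfield X Y d (0, 0)) (at t within UNIV)" for t :: real
        unfolding vfield_0[OF d] by (simp flip: zero_prod_def)
    qed (use dz z\<epsilon> 0 in auto)
    then show False using nc by (simp add: z_def)
  qed
  have xc: "continuous_on A x" for A using dx by (intro continuous_at_imp_continuous_on ballI DERIV_isCont)
  have "\<exists>t1\<in>{0..T}. \<forall>t\<in>{0..T}. x t \<le> x t1"
    by (rule continuous_attains_sup) (use xc T in auto)
  then obtain t1 where t1: "\<And>t. t \<in> {0..T} \<Longrightarrow> x t \<le> x t1" by blast
  have max: "x t \<le> x t1" for t
  proof -
    obtain u where "u \<in> {0..0 + T}" "x u = x t" by (rule periodic_reduce[where f = x and s = 0 and t = t, OF T per(1)])
    then show ?thesis using t1[of u] by simp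
  qed
  have x': "(x has_real_derivative (y t - Fr (x t) d) * Re (U (of_real (y t - Fr (x t) d), of_real (x t), cvec d))) (at t)" for t
    using dx[of t] vfield_xy(1)[OF d small] by simp
  have "(y t1 - Fr (x t1) d) * Re (U (of_real (y t1 - Fr (x t1) d), of_real (x t1), cvec d)) = 0"
    by (rule DERIV_local_max[OF x', of 1]) (use max in auto)
  then have w0: "y t1 = Fr (x t1) d" using U_pos[OF d(2) small(2,1)[of t1]] by simp
  have "x t1 \<noteq> 0" using no[of t1] w0 Fr_0[OF d] by (auto simp: z_def)
  \<comment> \<open>At a maximum with negative \<open>x\<close>, \<open>w\<close> would increase
    through 0, and \<open>x\<close> would then grow beyond its maximum.\<close>
  have xpos: "x t1 > 0"
  proof (rule ccontr)
    assume "\<not> x t1 > 0"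
    then have xn: "x t1 < 0" using \<open>x t1 \<noteq> 0\<close> by simp
    define w where "w t = y t - Fr (x t) d" for t
    have "odd (2 * n - 1)" using n by simp
    then have "x t1 ^ (2 * n - 1) < 0" using xn by (simp add: power_less_zero_eq)
    then have Yp: "Y (x t1) (y t1) d > 0"
      using vfield_xy(2)[OF d small w0] gt_pos[OF d(2) small(1)[of t1]] by (simp add: mult_neg_pos)
    have "((\<lambda>t. Fr (x t) d) has_real_derivative dFr (x t1) d * 0) (at t1)"
    proof (rule DERIV_chain2[where f = "\<lambda>x. Fr x d" and g = x])
      show "((\<lambda>x. Fr x d) has_real_derivative dFr (x t1) d) (at (x t1))"
        using small(1)[of t1] \<gamma> \<kappa> by (intro Fr_deriv d') auto
      show "(x has_real_derivative 0) (at t1)" using x'[of t1] w0 by simp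
    qed
    from DERIV_diff[OF dy[of t1] this] have "(w has_real_derivative Y (x t1) (y t1) d) (at t1)"
      by (simp add: w_def[abs_def])
    from DERIV_pos_inc_right[OF this Yp] obtain h where h: "h > 0" "\<And>k. k > 0 \<Longrightarrow> k < h \<Longrightarrow> w t1 < w (t1 + k)"
      by blast
    have w1: "w t1 = 0" using w0 by (simp add: w_def)
    have "x t1 < x (t1 + h / 2)"
    proof (rule DERIV_pos_imp_increasing_open[where f = x])
      show "t1 < t1 + h / 2" using h by simp
      fix s assume s: "t1 < s" "s < t1 + h / 2"
      have "w s > 0" using h(2)[of "s - t1"] s w1 h(1) by simp
      then show "\<exists>l. (x has_real_derivative l) (at s) \<and> 0 < l"
        using x'[of s] U_pos[OF d(2) small(2,1)[of s]] unfolding w_def by (blast intro: mult_pos_pos)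
    qed (rule xc)
    then show False using max[of "t1 + h / 2"] by simp
  qed
  have ret: "\<exists>\<tau>>0. z (s + \<tau>) = (Pm r d, Fr (Pm r d) d) \<and> z ` {s..s + \<tau>} = Gam d r"
    if s: "z s = (r, Fr r d)" "0 < r" for s r
  proof -
    have r\<gamma>: "r < \<gamma>" using small(1)[of s] s by (simp add: z_def)
    obtain \<tau> u where u: "\<tau> > 0"
      "\<And>t. t \<in> {0..\<tau>} \<Longrightarrow> (u has_vector_derivative vfield X Y d (u t)) (at t within {0..\<tau>})"
      "u 0 = (r, Fr r d)" "u \<tau> = (Pm r d, Fr (Pm r d) d)" "u ` {0..\<tau>} = Gam d r"
      by (rule orbit[OF d s(2) r\<gamma>]) blast
    have eq: "z (s + t) = u t" if t: "t \<in> {0..\<tau>}" for t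
    proof (rule sol_unique[OF d(2), of "{0..\<tau>}" "\<lambda>t. z (s + t)" u 0])
      show "((\<lambda>t. z (s + t)) has_vector_derivative vfield X Y d (z (s + t))) (at t within {0..\<tau>})" for t
        by (rule has_vector_derivative_at_within[OF shift])
    qed (use u s z\<epsilon> t in auto)
    have "z ` {s..s + \<tau>} = (\<lambda>t. z (s + t)) ` {0..\<tau>}"
    proof -
      have "{s..s + \<tau>} = (\<lambda>t. s + t) ` {0..\<tau>}" by simp
      then show ?thesis by (metis image_image)
    qed
    also have "\<dots> = Gam d r" using eq u(5) by (metis image_cong)
    finally show ?thesis using u(1,4) eq[of \<tau>] by (intro exI[of _ \<tau>]) auto
  qed
  define rj where "rj j = ((\<lambda>r. Pm r d) ^^ j) (x t1)" for j
  have rj0: "rj 0 = x t1" and rjS: "rj (Suc j) = Pm (rj j) d" for j by (simp_all add: rj_def)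
  have rj: "0 < rj j \<and> (\<exists>s. z s = (rj j, Fr (rj j) d))" for j
  proof (induction j)
    case 0
    then show ?case using xpos w0 by (auto simp: rj0 z_def)
  next
    case (Suc j)
    then obtain s where s: "z s = (rj j, Fr (rj j) d)" by blast
    have "rj j < \<gamma>" using small(1)[of s] s by (simp add: z_def)
    then have "0 < rj (Suc j)" unfolding rjS Pm_def using Suc \<gamma> \<sigma> d' by (intro rr_pos) auto
    then show ?case using ret[OF s] Suc unfolding rjS by blast
  qed
  have rj_le: "rj j \<le> x t1" for j
  proof -
    obtain s where "z s = (rj j, Fr (rj j) d)" using rj[of j] by blast
    then have "x s = rj j" by (simp add: z_def)
    then show ?thesis using max[of s] by simp
  qed
  \<comment> \<open>The first inequality is maximality of \<open>x t1\<close>; monotonicity of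
    \<open>Pm\<close> propagates it.\<close>
  have dec: "rj (Suc j) \<le> rj j" for j
  proof (induction j)
    case 0
    then show ?case using rj_le[of 1] by (simp add: rj0)
  next
    case (Suc j)
    have b: "\<bar>rj (Suc j)\<bar> < \<kappa>'" "\<bar>rj j\<bar> < \<kappa>'"
      using rj[of j] rj[of "Suc j"] rj_le[of j] rj_le[of "Suc j"] small(1)[of t1] \<gamma> \<sigma> by auto
    show ?case
    proof (cases "rj (Suc j) = rj j")
      case False
      then have "rj (Suc j) < rj j" using Suc by simp
      then have "Pm (rj (Suc j)) d < Pm (rj j) d"
        unfolding Pm_def using b d' by (intro rr_mono) auto
      then show ?thesis by (simp add: rjS)
    qed (simp add: rjS)
  qed
  have "decseq rj" using dec by (rule decseq_SucI)
  moreover have "\<And>j. 0 \<le> rj j" using rj less_imp_le by blast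
  ultimately obtain L where L: "rj \<longlonglongrightarrow> L" "\<And>j. L \<le> rj j" using decseq_convergent by blast
  have L0: "L \<ge> 0" by (rule LIMSEQ_le_const[OF L(1)]) (use \<open>\<And>j. 0 \<le> rj j\<close> in blast)
  have Lg: "L < \<gamma>" using L(2)[of 0] small(1)[of t1] by (simp add: rj0)
  have "isCont (\<lambda>x. Fr x d) L" using L0 Lg \<gamma> \<kappa> by (intro DERIV_isCont[OF Fr_deriv(1)] d') auto
  then have lim: "(\<lambda>j. (rj j, Fr (rj j) d)) \<longlonglongrightarrow> (L, Fr L d)"
    by (intro tendsto_Pair L isCont_tendsto_compose[of _ "\<lambda>x. Fr x d"])
  have "compact Q"
  proof -
    have "Q = z ` {0..0 + T}" unfolding Qz by (rule periodic_range[where f = z, OF T zper])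
    moreover have "continuous_on {0..0 + T} z"
      using dz by (intro continuous_at_imp_continuous_on ballI) (metis has_vector_derivative_continuous)
    ultimately show ?thesis by (simp add: compact_continuous_image)
  qed
  then have "(L, Fr L d) \<in> Q"
    by (rule closed_sequentially[OF compact_imp_closed _ lim]) (use rj Qz in \<open>metis rangeI\<close>)
  then obtain s where s: "z s = (L, Fr L d)" using Qz by auto
  have "L \<noteq> 0" using no[of s] s Fr_0[OF d] by auto
  then have Lp: "L > 0" using L0 by simp
  have PL: "Pm L d = L"
  proof (rule LIMSEQ_unique)
    show "(\<lambda>j. Pm (rj j) d) \<longlonglongrightarrow> Pm L d"
      using L0 Lg \<gamma> \<sigma> d' by (intro isCont_tendsto_compose[of _ "\<lambda>r. Pm r d"] Pm_deriv L(1)) auto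
    show "(\<lambda>j. Pm (rj j) d) \<longlonglongrightarrow> L" using LIMSEQ_Suc[OF L(1)] by (simp add: rjS)
  qed
  obtain \<tau> where \<tau>: "\<tau> > 0" "z (s + \<tau>) = z s" "z ` {s..s + \<tau>} = Gam d L"
    using ret[OF s Lp] PL s by auto
  \<comment> \<open>The return time replaces the arbitrary period \<open>T\<close>, because the arc
    over one return is known to be \<open>Gam d L\<close>.\<close>
  have "z (t + \<tau>) = z t" for t
  proof -
    have "z (\<tau> + t) = z t"
    proof (rule sol_unique[OF d(2), of UNIV "\<lambda>t. z (\<tau> + t)" z s])
      show "((\<lambda>t. z (\<tau> + t)) has_vector_derivative vfield X Y d (z (\<tau> + t))) (at t within UNIV)" for t
        using shift[of \<tau> t] by simp
      show "z (\<tau> + s) = z s" using \<tau>(2) by (simp add: add.commute)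
    qed (use dz z\<epsilon> in auto)
    then show ?thesis by (simp add: add.commute)
  qed
  from periodic_range[where f = z and s = s, OF \<tau>(1) this] have "Q = Gam d L" using Qz \<tau>(3) by simp
  moreover have "L < e" using xe(1)[of s] s by (simp add: z_def)
  ultimately show ?thesis using that Lp PL by blast
qed

end

section \<open>Counting closed orbits\<close>

lemma p_shift_eq: "p_shift n = (if even n then 1 else 0)"
  by (simp add: p_shift_def)

context polar_orbit
begin

abbreviation "B \<equiv> ball (0::complex) \<kappa>' \<times> ball (cvec \<delta>0) \<kappa>"

definition dc :: "complex \<times> (complex^'m) \<Rightarrow> complex" where
  "dc v = \<rho> (2 * pi) v - fst v"

text \<open>The coefficients on a full neighbourhood of \<open>\<delta>0\<close>, where they are
  differentiable; at nearby parameters of \<open>D\<close> they agree with \<open>v_coeff\<close>,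
  by \<open>v_coeff_V\<close>.\<close>

definition V :: "nat \<Rightarrow> real^'m \<Rightarrow> real" where
  "V j d = Re ((divx ^^ j) dc (0, cvec d))"

abbreviation "pn \<equiv> p_shift n"

lemma B: "open B" "radial B"
  by (auto intro: open_Times radial_Times)

lemma B0: "dist d \<delta>0 < \<kappa> \<Longrightarrow> (0, cvec d) \<in> B"
  using in_dom[of 0 d] \<kappa>' by simp

lemma dc_cd: "dc cdiff_on B"
  unfolding dc_def[abs_def] by (intro cdiff_on_diff \<rho>_cd cdiff_on_fst cdiff_on_id) auto

lemma dc_eq: "\<bar>r\<bar> < \<kappa>' \<Longrightarrow> dist d \<delta>0 < \<kappa> \<Longrightarrow> dc (of_real r, cvec d) = of_real (Pm r d - r)"
  using rr_eq[of "2*pi" r d] by (simp add: dc_def Pm_def)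

lemma dc_real: "real_on B (range cvec) dc"
  unfolding real_on_def
proof (intro allI impI)
  fix r p assume p: "p \<in> range (cvec :: real^'m \<Rightarrow> complex^'m)" "(complex_of_real r, p) \<in> B"
  then obtain d where d: "p = cvec d" by blast
  then have "\<bar>r\<bar> < \<kappa>'" "dist d \<delta>0 < \<kappa>" using p(2) by (auto simp: dist_commute)
  then show "dc (complex_of_real r, p) \<in> \<real>" using dc_eq d by simp
qed

lemma V_eq: "dist d \<delta>0 < \<kappa> \<Longrightarrow> (divx ^^ j) dc (0, cvec d) = of_real (V j d)"
  using real_on_divx_pow[OF dc_cd B dc_real, of j] B0[of d] unfolding real_on_def V_def
  by (metis of_real_0 of_real_Re rangeI)

lemma V_0: "dist d \<delta>0 < \<kappa> \<Longrightarrow> V 0 d = 0"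
  using dc_eq[of 0 d] rr_zero[of "2*pi" d] \<kappa>' by (simp add: V_def Pm_def)

text \<open>\<open>Pb\<close> is analytic and equals the return map at small positive radii, and
  \<open>fps_eq_at_right\<close> leaves its series as the only candidate for the definite
  description.\<close>

lemma v_coeff_V:
  assumes d: "d \<in> D" "dist d \<delta>0 < \<gamma>" and F: "\<forall>\<^sub>F x in nhds 0. F x d = Fr x d"
  shows "v_coeff X Y F j d = V j d"
proof -
  note d' = dist_less[OF d(2)]
  define Pb where "Pb x = Re (dc (of_real x, cvec d)) + x" for x
  define S where "S = Abs_fps (\<lambda>j. V j d) + fps_X"
  have e: "Pb has_fps_expansion S"
    unfolding Pb_def[abs_def] S_def V_def
    by (intro has_fps_expansion_add cdiff_real_fps_expansion[OF dc_cd B B0] d' has_fps_expansion_fps_X)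
  have "\<forall>\<^sub>F r in at_right (0::real). r < \<kappa>'" "\<forall>\<^sub>F r in at_right (0::real). 0 < r"
    using \<kappa>'(1) by (auto simp: eventually_at_right_field)
  with return_map_eq[where F = F, OF d F] have ev: "\<forall>\<^sub>F r in at_right 0. Pb r = return_map X Y F d r"
  proof eventually_elim
    case (elim r)
    then show ?case using dc_eq[of r d] d' by (simp add: Pb_def)
  qed
  have "return_series X Y F d = S"
    unfolding return_series_def
  proof (rule the_equality)
    show "\<exists>Pbar. Pbar has_fps_expansion S \<and> (\<forall>\<^sub>F x0 in at_right 0. Pbar x0 = return_map X Y F d x0)"
      using e ev by blast
    fix p assume "\<exists>Pbar. Pbar has_fps_expansion p \<and> (\<forall>\<^sub>F x0 in at_right 0. Pbar x0 = return_map X Y F d x0)"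
    then obtain Q where Q: "Q has_fps_expansion p" "\<forall>\<^sub>F x0 in at_right 0. Q x0 = return_map X Y F d x0" by blast
    have "\<forall>\<^sub>F x in at_right 0. Q x = Pb x" using Q(2) ev by eventually_elim simp
    then show "p = S" by (rule fps_eq_at_right[OF Q(1) e])
  qed
  then show ?thesis by (simp add: v_coeff_def S_def)
qed

text \<open>The quotient by \<open>r ^ m\<close> is continuous with value \<open>V m d\<close> at 0.
  Stating the sign as a product covers both signs of \<open>r\<close> and of the
  coefficient.\<close>

lemma disp_sign:
  assumes d: "dist d \<delta>0 < \<kappa>" and lo: "\<And>i. i < m \<Longrightarrow> V i d = 0" and hi: "V m d \<noteq> 0"
  obtains b where "b > 0" "b \<le> \<sigma>" "\<And>r. \<bar>r\<bar> < b \<Longrightarrow> r \<noteq> 0 \<Longrightarrow> (Pm r d - r) * (r ^ m * V m d) > 0"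
proof -
  define g where "g r = Re ((divx ^^ m) dc (of_real r, cvec d))" for r
  have c: "isCont ((divx ^^ m) dc) (of_real 0, cvec d)"
    by (rule cdiff_on_isCont[OF cdiff_divx_pow[OF dc_cd B]]) (use B0[OF d] in simp)
  have "isCont (\<lambda>r. (divx ^^ m) dc (of_real r, cvec d)) 0"
    by (rule isCont_o2[where f = "\<lambda>r. (complex_of_real r, cvec d)", OF _ c]) (intro continuous_intros)
  then have "isCont g 0" unfolding g_def by (rule isCont_Re)
  moreover have g0: "g 0 = V m d" by (simp add: g_def V_def)
  moreover have "\<bar>V m d\<bar> > 0" using hi by simp
  ultimately have "\<exists>b>0. \<forall>r. dist r 0 < b \<longrightarrow> dist (g r) (V m d) < \<bar>V m d\<bar>"
    unfolding continuous_at_eps_delta by metis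
  then obtain b where b: "b > 0" "\<And>r. \<bar>r\<bar> < b \<Longrightarrow> \<bar>g r - V m d\<bar> < \<bar>V m d\<bar>"
    by (auto simp: dist_real_def)
  show ?thesis
  proof (rule that[of "min b \<sigma>"])
    show "min b \<sigma> > 0" "min b \<sigma> \<le> \<sigma>" using b \<sigma> by auto
    fix r assume r: "\<bar>r\<bar> < min b \<sigma>" "r \<noteq> 0"
    have r': "\<bar>r\<bar> < \<kappa>'" using r \<sigma> by auto
    have "dc (of_real r, cvec d) = of_real r ^ m * (divx ^^ m) dc (of_real r, cvec d)"
      by (rule divx_pow_zero[OF dc_cd B in_dom[OF r' d]]) (simp add: V_eq[OF d] lo)
    then have "of_real (Pm r d - r) = of_real (r ^ m) * (divx ^^ m) dc (of_real r, cvec d)"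
      using dc_eq[OF r' d] by simp
    from arg_cong[OF this, of Re] have e: "Pm r d - r = r ^ m * g r" by (simp add: g_def)
    have "g r * V m d > 0" using b(2)[of r] r(1) hi by (auto simp: abs_if zero_less_mult_iff split: if_splits)
    moreover have "(r ^ m)\<^sup>2 > 0" using r(2) by simp
    ultimately have "(r ^ m * r ^ m) * (g r * V m d) > 0" unfolding power2_eq_square by (rule mult_pos_pos[rotated])
    then show "(Pm r d - r) * (r ^ m * V m d) > 0" unfolding e by (simp add: mult_ac)
  qed
qed

lemma hm_mono: "\<bar>r\<bar> < \<kappa>' \<Longrightarrow> \<bar>s\<bar> < \<kappa>' \<Longrightarrow> dist d \<delta>0 < \<kappa> \<Longrightarrow> r < s \<Longrightarrow> hm r d < hm s d"
  unfolding hm_def by (rule rr_mono) auto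

text \<open>An outward spiral moves the positive fixed-point displacement and its reflection in the directions
  prescribed by the identities for negative radii, which fixes the parity of the leading exponent.\<close>
lemma leading_parity:
  assumes d: "dist d \<delta>0 < \<kappa>" and lo: "\<And>i. i < m \<Longrightarrow> V i d = 0" and hi: "V m d \<noteq> 0"
  shows "even m \<longleftrightarrow> even n"
proof -
  obtain b where b: "b > 0" "b \<le> \<sigma>" "\<And>r. \<bar>r\<bar> < b \<Longrightarrow> r \<noteq> 0 \<Longrightarrow> (Pm r d - r) * (r ^ m * V m d) > 0"
    using disp_sign[OF d lo hi] by blast
  have MM: "M * M > 0" "M > 0" using M by auto
  \<comment> \<open>The factor \<open>M * M\<close> keeps even the half-turn image of the returned
    radius below \<open>b\<close>.\<close>
  define r where "r = b / (2 * (M * M))"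
  have r: "0 < r" "M * (M * r) < b" using b MM by (simp_all add: r_def)
  have a: "1 * r \<le> M * r" "1 * (M * r) \<le> M * (M * r)" using M r(1) by (intro mult_right_mono; simp)+
  have rb: "r < b" "M * r < b" using r a by linarith+
  have r\<sigma>: "\<bar>r\<bar> < \<sigma>" using rb b r by simp
  note mb = map_bounds[OF r\<sigma> d]
  have Pb: "\<bar>Pm r d\<bar> < b" using mb(2) rb r by simp
  have hPb: "\<bar>hm (Pm r d) d\<bar> < b"
  proof -
    have "\<bar>hm (Pm r d) d\<bar> \<le> M * \<bar>Pm r d\<bar>" unfolding hm_def by (rule rr_bound[OF _ mb(4) d]) auto
    also have "\<dots> \<le> M * (M * r)" using mb(2) MM r by (intro mult_left_mono) auto
    finally show ?thesis using r(2) by simp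
  qed
  have hb: "\<bar>hm r d\<bar> < b" using mb(3) rb r by simp
  have Pp: "Pm r d > 0" unfolding Pm_def using r(1) mb(1) d by (intro rr_pos) auto
  have hp: "hm r d > 0" unfolding hm_def using r(1) mb(1) d by (intro rr_pos) auto
  have hPp: "hm (Pm r d) d > 0" unfolding hm_def using Pp mb(4) d by (intro rr_pos) auto
  have s1: "(Pm r d - r) * V m d > 0"
  proof (rule zero_less_mult_pos2)
    show "0 < (Pm r d - r) * V m d * r ^ m" using b(3)[of r] rb r(1) by (simp add: mult_ac)
  qed (use r(1) in simp)
  \<comment> \<open>The half-turn map is increasing and so transfers the sign of the
    displacement.\<close>
  have hs: "(hm (Pm r d) d - hm r d) * V m d > 0"
    using s1 hm_mono[OF mb(1) mb(4) d] hm_mono[OF mb(4) mb(1) d] by (auto simp: zero_less_mult_iff)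
  show ?thesis
  proof (cases "even n")
    case False
    \<comment> \<open>The displacement at the paired negative radius has the opposite sign, which is
      possible only for an odd power.\<close>
    have "(Pm (- hm r d) d - (- hm r d)) * ((- hm r d) ^ m * V m d) > 0"
      using b(3)[of "- hm r d"] hb hp by simp
    then have "- (hm (Pm r d) d - hm r d) * ((- hm r d) ^ m * V m d) > 0"
      using Pm_odd[OF False r\<sigma> d] by simp
    then have "(- hm r d) ^ m < 0" using hs by (auto simp: zero_less_mult_iff mult_less_0_iff)
    then have "odd m" by (auto simp: power_less_zero_eq)
    then show ?thesis using False by simp
  next
    case True
    \<comment> \<open>The reversed angle turns the map into its inverse, so here the sign is kept
      and the power is even.\<close>
    have "(Pm (- hm (Pm r d) d) d - (- hm (Pm r d) d)) * ((- hm (Pm r d) d) ^ m * V m d) > 0"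
      using b(3)[of "- hm (Pm r d) d"] hPb hPp by simp
    then have "(hm (Pm r d) d - hm r d) * ((- hm (Pm r d) d) ^ m * V m d) > 0"
      using Pm_even[OF True r\<sigma> d] by simp
    then have "(- hm (Pm r d) d) ^ m > 0" using hs by (auto simp: zero_less_mult_iff mult_less_0_iff)
    then have "even m" using hPp by (auto simp: zero_less_power_eq)
    then show ?thesis using True by simp
  qed
qed

text \<open>The least index of a nonzero coefficient is positive and has the parity of
  \<open>n\<close>, so it is at least 1 for odd and at least 2 for even \<open>n\<close>; both
  values are \<open>1 + pn\<close>.\<close>

lemma V_low:
  assumes d: "dist d \<delta>0 < \<kappa>" and i: "i < 1 + pn"
  shows "V i d = 0"
proof (rule ccontr)
  assume "V i d \<noteq> 0"
  define m where "m = (LEAST m. V m d \<noteq> 0)"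
  have m: "V m d \<noteq> 0" "m \<le> i" "\<And>j. j < m \<Longrightarrow> V j d = 0"
    unfolding m_def using \<open>V i d \<noteq> 0\<close> LeastI Least_le not_less_Least by (metis (mono_tags, lifting))+
  have "even m \<longleftrightarrow> even n" by (rule leading_parity[OF d m(3,1)])
  moreover have "m \<noteq> 0" using m(1) V_0[OF d] by (cases m) auto
  ultimately show False using m(2) i by (auto simp: p_shift_eq split: if_splits)
qed

text \<open>Coefficients of the other parity vanish along with the lower admissible ones: a least
  nonzero index would itself have the form \<open>2 * j - 1 + pn\<close>.\<close>

lemma V_leading:
  assumes d: "dist d \<delta>0 < \<kappa>" and i: "i \<ge> 1" and lo: "\<And>j. 1 \<le> j \<Longrightarrow> j < i \<Longrightarrow> V (2 * j - 1 + pn) d = 0"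
    and hi: "V (2 * i - 1 + pn) d \<noteq> 0" and l: "l < 2 * i - 1 + pn"
  shows "V l d = 0"
proof (rule ccontr)
  assume "V l d \<noteq> 0"
  define m where "m = (LEAST m. V m d \<noteq> 0)"
  have m: "V m d \<noteq> 0" "m \<le> l" "\<And>j. j < m \<Longrightarrow> V j d = 0"
    unfolding m_def using \<open>V l d \<noteq> 0\<close> LeastI Least_le not_less_Least by (metis (mono_tags, lifting))+
  have "even m \<longleftrightarrow> even n" by (rule leading_parity[OF d m(3,1)])
  moreover have "m \<ge> 1 + pn" using m(1) V_low[OF d, of m] by force
  ultimately have "odd (m - pn)" "m - pn \<ge> 1" by (auto simp: p_shift_eq split: if_splits)
  then obtain q where q: "m - pn = 2 * q + 1" by (elim oddE)
  then have "m = 2 * (q + 1) - 1 + pn" using \<open>m \<ge> 1 + pn\<close> by simp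
  moreover have "q + 1 < i" using m(2) l calculation by simp
  ultimately show False using lo[of "q + 1"] m(1) by simp
qed

text \<open>The displacement without the factor \<open>r ^ (1 + pn)\<close> that it carries at every
  real parameter near \<open>\<delta>0\<close>; removing it sharpens the Rolle count for nonzero
  fixed points.\<close>

definition qc :: "complex \<times> (complex^'m) \<Rightarrow> complex" where
  "qc = (divx ^^ (1 + pn)) dc"

lemma qc_cd: "qc cdiff_on B"
  unfolding qc_def by (rule cdiff_divx_pow[OF dc_cd B])

lemma fixed_imp_qc:
  assumes r: "\<bar>r\<bar> < \<kappa>'" and d: "dist d \<delta>0 < \<kappa>" and "r \<noteq> 0" "Pm r d = r"
  shows "qc (of_real r, cvec d) = 0"
proof -
  have "dc (of_real r, cvec d) = of_real r ^ (1 + pn) * qc (of_real r, cvec d)"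
    unfolding qc_def
    by (rule divx_pow_zero[OF dc_cd B in_dom[OF r d]]) (simp add: V_eq[OF d] V_low[OF d])
  then show ?thesis using dc_eq[OF r d] assms by simp
qed

text \<open>The derivative of order \<open>i\<close> of \<open>qc\<close> in \<open>r\<close> is
  nonzero around \<open>(0, \<delta>0)\<close>, so Rolle's theorem bounds the zeros uniformly in the
  parameter.\<close>

lemma fixed_count:
  assumes V: "V (1 + pn + i) \<delta>0 \<noteq> 0"
  obtains b where "b > 0" "b \<le> \<kappa>'" "b \<le> \<kappa>"
    "\<And>d Z. dist d \<delta>0 < b \<Longrightarrow> finite Z \<Longrightarrow> (\<And>z. z \<in> Z \<Longrightarrow> \<bar>z\<bar> < b \<and> z \<noteq> 0 \<and> Pm z d = z) \<Longrightarrow> card Z \<le> i"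
proof -
  have d0: "dist \<delta>0 \<delta>0 < \<kappa>" using \<kappa> by simp
  define f where "f = (dd (1, 0) ^^ i) qc"
  have fcd: "f cdiff_on B" unfolding f_def by (rule cdiff_dd_pow[OF qc_cd B(1)])
  have "f (0, cvec \<delta>0) = fact i * (divx ^^ i) qc (0, cvec \<delta>0)"
    unfolding f_def by (rule dd_pow_divx[OF qc_cd B B0[OF d0]])
  also have "(divx ^^ i) qc = (divx ^^ (1 + pn + i)) dc"
    unfolding qc_def by (simp only: funpow_add o_apply flip: add.commute[of i])
  finally have "f (0, cvec \<delta>0) \<noteq> 0" "f (0, cvec \<delta>0) = of_real (fact i * V (1 + pn + i) \<delta>0)"
    using V V_eq[OF d0, of "1 + pn + i"] by simp_all
  then have f0: "Re (f (0, cvec \<delta>0)) \<noteq> 0" by simp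
  have "isCont (\<lambda>v. Re (f v)) (0, cvec \<delta>0)"
    by (rule isCont_Re[OF cdiff_on_isCont[OF fcd B0[OF d0]]])
  then obtain b0 where b0: "b0 > 0" "\<And>v. dist v (0, cvec \<delta>0) < b0 \<Longrightarrow> dist (Re (f v)) (Re (f (0, cvec \<delta>0))) < \<bar>Re (f (0, cvec \<delta>0))\<bar>"
    unfolding continuous_at_eps_delta using f0 by (metis zero_less_abs_iff)
  define b where "b = min (b0 / 2) (min \<kappa>' \<kappa>)"
  show ?thesis
  proof (rule that[of b])
    show "b > 0" "b \<le> \<kappa>'" "b \<le> \<kappa>" using b0 \<kappa> \<kappa>' by (auto simp: b_def)
    fix d Z assume d: "dist d \<delta>0 < b" and Z: "finite Z" "\<And>z. z \<in> Z \<Longrightarrow> \<bar>z\<bar> < b \<and> z \<noteq> 0 \<and> Pm z d = z"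
    have d\<kappa>: "dist d \<delta>0 < \<kappa>" using d by (simp add: b_def)
    have inB: "(complex_of_real x, cvec d) \<in> B" if "\<bar>x\<bar> < b" for x
      using that d\<kappa> by (intro in_dom) (simp_all add: b_def)
    show "card Z \<le> i"
    proof (rule rolle_card[of i b "\<lambda>j x. Re ((dd (1, 0) ^^ j) qc (of_real x, cvec d))" Z])
      fix j and x :: real assume "j < i" "\<bar>x\<bar> < b"
      have "((\<lambda>z. (dd (1, 0) ^^ j) qc (z, cvec d)) has_field_derivative (dd (1, 0) ^^ Suc j) qc (of_real x, cvec d)) (at (of_real x))"
        using dd_fst[OF cdiff_dd_pow[OF qc_cd B(1)] inB[OF \<open>\<bar>x\<bar> < b\<close>], of j "(1,0)"] by simp
      then have "((\<lambda>x. (dd (1, 0) ^^ j) qc (of_real x, cvec d)) has_vector_derivative (dd (1, 0) ^^ Suc j) qc (of_real x, cvec d)) (at x)"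
        by (rule has_vector_derivative_real_field)
      from bounded_linear.has_vector_derivative[OF bounded_linear_Re this]
      show "((\<lambda>x. Re ((dd (1, 0) ^^ j) qc (of_real x, cvec d))) has_real_derivative Re ((dd (1, 0) ^^ Suc j) qc (of_real x, cvec d))) (at x)"
        by (simp add: has_real_derivative_iff_has_vector_derivative)
    next
      fix x :: real assume x: "\<bar>x\<bar> < b"
      have "dist (complex_of_real x, cvec d) (0, cvec \<delta>0) \<le> \<bar>x\<bar> + dist d \<delta>0"
        using norm_Pair_le[of "complex_of_real x" "cvec d - cvec \<delta>0"] by (simp add: dist_norm flip: cvec_diff)
      also have "\<dots> < b0" using x d by (simp add: b_def)
      finally have "dist (Re (f (of_real x, cvec d))) (Re (f (0, cvec \<delta>0))) < \<bar>Re (f (0, cvec \<delta>0))\<bar>"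
        by (rule b0(2))
      then show "Re ((dd (1, 0) ^^ i) qc (of_real x, cvec d)) \<noteq> 0" by (auto simp: f_def dist_real_def)
    next
      fix z assume z: "z \<in> Z"
      have "qc (of_real z, cvec d) = 0"
        by (rule fixed_imp_qc[OF _ d\<kappa>]) (use Z(2)[OF z] in \<open>auto simp: b_def\<close>)
      then show "\<bar>z\<bar> < b \<and> Re ((dd (1, 0) ^^ 0) qc (of_real z, cvec d)) = 0" using Z(2)[OF z] by simp
    qed (rule Z(1))
  qed
qed

text \<open>A closed orbit yields one positive and one negative nonzero fixed point of the analytic return map.\<close>
lemma periodic_count:
  assumes \<delta>0: "\<delta>0 \<in> D" and V: "V (1 + pn + 2 * k) \<delta>0 \<noteq> 0"
  obtains e where "e > 0" "e \<le> \<epsilon>" "e \<le> \<gamma>"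
    "\<And>d. d \<in> D \<Longrightarrow> dist d \<delta>0 < e \<Longrightarrow> finite {Q. periodic_orbit X Y d Q \<and> Q \<subseteq> ball 0 e} \<and>
       card {Q. periodic_orbit X Y d Q \<and> Q \<subseteq> ball 0 e} \<le> k"
proof -
  obtain b where b: "b > 0" "b \<le> \<kappa>'" "b \<le> \<kappa>"
    "\<And>d Z. dist d \<delta>0 < b \<Longrightarrow> finite Z \<Longrightarrow> (\<And>z. z \<in> Z \<Longrightarrow> \<bar>z\<bar> < b \<and> z \<noteq> 0 \<and> Pm z d = z) \<Longrightarrow> card Z \<le> 2 * k"
    using fixed_count[OF V] by blast
  obtain c where c: "c > 0" "\<And>x d. \<bar>x\<bar> < c \<Longrightarrow> dist d \<delta>0 < c \<Longrightarrow> \<bar>Fr x d\<bar> < \<gamma> / 2"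
    using Fr_small[OF \<delta>0, of "\<gamma> / 2"] \<gamma> by auto
  have M0: "M > 0" using M by simp
  \<comment> \<open>The bound \<open>b / M\<close> keeps the paired negative fixed points
    \<open>- hm r d\<close> within the range of the count.\<close>
  define e where "e = min (min (b / M) c) (\<gamma> / 2)"
  have "b / M \<le> b / 1" using b(1) M by (intro divide_left_mono) auto
  then have eb: "e \<le> b" by (simp add: e_def)
  have e\<gamma>: "e \<le> \<gamma> / 2" unfolding e_def by (rule min.cobounded2)
  have "e > 0" "e \<le> c" "e \<le> b / M" using b c \<gamma> M0 by (auto simp: e_def)
  note e = this(1,2) e\<gamma> this(3)
  show ?thesis
  proof (rule that[of e])
    show "e > 0" "e \<le> \<epsilon>" "e \<le> \<gamma>" using e \<gamma> \<kappa> by auto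
    fix d assume d: "d \<in> D" "dist d \<delta>0 < e"
    have d\<gamma>: "dist d \<delta>0 < \<gamma>" and db: "dist d \<delta>0 < b" using d e eb \<gamma> by auto
    note d' = dist_less[OF d\<gamma>]
    define A where "A = {Q. periodic_orbit X Y d Q \<and> Q \<subseteq> ball 0 e}"
    have "\<exists>r. 0 < r \<and> r < e \<and> Pm r d = r \<and> Q = Gam d r" if "Q \<in> A" for Q
    proof -
      have "\<bar>Fr x d\<bar> < \<gamma> / 2" if "\<bar>x\<bar> < e" for x using c(2)[of x d] that d e by auto
      from periodic_fixed[OF d(1) d\<gamma> e(3) this] that show ?thesis unfolding A_def by blast
    qed
    then obtain rf where rf: "\<And>Q. Q \<in> A \<Longrightarrow> 0 < rf Q \<and> rf Q < e \<and> Pm (rf Q) d = rf Q \<and> Q = Gam d (rf Q)"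
      by metis
    have bound: "card A' \<le> k" if A': "finite A'" "A' \<subseteq> A" for A'
    proof -
      have inj: "inj_on rf A'" using rf A'(2) by (metis inj_onI subsetD)
      define R1 where "R1 = rf ` A'"
      define R2 where "R2 = (\<lambda>r. - hm r d) ` R1"
      have R1: "0 < r \<and> r < e \<and> Pm r d = r" if "r \<in> R1" for r using that rf A'(2) by (auto simp: R1_def)
      have r\<sigma>: "\<bar>r\<bar> < \<sigma>" if "r \<in> R1" for r using R1[OF that] e \<gamma> by auto
      have hmp: "0 < hm r d \<and> hm r d < b" if "r \<in> R1" for r
      proof -
        have "hm r d \<le> M * r" using map_bounds(3)[OF r\<sigma>[OF that] d'(1)] R1[OF that] by simp
        also have "\<dots> < b"
        proof -
          have "r < b / M" using R1[OF that] e by linarith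
          then show ?thesis using M0 by (simp add: field_simps)
        qed
        finally show ?thesis unfolding hm_def using R1[OF that] map_bounds(1)[OF r\<sigma>[OF that] d'(1)] d'
          by (auto intro!: rr_pos)
      qed
      have "inj_on (\<lambda>r. - hm r d) R1"
      proof (rule inj_onI)
        fix r s assume rs: "r \<in> R1" "s \<in> R1" "- hm r d = - hm s d"
        show "r = s"
          using hm_mono[OF map_bounds(1)[OF r\<sigma>[OF rs(1)] d'(1)] map_bounds(1)[OF r\<sigma>[OF rs(2)] d'(1)] d'(1)]
            hm_mono[OF map_bounds(1)[OF r\<sigma>[OF rs(2)] d'(1)] map_bounds(1)[OF r\<sigma>[OF rs(1)] d'(1)] d'(1)] rs(3)
          by (cases r s rule: linorder_cases) auto
      qed
      then have c2: "card R2 = card R1" unfolding R2_def by (rule card_image)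
      have c1: "card R1 = card A'" unfolding R1_def by (rule card_image[OF inj])
      have fin: "finite R1" "finite R2" using A'(1) by (auto simp: R1_def R2_def)
      have disj: "R1 \<inter> R2 = {}" using R1 hmp by (force simp: R2_def)
      \<comment> \<open>The positive and negative fixed points together are twice as many as the
        orbits.\<close>
      have "card (R1 \<union> R2) \<le> 2 * k"
      proof (rule b(4)[OF db])
        show "finite (R1 \<union> R2)" using fin by simp
        fix z assume "z \<in> R1 \<union> R2"
        then consider "z \<in> R1" | r where "r \<in> R1" "z = - hm r d" by (auto simp: R2_def)
        then show "\<bar>z\<bar> < b \<and> z \<noteq> 0 \<and> Pm z d = z"
        proof cases
          case 1
          then show ?thesis using R1[OF 1] eb by auto
        next
          case 2
          have "Pm (- hm r d) d = - hm r d"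
          proof (cases "even n")
            case True
            then show ?thesis using Pm_even[OF True r\<sigma>[OF 2(1)] d'(1)] R1[OF 2(1)] by simp
          next
            case False
            then show ?thesis using Pm_odd[OF False r\<sigma>[OF 2(1)] d'(1)] R1[OF 2(1)] by simp
          qed
          then show ?thesis using hmp[OF 2(1)] 2(2) by auto
        qed
      qed
      then show ?thesis using card_Un_disjoint[OF fin disj] c1 c2 by simp
    qed
    \<comment> \<open>The bound holds for all finite subfamilies, so an infinite family is
      impossible.\<close>
    have "finite A"
    proof (rule ccontr)
      assume "infinite A"
      then obtain A' where "finite A'" "card A' = Suc k" "A' \<subseteq> A"
        using infinite_arbitrarily_large by blast
      then show False using bound[of A'] by simp
    qed
    then show "finite {Q. periodic_orbit X Y d Q \<and> Q \<subseteq> ball 0 e} \<and> card {Q. periodic_orbit X Y d Q \<and> Q \<subseteq> ball 0 e} \<le> k"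
      using bound[of A] unfolding A_def by simp
  qed
qed

section \<open>From closed orbits to limit cycles\<close>

lemma periodic_orbit_eq:
  assumes d: "dist d \<delta>0 < \<gamma>" and Q: "periodic_orbit X Y d Q1" "periodic_orbit X Y d Q2"
    and sub: "Q1 \<subseteq> ball 0 \<epsilon>" and p: "p \<in> Q1" "p \<in> Q2"
  shows "Q1 = Q2"
proof -
  obtain x1 y1 where s1: "solution_on X Y d UNIV x1 y1" "Q1 = range (\<lambda>t. (x1 t, y1 t))"
    using Q(1) unfolding periodic_orbit_def by blast
  obtain x2 y2 where s2: "solution_on X Y d UNIV x2 y2" "Q2 = range (\<lambda>t. (x2 t, y2 t))"
    using Q(2) unfolding periodic_orbit_def by blast
  obtain t1 where t1: "p = (x1 t1, y1 t1)" using p(1) s1(2) by blast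
  obtain t2 where t2: "p = (x2 t2, y2 t2)" using p(2) s2(2) by blast
  note t = t1 t2
  have d1: "((\<lambda>t. (x1 t, y1 t)) has_vector_derivative vfield X Y d (x1 t, y1 t)) (at t)"
    and d2: "((\<lambda>t. (x2 t, y2 t)) has_vector_derivative vfield X Y d (x2 t, y2 t)) (at t)" for t
    using s1(1) s2(1) unfolding solution_on_vfield by auto
  have sh: "((\<lambda>t. (x2 (t2 - t1 + t), y2 (t2 - t1 + t))) has_vector_derivative vfield X Y d (x2 (t2 - t1 + t), y2 (t2 - t1 + t))) (at t)" for t
  proof -
    have "((\<lambda>t. t2 - t1 + t) has_vector_derivative 1) (at t)" by (auto intro!: derivative_eq_intros)
    from vector_diff_chain_at[OF this d2] show ?thesis by (simp add: o_def)
  qed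
  have eq: "(\<lambda>t. (x1 t, y1 t)) t = (\<lambda>t. (x2 (t2 - t1 + t), y2 (t2 - t1 + t))) t" for t
  proof (rule sol_unique[OF d, of UNIV "\<lambda>t. (x1 t, y1 t)" "\<lambda>t. (x2 (t2 - t1 + t), y2 (t2 - t1 + t))" t1])
    show "norm (x1 t, y1 t) < \<epsilon>" for t
    proof -
      have "(x1 t, y1 t) \<in> ball 0 \<epsilon>" using sub s1(2) by blast
      then show ?thesis by simp
    qed
  qed (use d1 sh t in auto)
  have "range (\<lambda>t. (x2 (t2 - t1 + t), y2 (t2 - t1 + t))) = range (\<lambda>t. (x2 t, y2 t))"
  proof -
    have "range (\<lambda>t. t2 - t1 + t) = (UNIV :: real set)" by simp
    moreover have "range (\<lambda>t. (x2 (t2 - t1 + t), y2 (t2 - t1 + t))) = (\<lambda>t. (x2 t, y2 t)) ` range (\<lambda>t. t2 - t1 + t)"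
      by (simp only: image_image)
    ultimately show ?thesis by (simp only:)
  qed
  then show ?thesis using eq s1(2) s2(2) by simp
qed

lemma periodic_compact:
  assumes "periodic_orbit X Y d Q" shows "compact Q"
proof -
  obtain x y T where s: "T > 0" "solution_on X Y d UNIV x y" "\<And>t. x (t + T) = x t \<and> y (t + T) = y t" "Q = range (\<lambda>t. (x t, y t))"
    using assms unfolding periodic_orbit_def by blast
  have "Q = (\<lambda>t. (x t, y t)) ` {0..0 + T}"
    unfolding s(4) by (rule periodic_range[where f = "\<lambda>t. (x t, y t)", OF s(1)]) (use s(3) in simp)
  moreover have "continuous_on {0..0 + T} (\<lambda>t. (x t, y t))"
    using s(2) unfolding solution_on_def
    by (intro continuous_intros continuous_at_imp_continuous_on ballI) (auto intro: DERIV_isCont)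
  ultimately show ?thesis by (simp add: compact_continuous_image)
qed

text \<open>Finitely many closed orbits are compact and pairwise disjoint, so removing the others
  from \<open>W\<close> leaves an open isolating neighbourhood of each.\<close>

lemma limit_cycles_eq_periodic:
  assumes d: "dist d \<delta>0 < \<gamma>" and W: "open W" "W \<subseteq> ball 0 \<epsilon>"
    and fin: "finite {Q. periodic_orbit X Y d Q \<and> Q \<subseteq> W}"
  shows "limit_cycles_in X Y d W = {Q. periodic_orbit X Y d Q \<and> Q \<subseteq> W}"
proof (intro equalityI subsetI)
  fix Q assume "Q \<in> {Q. periodic_orbit X Y d Q \<and> Q \<subseteq> W}"
  then have Q: "periodic_orbit X Y d Q" "Q \<subseteq> W" by auto
  define A where "A = {Q. periodic_orbit X Y d Q \<and> Q \<subseteq> W} - {Q}"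
  have "closed (\<Union>A)" using fin by (intro closed_Union) (auto simp: A_def intro: compact_imp_closed periodic_compact)
  then have "open (W - \<Union>A)" using W(1) by (rule open_Diff[rotated])
  moreover have "Q \<subseteq> W - \<Union>A"
    using Q periodic_orbit_eq[OF d Q(1)] W(2) unfolding A_def by blast
  moreover have "Q' = Q" if "periodic_orbit X Y d Q'" "Q' \<subseteq> W - \<Union>A" for Q'
  proof (rule ccontr)
    assume "Q' \<noteq> Q"
    then have "Q' \<in> A" using that by (auto simp: A_def)
    then have "Q' = {}" using that(2) by blast
    then show False using that(1) unfolding periodic_orbit_def by auto
  qed
  ultimately show "Q \<in> limit_cycles_in X Y d W"
    using Q unfolding limit_cycles_in_def limit_cycle_def by blast
qed (auto simp: limit_cycles_in_def limit_cycle_def)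

text \<open>\<open>Gam d r\<close> meets the positive section only at \<open>r\<close> and
  \<open>Pm r d\<close>, which coincide at a fixed point.\<close>

lemma Gam_inj:
  assumes d: "dist d \<delta>0 < \<gamma>" and r: "0 < r" "r < \<gamma>" "Pm r d = r" and s: "0 < s" "s < \<gamma>" and eq: "Gam d r = Gam d s"
  shows "r = s"
proof -
  have "(s, Fr s d) \<in> Gam d r" unfolding eq by (rule Gam_start[OF d s])
  from Gam_section[OF d r(1,2) this s(1)] show ?thesis using r(3) by simp
qed

end

section \<open>Bifurcation of closed orbits\<close>

lemma bounded_linear_cvec: "bounded_linear cvec"
  by (rule bounded_linear_intro[where K = 1])
     (auto simp: cvec_diff cvec_scale cs_of_real)

lemma cvec_axis: "cvec h = (\<Sum>i\<in>UNIV. (h $ i) *\<^sub>R axis i 1)"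
proof -
  have "(\<Sum>i\<in>UNIV. (h $ i) *\<^sub>R axis i (1::complex)) $ j = cvec h $ j" for j
  proof -
    have "(\<Sum>i\<in>UNIV. (h $ i) *\<^sub>R axis i (1::complex)) $ j = (\<Sum>i\<in>UNIV. if i = j then of_real (h $ j) else 0)"
      unfolding sum_component by (rule sum.cong) (auto simp: axis_def of_real_def)
    then show ?thesis by simp
  qed
  then show ?thesis by (simp add: vec_eq_iff)
qed

context polar_orbit
begin

lemma limit_cycles_bound:
  assumes \<delta>0: "\<delta>0 \<in> D" and j: "j \<in> {1..k+1}" and V: "V (2 * j - 1 + pn) \<delta>0 \<noteq> 0"
  obtains e where "e > 0"
    "\<And>d. d \<in> D \<Longrightarrow> dist d \<delta>0 < e \<Longrightarrow> finite {Q. periodic_orbit X Y d Q \<and> Q \<subseteq> ball 0 e} \<and>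
       card {Q. periodic_orbit X Y d Q \<and> Q \<subseteq> ball 0 e} \<le> k"
proof -
  have "1 + pn + 2 * (j - 1) = 2 * j - 1 + pn" using j by auto
  then have V': "V (1 + pn + 2 * (j - 1)) \<delta>0 \<noteq> 0" using V by (rule ssubst[where P = "\<lambda>i. V i \<delta>0 \<noteq> 0"])
  obtain e where e: "e > 0" "\<And>d. d \<in> D \<Longrightarrow> dist d \<delta>0 < e \<Longrightarrow> finite {Q. periodic_orbit X Y d Q \<and> Q \<subseteq> ball 0 e} \<and>
       card {Q. periodic_orbit X Y d Q \<and> Q \<subseteq> ball 0 e} \<le> j - 1"
    by (rule periodic_count[OF \<delta>0 V']) blast
  show ?thesis by (rule that[OF e(1)]) (use e(2) j in force)
qed

section \<open>Parameter gradients of the coefficients\<close>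

definition vc :: "nat \<Rightarrow> complex^'m \<Rightarrow> complex" where
  "vc j \<delta> = (divx ^^ j) dc (0, \<delta>)"

text \<open>The real gradient of \<open>V j\<close>, taken from the holomorphic extension
  \<open>vc j\<close>, which makes its continuity immediate.\<close>

definition wv :: "nat \<Rightarrow> real^'m \<Rightarrow> real^'m" where
  "wv j d = (\<chi> i. Re (dd (axis i 1) (vc j) (cvec d)))"

lemma vc_cd: "vc j cdiff_on ball (cvec \<delta>0) \<kappa>"
  unfolding vc_def[abs_def]
  by (rule cdiff_on_compose[OF _ cdiff_divx_pow[OF dc_cd B]]) (use \<kappa>' in \<open>auto intro!: cdiff_intros\<close>)

lemma V_deriv:
  assumes d: "dist d \<delta>0 < \<kappa>"
  shows "(V j has_derivative (\<lambda>h. wv j d \<bullet> h)) (at d)"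
proof -
  have v: "cvec d \<in> ball (cvec \<delta>0) \<kappa>" using d by (simp add: dist_commute)
  define L where "L h = dd h (vc j) (cvec d)" for h
  have L: "(vc j has_derivative L) (at (cvec d))"
    unfolding L_def by (rule has_derivative_dd(1)[OF vc_cd v])
  have "((\<lambda>d. Re (vc j (cvec d))) has_derivative (\<lambda>h. Re (L (cvec h)))) (at d)"
    by (rule bounded_linear.has_derivative[OF bounded_linear_Re has_derivative_compose[of cvec cvec]])
       (use L bounded_linear_imp_has_derivative[OF bounded_linear_cvec] in auto)
  moreover have "Re (L (cvec h)) = wv j d \<bullet> h" for h
  proof -
    have "linear L" using L by (rule has_derivative_linear)
    then have "L (cvec h) = (\<Sum>i\<in>UNIV. (h $ i) *\<^sub>R L (axis i 1))"
      unfolding cvec_axis by (simp add: linear_sum linear_scale)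
    then show ?thesis by (simp add: wv_def inner_vec_def L_def mult.commute)
  qed
  moreover have "(\<lambda>d. Re (vc j (cvec d))) = V j" by (simp add: V_def vc_def fun_eq_iff)
  ultimately show ?thesis by simp
qed

lemma wv_cont: "continuous_on (ball \<delta>0 \<kappa>) (wv j)"
  unfolding wv_def
proof (intro continuous_on_vec_lambda continuous_on_Re)
  fix i
  show "continuous_on (ball \<delta>0 \<kappa>) (\<lambda>d. dd (axis i 1) (vc j) (cvec d))"
    by (rule continuous_on_compose2[OF cdiff_on_continuous_on[OF cdiff_dd[OF vc_cd open_ball]]])
       (auto intro: bounded_linear.continuous_on[OF bounded_linear_cvec])
qed

lemma gradient_at_eq:
  assumes w: "\<forall>\<^sub>F d in nhds \<delta>0. f d = V j d"
  shows "gradient_at f \<delta>0 = wv j \<delta>0"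
proof -
  have d0: "dist \<delta>0 \<delta>0 < \<kappa>" using \<kappa> by simp
  have "deriv (\<lambda>s. f (\<delta>0 + s *\<^sub>R axis i 1)) 0 = wv j \<delta>0 $ i" for i
  proof -
    have "((\<lambda>s. \<delta>0 + s *\<^sub>R axis i 1) \<longlongrightarrow> \<delta>0 + 0 *\<^sub>R axis i 1) (nhds (0::real))"
      by (intro tendsto_intros filterlim_ident)
    then have "filterlim (\<lambda>s. \<delta>0 + s *\<^sub>R axis i 1) (nhds \<delta>0) (nhds (0::real))" by simp
    from eventually_compose_filterlim[OF w this]
    have ev: "\<forall>\<^sub>F s in nhds 0. f (\<delta>0 + s *\<^sub>R axis i 1) = V j (\<delta>0 + s *\<^sub>R axis i 1)" .
    have 1: "((\<lambda>s. \<delta>0 + s *\<^sub>R axis i 1) has_derivative (\<lambda>s. s *\<^sub>R axis i 1)) (at (0::real))"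
      by (auto intro!: derivative_eq_intros)
    have 2: "(V j has_derivative (\<lambda>h. wv j \<delta>0 \<bullet> h)) (at (\<delta>0 + 0 *\<^sub>R axis i 1))"
      using V_deriv[OF d0] by simp
    have "((\<lambda>s. V j (\<delta>0 + s *\<^sub>R axis i 1)) has_derivative (\<lambda>s. wv j \<delta>0 \<bullet> (s *\<^sub>R axis i 1))) (at 0)"
      by (rule has_derivative_compose[OF 1 2])
    then have "((\<lambda>s. V j (\<delta>0 + s *\<^sub>R axis i 1)) has_real_derivative wv j \<delta>0 $ i) (at 0)"
      by (simp add: has_field_derivative_def inner_axis mult.commute mult_commute_abs)
    then have "deriv (\<lambda>s. V j (\<delta>0 + s *\<^sub>R axis i 1)) 0 = wv j \<delta>0 $ i" by (rule DERIV_imp_deriv)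
    then show ?thesis using deriv_cong_ev[OF ev refl] by simp
  qed
  then show ?thesis by (simp add: gradient_at_def vec_eq_iff)
qed

lemma Pm_cont_param:
  assumes d: "dist d \<delta>0 < \<kappa>" and r: "\<bar>r\<bar> < \<kappa>'"
  shows "isCont (\<lambda>d. Pm r d) d"
proof -
  have c: "isCont (\<rho> (2 * pi)) (complex_of_real r, cvec d)"
    by (rule cdiff_on_isCont[OF \<rho>_cd]) (use in_dom[OF r d] in auto)
  have "isCont cvec d"
    by (rule has_derivative_continuous[OF bounded_linear_imp_has_derivative[OF bounded_linear_cvec]])
  then have "isCont (\<lambda>d. \<rho> (2 * pi) (complex_of_real r, cvec d)) d"
    by (intro isCont_o2[where f = "\<lambda>d. (complex_of_real r, cvec d)", OF _ c] continuous_intros)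
  then show ?thesis unfolding Pm_def rr_def by (rule isCont_Re)
qed

text \<open>
  Successive bifurcation: starting from \<open>\<delta>0\<close>, the coefficients are switched on one at a time, from the
  highest to the lowest, each with alternating sign and so small that the earlier signs of the displacement persist.
\<close>
lemma alternating_points:
  fixes u :: "nat \<Rightarrow> 'b::real_normed_vector"
  assumes W: "open W" "y0 \<in> W" "continuous_on W g" "g y0 = \<delta>0" "\<And>y. y \<in> W \<Longrightarrow> dist (g y) \<delta>0 < \<kappa>"
    and c: "\<And>c i. i \<in> {1..k} \<Longrightarrow> y0 + (\<Sum>j=1..k. c j *\<^sub>R u j) \<in> W \<Longrightarrow>
        V (2 * i - 1 + pn) (g (y0 + (\<Sum>j=1..k. c j *\<^sub>R u j))) = c i"
    and hi: "V (2 * k + 1 + pn) \<delta>0 = s" "s \<noteq> 0"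
    and lo: "\<And>j. j \<in> {1..k} \<Longrightarrow> V (2 * j - 1 + pn) \<delta>0 = 0"
    and \<beta>: "0 < \<beta>" "\<beta> \<le> \<sigma>" and e: "0 < e" and l: "l \<le> k"
  shows "\<exists>c xs. (\<forall>j\<le>k - l. c j = 0) \<and> y0 + (\<Sum>j=1..k. c j *\<^sub>R u j) \<in> W \<and>
     dist (g (y0 + (\<Sum>j=1..k. c j *\<^sub>R u j))) \<delta>0 < e \<and>
     (\<forall>m\<le>l. 0 < xs m \<and> xs m < \<beta>) \<and> (\<forall>m<l. xs (Suc m) < xs m) \<and>
     (\<forall>m\<le>l. s * (-1) ^ m * (Pm (xs m) (g (y0 + (\<Sum>j=1..k. c j *\<^sub>R u j))) - xs m) > 0)"
  using l
proof (induction l)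
  case 0
  have d0: "dist \<delta>0 \<delta>0 < \<kappa>" using \<kappa> by simp
  \<comment> \<open>At \<open>\<delta>0\<close> itself the leading index is the one with number
    \<open>k + 1\<close>, so the displacement has the sign of \<open>s\<close> at small positive
    radii.\<close>
  have i: "2 * (k + 1) - 1 + pn = 2 * k + 1 + pn" by simp
  have low: "V m \<delta>0 = 0" if "m < 2 * k + 1 + pn" for m
    by (rule V_leading[OF d0, of "k + 1"]) (use hi lo that i in auto)
  have hi0: "V (2 * k + 1 + pn) \<delta>0 \<noteq> 0" using hi by simp
  obtain b where b: "b > 0" "b \<le> \<sigma>" "\<And>r. \<bar>r\<bar> < b \<Longrightarrow> r \<noteq> 0 \<Longrightarrow> (Pm r \<delta>0 - r) * (r ^ (2 * k + 1 + pn) * V (2 * k + 1 + pn) \<delta>0) > 0"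
    using disp_sign[OF d0 low hi0] by blast
  define r where "r = min b \<beta> / 2"
  have r: "0 < r" "r < b" "r < \<beta>" using b \<beta> by (auto simp: r_def)
  have "s * (Pm r \<delta>0 - r) > 0"
  proof (rule zero_less_mult_pos2)
    show "0 < s * (Pm r \<delta>0 - r) * r ^ (2 * k + 1 + pn)" using b(3)[of r] r hi(1) by (simp add: mult_ac)
  qed (use r in simp)
  then show ?case
    by (rule_tac x = "\<lambda>_. 0" in exI, rule_tac x = "\<lambda>_. r" in exI) (use W r e in simp)
next
  case (Suc l)
  then obtain c0 xs where IH: "\<forall>j\<le>k - l. c0 j = 0" "y0 + (\<Sum>j=1..k. c0 j *\<^sub>R u j) \<in> W"
     "dist (g (y0 + (\<Sum>j=1..k. c0 j *\<^sub>R u j))) \<delta>0 < e"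
     "\<forall>m\<le>l. 0 < xs m \<and> xs m < \<beta>" "\<forall>m<l. xs (Suc m) < xs m"
     "\<forall>m\<le>l. s * (-1) ^ m * (Pm (xs m) (g (y0 + (\<Sum>j=1..k. c0 j *\<^sub>R u j))) - xs m) > 0"
    by auto
  define A where "A = y0 + (\<Sum>j=1..k. c0 j *\<^sub>R u j)"
  \<comment> \<open>The next coefficient from above: all those of index at most \<open>k - l\<close>
    are still zero.\<close>
  define i where "i = k - l"
  have i: "i \<in> {1..k}" using Suc.prems by (auto simp: i_def)
  have c0i: "c0 i = 0" using IH(1) by (simp add: i_def)
  \<comment> \<open>Since \<open>c0 i = 0\<close>, setting this single coefficient is a translation
    along \<open>u i\<close>.\<close>
  have pos: "y0 + (\<Sum>j=1..k. (c0(i := t)) j *\<^sub>R u j) = A + t *\<^sub>R u i" for t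
  proof -
    have "(\<Sum>j=1..k. (c0(i := t)) j *\<^sub>R u j) = (c0(i := t)) i *\<^sub>R u i + (\<Sum>j\<in>{1..k} - {i}. (c0(i := t)) j *\<^sub>R u j)"
      using i by (intro sum.remove) auto
    also have "(\<Sum>j\<in>{1..k} - {i}. (c0(i := t)) j *\<^sub>R u j) = (\<Sum>j\<in>{1..k} - {i}. c0 j *\<^sub>R u j)"
      by (rule sum.cong) auto
    finally have 1: "(\<Sum>j=1..k. (c0(i := t)) j *\<^sub>R u j) = t *\<^sub>R u i + (\<Sum>j\<in>{1..k} - {i}. c0 j *\<^sub>R u j)" by simp
    have "(\<Sum>j=1..k. c0 j *\<^sub>R u j) = c0 i *\<^sub>R u i + (\<Sum>j\<in>{1..k} - {i}. c0 j *\<^sub>R u j)"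
      using i by (intro sum.remove) auto
    then show ?thesis using 1 c0i by (simp add: A_def)
  qed
  have AW: "A \<in> W" using IH(2) by (simp add: A_def)
  have "((\<lambda>t. A + t *\<^sub>R u i) \<longlongrightarrow> A + 0 *\<^sub>R u i) (nhds (0::real))"
    by (intro tendsto_intros filterlim_ident)
  then have tA: "((\<lambda>t. A + t *\<^sub>R u i) \<longlongrightarrow> A) (nhds (0::real))" by simp
  have ev1: "\<forall>\<^sub>F t in nhds 0. A + t *\<^sub>R u i \<in> W" by (rule topological_tendstoD[OF tA W(1) AW])
  have gA: "isCont g A" using W(1,3) AW continuous_on_eq_continuous_at by blast
  have tg: "((\<lambda>t. g (A + t *\<^sub>R u i)) \<longlongrightarrow> g A) (nhds (0::real))"
    by (rule isCont_tendsto_compose[OF gA tA])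
  have ev2: "\<forall>\<^sub>F t in nhds 0. dist (g (A + t *\<^sub>R u i)) \<delta>0 < e"
  proof -
    have "\<forall>\<^sub>F t in nhds 0. g (A + t *\<^sub>R u i) \<in> ball \<delta>0 e"
      by (rule topological_tendstoD[OF tg open_ball]) (use IH(3) in \<open>simp add: A_def dist_commute\<close>)
    then show ?thesis by (simp add: dist_commute)
  qed
  \<comment> \<open>The signs found so far are strict and depend continuously on \<open>t\<close>,
    so they persist for small \<open>t\<close>.\<close>
  have "\<forall>\<^sub>F t in nhds 0. s * (-1) ^ m * (Pm (xs m) (g (A + t *\<^sub>R u i)) - xs m) > 0" if "m \<le> l" for m
  proof -
    have xm: "\<bar>xs m\<bar> < \<kappa>'" using IH(4) that \<beta> \<sigma> by auto
    have "((\<lambda>t. s * (-1) ^ m * (Pm (xs m) (g (A + t *\<^sub>R u i)) - xs m)) \<longlongrightarrow> s * (-1) ^ m * (Pm (xs m) (g A) - xs m)) (nhds (0::real))"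
      by (intro tendsto_intros isCont_tendsto_compose[OF Pm_cont_param[OF W(5)[OF AW] xm] tg])
    from order_tendstoD(1)[OF this] IH(6) that show ?thesis by (simp add: A_def)
  qed
  then have "\<forall>\<^sub>F t in nhds 0. \<forall>m\<in>{..l}. s * (-1) ^ m * (Pm (xs m) (g (A + t *\<^sub>R u i)) - xs m) > 0"
    by (intro eventually_ball_finite) auto
  from eventually_conj[OF ev1 eventually_conj[OF ev2 this]]
  obtain b where b: "b > 0" "\<And>t. \<bar>t\<bar> < b \<Longrightarrow> A + t *\<^sub>R u i \<in> W \<and> dist (g (A + t *\<^sub>R u i)) \<delta>0 < e \<and>
      (\<forall>m\<in>{..l}. s * (-1) ^ m * (Pm (xs m) (g (A + t *\<^sub>R u i)) - xs m) > 0)"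
    unfolding eventually_nhds_metric by (auto simp: dist_real_def)
  define q where "q = s * (-1) ^ Suc l"
  have q: "q \<noteq> 0" using hi(2) by (simp add: q_def)
  \<comment> \<open>\<open>q\<close> carries one more factor -1 than the previous stage, so the
    coefficient switched on now has the opposite sign of the preceding one.\<close>
  define t where "t = sgn q * (b / 2)"
  have t: "\<bar>t\<bar> < b" "t \<noteq> 0" "q * t > 0" using b(1) q by (auto simp: t_def abs_mult sgn_if mult_neg_pos)
  define c1 where "c1 = c0(i := t)"
  define d where "d = g (A + t *\<^sub>R u i)"
  have posd: "y0 + (\<Sum>j=1..k. c1 j *\<^sub>R u j) = A + t *\<^sub>R u i" unfolding c1_def by (rule pos)
  have dW: "A + t *\<^sub>R u i \<in> W" using b(2)[OF t(1)] by blast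
  have d\<kappa>: "dist d \<delta>0 < \<kappa>" unfolding d_def by (rule W(5)[OF dW])
  have Vd: "V (2 * j - 1 + pn) d = c1 j" if "j \<in> {1..k}" for j
    using c[OF that, of c1] dW unfolding posd d_def by simp
  have hid: "V (2 * i - 1 + pn) d \<noteq> 0" "V (2 * i - 1 + pn) d = t" using Vd[OF i] t(2) by (simp_all add: c1_def)
  have low: "V m d = 0" if "m < 2 * i - 1 + pn" for m
  proof (rule V_leading[OF d\<kappa> _ _ hid(1) that])
    fix j assume "1 \<le> j" "j < i"
    then show "V (2 * j - 1 + pn) d = 0" using Vd[of j] IH(1) i by (simp add: c1_def i_def)
  qed (use i in simp)
  obtain b' where b': "b' > 0" "\<And>r. \<bar>r\<bar> < b' \<Longrightarrow> r \<noteq> 0 \<Longrightarrow> (Pm r d - r) * (r ^ (2 * i - 1 + pn) * V (2 * i - 1 + pn) d) > 0"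
    using disp_sign[OF d\<kappa> low hid(1)] by blast
  \<comment> \<open>Below all earlier radii and small enough for the newly switched-on leading term
    to dominate.\<close>
  define r where "r = min b' (xs l) / 2"
  have r: "0 < r" "r < b'" "r < xs l" "r < \<beta>" using b' IH(4) by (auto simp: r_def min_def)
  have "(Pm r d - r) * t > 0"
  proof (rule zero_less_mult_pos2)
    show "0 < (Pm r d - r) * t * r ^ (2 * i - 1 + pn)" using b'(2)[of r] r hid(2) by (simp add: mult_ac)
  qed (use r in simp)
  then have disp: "q * (Pm r d - r) > 0" using t(3) by (auto simp: zero_less_mult_iff)
  define ys where "ys = xs(Suc l := r)"
  have "\<forall>j\<le>k - Suc l. c1 j = 0" using IH(1) Suc.prems by (auto simp: c1_def i_def)
  moreover have "\<forall>m\<le>Suc l. 0 < ys m \<and> ys m < \<beta>" using IH(4) r by (auto simp: ys_def le_Suc_eq)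
  moreover have "\<forall>m<Suc l. ys (Suc m) < ys m" using IH(5) r by (auto simp: ys_def less_Suc_eq)
  moreover have "\<forall>m\<le>Suc l. s * (-1) ^ m * (Pm (ys m) d - ys m) > 0"
    using b(2)[OF t(1)] disp by (auto simp: ys_def le_Suc_eq d_def q_def)
  moreover have "y0 + (\<Sum>j=1..k. c1 j *\<^sub>R u j) \<in> W" unfolding posd by (rule dW)
  moreover have "dist (g (y0 + (\<Sum>j=1..k. c1 j *\<^sub>R u j))) \<delta>0 < e" unfolding posd using b(2)[OF t(1)] by blast
  moreover have "g (y0 + (\<Sum>j=1..k. c1 j *\<^sub>R u j)) = d" unfolding posd d_def ..
  ultimately show ?case by (rule_tac x = c1 in exI, rule_tac x = ys in exI) simp
qed

text \<open>\<open>U\<^sub>0\<close> is a ball that contains at most \<open>k\<close> closed orbits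
  for parameters of \<open>D\<close> near \<open>\<delta>0\<close>. In any smaller neighbourhood the
  alternating points yield \<open>k\<close> fixed points whose orbits stay inside, so the count is
  exact.\<close>

lemma exact_limit_cycles:
  assumes int: "\<delta>0 \<in> interior D" and hi: "V (2 * k + 1 + pn) \<delta>0 \<noteq> 0"
    and lo: "\<And>j. j \<in> {1..k} \<Longrightarrow> V (2 * j - 1 + pn) \<delta>0 = 0"
    and dim: "dim ((\<lambda>j. wv (2 * j - 1 + pn) \<delta>0) ` {1..k}) = k"
  shows "\<exists>U\<^sub>0. open U\<^sub>0 \<and> (0, 0) \<in> U\<^sub>0 \<and>
              (\<forall>N. open N \<and> (0, 0) \<in> N \<and> N \<subseteq> U\<^sub>0 \<longrightarrow>
                 (\<forall>e>0. \<exists>d\<in>D. dist d \<delta>0 < e \<and>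
                    finite (limit_cycles_in X Y d N) \<and> card (limit_cycles_in X Y d N) = k))"
proof -
  have \<delta>D: "\<delta>0 \<in> D" using int interior_subset by blast
  obtain eD where eD: "eD > 0" "ball \<delta>0 eD \<subseteq> D" using int mem_interior by blast
  have "V (1 + pn + 2 * k) \<delta>0 \<noteq> 0" using hi by (simp add: add_ac)
  then obtain e0 where e0: "e0 > 0" "e0 \<le> \<epsilon>" "e0 \<le> \<gamma>"
    "\<And>d. d \<in> D \<Longrightarrow> dist d \<delta>0 < e0 \<Longrightarrow> finite {Q. periodic_orbit X Y d Q \<and> Q \<subseteq> ball 0 e0} \<and>
       card {Q. periodic_orbit X Y d Q \<and> Q \<subseteq> ball 0 e0} \<le> k"
    using periodic_count[OF \<delta>D] by blast
  have "open (ball \<delta>0 \<kappa>)" "\<delta>0 \<in> ball \<delta>0 \<kappa>" using \<kappa> by auto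
  then obtain W g y0 where W: "open W" "y0 \<in> W" "continuous_on W g" "g y0 = \<delta>0" "\<And>y. y \<in> W \<Longrightarrow> g y \<in> ball \<delta>0 \<kappa>"
    "\<And>c i. i \<in> {1..k} \<Longrightarrow> y0 + (\<Sum>j=1..k. c j *\<^sub>R wv (2 * j - 1 + pn) \<delta>0) \<in> W \<Longrightarrow>
        V (2 * i - 1 + pn) (g (y0 + (\<Sum>j=1..k. c j *\<^sub>R wv (2 * j - 1 + pn) \<delta>0))) = c i"
  proof (rule submersion_right_inverse[where V = "\<lambda>j. V (2 * j - 1 + pn)" and w = "\<lambda>j. wv (2 * j - 1 + pn)" and k = k])
    show "(V (2 * j - 1 + pn) has_derivative (\<lambda>h. wv (2 * j - 1 + pn) x \<bullet> h)) (at x)" if "x \<in> ball \<delta>0 \<kappa>" for j x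
      by (rule V_deriv) (use that in \<open>simp add: dist_commute\<close>)
  qed (use lo dim wv_cont in auto)
  have W5: "dist (g y) \<delta>0 < \<kappa>" if "y \<in> W" for y using W(5)[OF that] by (simp add: dist_commute)
  show ?thesis
  proof (intro exI[of _ "ball 0 e0"] conjI allI impI)
    show "(0, 0) \<in> ball (0 :: real \<times> real) e0" using e0(1) by (simp flip: zero_prod_def)
    fix N :: "(real \<times> real) set" and e :: real
    assume N: "open N \<and> (0, 0) \<in> N \<and> N \<subseteq> ball 0 e0" and e: "e > 0"
    then obtain \<eta> where \<eta>: "\<eta> > 0" "ball (0, 0) \<eta> \<subseteq> N" using open_contains_ball by blast
    obtain b where b: "b > 0" "b \<le> \<sigma>" "b \<le> \<kappa>"
      "\<And>d r \<phi>. dist d \<delta>0 < b \<Longrightarrow> 0 < r \<Longrightarrow> r < b \<Longrightarrow> \<phi> \<in> {0..4*pi} \<Longrightarrow> norm (pt d (rr \<phi> r d) \<phi>) < \<eta>"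
      using orbit_small_exists[OF \<delta>D \<eta>(1)] by blast
    define \<beta> where "\<beta> = min b \<gamma>"
    \<comment> \<open>\<open>eD\<close> keeps the parameter in \<open>D\<close>; \<open>e0\<close>
      and \<open>b\<close> keep it where the upper count and the bound on the size of orbits
      hold.\<close>
    define e1 where "e1 = min (min e eD) (min e0 b)"
    have \<beta>: "0 < \<beta>" "\<beta> \<le> \<sigma>" "\<beta> \<le> \<gamma>" "\<beta> \<le> b" using b \<gamma> by (auto simp: \<beta>_def)
    have e1: "0 < e1" "e1 \<le> e" "e1 \<le> eD" "e1 \<le> e0" "e1 \<le> b" using e eD(1) e0(1) b(1) by (auto simp: e1_def)
    define s where "s = V (2 * k + 1 + pn) \<delta>0"
    have s0: "s \<noteq> 0" using hi by (simp add: s_def)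
    have "\<exists>c xs. (\<forall>j\<le>k - k. c j = 0) \<and> y0 + (\<Sum>j=1..k. c j *\<^sub>R wv (2 * j - 1 + pn) \<delta>0) \<in> W \<and>
     dist (g (y0 + (\<Sum>j=1..k. c j *\<^sub>R wv (2 * j - 1 + pn) \<delta>0))) \<delta>0 < e1 \<and>
     (\<forall>m\<le>k. 0 < xs m \<and> xs m < \<beta>) \<and> (\<forall>m<k. xs (Suc m) < xs m) \<and>
     (\<forall>m\<le>k. s * (-1) ^ m * (Pm (xs m) (g (y0 + (\<Sum>j=1..k. c j *\<^sub>R wv (2 * j - 1 + pn) \<delta>0))) - xs m) > 0)"
      by (rule alternating_points[where u = "\<lambda>j. wv (2 * j - 1 + pn) \<delta>0", OF W(1-4) W5 W(6) s_def[symmetric] s0 lo \<beta>(1,2) e1(1) order_refl])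
    then obtain c xs where cx: "y0 + (\<Sum>j=1..k. c j *\<^sub>R wv (2 * j - 1 + pn) \<delta>0) \<in> W"
     "dist (g (y0 + (\<Sum>j=1..k. c j *\<^sub>R wv (2 * j - 1 + pn) \<delta>0))) \<delta>0 < e1"
     "\<forall>m\<le>k. 0 < xs m \<and> xs m < \<beta>" "\<forall>m<k. xs (Suc m) < xs m"
     "\<forall>m\<le>k. s * (-1) ^ m * (Pm (xs m) (g (y0 + (\<Sum>j=1..k. c j *\<^sub>R wv (2 * j - 1 + pn) \<delta>0))) - xs m) > 0"
      by blast
    define d where "d = g (y0 + (\<Sum>j=1..k. c j *\<^sub>R wv (2 * j - 1 + pn) \<delta>0))"
    have de: "dist d \<delta>0 < e1" and sg: "\<And>m. m \<le> k \<Longrightarrow> s * (-1) ^ m * (Pm (xs m) d - xs m) > 0"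
      using cx(2,5) by (auto simp: d_def)
    have dD: "d \<in> D" using de e1(3) eD(2) by (auto simp: dist_commute)
    have d\<gamma>: "dist d \<delta>0 < \<gamma>" using de e1(4) e0(3) by simp
    note d' = dist_less[OF d\<gamma>]
    \<comment> \<open>Opposite signs of the displacement at consecutive points enclose a fixed
      point, by the intermediate value theorem.\<close>
    have "\<exists>z. xs (Suc m) < z \<and> z < xs m \<and> Pm z d = z" if m: "m < k" for m
    proof -
      define f where "f z = s * (-1) ^ m * (Pm z d - z)" for z
      have f: "f (xs m) > 0" "f (xs (Suc m)) < 0"
        using sg[of m] sg[of "Suc m"] m by (simp_all add: f_def)
      have x: "0 < xs (Suc m)" "xs (Suc m) < xs m" "xs m < \<beta>" using cx(3,4) m by auto
      have "\<exists>z\<ge>xs (Suc m). z \<le> xs m \<and> f z = 0"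
      proof (rule IVT)
        show "\<forall>z. xs (Suc m) \<le> z \<and> z \<le> xs m \<longrightarrow> isCont f z"
        proof (intro allI impI)
          fix z assume z: "xs (Suc m) \<le> z \<and> z \<le> xs m"
          have "isCont (\<lambda>z. Pm z d) z" by (rule Pm_deriv[OF d'(1)]) (use z x \<beta> \<sigma> in auto)
          then show "isCont f z" unfolding f_def by (intro continuous_intros)
        qed
      qed (use f x in auto)
      then obtain z where z: "xs (Suc m) \<le> z" "z \<le> xs m" "f z = 0" by blast
      have "z \<noteq> xs (Suc m)" "z \<noteq> xs m" using z(3) f by auto
      moreover have "s \<noteq> 0" using hi by (simp add: s_def)
      then have "Pm z d = z" using z(3) by (simp add: f_def)
      ultimately show ?thesis using z(1,2) by (intro exI[of _ z]) auto
    qed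
    then obtain zf where zf: "\<And>m. m < k \<Longrightarrow> xs (Suc m) < zf m \<and> zf m < xs m \<and> Pm (zf m) d = zf m" by metis
    have anti: "xs m' \<le> xs m" if "m \<le> m'" "m' \<le> k" for m m'
      using that
    proof (induction m' rule: dec_induct)
      case (step j)
      then have "xs (Suc j) < xs j" using cx(4) by simp
      then show ?case using step by simp
    qed simp
    have zlt: "zf m' < zf m" if "m < m'" "m' < k" for m m'
      using zf[of m] zf[of m'] anti[of "Suc m" m'] that by fastforce
    have zb: "0 < zf m \<and> zf m < \<gamma> \<and> zf m < b" if "m < k" for m
    proof -
      have "0 < xs (Suc m)" "xs m < \<beta>" using cx(3) that by auto
      then show ?thesis using zf[OF that] \<beta> by auto
    qed
    define P where "P = {Q. periodic_orbit X Y d Q \<and> Q \<subseteq> N}"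
    have sub: "P \<subseteq> {Q. periodic_orbit X Y d Q \<and> Q \<subseteq> ball 0 e0}" using N by (auto simp: P_def)
    have fin: "finite P" "card P \<le> k"
    proof -
      have "dist d \<delta>0 < e0" using de e1(4) by simp
      from e0(4)[OF dD this] show "finite P" "card P \<le> k"
        using sub finite_subset card_mono by (blast, meson le_trans)
    qed
    have "Gam d (zf m) \<in> P" if m: "m < k" for m
    proof -
      have "periodic_orbit X Y d (Gam d (zf m))"
        using zb[OF m] zf[OF m] by (intro fixed_periodic dD d\<gamma>) auto
      moreover have "Gam d (zf m) \<subseteq> ball (0, 0) \<eta>"
      proof -
        have "norm (pt d (rr \<phi> (zf m) d) \<phi>) < \<eta>" if "\<phi> \<in> {0..2*pi}" for \<phi>
          by (rule b(4)) (use zb[OF m] that de e1 in auto)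
        then show ?thesis unfolding Gam_def by (auto simp flip: zero_prod_def)
      qed
      ultimately show ?thesis using \<eta>(2) by (auto simp: P_def)
    qed
    then have im: "(\<lambda>m. Gam d (zf m)) ` {..<k} \<subseteq> P" by auto
    have "inj_on (\<lambda>m. Gam d (zf m)) {..<k}"
    proof (rule inj_onI)
      fix m m' assume mm: "m \<in> {..<k}" "m' \<in> {..<k}" "Gam d (zf m) = Gam d (zf m')"
      have "zf m = zf m'" by (rule Gam_inj[OF d\<gamma> _ _ _ _ _ mm(3)]) (use zb zf mm in auto)
      then show "m = m'" using zlt[of m m'] zlt[of m' m] mm by (cases m m' rule: linorder_cases) auto
    qed
    then have "k \<le> card P" using card_mono[OF fin(1) im] by (simp add: card_image)
    then have "card P = k" using fin(2) by simp
    moreover have "limit_cycles_in X Y d N = P"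
      unfolding P_def by (rule limit_cycles_eq_periodic[OF d\<gamma>]) (use N e0 fin(1) in \<open>auto simp: P_def\<close>)
    ultimately show "\<exists>d\<in>D. dist d \<delta>0 < e \<and> finite (limit_cycles_in X Y d N) \<and> card (limit_cycles_in X Y d N) = k"
      using dD de e1(2) fin(1) by (intro bexI[of _ d]) auto
  qed auto
qed

end

text \<open>Finiteness is asserted next to each cardinality because \<open>card\<close> is 0 on
  infinite sets. In the second part the parameter lies in the interior of \<open>D\<close>, so that
  the partial derivatives of \<open>v_coeff\<close> depend on values at parameters of
  \<open>D\<close> only.\<close>

theorem theorem1p6:
  fixes X Y :: "real \<Rightarrow> real \<Rightarrow> real^'m \<Rightarrow> real"
    and D :: "(real^'m) set"
    and F :: "real \<Rightarrow> real^'m \<Rightarrow> real"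
    and a :: "real^'m \<Rightarrow> real"
    and b :: "nat \<Rightarrow> real^'m \<Rightarrow> real"
    and n k :: nat
  assumes "compact D"
    and "admissible_perturbation X D"
    and "admissible_perturbation Y D"
    and "is_implicit_solution X D F"
    and "n \<ge> 2"
    and "\<And>\<delta>. \<delta> \<in> D \<Longrightarrow>
           (\<lambda>x. g_fun Y F x \<delta> - a \<delta> * x ^ (2 * n - 1)) \<in> O[at 0](\<lambda>x. x ^ (2 * n))"
    and "\<And>\<delta>. \<delta> \<in> D \<Longrightarrow> a \<delta> > 0"
    and "\<And>\<delta>. \<delta> \<in> D \<Longrightarrow>
           \<forall>\<^sub>F x in nhds 0. ((\<lambda>j. b j \<delta> * x ^ j) has_sum f_fun X Y F x \<delta>) {n - 1..}"
    and "\<And>\<delta>. \<delta> \<in> D \<Longrightarrow> (b (n - 1) \<delta>)\<^sup>2 - 4 * real n * a \<delta> < 0"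
    and "k \<ge> 1"
  shows "((\<forall>\<delta>\<in>D. (\<Sum>j=1..k+1. \<bar>v_coeff X Y F (2 * j - 1 + p_shift n) \<delta>\<bar>) > 0) \<longrightarrow>
           (\<exists>U. open U \<and> (0, 0) \<in> U \<and>
              (\<forall>\<delta>\<in>D. finite (limit_cycles_in X Y \<delta> U) \<and> card (limit_cycles_in X Y \<delta> U) \<le> k)))
       \<and> (\<forall>\<delta>\<^sub>0 \<in> interior D.
           v_coeff X Y F (2 * k + 1 + p_shift n) \<delta>\<^sub>0 \<noteq> 0 \<and>
           (\<forall>j\<in>{1..k}. v_coeff X Y F (2 * j - 1 + p_shift n) \<delta>\<^sub>0 = 0) \<and>
           jacobian_rank k (\<lambda>j. v_coeff X Y F (2 * j - 1 + p_shift n)) \<delta>\<^sub>0 = k \<longrightarrow>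
           (\<exists>U\<^sub>0. open U\<^sub>0 \<and> (0, 0) \<in> U\<^sub>0 \<and>
              (\<forall>U. open U \<and> (0, 0) \<in> U \<and> U \<subseteq> U\<^sub>0 \<longrightarrow>
                 (\<forall>\<epsilon>>0. \<exists>\<delta>\<in>D. dist \<delta> \<delta>\<^sub>0 < \<epsilon> \<and>
                    finite (limit_cycles_in X Y \<delta> U) \<and> card (limit_cycles_in X Y \<delta> U) = k))))"
proof (intro conjI impI ballI)
  assume v: "\<forall>\<delta>\<in>D. (\<Sum>j=1..k+1. \<bar>v_coeff X Y F (2 * j - 1 + p_shift n) \<delta>\<bar>) > 0"
  \<comment> \<open>A single radius serves as parameter neighbourhood and as phase
    neighbourhood.\<close>
  have "\<exists>e>0. \<forall>d\<in>D. dist d \<delta>0 < e \<longrightarrow> finite {Q. periodic_orbit X Y d Q \<and> Q \<subseteq> ball 0 e} \<and>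
       card {Q. periodic_orbit X Y d Q \<and> Q \<subseteq> ball 0 e} \<le> k" if \<delta>0: "\<delta>0 \<in> D" for \<delta>0
  proof -
    obtain \<epsilon> K a0 b0 Fc gt ft UU H where wf: "weighted_form X Y D n \<delta>0 \<epsilon> K a0 b0 Fc gt ft UU H"
      and FF: "\<And>d. d \<in> D \<Longrightarrow> dist d \<delta>0 < \<epsilon> \<Longrightarrow> \<forall>\<^sub>F x in nhds 0. F x d = Re (Fc (of_real x, cvec d))"
      by (rule weighted_form_exists[OF assms(2-9) \<delta>0], assumption+, rule that, assumption, blast)
    interpret weighted_form X Y D n \<delta>0 \<epsilon> K a0 b0 Fc gt ft UU H by (rule wf)
    obtain \<kappa> \<kappa>' M KR \<rho> where pf: "polar_flow X Y D n \<delta>0 \<epsilon> K a0 b0 Fc gt ft UU H \<kappa> \<kappa>' M KR \<rho>"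
      using polar_flow_exists by blast
    interpret polar_flow X Y D n \<delta>0 \<epsilon> K a0 b0 Fc gt ft UU H \<kappa> \<kappa>' M KR \<rho> by (rule pf)
    obtain \<gamma> where po: "polar_orbit X Y D n \<delta>0 \<epsilon> K a0 b0 Fc gt ft UU H \<kappa> \<kappa>' M KR \<rho> \<gamma>"
      using polar_orbit_exists[OF \<delta>0] by blast
    interpret polar_orbit X Y D n \<delta>0 \<epsilon> K a0 b0 Fc gt ft UU H \<kappa> \<kappa>' M KR \<rho> \<gamma> by (rule po)
    have "\<exists>j\<in>{1..k+1}. v_coeff X Y F (2 * j - 1 + p_shift n) \<delta>0 \<noteq> 0"
    proof (rule ccontr)
      assume "\<not> (\<exists>j\<in>{1..k+1}. v_coeff X Y F (2 * j - 1 + p_shift n) \<delta>0 \<noteq> 0)"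
      then have "(\<Sum>j=1..k+1. \<bar>v_coeff X Y F (2 * j - 1 + p_shift n) \<delta>0\<bar>) = 0"
        by (intro sum.neutral) auto
      then show False using v \<delta>0 by force
    qed
    then obtain j where j: "j \<in> {1..k+1}" "v_coeff X Y F (2 * j - 1 + p_shift n) \<delta>0 \<noteq> 0" by blast
    have "\<forall>\<^sub>F x in nhds 0. F x \<delta>0 = Fr x \<delta>0" using FF[OF \<delta>0] \<epsilon> by (simp add: Fr_def)
    then have "V (2 * j - 1 + p_shift n) \<delta>0 \<noteq> 0"
      using v_coeff_V[where F = F, OF \<delta>0] j(2) \<gamma>(1) by simp
    from limit_cycles_bound[OF \<delta>0 j(1) this] obtain e where "e > 0"
      "\<And>d. d \<in> D \<Longrightarrow> dist d \<delta>0 < e \<Longrightarrow> finite {Q. periodic_orbit X Y d Q \<and> Q \<subseteq> ball 0 e} \<and>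
         card {Q. periodic_orbit X Y d Q \<and> Q \<subseteq> ball 0 e} \<le> k" by blast
    then show ?thesis by (intro exI[of _ e] conjI ballI impI) blast+
  qed
  then have "\<forall>\<delta>0\<in>D. \<exists>e. e > 0 \<and> (\<forall>d\<in>D. dist d \<delta>0 < e \<longrightarrow>
       finite {Q. periodic_orbit X Y d Q \<and> Q \<subseteq> ball 0 e} \<and>
       card {Q. periodic_orbit X Y d Q \<and> Q \<subseteq> ball 0 e} \<le> k)" by (intro ballI)
  from bchoice[OF this] obtain e where e': "\<forall>\<delta>0\<in>D. e \<delta>0 > 0 \<and> (\<forall>d\<in>D. dist d \<delta>0 < e \<delta>0 \<longrightarrow>
       finite {Q. periodic_orbit X Y d Q \<and> Q \<subseteq> ball 0 (e \<delta>0)} \<and>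
       card {Q. periodic_orbit X Y d Q \<and> Q \<subseteq> ball 0 (e \<delta>0)} \<le> k)" by (elim exE)
  have e: "e \<delta>0 > 0" if "\<delta>0 \<in> D" for \<delta>0 using e' that by simp
  have e2: "finite {Q. periodic_orbit X Y d Q \<and> Q \<subseteq> ball 0 (e \<delta>0)} \<and>
       card {Q. periodic_orbit X Y d Q \<and> Q \<subseteq> ball 0 (e \<delta>0)} \<le> k"
    if "\<delta>0 \<in> D" "d \<in> D" "dist d \<delta>0 < e \<delta>0" for \<delta>0 d
    using bspec[OF e' that(1)] that(2,3) by blast
  obtain C where C: "C \<subseteq> D" "finite C" "D \<subseteq> (\<Union>c\<in>C. ball c (e c))"
    by (rule compactE_image[OF assms(1), of D "\<lambda>c. ball c (e c)"]) (use e in auto)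
  \<comment> \<open>The smallest phase radius of the finite subcover; the element 1 covers an empty
    \<open>D\<close>.\<close>
  define m where "m = Min (insert 1 (e ` C))"
  have m: "m > 0" "\<And>c. c \<in> C \<Longrightarrow> m \<le> e c" using C e by (auto simp: m_def)
  show "\<exists>U. open U \<and> (0, 0) \<in> U \<and> (\<forall>\<delta>\<in>D. finite (limit_cycles_in X Y \<delta> U) \<and> card (limit_cycles_in X Y \<delta> U) \<le> k)"
  proof (intro exI[of _ "ball 0 m"] conjI ballI)
    show "(0, 0) \<in> ball (0 :: real \<times> real) m" using m by (simp flip: zero_prod_def)
    fix d assume d: "d \<in> D"
    then obtain c where c: "c \<in> C" "dist d c < e c" using C(3) by (auto simp: dist_commute)
    have sub: "limit_cycles_in X Y d (ball 0 m) \<subseteq> {Q. periodic_orbit X Y d Q \<and> Q \<subseteq> ball 0 (e c)}"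
      using subset_ball[OF m(2)[OF c(1)], of "0 :: real \<times> real"]
      unfolding limit_cycles_in_def limit_cycle_def by blast
    have "c \<in> D" using c C by blast
    note E = e2[OF this d c(2)]
    show "finite (limit_cycles_in X Y d (ball 0 m))" by (rule finite_subset[OF sub]) (use E in blast)
    show "card (limit_cycles_in X Y d (ball 0 m)) \<le> k"
      by (rule order_trans[OF card_mono[OF _ sub]]) (use E in blast)+
  qed auto
next
  fix \<delta>0
  assume int: "\<delta>0 \<in> interior D" and v: "v_coeff X Y F (2 * k + 1 + p_shift n) \<delta>0 \<noteq> 0 \<and>
           (\<forall>j\<in>{1..k}. v_coeff X Y F (2 * j - 1 + p_shift n) \<delta>0 = 0) \<and>
           jacobian_rank k (\<lambda>j. v_coeff X Y F (2 * j - 1 + p_shift n)) \<delta>0 = k"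
  have \<delta>0: "\<delta>0 \<in> D" using int interior_subset by blast
  obtain \<epsilon> K a0 b0 Fc gt ft UU H where wf: "weighted_form X Y D n \<delta>0 \<epsilon> K a0 b0 Fc gt ft UU H"
    and FF: "\<And>d. d \<in> D \<Longrightarrow> dist d \<delta>0 < \<epsilon> \<Longrightarrow> \<forall>\<^sub>F x in nhds 0. F x d = Re (Fc (of_real x, cvec d))"
    by (rule weighted_form_exists[OF assms(2-9) \<delta>0], assumption+, rule that, assumption, blast)
  interpret weighted_form X Y D n \<delta>0 \<epsilon> K a0 b0 Fc gt ft UU H by (rule wf)
  obtain \<kappa> \<kappa>' M KR \<rho> where pf: "polar_flow X Y D n \<delta>0 \<epsilon> K a0 b0 Fc gt ft UU H \<kappa> \<kappa>' M KR \<rho>"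
    using polar_flow_exists by blast
  interpret polar_flow X Y D n \<delta>0 \<epsilon> K a0 b0 Fc gt ft UU H \<kappa> \<kappa>' M KR \<rho> by (rule pf)
  obtain \<gamma> where po: "polar_orbit X Y D n \<delta>0 \<epsilon> K a0 b0 Fc gt ft UU H \<kappa> \<kappa>' M KR \<rho> \<gamma>"
    using polar_orbit_exists[OF \<delta>0] by blast
  interpret polar_orbit X Y D n \<delta>0 \<epsilon> K a0 b0 Fc gt ft UU H \<kappa> \<kappa>' M KR \<rho> \<gamma> by (rule po)
  have vV: "v_coeff X Y F j d = V j d" if "d \<in> D" "dist d \<delta>0 < \<gamma>" for j d
    by (rule v_coeff_V[where F = F, OF that]) (use FF[OF that(1)] dist_less(2)[OF that(2)] in \<open>simp add: Fr_def\<close>)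
  have d0: "dist \<delta>0 \<delta>0 < \<gamma>" using \<gamma>(1) by simp
  \<comment> \<open>\<open>v_coeff\<close> is known to equal \<open>V\<close> at parameters of
    \<open>D\<close> only, so the gradients are compared on a neighbourhood inside
    \<open>D\<close>.\<close>
  have "\<forall>\<^sub>F d in nhds \<delta>0. d \<in> interior D \<inter> ball \<delta>0 \<gamma>"
    by (rule eventually_nhds_in_open) (use int \<gamma>(1) in auto)
  then have "\<forall>\<^sub>F d in nhds \<delta>0. v_coeff X Y F j d = V j d" for j
    by eventually_elim (use vV interior_subset in \<open>auto simp: dist_commute\<close>)
  then have grad: "gradient_at (v_coeff X Y F j) \<delta>0 = wv j \<delta>0" for j
    by (rule gradient_at_eq)
  show "\<exists>U\<^sub>0. open U\<^sub>0 \<and> (0, 0) \<in> U\<^sub>0 \<and>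
              (\<forall>U. open U \<and> (0, 0) \<in> U \<and> U \<subseteq> U\<^sub>0 \<longrightarrow>
                 (\<forall>\<epsilon>>0. \<exists>\<delta>\<in>D. dist \<delta> \<delta>0 < \<epsilon> \<and>
                    finite (limit_cycles_in X Y \<delta> U) \<and> card (limit_cycles_in X Y \<delta> U) = k))"
  proof (rule exact_limit_cycles[OF int])
    show "dim ((\<lambda>j. wv (2 * j - 1 + p_shift n) \<delta>0) ` {1..k}) = k"
      using v by (simp add: jacobian_rank_def grad)
  qed (use v vV[OF \<delta>0 d0] in auto)
qed

end
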